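(* Let $\Omega_{\mathcal H}:=\{(p,q):1\le p,q\le\infty,\ p>q\}$. (1) (Weak-type level.) The collection of all pairs $(p,q)\in\Omega_{\mathcal H}$ that are weak-type Forelli--Rudin pairs for some parameters $(a,b,c)\in\mathbb R^3$ is precisely $$\mathcal{FR}_w:=\{(p,q)\in\Omega_{\mathcal H}:1<p\le 2\}.$$ In particular, if $(p,q)\in\mathcal{FR}_w$, then there exist $a,b,c\in\mathbb R$ such that $T_{a,b,c}:L^p(\mathbb D)\to L^{q,\infty}(\mathbb D)$ holds, whereas $S_{a,b,c}:L^p(\mathbb D)\to L^{q,\infty}(\mathbb D)$ fails. (2) (Restricted weak-type level.) The collection of all pairs $(p,q)\in\Omega_{\mathcal H}$ that are restricted weak-type Forelli--Rudin pairs for some parameters $(a,b,c)\in\mathbb R^3$ is precisely $$\mathcal{FR}_{rw}:=\{(p,q)\in\Omega_{\mathcal H}:p\neq\infty\}.$$ In particular, if $(p,q)\in\mathcal{FR}_{rw}$, then there exist $a,b,c\in\mathbb R$ such that $T_{a,b,c}:L^{p,1}(\mathbb D)\to L^{q,\infty}(\mathbb D)$ holds, whereas $S_{a,b,c}:L^{p,1}(\mathbb D)\to L^{q,\infty}(\mathbb D)$ fails.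
   Context: $\mathbb D$ is the open unit disc in $\mathbb C$, $dA$ is normalized area measure on $\mathbb D$, and $|E|$ is the $dA$-measure of $E\subseteq\mathbb D$. For $a,b,c\in\mathbb R$, $$T_{a,b,c}f(z):=(1-|z|^2)^a\int_{\mathbb D}\frac{(1-|w|^2)^b}{(1-z\overline w)^c}f(w)\,dA(w),\qquad S_{a,b,c}f(z):=(1-|z|^2)^a\int_{\mathbb D}\frac{(1-|w|^2)^b}{|1-z\overline w|^c}f(w)\,dA(w),$$ with the principal branch of the power. $L^p(\mathbb D)=L^p(\mathbb D,dA)$. For $1\le q<\infty$, $\|f\|_{L^{q,\infty}}=\sup_{\lambda>0}\lambda|\{|f|>\lambda\}|^{1/q}$, and $L^{\infty,\infty}=L^\infty$. For $1\le p<\infty$, $\|f\|_{L^{p,1}}=p\int_0^\infty|\{|f|>\lambda\}|^{1/p}\,d\lambda$. For an operator $\mathcal T$ and spaces $X,Y$, "$\mathcal T:X\to Y$ holds" means that $\mathcal T$ is bounded from $X$ to $Y$, i.e. for every $f\in X$ the defining integral converges absolutely for a.e. $z$ and $\|\mathcal Tf\|_Y\le C\|f\|_X$ with $C$ independent of $f$; otherwise it "fails". $\mathcal T$ is of weak type $(p,q)$ if $\mathcal T:L^p(\mathbb D)\to L^{q,\infty}(\mathbb D)$ holds. For $p<\infty$, $\mathcal T$ is of restricted weak type $(p,q)$ if $\mathcal T:L^{p,1}(\mathbb D)\to L^{q,\infty}(\mathbb D)$ holds; restricted weak type $(\infty,q)$ means $\|\mathcal T\mathbf 1_E\|_{L^{q,\infty}}\le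 C$ for all measurable $E\subseteq\mathbb D$. A pair $(p,q)$ is a weak-type (respectively restricted weak-type) Forelli--Rudin pair for $(a,b,c)$ if $T_{a,b,c}$ and $S_{a,b,c}$ have different boundedness behavior at $(p,q)$ for that type of estimate, i.e. exactly one of the two operators is of weak type (respectively restricted weak type) $(p,q)$. *)

theory Defs
  imports "HOL-Probability.Essential_Supremum"
begin

definition unit_disc :: "complex set" where
  "unit_disc = ball 0 1"

definition dA :: "complex measure" where
  "dA = density (lebesgue_on unit_disc) (\<lambda>_. ennreal (1 / pi))"

lemma space_dA: "space dA = unit_disc"
  by (simp add: dA_def unit_disc_def)

lemma emeasure_dA_disc: "emeasure dA unit_disc = 1"
proof -
  have "emeasure lebesgue unit_disc = ennreal pi"
    by (simp add: unit_disc_def emeasure_ball unit_ball_vol_2)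
  moreover have "emeasure dA unit_disc = ennreal (1 / pi) * emeasure lebesgue unit_disc"
    unfolding dA_def unit_disc_def
    by (subst emeasure_density_const) (auto simp: sets_restrict_space emeasure_restrict_space)
  ultimately show ?thesis
    by (simp add: ennreal_mult[symmetric])
qed


subsection \<open>Function spaces\<close>

text \<open>Exponents in \<open>[1, \<infinity>]\<close> have type \<^typ>\<open>ennreal\<close>; norms are
  \<^typ>\<open>ennreal\<close>-valued and may be infinite.\<close>

text \<open>Only used for positive exponents \<open>r\<close>.\<close>

definition ennreal_powr :: "ennreal \<Rightarrow> real \<Rightarrow> ennreal" where
  "ennreal_powr x r = (if x = \<infinity> then \<infinity> else ennreal (enn2real x powr r))"

definition distr_fun :: "(complex \<Rightarrow> complex) \<Rightarrow> real \<Rightarrow> real" where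
  "distr_fun f t = measure dA {z \<in> unit_disc. norm (f z) > t}"

definition Lp_norm :: "ennreal \<Rightarrow> (complex \<Rightarrow> complex) \<Rightarrow> ennreal" where
  "Lp_norm p f =
    (if p = \<infinity> then esssup dA (\<lambda>z. ennreal (norm (f z)))
     else ennreal_powr (\<integral>\<^sup>+ z. ennreal (norm (f z) powr enn2real p) \<partial>dA) (1 / enn2real p))"

definition weak_Lq_norm :: "ennreal \<Rightarrow> (complex \<Rightarrow> complex) \<Rightarrow> ennreal" where
  "weak_Lq_norm q f =
    (if q = \<infinity> then Lp_norm \<infinity> f
     else (SUP t\<in>{0<..}. ennreal (t * distr_fun f t powr (1 / enn2real q))))"

text \<open>The Lorentz norm of \<open>L\<^sup>p\<^sup>,\<^sup>1\<close>, for finite \<open>p\<close>.\<close>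

definition Lp1_norm :: "ennreal \<Rightarrow> (complex \<Rightarrow> complex) \<Rightarrow> ennreal" where
  "Lp1_norm p f =
    p * (\<integral>\<^sup>+ t \<in> {0<..}. ennreal (distr_fun f t powr (1 / enn2real p)) \<partial>lborel)"

definition Lp_space :: "ennreal \<Rightarrow> (complex \<Rightarrow> complex) set" where
  "Lp_space p = {f \<in> borel_measurable dA. Lp_norm p f < \<infinity>}"

definition Lp1_space :: "ennreal \<Rightarrow> (complex \<Rightarrow> complex) set" where
  "Lp1_space p = {f \<in> borel_measurable dA. Lp1_norm p f < \<infinity>}"


subsection \<open>The operators\<close>

text \<open>An integral operator \<open>f \<mapsto> (\<lambda>z. weight z * \<integral> kernel z w * f w dA(w))\<close>. The weight and the
  kernel are kept as data because boundedness includes the absolute convergence of the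
  defining integral.\<close>

datatype integral_operator =
  Integral_Operator (weight: "complex \<Rightarrow> complex") (kernel: "complex \<Rightarrow> complex \<Rightarrow> complex")

definition apply_op :: "integral_operator \<Rightarrow> (complex \<Rightarrow> complex) \<Rightarrow> complex \<Rightarrow> complex" where
  "apply_op \<T> f z = weight \<T> z * (LINT w|dA. kernel \<T> z w * f w)"

definition converges_ae :: "integral_operator \<Rightarrow> (complex \<Rightarrow> complex) \<Rightarrow> bool" where
  "converges_ae \<T> f \<longleftrightarrow> (AE z in dA. integrable dA (\<lambda>w. kernel \<T> z w * f w))"

definition T_op :: "real \<Rightarrow> real \<Rightarrow> real \<Rightarrow> integral_operator" where
  "T_op a b c = Integral_Operator
     (\<lambda>z. complex_of_real ((1 - (norm z)\<^sup>2) powr a))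
     (\<lambda>z w. complex_of_real ((1 - (norm w)\<^sup>2) powr b)
              / (1 - z * cnj w) powr complex_of_real c)"

definition S_op :: "real \<Rightarrow> real \<Rightarrow> real \<Rightarrow> integral_operator" where
  "S_op a b c = Integral_Operator
     (\<lambda>z. complex_of_real ((1 - (norm z)\<^sup>2) powr a))
     (\<lambda>z w. complex_of_real ((1 - (norm w)\<^sup>2) powr b / norm (1 - z * cnj w) powr c))"


subsection \<open>Boundedness\<close>

definition bounded_op ::
  "(complex \<Rightarrow> complex) set \<Rightarrow> ((complex \<Rightarrow> complex) \<Rightarrow> ennreal) \<Rightarrow>
   ((complex \<Rightarrow> complex) \<Rightarrow> ennreal) \<Rightarrow> integral_operator \<Rightarrow> bool" where
  "bounded_op X norm_X norm_Y \<T> \<longleftrightarrow>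
    (\<exists>C::real. \<forall>f\<in>X. converges_ae \<T> f \<and> norm_Y (apply_op \<T> f) \<le> ennreal C * norm_X f)"

definition weak_type :: "integral_operator \<Rightarrow> ennreal \<Rightarrow> ennreal \<Rightarrow> bool" where
  "weak_type \<T> p q \<longleftrightarrow> bounded_op (Lp_space p) (Lp_norm p) (weak_Lq_norm q) \<T>"

text \<open>For \<open>p = \<infinity>\<close>, convergence is required as well: \<^const>\<open>lebesgue_integral\<close> is 0 on
  non-integrable functions, so the norm bound alone would not express that
  the operator is defined on indicator functions.\<close>

definition restricted_weak_type :: "integral_operator \<Rightarrow> ennreal \<Rightarrow> ennreal \<Rightarrow> bool" where
  "restricted_weak_type \<T> p q \<longleftrightarrow>
    (if p = \<infinity>
     then \<exists>C::real. \<forall>E\<in>sets dA.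
            converges_ae \<T> (indicator E) \<and> weak_Lq_norm q (apply_op \<T> (indicator E)) \<le> ennreal C
     else bounded_op (Lp1_space p) (Lp1_norm p) (weak_Lq_norm q) \<T>)"


subsection \<open>Forelli--Rudin pairs\<close>

definition weak_FR_pair :: "real \<Rightarrow> real \<Rightarrow> real \<Rightarrow> ennreal \<Rightarrow> ennreal \<Rightarrow> bool" where
  "weak_FR_pair a b c p q \<longleftrightarrow> weak_type (T_op a b c) p q \<noteq> weak_type (S_op a b c) p q"

definition restricted_weak_FR_pair :: "real \<Rightarrow> real \<Rightarrow> real \<Rightarrow> ennreal \<Rightarrow> ennreal \<Rightarrow> bool" where
  "restricted_weak_FR_pair a b c p q \<longleftrightarrow>
    restricted_weak_type (T_op a b c) p q \<noteq> restricted_weak_type (S_op a b c) p q"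

definition Omega_H :: "(ennreal \<times> ennreal) set" where
  "Omega_H = {(p, q). 1 \<le> p \<and> 1 \<le> q \<and> p > q}"

definition FR_w :: "(ennreal \<times> ennreal) set" where
  "FR_w = {(p, q) \<in> Omega_H. 1 < p \<and> p \<le> 2}"

definition FR_rw :: "(ennreal \<times> ennreal) set" where
  "FR_rw = {(p, q) \<in> Omega_H. p \<noteq> \<infinity>}"

end

theory Submission
  imports Defs "HOL-Probability.Probability" "HOL-Complex_Analysis.Complex_Analysis"
begin

text \<open>
  Everything is reduced to estimates on circles: a bound for the distribution function of
  \<open>v \<mapsto> F (v z)\<close> on the unit circle with an exponent \<open>s > q\<close> integrates to a weak-type bound for
  \<open>(1 - \<bar>z\<bar>\<^sup>2)\<^sup>a F\<close> on the disc, since \<open>1 - \<bar>z\<bar>\<^sup>2\<close> is uniformly distributed on \<open>[0, 1]\<close>.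

  The pairs in question separate \<open>T\<close> and \<open>S\<close> at the critical parameters \<open>a = -1/q\<close>, \<open>c - 1 = b + 1 - 1/p\<close>.
  For \<open>p \<le> 2\<close> and \<open>(b, c) = (1/p, 2)\<close>, split \<open>f\<close> at a height and use Parseval's identity for
  the bounded part and an \<open>L\<^sup>1\<close> bound for the rest; for
  \<open>S\<close> the functions \<open>(1 - \<bar>w\<bar>\<^sup>2)\<^sup>-\<^sup>1\<^sup>/\<^sup>p\<close> cut off at the boundary produce an unbounded logarithm.
  For the restricted estimate and \<open>(b, c) = (1/p - 1, 1)\<close>, duality reduces the bound for \<open>T\<close> to
  circle means of Cauchy integrals of indicator functions.

  Conversely, suppose that \<open>T\<close> is of weak type \<open>(p, q)\<close> with \<open>p > 2\<close>. Homogeneous test functions give the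
  necessary inequalities between \<open>a\<close>, \<open>b\<close> and \<open>c\<close>, and superpositions of \<open>N\<close> of them with lacunary
  frequencies \<open>2\<^sup>j\<close> and disjoint radial supports have norm of order \<open>N\<^sup>1\<^sup>/\<^sup>p\<close> but image of order
  \<open>N\<^sup>1\<^sup>/\<^sup>2\<close>, by comparison of second and fourth moments. This excludes the critical case, and the
  remaining conditions are sufficient for \<open>S\<close>. For \<open>p = \<infinity>\<close> the restricted estimate for \<open>T\<close>
  already implies the weak one.
\<close>

section \<open>The disc and the circle measure\<close>

text \<open>The exponent s > q on circles must be strict: at a = -1/q the circle of defect x
  contributes min 1 ((X / x)^(s / q)), whose integral in x diverges logarithmically for s = q. This
  is how p > q enters. The two critical families differ in the common value \<beta> = b + 1 - 1/p =
  c - 1, which is 1 for weak type and 0 for restricted type. At \<beta> = 0 the factor (1 -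
  |w|^2)^(1/p - 1) just misses the dual of L^p, but it lies in the weak space dual to L^{p,1}, so
  \<beta> = 0 becomes available for every finite p. There c = 1, and the circle means of the modulus
  of the kernel diverge logarithmically, which destroys S, while the Cauchy kernel itself has enough
  cancellation for T. The threshold p = 2 is a matter of orthogonality: at criticality the lacunary
  Taylor coefficients are bounded below, so N of them produce mean square size N^(1/2) on circles,
  and this is compatible with an input norm N^(1/p) only for p \<le> 2.\<close>

definition disc_measure :: "complex measure" where
  "disc_measure = uniform_measure lborel unit_disc"

text \<open>Normalized arc length, obtained as the image of area under radial projection: rotation
  invariance is inherited from the disc, and the value \<open>sgn 0 = 0\<close> concerns a null set
  only.\<close>

definition circle_measure :: "complex measure" where
  "circle_measure = distr disc_measure borel sgn"

lemma unit_disc_borel [measurable, simp]: "unit_disc \<in> sets borel"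
  by (simp add: unit_disc_def)

lemma emeasure_lborel_unit_disc: "emeasure lborel unit_disc = ennreal pi"
  by (simp add: unit_disc_def emeasure_ball unit_ball_vol_2)

lemma sets_disc_measure [simp, measurable_cong]: "sets disc_measure = sets borel"
  by (simp add: disc_measure_def)

lemma space_disc_measure [simp]: "space disc_measure = UNIV"
  by (simp add: disc_measure_def)

lemma sets_circle_measure [simp, measurable_cong]: "sets circle_measure = sets borel"
  by (simp add: circle_measure_def)

lemma space_circle_measure [simp]: "space circle_measure = UNIV"
  by (simp add: circle_measure_def)

lemma sgn_complex_borel [measurable]: "sgn \<in> borel_measurable (borel :: complex measure)"
  unfolding sgn_div_norm by measurable

lemma cnj_borel [measurable]: "cnj \<in> borel_measurable borel"
  by (intro borel_measurable_continuous_onI continuous_intros)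

interpretation disc: prob_space disc_measure
  unfolding disc_measure_def
  by (rule prob_space_uniform_measure) (auto simp: emeasure_lborel_unit_disc)

interpretation circle: prob_space circle_measure
  unfolding circle_measure_def by (rule disc.prob_space_distr) simp

lemma measure_disc_UNIV [simp]: "measure disc_measure UNIV = 1"
  using disc.prob_space by simp

lemma measure_circle_UNIV [simp]: "measure circle_measure UNIV = 1"
  using circle.prob_space by simp

interpretation disc_circle: pair_sigma_finite disc_measure circle_measure ..
interpretation circle_disc: pair_sigma_finite circle_measure disc_measure ..

lemma nn_integral_disc:
  assumes [measurable]: "f \<in> borel_measurable borel"
  shows "nn_integral disc_measure f = (\<integral>\<^sup>+ z. f z * indicator unit_disc z \<partial>lborel) / ennreal pi"
  unfolding disc_measure_def
  by (subst nn_integral_uniform_measure) (auto simp: emeasure_lborel_unit_disc)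

lemma AE_disc_unit_disc: "AE z in disc_measure. z \<in> unit_disc"
  unfolding disc_measure_def by (rule AE_uniform_measureI) auto

lemma AE_disc_nonzero: "AE z in disc_measure. z \<noteq> 0"
  unfolding disc_measure_def
  by (rule AE_uniform_measureI) (auto intro: AE_mp[OF AE_lborel_singleton[of 0]])

lemma emeasure_disc:
  assumes "A \<in> sets borel"
  shows "emeasure disc_measure A = emeasure lborel (unit_disc \<inter> A) / ennreal pi"
  unfolding disc_measure_def using assms by (simp add: emeasure_lborel_unit_disc)

section \<open>Rotation invariance of area and arc length\<close>

text \<open>Uniqueness of Haar measure by double counting: the M-measure of A times the Lebesgue
  measure of the unit ball is rewritten by Tonelli's theorem and translations until the two measures
  have changed places. The ball is the test set because it is symmetric and invariant under
  rotations.\<close>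

lemma translation_invariant_eq_lborel:
  fixes M :: "'a::euclidean_space measure"
  assumes "sigma_finite_measure M" and [measurable_cong, simp]: "sets M = sets borel"
    and trans: "\<And>c. distr M borel ((+) c) = M"
    and ball: "emeasure M (ball 0 1) = emeasure lborel (ball (0::'a) 1)"
  shows "M = lborel"
proof (rule measure_eqI)
  interpret M: sigma_finite_measure M by fact
  interpret P: pair_sigma_finite M lborel ..
  interpret Q: pair_sigma_finite lborel M ..
  have shiftM: "(\<integral>\<^sup>+ x. h (c + x) \<partial>M) = (\<integral>\<^sup>+ x. h x \<partial>M)"
    if [measurable]: "h \<in> borel_measurable borel" for h :: "'a \<Rightarrow> ennreal" and c
    by (subst (2) trans[of c, symmetric], subst nn_integral_distr) auto
  have shiftL: "(\<integral>\<^sup>+ x. h (c + x) \<partial>lborel) = (\<integral>\<^sup>+ x. h x \<partial>lborel)"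
    if [measurable]: "h \<in> borel_measurable borel" for h :: "'a \<Rightarrow> ennreal" and c
    by (subst (2) lborel_distr_plus[of c, symmetric], subst nn_integral_distr) auto
  fix A assume "A \<in> sets M"
  then have [measurable]: "A \<in> sets borel" by simp
  let ?B = "ball (0::'a) 1"
  let ?a = "\<lambda>x. indicator A x :: ennreal" and ?b = "\<lambda>x. indicator ?B x :: ennreal"
  have [measurable]: "?B \<in> sets borel" by simp
  have b_sym: "?b (- x) = ?b x" for x by (auto simp: indicator_def)
  have "emeasure M A * emeasure lborel ?B = (\<integral>\<^sup>+ y. (\<integral>\<^sup>+ x. ?a (y + x) \<partial>M) * ?b y \<partial>lborel)"
    by (subst shiftM) (auto simp: nn_integral_cmult_indicator)
  also have "\<dots> = (\<integral>\<^sup>+ y. (\<integral>\<^sup>+ x. ?a (y + x) * ?b y \<partial>M) \<partial>lborel)"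
    by (simp add: nn_integral_multc)
  also have "\<dots> = (\<integral>\<^sup>+ x. (\<integral>\<^sup>+ y. ?a (x + y) * ?b (-x + (x + y)) \<partial>lborel) \<partial>M)"
    by (subst P.Fubini'[symmetric]) (auto simp: add.commute)
  also have "\<dots> = (\<integral>\<^sup>+ x. (\<integral>\<^sup>+ y. ?a y * ?b (-x + y) \<partial>lborel) \<partial>M)"
    by (subst shiftL[where h="\<lambda>y. ?a y * ?b (-_ + y)"]) auto
  also have "\<dots> = (\<integral>\<^sup>+ y. (\<integral>\<^sup>+ x. ?a y * ?b (-x + y) \<partial>M) \<partial>lborel)"
    by (subst P.Fubini') auto
  also have "\<dots> = (\<integral>\<^sup>+ y. ?a y * (\<integral>\<^sup>+ x. ?b (- y + x) \<partial>M) \<partial>lborel)"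
    by (subst b_sym[symmetric]) (simp add: nn_integral_cmult)
  also have "\<dots> = emeasure lborel A * emeasure M ?B"
    by (subst shiftM) (auto simp: nn_integral_multc)
  finally have "emeasure lborel ?B * emeasure M A = emeasure lborel ?B * emeasure lborel A"
    by (simp add: ball mult.commute)
  moreover have "emeasure lborel ?B \<noteq> 0" and "emeasure lborel ?B \<noteq> \<infinity>"
    using content_ball_gt_0_iff[of "0::'a" 1] by (auto simp: measure_def)
  ultimately show "emeasure M A = emeasure lborel A"
    by (simp add: ennreal_mult_cancel_left)
qed simp

text \<open>Translating by c after the rotation is the same as translating by c / u before it, and
  the unit ball is fixed, so the uniqueness lemma applies to the rotated measure.\<close>

lemma lborel_rotate:
  fixes u :: complex
  assumes "norm u = 1"
  shows "distr lborel borel ((*) u) = lborel"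
proof (rule translation_invariant_eq_lborel)
  have u: "u \<noteq> 0" using assms by auto
  let ?M = "distr lborel borel ((*) u)"
  \<comment> \<open>Rotating back recovers \<open>lborel\<close>; sigma-finiteness passes from that
    image measure to the rotated one.\<close>
  have inv: "distr ?M borel ((*) (inverse u)) = lborel"
    by (subst distr_distr) (use u in \<open>auto simp: comp_def mult.assoc[symmetric] distr_id2\<close>)
  have "sigma_finite_measure (distr ?M borel ((*) (inverse u)))"
    unfolding inv by (rule lborel.sigma_finite_measure_axioms)
  then show "sigma_finite_measure ?M"
    by (rule sigma_finite_measure_distr) simp
  show "distr ?M borel ((+) c) = ?M" for c
  proof -
    have "distr ?M borel ((+) c) = distr (distr lborel borel ((+) (c / u))) borel ((*) u)"
      by (simp add: distr_distr comp_def distrib_left u)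
    then show ?thesis by (simp add: lborel_distr_plus)
  qed
  have "emeasure ?M (ball 0 1) = emeasure lborel ((*) u -` ball 0 1)"
    by (simp add: emeasure_distr)
  also have "(*) u -` ball 0 1 = ball 0 1"
    using assms by (auto simp: norm_mult)
  finally show "emeasure ?M (ball 0 1) = emeasure lborel (ball (0::complex) 1)" .
qed simp

lemma nn_integral_disc_rotate:
  fixes u :: complex
  assumes "norm u = 1" and [measurable]: "h \<in> borel_measurable borel"
  shows "(\<integral>\<^sup>+ w. h (u * w) \<partial>disc_measure) = (\<integral>\<^sup>+ w. h w \<partial>disc_measure)"
proof -
  have "(\<integral>\<^sup>+ w. h w * indicator unit_disc w \<partial>lborel)
      = (\<integral>\<^sup>+ w. h w * indicator unit_disc w \<partial>distr lborel borel ((*) u))"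
    by (simp add: lborel_rotate assms)
  also have "\<dots> = (\<integral>\<^sup>+ w. h (u * w) * indicator unit_disc (u * w) \<partial>lborel)"
    by (subst nn_integral_distr) auto
  also have "\<dots> = (\<integral>\<^sup>+ w. h (u * w) * indicator unit_disc w \<partial>lborel)"
    using assms by (intro nn_integral_cong) (auto simp: unit_disc_def indicator_def norm_mult)
  finally show ?thesis by (simp add: nn_integral_disc)
qed

lemma nn_integral_circle:
  assumes [measurable]: "h \<in> borel_measurable borel"
  shows "(\<integral>\<^sup>+ v. h v \<partial>circle_measure) = (\<integral>\<^sup>+ w. h (sgn w) \<partial>disc_measure)"
  unfolding circle_measure_def by (subst nn_integral_distr) auto

lemma AE_circle_norm: "AE v in circle_measure. norm v = 1"
  unfolding circle_measure_def
  by (subst AE_distr_iff) (use AE_disc_nonzero in \<open>auto simp: norm_sgn\<close>)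

lemma nn_integral_circle_rotate:
  fixes u :: complex
  assumes "norm u = 1" and [measurable]: "h \<in> borel_measurable borel"
  shows "(\<integral>\<^sup>+ v. h (u * v) \<partial>circle_measure) = (\<integral>\<^sup>+ v. h v \<partial>circle_measure)"
proof -
  have "sgn (u * w) = u * sgn w" for w using assms
    by (simp add: sgn_div_norm norm_mult)
  then show ?thesis
    using nn_integral_disc_rotate[OF assms(1), of "\<lambda>w. h (sgn w)"] by (simp add: nn_integral_circle)
qed

lemma circle_rotate:
  assumes "norm u = 1"
  shows "distr circle_measure borel ((*) u) = circle_measure"
proof (rule measure_eqI)
  fix A assume "A \<in> sets (distr circle_measure borel ((*) u))"
  then have [measurable]: "A \<in> sets borel" by simp
  have "emeasure (distr circle_measure borel ((*) u)) A = (\<integral>\<^sup>+ v. indicator A v \<partial>distr circle_measure borel ((*) u))"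
    by simp
  also have "\<dots> = (\<integral>\<^sup>+ v. indicator A (u * v) \<partial>circle_measure)"
    by (subst nn_integral_distr) auto
  also have "\<dots> = emeasure circle_measure A"
    using nn_integral_circle_rotate[OF assms, of "indicator A"] by simp
  finally show "emeasure (distr circle_measure borel ((*) u)) A = emeasure circle_measure A" .
qed simp

lemma integral_circle_rotate:
  fixes h :: "complex \<Rightarrow> complex"
  assumes "norm u = 1" and [measurable]: "h \<in> borel_measurable borel"
  shows "(LINT v|circle_measure. h (u * v)) = (LINT v|circle_measure. h v)"
  by (subst (2) circle_rotate[OF assms(1), symmetric], subst integral_distr) auto

text \<open>The invariance under a fixed rotation v, averaged over v. Together with
  \<open>distr_defect\<close> it plays the role of polar coordinates, since the inner integral is
  the mean of h over the circle through w.\<close>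

lemma nn_integral_disc_average:
  assumes [measurable]: "h \<in> borel_measurable borel"
  shows "(\<integral>\<^sup>+ w. h w \<partial>disc_measure) = (\<integral>\<^sup>+ w. (\<integral>\<^sup>+ v. h (v * w) \<partial>circle_measure) \<partial>disc_measure)"
proof -
  have "(\<integral>\<^sup>+ w. (\<integral>\<^sup>+ v. h (v * w) \<partial>circle_measure) \<partial>disc_measure)
      = (\<integral>\<^sup>+ v. (\<integral>\<^sup>+ w. h (v * w) \<partial>disc_measure) \<partial>circle_measure)"
    by (rule circle_disc.Fubini') auto
  also have "\<dots> = (\<integral>\<^sup>+ v. (\<integral>\<^sup>+ w. h w \<partial>disc_measure) \<partial>circle_measure)"
    by (rule nn_integral_cong_AE) (use AE_circle_norm in \<open>auto simp: nn_integral_disc_rotate\<close>)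
  finally show ?thesis by (simp add: circle.emeasure_space_1[simplified])
qed

lemma distr_disc_rotate:
  assumes "norm u = 1"
  shows "distr disc_measure borel ((*) u) = disc_measure"
proof (rule measure_eqI)
  fix A assume "A \<in> sets (distr disc_measure borel ((*) u))"
  then have [measurable]: "A \<in> sets borel" by simp
  have "emeasure (distr disc_measure borel ((*) u)) A = (\<integral>\<^sup>+ v. indicator A v \<partial>distr disc_measure borel ((*) u))"
    by simp
  also have "\<dots> = (\<integral>\<^sup>+ v. indicator A (u * v) \<partial>disc_measure)"
    by (subst nn_integral_distr) auto
  also have "\<dots> = emeasure disc_measure A"
    using nn_integral_disc_rotate[OF assms, of "indicator A"] by simp
  finally show "emeasure (distr disc_measure borel ((*) u)) A = emeasure disc_measure A" .
qed simp

lemma integral_disc_average: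
  fixes h :: "complex \<Rightarrow> complex"
  assumes "integrable disc_measure h"
  shows "(LINT w|disc_measure. h w) = (LINT w|disc_measure. (LINT v|circle_measure. h (v * w)))"
proof -
  have [measurable]: "h \<in> borel_measurable borel" using borel_measurable_integrable[OF assms] by simp
  have "integrable (circle_measure \<Otimes>\<^sub>M disc_measure) (\<lambda>(v, w). h (v * w))"
  proof (rule integrableI_bounded)
    have "(\<integral>\<^sup>+ x. norm (case x of (v, w) \<Rightarrow> h (v * w)) \<partial>(circle_measure \<Otimes>\<^sub>M disc_measure))
       = (\<integral>\<^sup>+ v. \<integral>\<^sup>+ w. norm (h (v * w)) \<partial>disc_measure \<partial>circle_measure)"
      by (subst disc.nn_integral_fst[symmetric]) auto
    also have "\<dots> = (\<integral>\<^sup>+ w. \<integral>\<^sup>+ v. norm (h (v * w)) \<partial>circle_measure \<partial>disc_measure)"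
      by (rule circle_disc.Fubini'[symmetric]) auto
    also have "\<dots> = (\<integral>\<^sup>+ w. norm (h w) \<partial>disc_measure)"
      by (rule nn_integral_disc_average[symmetric]) auto
    also have "\<dots> < \<infinity>" using assms by (simp add: integrable_iff_bounded)
    finally show "(\<integral>\<^sup>+ x. norm (case x of (v, w) \<Rightarrow> h (v * w)) \<partial>(circle_measure \<Otimes>\<^sub>M disc_measure)) < \<infinity>" .
  qed auto
  then have "(LINT w|disc_measure. (LINT v|circle_measure. h (v * w)))
      = (LINT v|circle_measure. (LINT w|disc_measure. h (v * w)))"
    by (rule circle_disc.Fubini_integral)
  also have "\<dots> = (LINT v|circle_measure. (LINT w|disc_measure. h w))"
  proof (rule integral_cong_AE)
    show "AE v in circle_measure. (LINT w|disc_measure. h (v * w)) = (LINT w|disc_measure. h w)"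
      using AE_circle_norm
    proof eventually_elim
      case (elim v)
      then show ?case
        by (subst (2) distr_disc_rotate[OF elim, symmetric], subst integral_distr) auto
    qed
  qed auto
  also have "\<dots> = (LINT w|disc_measure. h w)" by simp
  finally show ?thesis ..
qed

section \<open>The radial distribution of area\<close>

abbreviation defect :: "complex \<Rightarrow> real" where
  "defect z \<equiv> 1 - (norm z)\<^sup>2"

text \<open>The sublevel set at t in [0, 1] is the disc minus the concentric disc of radius
  \<open>sqrt (1 - t)\<close>, of area pi t. This linearity in t is the reason for measuring the
  distance to the boundary by 1 - |z|^2 instead of 1 - |z|.\<close>

lemma distr_defect: "distr disc_measure borel defect = uniform_measure lborel {0..1}"
proof (rule cdf_unique)
  let ?U = "uniform_measure lborel {0..1::real}"
  have U: "prob_space ?U" by (rule prob_space_uniform_measure) auto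
  show "real_distribution (distr disc_measure borel defect)"
    by (rule disc.real_distribution_distr) simp
  show "real_distribution ?U"
    using U by (auto simp: real_distribution_def real_distribution_axioms_def)
  have eq: "emeasure disc_measure {w. defect w \<le> t} = emeasure ?U {..t}" for t
  proof -
    consider "t < 0" | "0 \<le> t" "t \<le> 1" | "1 < t" by linarith
    then show ?thesis
    proof cases
      case 1
      have "defect w > t" if "w \<in> unit_disc" for w
      proof -
        have "(norm w)\<^sup>2 \<le> 1" using that by (simp add: unit_disc_def power_le_one)
        then show ?thesis using 1 by linarith
      qed
      then have *: "unit_disc \<inter> {w. defect w \<le> t} = {}" by fastforce
      have "emeasure disc_measure {w. defect w \<le> t} = 0"
        by (subst emeasure_disc) (auto simp: *)
      moreover have "{0..1} \<inter> {..t} = {}" using 1 by auto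
      ultimately show ?thesis by simp
    next
      case 2
      have *: "unit_disc \<inter> {w. defect w \<le> t} = unit_disc - ball 0 (sqrt (1 - t))"
      proof -
        have "norm w < sqrt (1 - t) \<longleftrightarrow> (norm w)\<^sup>2 < 1 - t" for w :: complex
          using real_less_rsqrt[of "norm w" "1 - t"] real_sqrt_less_iff[of "(norm w)\<^sup>2" "1-t"] by auto
        then show ?thesis by auto
      qed
      have "emeasure lborel (unit_disc \<inter> {w. defect w \<le> t}) = ennreal pi - ennreal (pi * (1 - t))"
        unfolding * using 2
        by (subst emeasure_Diff)
           (auto simp: emeasure_lborel_unit_disc emeasure_ball unit_ball_vol_2 unit_disc_def
                 elim!: less_le_trans)
      also have "\<dots> = ennreal (pi * t)" using 2 by (subst ennreal_minus) (auto simp: algebra_simps)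
      finally have "emeasure disc_measure {w. defect w \<le> t} = ennreal t"
        using 2 by (subst emeasure_disc) (auto simp: divide_ennreal)
      moreover have "{0..1} \<inter> {..t} = {0..t}" using 2 by auto
      ultimately show ?thesis using 2 by (simp add: divide_ennreal_def)
    next
      case 3
      have *: "unit_disc \<inter> {w. defect w \<le> t} = unit_disc" using 3
        by (auto simp: algebra_simps intro: add_increasing2)
      have "emeasure disc_measure {w. defect w \<le> t} = 1"
        by (subst emeasure_disc) (auto simp: * emeasure_lborel_unit_disc divide_ennreal)
      moreover have "{0..1} \<inter> {..t} = {0..1}" using 3 by auto
      ultimately show ?thesis by (simp add: divide_ennreal_def)
    qed
  qed
  show "cdf (distr disc_measure borel defect) = cdf ?U"
  proof
    fix t
    have "emeasure (distr disc_measure borel defect) {..t} = emeasure ?U {..t}"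
      unfolding eq[symmetric] by (subst emeasure_distr) (auto intro: arg_cong[where f="emeasure disc_measure"])
    then show "cdf (distr disc_measure borel defect) t = cdf ?U t"
      by (simp add: cdf_def measure_def)
  qed
qed

lemma nn_integral_disc_radial:
  assumes [measurable]: "h \<in> borel_measurable borel"
  shows "(\<integral>\<^sup>+ w. h (defect w) \<partial>disc_measure) = (\<integral>\<^sup>+ s. h s * indicator {0..1} s \<partial>lborel)"
proof -
  have "(\<integral>\<^sup>+ w. h (defect w) \<partial>disc_measure) = (\<integral>\<^sup>+ s. h s \<partial>distr disc_measure borel defect)"
    by (subst nn_integral_distr) auto
  also have "\<dots> = (\<integral>\<^sup>+ s. h s * indicator {0..1} s \<partial>lborel)"
    unfolding distr_defect by (subst nn_integral_uniform_measure) (auto simp: divide_ennreal_def)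
  finally show ?thesis .
qed

lemma emeasure_disc_defect:
  assumes [measurable]: "A \<in> sets borel"
  shows "emeasure disc_measure {w. defect w \<in> A} = emeasure lborel (A \<inter> {0..1})"
proof -
  have "emeasure disc_measure {w. defect w \<in> A} = emeasure (distr disc_measure borel defect) A"
    by (subst emeasure_distr) (auto simp: vimage_def)
  then show ?thesis
    unfolding distr_defect by (simp add: divide_ennreal_def Int_commute)
qed

section \<open>Power series on the circle\<close>

lemma integrable_circle_bounded:
  fixes h :: "complex \<Rightarrow> complex"
  assumes "h \<in> borel_measurable borel" "\<And>v. norm v = 1 \<Longrightarrow> norm (h v) \<le> B"
  shows "integrable circle_measure h"
  by (rule circle.integrable_const_bound[where B=B]) (use assms AE_circle_norm in auto)

text \<open>Off the diagonal a suitable rotation multiplies the integrand by -1, so the integral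
  equals its own negative; the circle need not be parametrized.\<close>

lemma circle_orthogonal:
  "(LINT v|circle_measure. v ^ k * cnj v ^ l) = (if k = l then 1 else 0)"
proof (cases "k = l")
  case True
  have "(LINT v|circle_measure. v ^ k * cnj v ^ l) = (LINT v|circle_measure. 1 :: complex)"
  proof (rule integral_cong_AE)
    show "AE v in circle_measure. v ^ k * cnj v ^ l = 1"
      using AE_circle_norm
      by eventually_elim (simp add: True power_mult_distrib[symmetric] complex_norm_square[symmetric])
  qed auto
  then show ?thesis using True by simp
next
  case False
  let ?m = "LINT v|circle_measure. v ^ k * cnj v ^ l"
  \<comment> \<open>The angle solves (k - l) t = pi, so that \<open>u ^ k * cnj u ^ l\<close>
    becomes \<open>cis pi\<close>.\<close>
  define t where "t = pi / (real k - real l)"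
  define u where "u = cis t"
  have "u ^ k * cnj u ^ l = cis (real k * t) * cis (real l * (- t))"
    unfolding u_def cis_cnj Complex.DeMoivre ..
  also have "\<dots> = cis (real k * t - real l * t)"
    by (simp add: cis_mult)
  also have "real k * t - real l * t = pi"
    using False by (simp add: t_def diff_divide_distrib[symmetric] left_diff_distrib[symmetric])
  finally have u: "u ^ k * cnj u ^ l = -1" by simp
  have "?m = (LINT v|circle_measure. (u * v) ^ k * cnj (u * v) ^ l)"
    by (rule integral_circle_rotate[symmetric]) (auto simp: u_def)
  also have "\<dots> = (LINT v|circle_measure. (u ^ k * cnj u ^ l) * (v ^ k * cnj v ^ l))"
    by (simp add: power_mult_distrib mult_ac)
  also have "\<dots> = - ?m" unfolding u by simp
  finally have "?m = 0" by simp
  then show ?thesis using False by simp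
qed

text \<open>The unimodular function \<open>e\<close> stands for v in the extraction of coefficients,
  and for \<open>cnj v\<close> in Parseval's identity and in Cauchy integrals.\<close>

lemma circle_suminf_integral:
  fixes a :: "nat \<Rightarrow> complex" and g :: "complex \<Rightarrow> complex"
  assumes a: "summable (\<lambda>k. norm (a k))" and [measurable]: "g \<in> borel_measurable borel"
    and e [measurable]: "e \<in> borel_measurable borel"
    and e1: "\<And>v. norm v = 1 \<Longrightarrow> norm (e v) = 1"
    and g: "\<And>v. norm v = 1 \<Longrightarrow> norm (g v) \<le> B"
  shows "(LINT v|circle_measure. (\<Sum>k. a k * e v ^ k) * g v)
       = (\<Sum>k. a k * (LINT v|circle_measure. e v ^ k * g v))"
    and "summable (\<lambda>k. a k * (LINT v|circle_measure. e v ^ k * g v))"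
proof -
  have int: "integrable circle_measure (\<lambda>v. e v ^ k * g v)" for k
    by (rule integrable_circle_bounded[where B=B]) (auto simp: norm_mult norm_power e1 g)
  have bd: "norm (a k * (LINT v|circle_measure. e v ^ k * g v)) \<le> norm (a k) * B" for k
  proof -
    have "norm (LINT v|circle_measure. e v ^ k * g v) \<le> (LINT v|circle_measure. norm (e v ^ k * g v))"
      by (rule integral_norm_bound)
    also have "\<dots> \<le> (LINT v|circle_measure. B)"
      by (rule integral_mono_AE)
         (use int[of k, THEN integrable_norm] AE_circle_norm in \<open>auto simp: norm_mult norm_power e1 g\<close>)
    finally show ?thesis by (simp add: norm_mult mult_left_mono)
  qed
  show sm: "summable (\<lambda>k. a k * (LINT v|circle_measure. e v ^ k * g v))"
    by (rule summable_norm_cancel, rule summable_comparison_test'[OF summable_mult2[OF a, of B], of 0])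
       (use bd in auto)
  have "(LINT v|circle_measure. (\<Sum>k. a k * e v ^ k) * g v)
      = (LINT v|circle_measure. (\<Sum>k. a k * (e v ^ k * g v)))"
  proof (rule integral_cong_AE)
    show "AE v in circle_measure. (\<Sum>k. a k * e v ^ k) * g v = (\<Sum>k. a k * (e v ^ k * g v))"
      using AE_circle_norm
    proof eventually_elim
      case (elim v)
      have "summable (\<lambda>k. a k * e v ^ k)"
        by (rule summable_norm_cancel) (use a elim in \<open>simp add: norm_mult norm_power e1\<close>)
      from suminf_mult2[OF this] show ?case by (simp add: mult.assoc)
    qed
  qed auto
  also have "\<dots> = (\<Sum>k. LINT v|circle_measure. a k * (e v ^ k * g v))"
  proof (rule integral_suminf)
    show "integrable circle_measure (\<lambda>v. a k * (e v ^ k * g v))" for k using int by simp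
    show "AE v in circle_measure. summable (\<lambda>k. norm (a k * (e v ^ k * g v)))"
      using AE_circle_norm
      by eventually_elim (use a in \<open>auto simp: norm_mult norm_power e1 intro: summable_mult2\<close>)
    show "summable (\<lambda>k. LINT v|circle_measure. norm (a k * (e v ^ k * g v)))"
    proof (rule summable_comparison_test'[OF summable_mult2[OF a, of B], of 0])
      fix k
      have "(LINT v|circle_measure. norm (a k * (e v ^ k * g v))) \<le> (LINT v|circle_measure. norm (a k) * B)"
        by (rule integral_mono_AE)
           (use int[of k, THEN integrable_norm] AE_circle_norm in \<open>auto simp: norm_mult norm_power e1 intro!: mult_left_mono g\<close>)
      then show "norm (LINT v|circle_measure. norm (a k * (e v ^ k * g v))) \<le> norm (a k) * B" by simp
    qed
  qed
  also have "\<dots> = (\<Sum>k. a k * (LINT v|circle_measure. e v ^ k * g v))" by simp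
  finally show "(LINT v|circle_measure. (\<Sum>k. a k * e v ^ k) * g v)
       = (\<Sum>k. a k * (LINT v|circle_measure. e v ^ k * g v))" .
qed

lemma circle_series_coeff:
  fixes a :: "nat \<Rightarrow> complex"
  assumes a: "summable (\<lambda>k. norm (a k))"
  shows "(LINT v|circle_measure. (\<Sum>k. a k * v ^ k) * cnj v ^ n) = a n"
proof -
  have "(LINT v|circle_measure. (\<Sum>k. a k * v ^ k) * cnj v ^ n)
      = (\<Sum>k. a k * (LINT v|circle_measure. v ^ k * cnj v ^ n))"
    by (rule circle_suminf_integral[OF a, where B=1]) (auto simp: norm_power)
  also have "\<dots> = (\<Sum>k. if k = n then a k else 0)"
    by (rule suminf_cong) (simp add: circle_orthogonal)
  also have "\<dots> = a n" using sums_single[of n a] by (simp add: sums_iff)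
  finally show ?thesis .
qed

text \<open>Only the conjugate factor is expanded. The full sum is kept as a bounded factor, and
  each integral that remains is one of its own coefficients.\<close>

lemma circle_parseval:
  fixes a :: "nat \<Rightarrow> complex"
  assumes a: "summable (\<lambda>k. norm (a k))"
  shows "(LINT v|circle_measure. (norm (\<Sum>k. a k * v ^ k))\<^sup>2) = (\<Sum>k. (norm (a k))\<^sup>2)"
    and "summable (\<lambda>k. (norm (a k))\<^sup>2)"
proof -
  let ?S = "\<lambda>v. \<Sum>k. a k * v ^ k"
  have bd: "norm (?S v) \<le> (\<Sum>k. norm (a k))" if "norm v = 1" for v
    by (rule order_trans[OF summable_norm]) (use a that in \<open>auto simp: norm_mult norm_power\<close>)
  have e: "(LINT v|circle_measure. cnj v ^ k * ?S v) = a k" for k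
    using circle_series_coeff[OF a, of k] by (simp add: mult.commute)
  note * = circle_suminf_integral[where a="\<lambda>k. cnj (a k)" and g="?S" and e=cnj and B="\<Sum>k. norm (a k)"]
  have "(LINT v|circle_measure. complex_of_real ((norm (?S v))\<^sup>2))
      = (LINT v|circle_measure. (\<Sum>k. cnj (a k) * cnj v ^ k) * ?S v)"
  proof (rule integral_cong_AE)
    show "AE v in circle_measure. complex_of_real ((norm (?S v))\<^sup>2) = (\<Sum>k. cnj (a k) * cnj v ^ k) * ?S v"
      using AE_circle_norm
    proof eventually_elim
      case (elim v)
      have "summable (\<lambda>k. a k * v ^ k)"
        by (rule summable_norm_cancel) (use a elim in \<open>simp add: norm_mult norm_power\<close>)
      then have "(\<lambda>k. cnj (a k * v ^ k)) sums cnj (?S v)"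
        by (intro sums_cnj[THEN iffD2] summable_sums)
      then have "cnj (?S v) = (\<Sum>k. cnj (a k) * cnj v ^ k)" by (simp add: sums_iff)
      then show ?case by (metis complex_norm_square mult.commute of_real_power)
    qed
  qed auto
  also have "\<dots> = (\<Sum>k. cnj (a k) * a k)"
    using *(1) a bd e by (auto simp: e)
  finally have 1: "complex_of_real (LINT v|circle_measure. ((norm (?S v))\<^sup>2)) = (\<Sum>k. cnj (a k) * a k)"
    by (simp only: integral_complex_of_real)
  have "summable (\<lambda>k. cnj (a k) * a k)" using *(2) a bd by (auto simp: e)
  moreover have eq: "cnj (a k) * a k = complex_of_real ((norm (a k))\<^sup>2)" for k
    by (metis complex_norm_square mult.commute of_real_power)
  ultimately show sm: "summable (\<lambda>k. (norm (a k))\<^sup>2)"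
    unfolding eq by (simp only: summable_complex_of_real)
  have "(\<Sum>k. cnj (a k) * a k) = complex_of_real (\<Sum>k. (norm (a k))\<^sup>2)"
    unfolding eq by (rule suminf_of_real[OF sm, symmetric])
  with 1 show "(LINT v|circle_measure. (norm (\<Sum>k. a k * v ^ k))\<^sup>2) = (\<Sum>k. (norm (a k))\<^sup>2)"
    by (simp only: of_real_eq_iff)
qed

section \<open>Reduction to Borel functions\<close>

lemma borel_measurable_dA:
  "f \<in> borel_measurable borel \<Longrightarrow> f \<in> borel_measurable dA"
  unfolding dA_def by (simp add: measurable_completion measurable_restrict_space1)

lemma sets_dA_iff: "A \<in> sets dA \<longleftrightarrow> A \<subseteq> unit_disc \<and> A \<in> sets lebesgue"
  unfolding dA_def by (simp add: sets_restrict_space_iff)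

text \<open>\<open>dA\<close> carries the completed sigma-algebra of the disc,
  \<open>disc_measure\<close> the Borel sets of the plane. They agree on Borel integrands, and the
  Borel model is the one suited to product and image measures.\<close>

lemma nn_integral_dA:
  assumes [measurable]: "f \<in> borel_measurable borel"
  shows "nn_integral dA f = nn_integral disc_measure f"
proof -
  have "nn_integral dA f = (\<integral>\<^sup>+ z. ennreal (1 / pi) * f z \<partial>lebesgue_on unit_disc)"
    unfolding dA_def
    by (subst nn_integral_density) (auto simp: measurable_completion measurable_restrict_space1)
  also have "\<dots> = (\<integral>\<^sup>+ z. ennreal (1 / pi) * f z * indicator unit_disc z \<partial>lebesgue)"
    by (subst nn_integral_restrict_space) auto
  also have "\<dots> = (\<integral>\<^sup>+ z. ennreal (1 / pi) * (f z * indicator unit_disc z) \<partial>lborel)"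
    by (simp add: nn_integral_completion mult.assoc)
  also have "\<dots> = ennreal (1 / pi) * (\<integral>\<^sup>+ z. f z * indicator unit_disc z \<partial>lborel)"
    by (subst nn_integral_cmult) auto
  also have "\<dots> = nn_integral disc_measure f"
  proof -
    have "ennreal (1 / pi) = inverse (ennreal pi)"
      by (subst inverse_ennreal) (simp_all only: pi_gt_zero inverse_eq_divide)
    then show ?thesis by (simp only: nn_integral_disc[OF assms] divide_ennreal_def mult.commute)
  qed
  finally show ?thesis .
qed

lemma emeasure_dA:
  assumes [measurable]: "A \<in> sets borel"
  shows "emeasure dA (A \<inter> unit_disc) = emeasure disc_measure A"
proof -
  have "A \<inter> unit_disc \<in> sets dA" by (auto simp: sets_dA_iff)
  then have "emeasure dA (A \<inter> unit_disc) = (\<integral>\<^sup>+ z. indicator (A \<inter> unit_disc) z \<partial>dA)"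
    by simp
  also have "\<dots> = (\<integral>\<^sup>+ z. indicator A z \<partial>dA)"
    by (rule nn_integral_cong) (auto simp: space_dA indicator_def)
  finally show ?thesis by (simp add: nn_integral_dA)
qed

lemma AE_dA_iff:
  assumes [measurable]: "Measurable.pred borel P"
  shows "(AE z in dA. P z) \<longleftrightarrow> (AE z in disc_measure. P z)"
proof -
  have m: "{z \<in> space dA. \<not> P z} = {z. \<not> P z} \<inter> unit_disc" by (auto simp: space_dA)
  have "{z. \<not> P z} \<inter> unit_disc \<in> sets dA" by (auto simp: sets_dA_iff)
  then have "(AE z in dA. P z) \<longleftrightarrow> emeasure dA {z \<in> space dA. \<not> P z} = 0"
    by (subst AE_iff_measurable[OF _ refl]) (simp_all add: m)
  also have "\<dots> \<longleftrightarrow> emeasure disc_measure {z. \<not> P z} = 0"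
    unfolding m by (subst emeasure_dA) auto
  also have "\<dots> \<longleftrightarrow> (AE z in disc_measure. P z)"
    by (subst AE_iff_measurable[OF _ refl]) auto
  finally show ?thesis .
qed

lemma AE_dA_unit_disc: "AE z in dA. z \<in> unit_disc"
  by (rule AE_I2) (simp add: space_dA)

lemma integrable_dA_iff:
  fixes f :: "complex \<Rightarrow> complex"
  assumes [measurable]: "f \<in> borel_measurable borel"
  shows "integrable dA f \<longleftrightarrow> integrable disc_measure f"
  using nn_integral_dA[of "\<lambda>z. ennreal (norm (f z))"]
  by (simp add: integrable_iff_bounded borel_measurable_dA)

lemma integral_dA:
  fixes f :: "complex \<Rightarrow> complex"
  assumes [measurable]: "f \<in> borel_measurable borel"
  shows "(LINT z|dA. f z) = (LINT z|disc_measure. f z)"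
proof -
  have *: "distr dA borel (\<lambda>z. z) = disc_measure"
  proof (rule measure_eqI)
    fix A assume "A \<in> sets (distr dA borel (\<lambda>z. z))"
    then have "A \<in> sets borel" by simp
    then show "emeasure (distr dA borel (\<lambda>z. z)) A = emeasure disc_measure A"
      by (subst emeasure_distr) (auto simp: emeasure_dA space_dA borel_measurable_dA)
  qed simp
  show ?thesis unfolding *[symmetric]
    by (subst integral_distr) (auto simp: borel_measurable_dA)
qed

lemma measure_dA:
  assumes "A \<in> sets borel"
  shows "measure dA (A \<inter> unit_disc) = measure disc_measure A"
  using emeasure_dA[OF assms] by (simp add: measure_def)

lemma distr_fun_eq:
  assumes [measurable]: "f \<in> borel_measurable borel"
  shows "distr_fun f t = measure disc_measure {z. norm (f z) > t}"
proof -
  have "{z \<in> unit_disc. norm (f z) > t} = {z. norm (f z) > t} \<inter> unit_disc" by auto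
  then show ?thesis unfolding distr_fun_def by (simp only:) (rule measure_dA, measurable)
qed

text \<open>Extended by 0 outside the disc, f is measurable for the completion of Lebesgue measure,
  where its real and imaginary parts have Borel versions.\<close>

lemma dA_borel_version:
  fixes f :: "complex \<Rightarrow> complex"
  assumes "f \<in> borel_measurable dA"
  shows "\<exists>g\<in>borel_measurable borel. AE z in dA. f z = g z"
proof -
  have "f \<in> borel_measurable (lebesgue_on unit_disc)"
    using assms unfolding dA_def by simp
  define F where "F z = (if z \<in> unit_disc then f z else 0)" for z
  have "F \<in> borel_measurable lebesgue" unfolding F_def
    by (rule borel_measurable_if[THEN iffD2]) (simp, fact)
  then have F [measurable]: "F \<in> borel_measurable (completion lborel)" .
  obtain g1 where g1: "g1 \<in> borel_measurable borel" "AE z in lborel. Re (F z) = g1 z"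
    using completion_ex_borel_measurable_real[of "\<lambda>z. Re (F z)" lborel] by auto
  obtain g2 where g2: "g2 \<in> borel_measurable borel" "AE z in lborel. Im (F z) = g2 z"
    using completion_ex_borel_measurable_real[of "\<lambda>z. Im (F z)" lborel] by auto
  define g where "g z = Complex (g1 z) (g2 z)" for z
  have "AE z in lborel. F z = g z"
    using g1(2) g2(2) by eventually_elim (simp add: complex_eq_iff g_def)
  then have "AE z in lebesgue. F z = g z" by (rule AE_completion)
  then have "AE z in lebesgue_on unit_disc. f z = g z"
    by (subst AE_restrict_space_iff) (auto simp: F_def elim: eventually_mono)
  then have "AE z in dA. f z = g z"
    unfolding dA_def by (subst AE_density) (auto elim: eventually_mono)
  moreover have "g \<in> borel_measurable borel"
    unfolding g_def using g1(1) g2(1) by (simp add: borel_measurable_complex_iff)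
  ultimately show ?thesis by blast
qed

lemma distr_fun_cong_AE:
  assumes "f \<in> borel_measurable dA" "g \<in> borel_measurable dA" "AE z in dA. f z = g z"
  shows "distr_fun f = distr_fun g"
proof
  fix t
  have [measurable]: "f \<in> borel_measurable dA" "g \<in> borel_measurable dA" by fact+
  show "distr_fun f t = distr_fun g t"
    unfolding distr_fun_def space_dA[symmetric]
    by (rule measure_eq_AE) (use assms(3) in auto)
qed

lemma Lp_norm_cong_AE:
  assumes "f \<in> borel_measurable dA" "g \<in> borel_measurable dA" "AE z in dA. f z = g z"
  shows "Lp_norm p f = Lp_norm p g"
proof -
  have "esssup dA (\<lambda>z. ennreal (norm (f z))) = esssup dA (\<lambda>z. ennreal (norm (g z)))"
    by (rule esssup_AE_cong) (use assms in auto)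
  moreover have "(\<integral>\<^sup>+ z. ennreal (norm (f z) powr enn2real p) \<partial>dA) = (\<integral>\<^sup>+ z. ennreal (norm (g z) powr enn2real p) \<partial>dA)"
    by (rule nn_integral_cong_AE) (use assms(3) in auto)
  ultimately show ?thesis by (simp add: Lp_norm_def)
qed

lemma Lp1_norm_cong_AE:
  assumes "f \<in> borel_measurable dA" "g \<in> borel_measurable dA" "AE z in dA. f z = g z"
  shows "Lp1_norm p f = Lp1_norm p g"
  using distr_fun_cong_AE[OF assms] by (simp add: Lp1_norm_def)

definition borel_kernel :: "integral_operator \<Rightarrow> bool" where
  "borel_kernel K \<longleftrightarrow> (\<forall>z. kernel K z \<in> borel_measurable borel)"

lemma integral_operator_cong_AE:
  assumes "borel_kernel K" "f \<in> borel_measurable dA" "g \<in> borel_measurable dA" "AE z in dA. f z = g z"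
  shows "apply_op K f = apply_op K g" "converges_ae K f = converges_ae K g"
proof -
  have [measurable]: "kernel K z \<in> borel_measurable dA" for z
    using assms(1) by (simp add: borel_kernel_def borel_measurable_dA)
  have [measurable]: "f \<in> borel_measurable dA" "g \<in> borel_measurable dA" by fact+
  show "apply_op K f = apply_op K g"
    unfolding apply_op_def by (intro ext arg_cong2[where f="(*)"] refl integral_cong_AE) (use assms(4) in auto)
  have "integrable dA (\<lambda>w. kernel K z w * f w) = integrable dA (\<lambda>w. kernel K z w * g w)" for z
    by (rule integrable_cong_AE) (use assms(4) in auto)
  then show "converges_ae K f = converges_ae K g" by (simp add: converges_ae_def)
qed

section \<open>Norm estimates as bounds on distribution functions\<close>

lemma weak_Lq_norm_le_iff:
  assumes "0 < q" "0 \<le> C"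
  shows "weak_Lq_norm (ennreal q) u \<le> ennreal C \<longleftrightarrow> (\<forall>t>0. distr_fun u t \<le> (C / t) powr q)"
proof -
  have eq: "ennreal (t * distr_fun u t powr (1 / q)) \<le> ennreal C \<longleftrightarrow> distr_fun u t \<le> (C / t) powr q"
    if t: "t > 0" for t
  proof -
    let ?d = "distr_fun u t"
    have d: "0 \<le> ?d" by (simp add: distr_fun_def)
    have "ennreal (t * ?d powr (1 / q)) \<le> ennreal C \<longleftrightarrow> ?d powr (1 / q) \<le> C / t"
      using t assms by (simp add: ennreal_le_iff field_simps)
    also have "\<dots> \<longleftrightarrow> (?d powr (1 / q)) powr q \<le> (C / t) powr q"
      using assms t powr_mono2[of q "?d powr (1/q)" "C / t"] powr_less_mono2[of q "C / t" "?d powr (1/q)"]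
      by (auto simp: not_le[symmetric] simp del: powr_powr)
    also have "(?d powr (1 / q)) powr q = ?d" using assms d by (simp add: powr_powr)
    finally show ?thesis .
  qed
  have "weak_Lq_norm (ennreal q) u = (SUP t\<in>{0<..}. ennreal (t * distr_fun u t powr (1 / q)))"
    using assms by (simp add: weak_Lq_norm_def)
  then show ?thesis by (auto simp: SUP_le_iff eq)
qed

text \<open>A real majorant B replaces the norm of f and a Borel version replaces f, so that later
  arguments are free of extended reals and of the completion. The functional \<open>N\<close> is
  kept abstract because the Lebesgue and the Lorentz norms both pass through here.\<close>

lemma bounded_op_weak_iff:
  assumes cong: "\<And>f g. f \<in> borel_measurable dA \<Longrightarrow> g \<in> borel_measurable dA \<Longrightarrow> AE z in dA. f z = g z \<Longrightarrow> N f = N g"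
    and K: "borel_kernel K" and q: "0 < q"
  shows "bounded_op {f \<in> borel_measurable dA. N f < \<infinity>} N (weak_Lq_norm (ennreal q)) K \<longleftrightarrow>
    (\<exists>C\<ge>0. \<forall>f\<in>borel_measurable borel. \<forall>B\<ge>0. N f \<le> ennreal B \<longrightarrow>
       converges_ae K f \<and> (\<forall>t>0. distr_fun (apply_op K f) t \<le> (C * B / t) powr q))"
    (is "?L \<longleftrightarrow> ?R")
proof
  assume ?L
  then obtain C where C: "\<And>f. f \<in> borel_measurable dA \<Longrightarrow> N f < \<infinity> \<Longrightarrow>
     converges_ae K f \<and> weak_Lq_norm (ennreal q) (apply_op K f) \<le> ennreal C * N f"
    unfolding bounded_op_def by auto
  \<comment> \<open>\<open>C\<close> may be negative, in which case \<open>ennreal C\<close> is 0;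
    \<open>max 0 C\<close> gives the same extended value and is a legal constant.\<close>
  have "converges_ae K f \<and> (\<forall>t>0. distr_fun (apply_op K f) t \<le> (max 0 C * B / t) powr q)"
    if f: "f \<in> borel_measurable borel" and B: "B \<ge> 0" "N f \<le> ennreal B" for f B
  proof -
    have "N f < \<infinity>" using B le_less_trans[OF B(2)] by simp
    note * = C[OF borel_measurable_dA[OF f] this]
    have "weak_Lq_norm (ennreal q) (apply_op K f) \<le> ennreal C * N f" using * by simp
    also have "\<dots> \<le> ennreal (max 0 C) * ennreal B"
      by (rule mult_mono) (use B in \<open>auto intro: ennreal_leI\<close>)
    also have "\<dots> = ennreal (max 0 C * B)" using B by (intro ennreal_mult[symmetric]) auto
    finally have "weak_Lq_norm (ennreal q) (apply_op K f) \<le> ennreal (max 0 C * B)" .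
    moreover have "0 \<le> max 0 C * B" using B by simp
    ultimately show ?thesis using * weak_Lq_norm_le_iff[OF q] by blast
  qed
  then show ?R by (intro exI[of _ "max 0 C"]) auto
next
  assume ?R
  then obtain C where C0: "C \<ge> 0" and C: "\<And>f B. f \<in> borel_measurable borel \<Longrightarrow> B \<ge> 0 \<Longrightarrow> N f \<le> ennreal B \<Longrightarrow>
     converges_ae K f \<and> (\<forall>t>0. distr_fun (apply_op K f) t \<le> (C * B / t) powr q)" by blast
  show ?L unfolding bounded_op_def
  proof (intro exI[of _ C] ballI)
    fix f assume "f \<in> {f \<in> borel_measurable dA. N f < \<infinity>}"
    then have f: "f \<in> borel_measurable dA" "N f < \<infinity>" by auto
    obtain g where g: "g \<in> borel_measurable borel" "AE z in dA. f z = g z"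
      using dA_borel_version[OF f(1)] by blast
    note gm = borel_measurable_dA[OF g(1)]
    have Nfg: "N f = N g" by (rule cong[OF f(1) gm g(2)])
    define B where "B = enn2real (N f)"
    have B: "B \<ge> 0" "N f = ennreal B" using f(2) by (auto simp: B_def less_top)
    then have "N g \<le> ennreal B" using Nfg by simp
    from C[OF g(1) B(1) this]
    have "converges_ae K g" "weak_Lq_norm (ennreal q) (apply_op K g) \<le> ennreal (C * B)"
      using q C0 B by (auto simp: weak_Lq_norm_le_iff)
    then show "converges_ae K f \<and> weak_Lq_norm (ennreal q) (apply_op K f) \<le> ennreal C * N f"
      using integral_operator_cong_AE[OF K f(1) gm g(2)] B C0 by (simp add: ennreal_mult)
  qed
qed

lemma weak_type_iff:
  assumes "borel_kernel K" "0 < q"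
  shows "weak_type K p (ennreal q) \<longleftrightarrow>
    (\<exists>C\<ge>0. \<forall>f\<in>borel_measurable borel. \<forall>B\<ge>0. Lp_norm p f \<le> ennreal B \<longrightarrow>
       converges_ae K f \<and> (\<forall>t>0. distr_fun (apply_op K f) t \<le> (C * B / t) powr q))"
  unfolding weak_type_def Lp_space_def
  by (rule bounded_op_weak_iff) (use assms in \<open>auto intro: Lp_norm_cong_AE\<close>)

lemma restricted_weak_type_iff:
  assumes "borel_kernel K" "0 < q" "p \<noteq> \<infinity>"
  shows "restricted_weak_type K p (ennreal q) \<longleftrightarrow>
    (\<exists>C\<ge>0. \<forall>f\<in>borel_measurable borel. \<forall>B\<ge>0. Lp1_norm p f \<le> ennreal B \<longrightarrow>
       converges_ae K f \<and> (\<forall>t>0. distr_fun (apply_op K f) t \<le> (C * B / t) powr q))"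
  unfolding restricted_weak_type_def Lp1_space_def unfolding if_not_P[OF assms(3)]
  by (rule bounded_op_weak_iff) (use assms in \<open>auto intro: Lp1_norm_cong_AE\<close>)

lemma restricted_weak_type_infinity_iff:
  assumes "borel_kernel K" "0 < q"
  shows "restricted_weak_type K \<infinity> (ennreal q) \<longleftrightarrow>
    (\<exists>C\<ge>0. \<forall>E\<in>sets borel. converges_ae K (indicator E) \<and>
       (\<forall>t>0. distr_fun (apply_op K (indicator E)) t \<le> (C / t) powr q))"
    (is "?L \<longleftrightarrow> ?R")
proof
  assume ?L
  then obtain C where C: "\<And>E. E \<in> sets dA \<Longrightarrow> converges_ae K (indicator E) \<and>
     weak_Lq_norm (ennreal q) (apply_op K (indicator E)) \<le> ennreal C"
    unfolding restricted_weak_type_def by auto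
  have "converges_ae K (indicator E) \<and> (\<forall>t>0. distr_fun (apply_op K (indicator E)) t \<le> (max 0 C / t) powr q)"
    if E [measurable]: "E \<in> sets borel" for E
  proof -
    have "E \<inter> unit_disc \<in> sets dA" by (auto simp: sets_dA_iff)
    note * = C[OF this]
    have "weak_Lq_norm (ennreal q) (apply_op K (indicator (E \<inter> unit_disc))) \<le> ennreal (max 0 C)"
      by (rule order_trans[OF conjunct2[OF *]]) (auto intro: ennreal_leI)
    moreover have "AE z in dA. (indicator E z :: complex) = indicator (E \<inter> unit_disc) z"
      using AE_dA_unit_disc by eventually_elim (auto simp: indicator_def)
    note eq = integral_operator_cong_AE[OF assms(1) _ _ this]
    have "apply_op K (indicator E) = apply_op K (indicator (E \<inter> unit_disc))"
      "converges_ae K (indicator E) = converges_ae K (indicator (E \<inter> unit_disc))"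
      by (rule eq; intro borel_measurable_dA borel_measurable_indicator; simp)+
    ultimately show ?thesis
      using * weak_Lq_norm_le_iff[OF assms(2), of "max 0 C"] by (metis max.cobounded1)
  qed
  then show ?R by (intro exI[of _ "max 0 C"]) auto
next
  assume ?R
  then obtain C where C0: "C \<ge> 0" and C: "\<And>E. E \<in> sets borel \<Longrightarrow> converges_ae K (indicator E) \<and>
     (\<forall>t>0. distr_fun (apply_op K (indicator E)) t \<le> (C / t) powr q)" by blast
  have "converges_ae K (indicator E) \<and> weak_Lq_norm (ennreal q) (apply_op K (indicator E)) \<le> ennreal C"
    if E: "E \<in> sets dA" for E
  proof -
    have "(indicator E :: complex \<Rightarrow> complex) \<in> borel_measurable dA" using E by simp
    from dA_borel_version[OF this] obtain g where
      g: "g \<in> borel_measurable borel" "AE z in dA. (indicator E z :: complex) = g z" by blast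
    \<comment> \<open>The Borel version g of the indicator need not take its values in {0, 1}; the
      set where it equals 1 restores an indicator.\<close>
    define F where "F = {z. g z = 1}"
    have F: "F \<in> sets borel" unfolding F_def using g(1) by measurable
    have "AE z in dA. (indicator E z :: complex) = indicator F z"
      using g(2) by eventually_elim (auto simp: F_def indicator_def of_bool_def split: if_splits)
    note eq = integral_operator_cong_AE[OF assms(1) _ _ this]
    have "apply_op K (indicator E) = apply_op K (indicator F)"
      "converges_ae K (indicator E) = converges_ae K (indicator F)"
      by (rule eq; (use E in simp)?; intro borel_measurable_dA borel_measurable_indicator F)+
    then show ?thesis using C[OF F] C0 assms(2) by (simp add: weak_Lq_norm_le_iff)
  qed
  then show ?L unfolding restricted_weak_type_def by auto
qed

lemma Lp_norm_le_iff:
  assumes [measurable]: "f \<in> borel_measurable borel" and "0 < p" "0 \<le> B"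
  shows "Lp_norm (ennreal p) f \<le> ennreal B \<longleftrightarrow> (\<integral>\<^sup>+ z. ennreal (norm (f z) powr p) \<partial>disc_measure) \<le> ennreal (B powr p)"
proof -
  let ?I = "\<integral>\<^sup>+ z. ennreal (norm (f z) powr p) \<partial>disc_measure"
  have "Lp_norm (ennreal p) f = ennreal_powr ?I (1 / p)"
    using assms by (simp add: Lp_norm_def nn_integral_dA)
  also have "\<dots> \<le> ennreal B \<longleftrightarrow> ?I \<le> ennreal (B powr p)"
  proof (cases "?I = \<infinity>")
    case True
    then show ?thesis by (simp add: ennreal_powr_def top_unique)
  next
    case False
    define J where "J = enn2real ?I"
    have J: "?I = ennreal J" "J \<ge> 0" using False by (auto simp: J_def less_top)
    have "J powr (1 / p) \<le> B \<longleftrightarrow> (J powr (1 / p)) powr p \<le> B powr p"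
      using assms powr_mono2[of p "J powr (1/p)" B] powr_less_mono2[of p B "J powr (1/p)"]
      by (auto simp: not_le[symmetric] simp del: powr_powr)
    also have "(J powr (1 / p)) powr p = J" using assms J by (simp add: powr_powr)
    finally show ?thesis using False J assms by (simp add: ennreal_powr_def ennreal_le_iff)
  qed
  finally show ?thesis .
qed

lemma Lp_norm_infinity_le_iff:
  assumes [measurable]: "f \<in> borel_measurable borel" and "0 \<le> B"
  shows "Lp_norm \<infinity> f \<le> ennreal B \<longleftrightarrow> (AE z in disc_measure. norm (f z) \<le> B)"
proof -
  have "Lp_norm \<infinity> f \<le> ennreal B \<longleftrightarrow> (AE z in dA. ennreal (norm (f z)) \<le> ennreal B)"
  proof
    assume "Lp_norm \<infinity> f \<le> ennreal B"
    moreover have "AE z in dA. ennreal (norm (f z)) \<le> Lp_norm \<infinity> f"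
      unfolding Lp_norm_def by (simp add: esssup_AE)
    ultimately show "AE z in dA. ennreal (norm (f z)) \<le> ennreal B"
      by (auto elim: eventually_mono intro: order_trans)
  next
    assume "AE z in dA. ennreal (norm (f z)) \<le> ennreal B"
    then show "Lp_norm \<infinity> f \<le> ennreal B"
      unfolding Lp_norm_def by (auto intro!: esssup_I borel_measurable_dA)
  qed
  also have "\<dots> \<longleftrightarrow> (AE z in disc_measure. norm (f z) \<le> B)"
    using assms by (subst AE_dA_iff) (auto simp: ennreal_le_iff)
  finally show ?thesis .
qed

section \<open>Weak-type bounds from bounds on circles\<close>

lemma defect_pos: "z \<in> unit_disc \<Longrightarrow> 0 < defect z"
  by (simp add: unit_disc_def power_less_one_iff abs_square_less_1)

lemma AE_disc_defect_pos: "AE z in disc_measure. 0 < defect z"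
  using AE_disc_unit_disc by eventually_elim (rule defect_pos)

text \<open>The two terms of the minimum meet at x = X. The part below contributes X and the tail X
  / (r - 1), which is finite because r > 1.\<close>

lemma nn_integral_truncated_powr:
  fixes X r :: real
  assumes "0 \<le> X" "1 < r"
  shows "(\<integral>\<^sup>+ x. ennreal (min 1 ((X / x) powr r)) * indicator {0..} x \<partial>lborel) \<le> ennreal (r / (r - 1) * X)"
proof (cases "X = 0")
  case True then show ?thesis by simp
next
  case False
  then have X: "0 < X" using assms by simp
  let ?F = "\<lambda>x. - (X powr r) / (r - 1) * x powr (1 - r)"
  have min_le: "min 1 y \<le> y" for y :: real by simp
  have "(\<integral>\<^sup>+ x. ennreal (min 1 ((X / x) powr r)) * indicator {0..} x \<partial>lborel)
      \<le> (\<integral>\<^sup>+ x. indicator {0..X} x + ennreal (X powr r * x powr (-r)) * indicator {X..} x \<partial>lborel)"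
    by (rule nn_integral_mono)
       (use X in \<open>auto simp: indicator_def powr_divide powr_minus_divide min.coboundedI2\<close>)
  also have "\<dots> = emeasure lborel {0..X} + (\<integral>\<^sup>+ x. ennreal (X powr r * x powr (-r)) * indicator {X..} x \<partial>lborel)"
    by (subst nn_integral_add) auto
  also have "(\<integral>\<^sup>+ x. ennreal (X powr r * x powr (-r)) * indicator {X..} x \<partial>lborel) = ennreal (0 - ?F X)"
  proof (rule nn_integral_FTC_atLeast[where F="?F" and T=0])
    fix x assume "X \<le> x"
    then have x: "x > 0" using X by simp
    have "((\<lambda>x. x powr (1 - r)) has_real_derivative (1 - r) * x powr (1 - r - 1)) (at x)"
      using x by (rule has_real_derivative_powr)
    from DERIV_cmult[OF this, of "- (X powr r) / (r - 1)"]
    have "(?F has_real_derivative - (X powr r) / (r - 1) * ((1 - r) * x powr (1 - r - 1))) (at x)" .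
    also have "- (X powr r) / (r - 1) * ((1 - r) * x powr (1 - r - 1)) = ((r - 1) / (r - 1)) * (X powr r * x powr - r)"
      using assms(2) by (simp add: divide_simps) (simp add: algebra_simps)
    also have "\<dots> = X powr r * x powr - r" using assms(2) by simp
    finally show "(?F has_real_derivative X powr r * x powr - r) (at x)" .
    show "0 \<le> X powr r * x powr - r" by simp
  next
    have "((\<lambda>x. x powr (1 - r)) \<longlongrightarrow> 0) at_top"
      using assms(2) by (intro tendsto_neg_powr filterlim_ident) auto
    from tendsto_mult_left[OF this, of "- (X powr r) / (r - 1)"]
    show "(?F \<longlongrightarrow> 0) at_top" by simp
  qed simp
  also have "0 - ?F X = X / (r - 1)"
    using X by (simp add: powr_add[symmetric] mult.assoc)
  also have "emeasure lborel {0..X} + ennreal (X / (r - 1)) = ennreal (X + X / (r - 1))"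
    using X assms by (simp add: ennreal_plus)
  also have "X + X / (r - 1) = r / (r - 1) * X"
    using assms by (simp add: field_simps)
  finally show ?thesis .
qed

text \<open>Rotation averaging expresses the area of the level set through its share of each circle.
  On the circle of defect d the hypothesis at t = l d^(-a) bounds this share by (X / d)^(s / q) with
  X = (N / l)^q. The share is also at most 1, and d is uniformly distributed on [0, 1].\<close>

lemma weak_bound_from_circles:
  fixes F :: "complex \<Rightarrow> complex"
  assumes q: "0 < q" "q < s" and N: "0 \<le> N" and [measurable]: "F \<in> borel_measurable borel"
    and bound: "\<And>z t. z \<in> unit_disc \<Longrightarrow> 0 < t \<Longrightarrow>
       measure circle_measure {v. norm (F (v * z)) > t} \<le> (N * defect z powr - (a + 1 / q) / t) powr s"
    and l: "0 < l"
  shows "measure disc_measure {z. defect z powr a * norm (F z) > l} \<le> s / (s - q) * (N / l) powr q"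
proof -
  define X where "X = (N / l) powr q"
  have X: "X \<ge> 0" by (simp add: X_def)
  let ?S = "{z. defect z powr a * norm (F z) > l}"
  have [measurable]: "?S \<in> sets borel" by measurable
  have "emeasure disc_measure ?S = (\<integral>\<^sup>+ z. indicator ?S z \<partial>disc_measure)" by simp
  also have "\<dots> = (\<integral>\<^sup>+ z. (\<integral>\<^sup>+ v. indicator ?S (v * z) \<partial>circle_measure) \<partial>disc_measure)"
    by (rule nn_integral_disc_average) simp
  also have "\<dots> \<le> (\<integral>\<^sup>+ z. ennreal (min 1 ((X / defect z) powr (s / q))) \<partial>disc_measure)"
  proof (rule nn_integral_mono_AE)
    show "AE z in disc_measure. (\<integral>\<^sup>+ v. indicator ?S (v * z) \<partial>circle_measure)
        \<le> ennreal (min 1 ((X / defect z) powr (s / q)))"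
      using AE_disc_unit_disc
    proof eventually_elim
      case (elim z)
      have d: "0 < defect z" by (rule defect_pos[OF elim])
      let ?t = "l * defect z powr (- a)"
      have t: "?t > 0" using d l by simp
      have "(\<integral>\<^sup>+ v. indicator ?S (v * z) \<partial>circle_measure) = (\<integral>\<^sup>+ v. indicator {v. norm (F (v * z)) > ?t} v \<partial>circle_measure)"
      proof (rule nn_integral_cong_AE)
        show "AE v in circle_measure. indicator ?S (v * z) = (indicator {v. norm (F (v * z)) > ?t} v :: ennreal)"
          using AE_circle_norm
        proof eventually_elim
          case (elim v)
          have "defect (v * z) = defect z" using elim by (simp add: norm_mult)
          moreover have "defect z powr a * norm (F (v * z)) > l \<longleftrightarrow> norm (F (v * z)) > ?t"
            using d by (simp add: powr_minus divide_simps mult.commute)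
          ultimately show ?case by (simp add: indicator_def)
        qed
      qed
      also have "\<dots> = ennreal (measure circle_measure {v. norm (F (v * z)) > ?t})"
        by (simp add: circle.emeasure_eq_measure)
      also have "\<dots> \<le> ennreal (min 1 ((X / defect z) powr (s / q)))"
      proof (rule ennreal_leI, rule min.boundedI)
        have "measure circle_measure {v. norm (F (v * z)) > ?t} \<le> (N * defect z powr - (a + 1 / q) / ?t) powr s"
          by (rule bound[OF elim t])
        also have "N * defect z powr - (a + 1 / q) / ?t = N / l * (defect z powr - (a + 1 / q) * defect z powr a)"
          using d l by (simp add: powr_minus divide_simps)
        also have "defect z powr - (a + 1 / q) * defect z powr a = defect z powr (- (1 / q))"
          by (simp add: powr_add[symmetric])
        also have "(N / l * defect z powr (- (1 / q))) powr s = (X / defect z) powr (s / q)"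
          using N l d q by (simp add: X_def powr_mult powr_divide powr_powr powr_minus_divide)
        finally show "measure circle_measure {v. norm (F (v * z)) > ?t} \<le> (X / defect z) powr (s / q)" .
      qed simp
      finally show ?case .
    qed
  qed
  also have "\<dots> = (\<integral>\<^sup>+ x. ennreal (min 1 ((X / x) powr (s / q))) * indicator {0..1} x \<partial>lborel)"
    by (rule nn_integral_disc_radial) measurable
  also have "\<dots> \<le> (\<integral>\<^sup>+ x. ennreal (min 1 ((X / x) powr (s / q))) * indicator {0..} x \<partial>lborel)"
    by (rule nn_integral_mono) (auto simp: indicator_def)
  also have "\<dots> \<le> ennreal ((s / q) / (s / q - 1) * X)"
    by (rule nn_integral_truncated_powr) (use X q in auto)
  also have "(s / q) / (s / q - 1) = s / (s - q)" using q by (simp add: divide_simps)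
  finally have "emeasure disc_measure ?S \<le> ennreal (s / (s - q) * X)" .
  then show ?thesis using X q
    by (simp add: disc.emeasure_eq_measure ennreal_le_iff X_def)
qed

section \<open>The operators\<close>

lemma norm_powr_of_real: "norm (x powr complex_of_real c) = norm x powr c"
  by (cases "x = 0") (simp_all add: powr_def)

text \<open>\<open>Ln\<close> is continuous off the nonpositive real axis. On that axis, away from
  0, its imaginary part is constantly pi, so it agrees there with the Borel function g.\<close>

lemma Ln_borel [measurable]: "Ln \<in> borel_measurable borel"
proof -
  define g where "g z = (if z = 0 then Ln 0 else complex_of_real (ln (norm z)) + \<i> * complex_of_real pi)" for z :: complex
  have [measurable]: "g \<in> borel_measurable borel" unfolding g_def by measurable
  have Re0: "z \<in> \<real>\<^sub>\<le>\<^sub>0 \<longleftrightarrow> Re z \<le> 0 \<and> Im z = 0" for z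
    by (simp add: complex_nonpos_Reals_iff)
  have eq: "Ln z = g z" if "z \<in> \<real>\<^sub>\<le>\<^sub>0" for z
  proof (cases "z = 0")
    case False
    then have "Re z < 0" "Im z = 0" using that by (auto simp: Re0 complex_eq_iff)
    then have "Arg z = pi" by (simp add: Arg_eq_pi)
    then show ?thesis using False by (simp add: g_def Ln_Arg)
  qed (simp add: g_def)
  have "(\<lambda>z. if z \<in> \<real>\<^sub>\<le>\<^sub>0 then g z else Ln z) \<in> borel_measurable borel"
  proof (subst measurable_If_restrict_space_iff, safe)
    show "{x \<in> space borel. x \<in> \<real>\<^sub>\<le>\<^sub>0} \<in> sets (borel :: complex measure)"
      by (simp add: Re0)
    show "g \<in> borel_measurable (restrict_space borel {x. x \<in> \<real>\<^sub>\<le>\<^sub>0})"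
      by (rule measurable_restrict_space1) measurable
    show "Ln \<in> borel_measurable (restrict_space borel {x. x \<notin> \<real>\<^sub>\<le>\<^sub>0})"
      by (rule borel_measurable_continuous_on_restrict) (auto intro!: continuous_intros)
  qed
  also have "(\<lambda>z. if z \<in> \<real>\<^sub>\<le>\<^sub>0 then g z else Ln z) = Ln" using eq by auto
  finally show ?thesis .
qed

lemma complex_powr_borel [measurable]:
  assumes [measurable]: "f \<in> borel_measurable M"
  shows "(\<lambda>x. f x powr (c :: complex)) \<in> borel_measurable M"
  unfolding powr_def by measurable

text \<open>Joint measurability of the kernel, stronger than measurability in w for each z, makes
  the image of a Borel function Borel.\<close>

definition weighted_operator :: "real \<Rightarrow> integral_operator \<Rightarrow> bool" where
  "weighted_operator a K \<longleftrightarrow> weight K = (\<lambda>z. complex_of_real (defect z powr a)) \<and>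
     case_prod (kernel K) \<in> borel_measurable (borel \<Otimes>\<^sub>M borel)"

lemma weighted_operator_T_op: "weighted_operator a (T_op a b c)"
  unfolding weighted_operator_def T_op_def by (simp, measurable)

lemma weighted_operator_S_op: "weighted_operator a (S_op a b c)"
  unfolding weighted_operator_def S_op_def by (simp, measurable)

lemma weighted_operator_borel_kernel:
  assumes "weighted_operator a K" shows "borel_kernel K"
proof -
  have [measurable]: "case_prod (kernel K) \<in> borel_measurable (borel \<Otimes>\<^sub>M borel)"
    using assms by (simp add: weighted_operator_def)
  have "(\<lambda>w. case_prod (kernel K) (z, w)) \<in> borel_measurable borel" for z by measurable
  then show ?thesis by (simp add: borel_kernel_def)
qed

lemma apply_weighted_operator:
  assumes K: "weighted_operator a K" and f [measurable]: "f \<in> borel_measurable borel"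
  shows "apply_op K f z = complex_of_real (defect z powr a) * (LINT w|disc_measure. kernel K z w * f w)"
proof -
  have [measurable]: "kernel K z \<in> borel_measurable borel"
    using weighted_operator_borel_kernel[OF K] by (simp add: borel_kernel_def)
  show ?thesis using K
    by (subst integral_dA[symmetric]) (auto simp: apply_op_def weighted_operator_def)
qed

lemma borel_integral_kernel [measurable]:
  assumes K: "weighted_operator a K" and f [measurable]: "f \<in> borel_measurable borel"
  shows "(\<lambda>z. LINT w|disc_measure. kernel K z w * f w) \<in> borel_measurable borel"
proof -
  have [measurable]: "case_prod (kernel K) \<in> borel_measurable (borel \<Otimes>\<^sub>M borel)"
    using K by (simp add: weighted_operator_def)
  have "(\<lambda>z. LINT w|disc_measure. case_prod (kernel K) (z, w) * f w) \<in> borel_measurable borel"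
    by measurable
  then show ?thesis by simp
qed

lemma borel_apply_op:
  assumes K: "weighted_operator a K" and f [measurable]: "f \<in> borel_measurable borel"
  shows "apply_op K f \<in> borel_measurable borel"
proof -
  have [measurable]: "(\<lambda>z. LINT w|disc_measure. kernel K z w * f w) \<in> borel_measurable borel"
    by (rule borel_integral_kernel[OF assms])
  show ?thesis by (subst apply_weighted_operator[OF assms, abs_def]) measurable
qed

lemma converges_ae_borel_iff:
  assumes K: "weighted_operator a K" and f [measurable]: "f \<in> borel_measurable borel"
  shows "converges_ae K f \<longleftrightarrow> (AE z in disc_measure. integrable disc_measure (\<lambda>w. kernel K z w * f w))"
proof -
  have [measurable]: "case_prod (kernel K) \<in> borel_measurable (borel \<Otimes>\<^sub>M borel)"
    using K by (simp add: weighted_operator_def)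
  have [measurable]: "kernel K z \<in> borel_measurable borel" for z
    using weighted_operator_borel_kernel[OF K] by (simp add: borel_kernel_def)
  have "converges_ae K f \<longleftrightarrow> (AE z in dA. integrable disc_measure (\<lambda>w. kernel K z w * f w))"
    unfolding converges_ae_def by (simp add: integrable_dA_iff)
  also have "\<dots> \<longleftrightarrow> (AE z in disc_measure. integrable disc_measure (\<lambda>w. kernel K z w * f w))"
  proof (rule AE_dA_iff)
    have "Measurable.pred borel (\<lambda>z. integrable disc_measure (\<lambda>w. case_prod (kernel K) (z, w) * f w))"
      by measurable
    then show "Measurable.pred borel (\<lambda>z. integrable disc_measure (\<lambda>w. kernel K z w * f w))" by simp
  qed
  finally show ?thesis .
qed

lemma norm_kernel_T_op: "norm (kernel (T_op a b c) z w) = defect w powr b / norm (1 - z * cnj w) powr c"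
  by (simp add: T_op_def norm_divide norm_powr_of_real)

lemma kernel_S_op: "kernel (S_op a b c) z w = complex_of_real (defect w powr b / norm (1 - z * cnj w) powr c)"
  by (simp add: S_op_def)

lemma norm_kernel_S_op: "norm (kernel (S_op a b c) z w) = defect w powr b / norm (1 - z * cnj w) powr c"
  unfolding kernel_S_op norm_of_real by simp

lemma distr_fun_weighted:
  assumes K: "weighted_operator a K" and f [measurable]: "f \<in> borel_measurable borel"
  shows "distr_fun (apply_op K f) t =
    measure disc_measure {z. defect z powr a * norm (LINT w|disc_measure. kernel K z w * f w) > t}"
  by (subst distr_fun_eq[OF borel_apply_op[OF assms]]) (simp add: apply_weighted_operator[OF assms] norm_mult)

lemma weighted_operator_weak_bound:
  assumes K: "weighted_operator a K" and f: "f \<in> borel_measurable borel" and q: "0 < q" "q < s" "0 \<le> N"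
    and conv: "\<And>z. z \<in> unit_disc \<Longrightarrow> integrable disc_measure (\<lambda>w. kernel K z w * f w)"
    and bound: "\<And>z t. z \<in> unit_disc \<Longrightarrow> 0 < t \<Longrightarrow>
       measure circle_measure {v. norm (LINT w|disc_measure. kernel K (v * z) w * f w) > t}
         \<le> (N * defect z powr - (a + 1 / q) / t) powr s"
  shows "converges_ae K f \<and> (\<forall>t>0. distr_fun (apply_op K f) t \<le> ((s / (s - q)) powr (1 / q) * N / t) powr q)"
proof (intro conjI allI impI)
  show "converges_ae K f"
    unfolding converges_ae_borel_iff[OF K f] using AE_disc_unit_disc by eventually_elim (rule conv)
  fix t :: real assume t: "t > 0"
  have "distr_fun (apply_op K f) t \<le> s / (s - q) * (N / t) powr q"
    unfolding distr_fun_weighted[OF K f]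
    by (rule weak_bound_from_circles[OF q borel_integral_kernel[OF K f] bound t])
  also have "s / (s - q) * (N / t) powr q = ((s / (s - q)) powr (1 / q) * (N / t)) powr q"
    by (subst powr_mult) (use q t in \<open>auto simp: powr_powr\<close>)
  finally show "distr_fun (apply_op K f) t \<le> ((s / (s - q)) powr (1 / q) * N / t) powr q" by simp
qed

definition weakly_bounded where
  "weakly_bounded N K q \<longleftrightarrow> (\<exists>C\<ge>0. \<forall>f\<in>borel_measurable borel. \<forall>B\<ge>0. N f \<le> ennreal B \<longrightarrow>
       converges_ae K f \<and> (\<forall>t>0. distr_fun (apply_op K f) t \<le> (C * B / t) powr q))"
  for N :: "(complex \<Rightarrow> complex) \<Rightarrow> ennreal"

lemma weak_type_weakly_bounded:
  assumes "weighted_operator a K" "0 < q"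
  shows "weak_type K p (ennreal q) \<longleftrightarrow> weakly_bounded (Lp_norm p) K q"
  unfolding weakly_bounded_def
  by (rule weak_type_iff[OF weighted_operator_borel_kernel[OF assms(1)] assms(2)])

lemma restricted_weak_type_weakly_bounded:
  assumes "weighted_operator a K" "0 < q" "p \<noteq> \<infinity>"
  shows "restricted_weak_type K p (ennreal q) \<longleftrightarrow> weakly_bounded (Lp1_norm p) K q"
  unfolding weakly_bounded_def
  by (rule restricted_weak_type_iff[OF weighted_operator_borel_kernel[OF assms(1)] assms(2,3)])

section \<open>T compared with S\<close>

text \<open>The two kernels have the same modulus, and absolute convergence sees nothing
  else.\<close>

lemma integrable_kernel_S_iff_T:
  assumes [measurable]: "f \<in> borel_measurable borel"
  shows "integrable disc_measure (\<lambda>w. kernel (S_op a b c) z w * f w)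
     \<longleftrightarrow> integrable disc_measure (\<lambda>w. kernel (T_op a b c) z w * f w)"
proof -
  have [measurable]: "kernel (T_op a b c) z \<in> borel_measurable borel" "kernel (S_op a b c) z \<in> borel_measurable borel"
    using weighted_operator_borel_kernel[OF weighted_operator_T_op]
          weighted_operator_borel_kernel[OF weighted_operator_S_op] by (auto simp: borel_kernel_def)
  show ?thesis
    by (simp add: integrable_iff_bounded norm_mult norm_kernel_T_op norm_kernel_S_op)
qed

lemma converges_ae_S_iff_T:
  assumes "f \<in> borel_measurable borel"
  shows "converges_ae (S_op a b c) f \<longleftrightarrow> converges_ae (T_op a b c) f"
  unfolding converges_ae_borel_iff[OF weighted_operator_T_op assms]
    converges_ae_borel_iff[OF weighted_operator_S_op assms] integrable_kernel_S_iff_T[OF assms] ..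

text \<open>The modulus of the kernel of T is the kernel of S, whence |T f| \<le> S |f|
  pointwise.\<close>

lemma distr_fun_T_le_S:
  assumes [measurable]: "f \<in> borel_measurable borel"
  shows "distr_fun (apply_op (T_op a b c) f) t
    \<le> distr_fun (apply_op (S_op a b c) (\<lambda>w. complex_of_real (norm (f w)))) t"
proof -
  let ?T = "\<lambda>z. LINT w|disc_measure. kernel (T_op a b c) z w * f w"
  let ?S = "\<lambda>z. LINT w|disc_measure. kernel (S_op a b c) z w * complex_of_real (norm (f w))"
  have [measurable]: "?T \<in> borel_measurable borel" "?S \<in> borel_measurable borel"
    by (intro borel_integral_kernel[OF weighted_operator_T_op] borel_integral_kernel[OF weighted_operator_S_op]; measurable)+
  have "norm (?T z) \<le> norm (?S z)" for z
  proof -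
    have "?S z = (LINT w|disc_measure. complex_of_real (norm (kernel (T_op a b c) z w * f w)))"
      by (simp add: kernel_S_op norm_mult norm_kernel_T_op)
    also have "\<dots> = complex_of_real (LINT w|disc_measure. norm (kernel (T_op a b c) z w * f w))"
      by (rule integral_complex_of_real)
    finally have "norm (?S z) = (LINT w|disc_measure. norm (kernel (T_op a b c) z w * f w))"
      by simp
    then show ?thesis by (simp only: integral_norm_bound)
  qed
  note le = mult_left_mono[OF this, of "defect _ powr a"]
  show ?thesis
    unfolding distr_fun_weighted[OF weighted_operator_T_op assms]
    by (subst distr_fun_weighted[OF weighted_operator_S_op])
       (auto intro!: disc.finite_measure_mono less_le_trans[OF _ le])
qed

text \<open>For a norm that depends on the modulus alone, boundedness of S implies that of T. A
  separating pair can thus only mean that T is bounded and S is not.\<close>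

lemma weakly_bounded_T_if_S:
  assumes "\<And>f. f \<in> borel_measurable borel \<Longrightarrow> N (\<lambda>w. complex_of_real (norm (f w))) = N f"
    and "weakly_bounded N (S_op a b c) q"
  shows "weakly_bounded N (T_op a b c) q"
proof -
  obtain C where C0: "C \<ge> 0" and C: "\<And>f B. f \<in> borel_measurable borel \<Longrightarrow> B \<ge> 0 \<Longrightarrow> N f \<le> ennreal B \<Longrightarrow>
     converges_ae (S_op a b c) f \<and> (\<forall>t>0. distr_fun (apply_op (S_op a b c) f) t \<le> (C * B / t) powr q)"
    using assms(2) unfolding weakly_bounded_def by blast
  have "converges_ae (T_op a b c) f \<and> (\<forall>t>0. distr_fun (apply_op (T_op a b c) f) t \<le> (C * B / t) powr q)"
    if f [measurable]: "f \<in> borel_measurable borel" and B: "B \<ge> 0" "N f \<le> ennreal B" for f B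
  proof -
    have "(\<lambda>w. complex_of_real (norm (f w))) \<in> borel_measurable borel" by measurable
    from C[OF this B(1)] C[OF f B] show ?thesis
      using distr_fun_T_le_S[OF f, THEN order_trans] B assms(1)[OF f] converges_ae_S_iff_T[OF f] by auto
  qed
  then show ?thesis unfolding weakly_bounded_def using C0 by blast
qed

lemma weak_type_T_if_S:
  assumes "0 < q" "weak_type (S_op a b c) p (ennreal q)"
  shows "weak_type (T_op a b c) p (ennreal q)"
  using assms(2) unfolding weak_type_weakly_bounded[OF weighted_operator_T_op assms(1)]
    weak_type_weakly_bounded[OF weighted_operator_S_op assms(1)]
  by (rule weakly_bounded_T_if_S[rotated]) (simp add: Lp_norm_def)

lemma restricted_weak_type_T_if_S:
  assumes "0 < q" "restricted_weak_type (S_op a b c) p (ennreal q)"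
  shows "restricted_weak_type (T_op a b c) p (ennreal q)"
proof (cases "p = \<infinity>")
  case False
  show ?thesis
    using assms(2) unfolding restricted_weak_type_weakly_bounded[OF weighted_operator_T_op assms(1) False]
      restricted_weak_type_weakly_bounded[OF weighted_operator_S_op assms(1) False]
    by (rule weakly_bounded_T_if_S[rotated]) (simp add: Lp1_norm_def distr_fun_def)
next
  case True
  have "(\<lambda>w. complex_of_real (norm (indicator E w :: complex))) = indicator E" for E :: "complex set"
    by (auto simp: indicator_def)
  then have *: "distr_fun (apply_op (T_op a b c) (indicator E)) t \<le> distr_fun (apply_op (S_op a b c) (indicator E)) t"
    if "E \<in> sets borel" for E t
    using distr_fun_T_le_S[of "indicator E" a b c t] that by simp
  have conv: "converges_ae (T_op a b c) (indicator E) = converges_ae (S_op a b c) (indicator E)"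
    if "E \<in> sets borel" for E
    by (rule converges_ae_S_iff_T[symmetric]) (use that in simp)
  obtain C where "C \<ge> 0" "\<forall>E\<in>sets borel. converges_ae (S_op a b c) (indicator E) \<and>
       (\<forall>t>0. distr_fun (apply_op (S_op a b c) (indicator E)) t \<le> (C / t) powr q)"
    using assms(2) unfolding True
      restricted_weak_type_infinity_iff[OF weighted_operator_borel_kernel[OF weighted_operator_S_op] assms(1)]
    by blast
  then have "\<forall>E\<in>sets borel. converges_ae (T_op a b c) (indicator E) \<and>
       (\<forall>t>0. distr_fun (apply_op (T_op a b c) (indicator E)) t \<le> (C / t) powr q)"
    by (auto simp: conv intro: order_trans[OF *])
  with \<open>C \<ge> 0\<close> show ?thesis unfolding True
      restricted_weak_type_infinity_iff[OF weighted_operator_borel_kernel[OF weighted_operator_T_op] assms(1)]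
    by blast
qed

section \<open>Taylor coefficients of the holomorphic operators\<close>

text \<open>The Taylor coefficients of (1 - x)^(-c); the rising factorial shows that they are
  positive for c > 0.\<close>

definition binomial_coeff :: "real \<Rightarrow> nat \<Rightarrow> real" where
  "binomial_coeff c k = pochhammer c k / fact k"

lemma binomial_coeff_sums:
  fixes x :: complex
  assumes "norm x < 1"
  shows "(\<lambda>k. complex_of_real (binomial_coeff c k) * x ^ k) sums (1 / (1 - x) powr complex_of_real c)"
proof -
  have "(\<lambda>k. ((- complex_of_real c) gchoose k) * (- x) ^ k) sums (1 + (- x)) powr (- complex_of_real c)"
    by (rule gen_binomial_complex) (use assms in simp)
  moreover have "((- complex_of_real c) gchoose k) * (- x) ^ k = complex_of_real (binomial_coeff c k) * x ^ k" for k
  proof -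
    have "((- complex_of_real c) gchoose k) * (- x) ^ k
        = pochhammer (complex_of_real c) k / fact k * ((-1) ^ k * (- x) ^ k)"
      by (simp add: gbinomial_pochhammer)
    also have "(-1) ^ k * (- x) ^ k = x ^ k"
      by (simp add: power_mult_distrib[symmetric])
    finally show ?thesis by (simp add: binomial_coeff_def pochhammer_of_real)
  qed
  ultimately show ?thesis by (simp add: powr_minus_divide)
qed

text \<open>Convergence at the larger radius (r + 1) / 2 forces absolute convergence at r, whatever
  the signs of the coefficients.\<close>

lemma binomial_coeff_summable:
  fixes r :: real
  assumes "0 \<le> r" "r < 1"
  shows "summable (\<lambda>k. \<bar>binomial_coeff c k\<bar> * r ^ k)"
proof -
  define x where "x = complex_of_real ((r + 1) / 2)"
  have "norm x = (r + 1) / 2" using assms unfolding x_def norm_of_real by simp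
  then have "summable (\<lambda>k. complex_of_real (binomial_coeff c k) * x ^ k)"
    using binomial_coeff_sums[of x c] assms by (auto simp: sums_iff)
  from powser_insidea[OF this, of "complex_of_real r"]
  show ?thesis using \<open>norm x = _\<close> assms by (simp add: norm_mult norm_power)
qed

lemma norm_mult_cnj_less: "z \<in> unit_disc \<Longrightarrow> w \<in> unit_disc \<Longrightarrow> norm (z * cnj w) < 1"
  unfolding norm_mult complex_mod_cnj
  by (metis dist_0_norm mem_ball mult.right_neutral mult_strict_mono norm_ge_zero unit_disc_def zero_less_one)

lemma norm_cnj_mult_le: "w \<in> unit_disc \<Longrightarrow> norm (z * cnj w) \<le> norm z"
  by (simp add: norm_mult unit_disc_def mult_left_le)

lemma norm_one_minus_ge: "w \<in> unit_disc \<Longrightarrow> 1 - norm z \<le> norm (1 - z * cnj w)"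
  using norm_triangle_ineq2[of 1 "z * cnj w"] norm_cnj_mult_le[of w z] by simp

text \<open>The kernel is expanded in powers of \<open>z * cnj w\<close>. Every moment of g is at
  most its L^1 norm, so the series of absolute binomial coefficients at radius |z| is a summable
  majorant for termwise integration.\<close>

lemma disc_series:
  fixes c :: real
  assumes g: "integrable disc_measure g" and z: "z \<in> unit_disc"
  defines "a \<equiv> \<lambda>k. complex_of_real (binomial_coeff c k) * (LINT w|disc_measure. g w * cnj w ^ k) * z ^ k"
  shows "(LINT w|disc_measure. g w / (1 - z * cnj w) powr complex_of_real c) = (\<Sum>k. a k)"
    and "summable (\<lambda>k. norm (a k))"
proof -
  have [measurable]: "g \<in> borel_measurable borel" using borel_measurable_integrable[OF g] by simp
  let ?r = "norm z"
  have r: "0 \<le> ?r" "?r < 1" using z by (auto simp: unit_disc_def)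
  have int: "integrable disc_measure (\<lambda>w. g w * cnj w ^ k)" for k
  proof (rule Bochner_Integration.integrable_bound[OF g])
    show "AE w in disc_measure. norm (g w * cnj w ^ k) \<le> norm (g w)"
      using AE_disc_unit_disc
      by eventually_elim (auto simp: norm_mult norm_power unit_disc_def intro!: mult_left_le power_le_one)
  qed simp
  define t where "t k w = complex_of_real (binomial_coeff c k) * z ^ k * (g w * cnj w ^ k)" for k w
  let ?G = "LINT w|disc_measure. norm (g w)"
  have t_le: "norm (t k w) \<le> \<bar>binomial_coeff c k\<bar> * ?r ^ k * norm (g w)" if "w \<in> unit_disc" for k w
    using that by (auto simp: t_def norm_mult norm_power unit_disc_def intro!: mult_left_mono mult_left_le power_le_one)
  have t_int: "integrable disc_measure (t k)" for k unfolding t_def using int by simp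
  have t_norm: "(LINT w|disc_measure. norm (t k w)) \<le> \<bar>binomial_coeff c k\<bar> * ?r ^ k * ?G" for k
  proof -
    have "(LINT w|disc_measure. norm (t k w)) \<le> (LINT w|disc_measure. \<bar>binomial_coeff c k\<bar> * ?r ^ k * norm (g w))"
    proof (rule integral_mono_AE)
      show "AE w in disc_measure. norm (t k w) \<le> \<bar>binomial_coeff c k\<bar> * ?r ^ k * norm (g w)"
        using AE_disc_unit_disc by eventually_elim (rule t_le)
    qed (use t_int g in auto)
    then show ?thesis by simp
  qed
  have sm: "summable (\<lambda>k. \<bar>binomial_coeff c k\<bar> * ?r ^ k * ?G)"
    by (intro summable_mult2 binomial_coeff_summable r)
  have a_t: "a k = (LINT w|disc_measure. t k w)" for k
    unfolding a_def t_def by simp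
  have "(LINT w|disc_measure. g w / (1 - z * cnj w) powr complex_of_real c) = (LINT w|disc_measure. (\<Sum>k. t k w))"
  proof (rule integral_cong_AE)
    show "AE w in disc_measure. g w / (1 - z * cnj w) powr complex_of_real c = (\<Sum>k. t k w)"
      using AE_disc_unit_disc
    proof eventually_elim
      case (elim w)
      from sums_mult[OF binomial_coeff_sums[OF norm_mult_cnj_less[OF z elim], of c], of "g w"]
      show ?case by (simp add: t_def sums_iff power_mult_distrib mult_ac)
    qed
  qed (simp_all add: t_def)
  also have "\<dots> = (\<Sum>k. LINT w|disc_measure. t k w)"
  proof (rule integral_suminf)
    show "integrable disc_measure (t k)" for k by (rule t_int)
    show "AE w in disc_measure. summable (\<lambda>k. norm (t k w))"
      using AE_disc_unit_disc
    proof eventually_elim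
      case (elim w)
      show ?case
        by (rule summable_comparison_test'[OF summable_mult2[OF binomial_coeff_summable[OF r]], of 0])
           (use t_le[OF elim] in simp)
    qed
    show "summable (\<lambda>k. LINT w|disc_measure. norm (t k w))"
      by (rule summable_comparison_test'[OF sm, of 0]) (use t_norm in simp)
  qed
  finally show "(LINT w|disc_measure. g w / (1 - z * cnj w) powr complex_of_real c) = (\<Sum>k. a k)"
    by (simp add: a_t)
  show "summable (\<lambda>k. norm (a k))"
  proof (rule summable_comparison_test'[OF sm, of 0])
    fix k
    show "norm (norm (a k)) \<le> \<bar>binomial_coeff c k\<bar> * ?r ^ k * ?G"
      unfolding a_t real_norm_def abs_norm_cancel by (rule order_trans[OF integral_norm_bound t_norm])
  qed
qed

text \<open>For a function that is not integrable the Bochner integral is 0 by convention, and the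
  bound is trivial.\<close>

lemma integral_norm_bound_ennreal_any:
  fixes f :: "'a \<Rightarrow> 'b::{banach, second_countable_topology}"
  shows "ennreal (norm (integral\<^sup>L M f)) \<le> (\<integral>\<^sup>+ x. ennreal (norm (f x)) \<partial>M)"
  by (cases "integrable M f") (auto simp: integral_norm_bound_ennreal not_integrable_integral_eq)

section \<open>The critical operator on \<open>L\<^sup>p\<close>, \<open>p \<le> 2\<close>\<close>

text \<open>Off the diagonal the circle average vanishes. On the diagonal the substitution s =
  \<open>defect w\<close> leaves the beta integral of s (1 - s)^k over [0, 1].\<close>

lemma disc_moment:
  "(LINT w|disc_measure. complex_of_real (defect w) * (w ^ k * cnj w ^ l))
     = (if k = l then complex_of_real (1 / ((real k + 1) * (real k + 2))) else 0)"
proof -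
  let ?h = "\<lambda>w. complex_of_real (defect w) * (w ^ k * cnj w ^ l)"
  have int: "integrable disc_measure ?h"
  proof (rule disc.integrable_const_bound[where B=1])
    show "AE w in disc_measure. norm (?h w) \<le> 1" using AE_disc_unit_disc
    proof eventually_elim
      case (elim w)
      have "norm w \<le> 1" "0 \<le> defect w" "defect w \<le> 1"
        using elim defect_pos[OF elim] by (auto simp: unit_disc_def)
      then show ?case
        unfolding norm_mult norm_of_real norm_power complex_mod_cnj
        by (intro mult_le_one) (auto intro!: mult_nonneg_nonneg power_le_one simp del: diff_ge_0_iff_ge)
    qed
  qed simp
  have "(LINT w|disc_measure. ?h w) = (LINT w|disc_measure. (LINT v|circle_measure. ?h (v * w)))"
    by (rule integral_disc_average[OF int])
  also have "\<dots> = (LINT w|disc_measure. ?h w * (if k = l then 1 else 0))"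
  proof (rule Bochner_Integration.integral_cong[OF refl])
    fix w
    have "(LINT v|circle_measure. ?h (v * w)) = (LINT v|circle_measure. ?h w * (v ^ k * cnj v ^ l))"
      by (rule integral_cong_AE) (use AE_circle_norm in \<open>auto simp: norm_mult power_mult_distrib mult_ac elim: eventually_mono\<close>)
    then show "(LINT v|circle_measure. ?h (v * w)) = ?h w * (if k = l then 1 else 0)"
      by (simp add: circle_orthogonal)
  qed
  finally have *: "(LINT w|disc_measure. ?h w) = (LINT w|disc_measure. ?h w) * (if k = l then 1 else 0)" by simp
  show ?thesis
  proof (cases "k = l")
    case False then show ?thesis using * by simp
  next
    case True
    \<comment> \<open>An antiderivative of s (1 - s)^k, found by integration by parts.\<close>
    let ?F = "\<lambda>s. - (s * (1 - s) ^ Suc k / (real k + 1)) - (1 - s) ^ Suc (Suc k) / ((real k + 1) * (real k + 2))"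
    have "?h w = complex_of_real (defect w * (1 - defect w) ^ k)" for w
    proof -
      have "w ^ k * cnj w ^ l = complex_of_real (((norm w)\<^sup>2) ^ k)"
        using True by (simp add: power_mult_distrib[symmetric] complex_norm_square[symmetric])
      then show ?thesis by simp
    qed
    then have "(LINT w|disc_measure. ?h w) = complex_of_real (LINT w|disc_measure. defect w * (1 - defect w) ^ k)"
      by (simp only: integral_complex_of_real)
    also have "(LINT w|disc_measure. defect w * (1 - defect w) ^ k) = 1 / ((real k + 1) * (real k + 2))"
    proof (rule integral_eq_nn_integral[THEN trans])
      show "AE w in disc_measure. 0 \<le> defect w * (1 - defect w) ^ k"
        using AE_disc_defect_pos by eventually_elim simp
      have "(\<integral>\<^sup>+ w. ennreal (defect w * (1 - defect w) ^ k) \<partial>disc_measure)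
          = (\<integral>\<^sup>+ s. ennreal (s * (1 - s) ^ k) * indicator {0..1} s \<partial>lborel)"
        by (rule nn_integral_disc_radial) simp
      also have "\<dots> = ennreal (?F 1 - ?F 0)"
      proof (rule nn_integral_FTC_Icc[where F="?F"])
        fix s :: real assume "s \<in> {0..1}"
        then show "0 \<le> s * (1 - s) ^ k" by simp
        have D: "((\<lambda>s. (1 - s) ^ Suc n) has_real_derivative - (real (Suc n) * (1 - s) ^ n)) (at s)" for n
          by (rule derivative_eq_intros refl | simp)+
        have "(?F has_real_derivative - ((1 * (1 - s) ^ Suc k + - (real (Suc k) * (1 - s) ^ k) * s) / (real k + 1))
            - (- (real (Suc (Suc k)) * (1 - s) ^ Suc k)) / ((real k + 1) * (real k + 2))) (at s)"
          by (intro DERIV_diff DERIV_minus DERIV_cdivide DERIV_mult D DERIV_ident)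
        also have "- ((1 * (1 - s) ^ Suc k + - (real (Suc k) * (1 - s) ^ k) * s) / (real k + 1))
            - (- (real (Suc (Suc k)) * (1 - s) ^ Suc k)) / ((real k + 1) * (real k + 2)) = s * (1 - s) ^ k"
        proof -
          have "- ((1 * X + - (A * Y) * s) / A) - (- (B * X)) / (A * B) = s * Y" if "A > 0" "B > 0" for A B X Y :: real
            using that by (simp add: field_simps)
          from this[of "real k + 1" "real k + 2"] show ?thesis by (simp add: add.commute)
        qed
        finally show "(?F has_real_derivative s * (1 - s) ^ k) (at s)" .
      qed simp_all
      also have "?F 1 - ?F 0 = 1 / ((real k + 1) * (real k + 2))" by simp
      finally show "enn2real (\<integral>\<^sup>+ w. ennreal (defect w * (1 - defect w) ^ k) \<partial>disc_measure) = 1 / ((real k + 1) * (real k + 2))"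
        by simp
    qed simp
    finally show ?thesis using True by simp
  qed
qed

text \<open>Bessel's inequality for g / defect in the L^2 space with weight defect, where the
  monomials are orthogonal with squared norms 1 / ((k + 1) (k + 2)). The factors (k + 1)^2 are the
  squared Taylor coefficients of (1 - x)^(-2), which is why the kernel exponent 2 goes with this
  weight.\<close>

lemma disc_bessel:
  assumes g [measurable]: "g \<in> borel_measurable borel"
    and int: "integrable disc_measure (\<lambda>w. (norm (g w))\<^sup>2 / defect w)"
    and g_int: "integrable disc_measure g"
  defines "c \<equiv> \<lambda>k. LINT w|disc_measure. g w * cnj w ^ k"
  shows "(\<Sum>k<n. (real k + 1)\<^sup>2 * (norm (c k))\<^sup>2) \<le> (LINT w|disc_measure. (norm (g w))\<^sup>2 / defect w)"
proof -
  \<comment> \<open>Fourier coefficients for the unnormalized monomials: P is the orthogonal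
    projection of g / defect onto the polynomials of degree less than n.\<close>
  define d where "d k = complex_of_real ((real k + 1) * (real k + 2)) * c k" for k
  define P where "P w = (\<Sum>k<n. d k * w ^ k)" for w
  define S where "S = (\<Sum>k<n. (real k + 1) * (real k + 2) * (norm (c k))\<^sup>2)"
  have [measurable]: "P \<in> borel_measurable borel" unfolding P_def by measurable
  have gk: "integrable disc_measure (\<lambda>w. g w * cnj w ^ k)" for k
  proof (rule Bochner_Integration.integrable_bound[OF g_int])
    show "AE w in disc_measure. norm (g w * cnj w ^ k) \<le> norm (g w)"
      using AE_disc_unit_disc
      by eventually_elim (auto simp: norm_mult norm_power unit_disc_def intro!: mult_left_le power_le_one)
  qed simp
  have gP_eq: "g w * cnj (P w) = (\<Sum>k<n. cnj (d k) * (g w * cnj w ^ k))" for w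
    unfolding P_def by (simp add: sum_distrib_left mult_ac)
  have gP_int: "integrable disc_measure (\<lambda>w. g w * cnj (P w))"
    unfolding gP_eq using gk by auto
  have "(LINT w|disc_measure. g w * cnj (P w)) = (\<Sum>k<n. cnj (d k) * c k)"
    unfolding gP_eq c_def using gk by simp
  also have "\<dots> = complex_of_real S"
    unfolding S_def d_def of_real_sum
  proof (rule sum.cong[OF refl])
    fix k
    have "cnj (c k) * c k = complex_of_real ((norm (c k))\<^sup>2)"
      by (simp only: complex_norm_square mult.commute)
    then show "cnj (complex_of_real ((real k + 1) * (real k + 2)) * c k) * c k
        = complex_of_real ((real k + 1) * (real k + 2) * (norm (c k))\<^sup>2)"
      by (simp only: complex_cnj_mult complex_cnj_complex_of_real of_real_mult mult.assoc)
  qed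
  finally have gP: "(LINT w|disc_measure. g w * cnj (P w)) = complex_of_real S" .
  have mom_int: "integrable disc_measure (\<lambda>w. complex_of_real (defect w) * (w ^ k * cnj w ^ l))" for k l
  proof (rule disc.integrable_const_bound[where B=1])
    show "AE w in disc_measure. norm (complex_of_real (defect w) * (w ^ k * cnj w ^ l)) \<le> 1" using AE_disc_unit_disc
    proof eventually_elim
      case (elim w)
      have "norm w \<le> 1" "0 \<le> defect w" "defect w \<le> 1"
        using elim defect_pos[OF elim] by (auto simp: unit_disc_def)
      then show ?case
        unfolding norm_mult norm_of_real norm_power complex_mod_cnj
        by (intro mult_le_one) (auto intro!: mult_nonneg_nonneg power_le_one simp del: diff_ge_0_iff_ge)
    qed
  qed simp
  have PP_eq: "complex_of_real (defect w * (norm (P w))\<^sup>2)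
      = (\<Sum>k<n. \<Sum>l<n. d k * cnj (d l) * (complex_of_real (defect w) * (w ^ k * cnj w ^ l)))" for w
  proof -
    have "complex_of_real (defect w * (norm (P w))\<^sup>2) = complex_of_real (defect w) * (P w * cnj (P w))"
      by (simp only: of_real_mult complex_norm_square)
    also have "P w * cnj (P w) = (\<Sum>k<n. \<Sum>l<n. (d k * w ^ k) * (cnj (d l) * cnj w ^ l))"
      unfolding P_def cnj_sum complex_cnj_mult complex_cnj_power by (rule sum_product)
    finally show ?thesis by (simp add: sum_distrib_left mult_ac)
  qed
  have "complex_of_real (LINT w|disc_measure. defect w * (norm (P w))\<^sup>2)
      = (LINT w|disc_measure. (\<Sum>k<n. \<Sum>l<n. d k * cnj (d l) * (complex_of_real (defect w) * (w ^ k * cnj w ^ l))))"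
    unfolding PP_eq[symmetric] by (rule integral_complex_of_real[symmetric])
  also have "\<dots> = (\<Sum>k<n. \<Sum>l<n. d k * cnj (d l) * (LINT w|disc_measure. complex_of_real (defect w) * (w ^ k * cnj w ^ l)))"
    using mom_int by simp
  also have "\<dots> = (\<Sum>k<n. d k * cnj (d k) * complex_of_real (1 / ((real k + 1) * (real k + 2))))"
    unfolding disc_moment by (rule sum.cong[OF refl]) (simp add: if_distrib[where f="\<lambda>x. _ * x"] sum.delta cong: if_cong)
  also have "\<dots> = complex_of_real S"
    unfolding S_def of_real_sum
  proof (rule sum.cong[OF refl])
    fix k
    have "c k * cnj (c k) = complex_of_real ((norm (c k))\<^sup>2)" by (simp only: complex_norm_square)
    moreover have "d k * cnj (d k) = complex_of_real ((real k + 1) * (real k + 2))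
        * complex_of_real ((real k + 1) * (real k + 2)) * (c k * cnj (c k))"
      unfolding d_def complex_cnj_mult complex_cnj_complex_of_real by (simp only: mult_ac)
    ultimately have "d k * cnj (d k) = complex_of_real ((real k + 1) * (real k + 2)
        * ((real k + 1) * (real k + 2)) * (norm (c k))\<^sup>2)"
      by (simp only: of_real_mult)
    then show "d k * cnj (d k) * complex_of_real (1 / ((real k + 1) * (real k + 2))) =
         complex_of_real ((real k + 1) * (real k + 2) * (cmod (c k))\<^sup>2)"
      by (simp only: of_real_mult[symmetric]) (simp add: power2_eq_square)
  qed
  finally have PP: "(LINT w|disc_measure. defect w * (norm (P w))\<^sup>2) = S"
    by (simp only: of_real_eq_iff)
  have PP_int: "integrable disc_measure (\<lambda>w. defect w * (norm (P w))\<^sup>2)"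
  proof -
    have "integrable disc_measure (\<lambda>w. complex_of_real (defect w * (norm (P w))\<^sup>2))"
      unfolding PP_eq using mom_int by auto
    from integrable_Re[OF this] show ?thesis by (simp only: Re_complex_of_real)
  qed
  \<comment> \<open>The integrand equals |g - defect P|^2 / defect, the squared error of the
    projection.\<close>
  have "0 \<le> (LINT w|disc_measure. (norm (g w))\<^sup>2 / defect w - 2 * Re (g w * cnj (P w)) + defect w * (norm (P w))\<^sup>2)"
  proof (rule integral_nonneg_AE)
    show "AE w in disc_measure. 0 \<le> (norm (g w))\<^sup>2 / defect w - 2 * Re (g w * cnj (P w)) + defect w * (norm (P w))\<^sup>2"
      using AE_disc_defect_pos
    proof eventually_elim
      case (elim w)
      let ?t = "defect w"
      have "Re (g w * cnj (P w)) \<le> norm (g w) * norm (P w)"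
        using complex_Re_le_cmod[of "g w * cnj (P w)"] by (simp add: norm_mult)
      moreover have "0 \<le> (norm (g w) - ?t * norm (P w))\<^sup>2 / ?t" using elim by simp
      moreover have "(norm (g w) - ?t * norm (P w))\<^sup>2 / ?t = (norm (g w))\<^sup>2 / ?t - 2 * (norm (g w) * norm (P w)) + ?t * (norm (P w))\<^sup>2"
      proof -
        have "(x - t * y)\<^sup>2 / t = x\<^sup>2 / t - 2 * (x * y) + t * y\<^sup>2" if "t > 0" for x t y :: real
          using that by (simp add: field_simps power2_eq_square)
        then show ?thesis using elim by blast
      qed
      ultimately show ?case by linarith
    qed
  qed
  also have "\<dots> = (LINT w|disc_measure. (norm (g w))\<^sup>2 / defect w) - 2 * S + S"
  proof -
    define R where "R w = Re (g w * cnj (P w))" for w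
    have "(LINT w|disc_measure. R w) = S" unfolding R_def
      using integral_Re[OF gP_int] gP by simp
    moreover have "integrable disc_measure R" unfolding R_def using gP_int by (rule integrable_Re)
    ultimately show ?thesis unfolding R_def[symmetric] using int PP_int PP by simp
  qed
  finally have "S \<le> (LINT w|disc_measure. (norm (g w))\<^sup>2 / defect w)" by simp
  moreover have "(\<Sum>k<n. (real k + 1)\<^sup>2 * (norm (c k))\<^sup>2) \<le> S"
    unfolding S_def power2_eq_square[of "real _ + 1"] by (intro sum_mono mult_right_mono mult_left_mono) auto
  ultimately show ?thesis by linarith
qed

lemma measure_mono_AE_circle:
  assumes "AE v in circle_measure. v \<in> A \<longrightarrow> v \<in> B" "B \<in> sets borel"
  shows "measure circle_measure A \<le> measure circle_measure B"
  using circle.finite_measure_mono_AE[OF assms(1)] assms(2) by simp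

lemma markov_circle:
  assumes [measurable]: "u \<in> borel_measurable borel" and "0 < l" "0 \<le> K"
    and "(\<integral>\<^sup>+ v. ennreal (u v) \<partial>circle_measure) \<le> ennreal K"
  shows "measure circle_measure {v. u v > l} \<le> K / l"
proof -
  have "emeasure circle_measure {v. u v > l} \<le> emeasure circle_measure {v\<in>UNIV. 1 \<le> ennreal (1 / l) * ennreal (u v)}"
  proof (rule emeasure_mono)
    show "{v. u v > l} \<subseteq> {v\<in>UNIV. 1 \<le> ennreal (1 / l) * ennreal (u v)}"
      using assms(2) by (auto simp: ennreal_mult''[symmetric] ennreal_ge_1 divide_simps)
  qed simp
  also have "\<dots> \<le> ennreal (1 / l) * (\<integral>\<^sup>+ v. ennreal (u v) * indicator UNIV v \<partial>circle_measure)"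
    by (rule nn_integral_Markov_inequality) auto
  also have "\<dots> \<le> ennreal (1 / l) * ennreal K" by (rule mult_left_mono) (use assms in auto)
  also have "\<dots> = ennreal (K / l)" using assms by (simp add: ennreal_mult''[symmetric])
  finally show ?thesis using assms by (simp add: circle.emeasure_eq_measure ennreal_le_iff)
qed

lemma binomial_coeff_two: "binomial_coeff 2 k = real k + 1"
proof -
  have "pochhammer (2::real) k = fact (Suc k)"
    by (induction k) (simp_all add: pochhammer_Suc)
  then show ?thesis by (simp add: binomial_coeff_def)
qed

text \<open>On the circle through z the image has the Taylor coefficients (k + 1) c_k z^k, where c_k
  are the moments of g. Parseval's identity and |z| < 1 reduce the claim to the sums bounded in
  \<open>disc_bessel\<close>.\<close>

lemma circle_L2_bound:
  assumes g [measurable]: "g \<in> borel_measurable borel" and g_int: "integrable disc_measure g"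
    and M: "0 \<le> M" "(\<integral>\<^sup>+ w. ennreal ((norm (g w))\<^sup>2 / defect w) \<partial>disc_measure) \<le> ennreal M"
    and z: "z \<in> unit_disc"
  shows "(\<integral>\<^sup>+ v. ennreal ((norm (LINT w|disc_measure. g w / (1 - (v * z) * cnj w) powr 2))\<^sup>2) \<partial>circle_measure) \<le> ennreal M"
proof -
  have int: "integrable disc_measure (\<lambda>w. (norm (g w))\<^sup>2 / defect w)"
  proof (rule integrableI_bounded)
    have "(\<integral>\<^sup>+ w. ennreal (norm ((norm (g w))\<^sup>2 / defect w)) \<partial>disc_measure)
        = (\<integral>\<^sup>+ w. ennreal ((norm (g w))\<^sup>2 / defect w) \<partial>disc_measure)"
      by (rule nn_integral_cong_AE) (use AE_disc_defect_pos in eventually_elim, simp)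
    then show "(\<integral>\<^sup>+ w. ennreal (norm ((norm (g w))\<^sup>2 / defect w)) \<partial>disc_measure) < \<infinity>"
      using M(2) by (simp add: le_less_trans)
  qed simp
  have int_le: "(LINT w|disc_measure. (norm (g w))\<^sup>2 / defect w) \<le> M"
  proof -
    have "(LINT w|disc_measure. (norm (g w))\<^sup>2 / defect w) = enn2real (\<integral>\<^sup>+ w. ennreal ((norm (g w))\<^sup>2 / defect w) \<partial>disc_measure)"
      by (rule integral_eq_nn_integral) (use AE_disc_defect_pos in \<open>auto elim: eventually_mono\<close>)
    also have "\<dots> \<le> M" using M by (simp add: enn2real_leI)
    finally show ?thesis .
  qed
  define c where "c k = (LINT w|disc_measure. g w * cnj w ^ k)" for k
  define a where "a k = complex_of_real (binomial_coeff 2 k) * c k * z ^ k" for k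
  note coeff2 = binomial_coeff_two
  have sm: "summable (\<lambda>k. norm (a k))"
    unfolding a_def c_def by (rule disc_series(2)[OF g_int z])
  have ser: "(LINT w|disc_measure. g w / (1 - (v * z) * cnj w) powr 2) = (\<Sum>k. a k * v ^ k)" if "norm v = 1" for v
  proof -
    have "v * z \<in> unit_disc" using z that by (simp add: unit_disc_def norm_mult)
    from disc_series(1)[OF g_int this, of 2] show ?thesis
      by (simp add: a_def c_def power_mult_distrib mult_ac)
  qed
  have le: "(\<Sum>k. (norm (a k))\<^sup>2) \<le> M"
  proof (rule suminf_le_const[OF circle_parseval(2)[OF sm]])
    fix n
    have "(\<Sum>k<n. (norm (a k))\<^sup>2) \<le> (\<Sum>k<n. (real k + 1)\<^sup>2 * (norm (c k))\<^sup>2)"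
    proof (rule sum_mono)
      fix k
      have "norm z ^ k \<le> 1" using z by (intro power_le_one) (auto simp: unit_disc_def)
      then have "norm (a k) \<le> (real k + 1) * norm (c k)"
        by (simp add: a_def coeff2 norm_mult norm_power mult_left_le del: of_real_add)
      then have "(norm (a k))\<^sup>2 \<le> ((real k + 1) * norm (c k))\<^sup>2" by (rule power_mono) simp
      then show "(norm (a k))\<^sup>2 \<le> (real k + 1)\<^sup>2 * (norm (c k))\<^sup>2" by (simp add: power_mult_distrib)
    qed
    also have "\<dots> \<le> M"
      using disc_bessel[OF g int g_int, of n] int_le unfolding c_def by linarith
    finally show "(\<Sum>k<n. (norm (a k))\<^sup>2) \<le> M" .
  qed
  have bd: "norm (\<Sum>k. a k * v ^ k) \<le> (\<Sum>k. norm (a k))" if "norm v = 1" for v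
    by (rule order_trans[OF summable_norm]) (use sm that in \<open>auto simp: norm_mult norm_power\<close>)
  have "(\<integral>\<^sup>+ v. ennreal ((norm (LINT w|disc_measure. g w / (1 - (v * z) * cnj w) powr 2))\<^sup>2) \<partial>circle_measure)
      = (\<integral>\<^sup>+ v. ennreal ((norm (\<Sum>k. a k * v ^ k))\<^sup>2) \<partial>circle_measure)"
    by (rule nn_integral_cong_AE) (use AE_circle_norm in eventually_elim, simp only: ser)
  also have "\<dots> = ennreal (LINT v|circle_measure. (norm (\<Sum>k. a k * v ^ k))\<^sup>2)"
  proof (rule nn_integral_eq_integral)
    show "integrable circle_measure (\<lambda>v. (norm (\<Sum>k. a k * v ^ k))\<^sup>2)"
      by (rule circle.integrable_const_bound[where B="(\<Sum>k. norm (a k))\<^sup>2"])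
         (use AE_circle_norm in \<open>auto intro!: power_mono bd elim: eventually_mono\<close>)
  qed simp
  also have "\<dots> \<le> ennreal M" using le circle_parseval(1)[OF sm] by (simp add: ennreal_leI)
  finally show ?thesis .
qed

text \<open>Parseval's identity for the geometric series of 1 / (1 - v x).\<close>

lemma circle_poisson:
  assumes x: "norm x < 1"
  shows "(\<integral>\<^sup>+ v. ennreal (1 / (norm (1 - v * x))\<^sup>2) \<partial>circle_measure) = ennreal (1 / (1 - (norm x)\<^sup>2))"
proof -
  have sm: "summable (\<lambda>k. norm (x ^ k))" using x by (simp add: norm_power summable_geometric)
  have eq: "1 / (norm (1 - v * x))\<^sup>2 = (norm (\<Sum>k. x ^ k * v ^ k))\<^sup>2" if "norm v = 1" for v
  proof -
    have "norm (v * x) < 1" using x that by (simp add: norm_mult)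
    from suminf_geometric[OF this] have "(\<Sum>k. x ^ k * v ^ k) = 1 / (1 - v * x)"
      by (simp add: power_mult_distrib mult_ac)
    then show ?thesis by (simp add: norm_divide power_divide)
  qed
  have bd: "norm (\<Sum>k. x ^ k * v ^ k) \<le> (\<Sum>k. norm (x ^ k))" if "norm v = 1" for v
    by (rule order_trans[OF summable_norm]) (use sm that in \<open>auto simp: norm_mult norm_power\<close>)
  have "(\<integral>\<^sup>+ v. ennreal (1 / (norm (1 - v * x))\<^sup>2) \<partial>circle_measure)
      = (\<integral>\<^sup>+ v. ennreal ((norm (\<Sum>k. x ^ k * v ^ k))\<^sup>2) \<partial>circle_measure)"
    by (rule nn_integral_cong_AE) (use AE_circle_norm in eventually_elim, simp only: eq)
  also have "\<dots> = ennreal (LINT v|circle_measure. (norm (\<Sum>k. x ^ k * v ^ k))\<^sup>2)"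
  proof (rule nn_integral_eq_integral)
    show "integrable circle_measure (\<lambda>v. (norm (\<Sum>k. x ^ k * v ^ k))\<^sup>2)"
      by (rule circle.integrable_const_bound[where B="(\<Sum>k. norm (x ^ k))\<^sup>2"])
         (use AE_circle_norm in \<open>auto intro!: power_mono bd elim: eventually_mono\<close>)
  qed simp
  also have "(LINT v|circle_measure. (norm (\<Sum>k. x ^ k * v ^ k))\<^sup>2) = (\<Sum>k. (norm (x ^ k))\<^sup>2)"
    by (rule circle_parseval(1)[OF sm])
  also have "\<dots> = (\<Sum>k. ((norm x)\<^sup>2) ^ k)" by (simp add: norm_power power_mult[symmetric] mult.commute)
  also have "\<dots> = 1 / (1 - (norm x)\<^sup>2)"
    by (rule suminf_geometric) (use x in \<open>simp add: abs_square_less_1\<close>)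
  finally show ?thesis .
qed

text \<open>Tonelli's theorem and the mean of the squared Cauchy kernel. Since |z w| \<le> |w|, the
  radius of the circle disappears from the bound.\<close>

lemma circle_L1_bound:
  assumes g [measurable]: "g \<in> borel_measurable borel" and z: "z \<in> unit_disc"
  shows "(\<integral>\<^sup>+ v. ennreal (norm (LINT w|disc_measure. g w / (1 - (v * z) * cnj w) powr 2)) \<partial>circle_measure)
    \<le> (\<integral>\<^sup>+ w. ennreal (norm (g w) / defect w) \<partial>disc_measure)"
proof -
  have k: "ennreal (norm (g w / (1 - (v * z) * cnj w) powr 2)) = ennreal (norm (g w)) * ennreal (1 / (norm (1 - v * (z * cnj w)))\<^sup>2)" for v w
    using norm_powr_of_real[of "1 - v * z * cnj w" 2]
    by (simp add: norm_divide ennreal_mult''[symmetric] mult.assoc powr_numeral)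
  have "(\<integral>\<^sup>+ v. ennreal (norm (LINT w|disc_measure. g w / (1 - (v * z) * cnj w) powr 2)) \<partial>circle_measure)
     \<le> (\<integral>\<^sup>+ v. (\<integral>\<^sup>+ w. ennreal (norm (g w / (1 - (v * z) * cnj w) powr 2)) \<partial>disc_measure) \<partial>circle_measure)"
    by (rule nn_integral_mono) (rule integral_norm_bound_ennreal_any)
  also have "\<dots> = (\<integral>\<^sup>+ w. (\<integral>\<^sup>+ v. ennreal (norm (g w)) * ennreal (1 / (norm (1 - v * (z * cnj w)))\<^sup>2) \<partial>circle_measure) \<partial>disc_measure)"
    unfolding k by (rule disc_circle.Fubini') measurable
  also have "\<dots> \<le> (\<integral>\<^sup>+ w. ennreal (norm (g w) / defect w) \<partial>disc_measure)"
  proof (rule nn_integral_mono_AE)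
    show "AE w in disc_measure. (\<integral>\<^sup>+ v. ennreal (norm (g w)) * ennreal (1 / (norm (1 - v * (z * cnj w)))\<^sup>2) \<partial>circle_measure)
       \<le> ennreal (norm (g w) / defect w)"
      using AE_disc_unit_disc
    proof eventually_elim
      case (elim w)
      let ?x = "z * cnj w"
      have x: "norm ?x < 1" by (rule norm_mult_cnj_less[OF z elim])
      have "norm ?x \<le> norm w" using z by (simp add: norm_mult unit_disc_def mult_left_le_one_le)
      then have le: "1 / (1 - (norm ?x)\<^sup>2) \<le> 1 / defect w"
        using defect_pos[OF elim] by (intro divide_left_mono mult_pos_pos diff_left_mono power_mono)
           (use x in \<open>auto simp: abs_square_less_1\<close>)
      have "(\<integral>\<^sup>+ v. ennreal (norm (g w)) * ennreal (1 / (norm (1 - v * ?x))\<^sup>2) \<partial>circle_measure)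
         = ennreal (norm (g w)) * ennreal (1 / (1 - (norm ?x)\<^sup>2))"
        by (subst nn_integral_cmult) (simp_all add: circle_poisson[OF x])
      also have "\<dots> \<le> ennreal (norm (g w)) * ennreal (1 / defect w)"
        by (intro mult_left_mono ennreal_leI le) simp
      also have "\<dots> = ennreal (norm (g w) / defect w)" by (simp add: ennreal_mult'[symmetric])
      finally show ?case .
    qed
  qed
  finally show ?thesis .
qed

lemma norm_powr_two: "norm (x powr 2) = (norm x)\<^sup>2" for x :: complex
  by (cases "x = 0") (simp_all add: norm_power powr_numeral)

text \<open>In the application g is f times \<open>defect powr (1 / p)\<close>, so M bounds the p-th
  power of the L^p norm of f. The cut is made at the level t itself: |g| > t lowers the power p to 1
  for the L^1 bound, and |g| \<le> t raises it to 2 for the L^2 bound, at the cost of powers of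
  t.\<close>

lemma circle_weak_bound:
  assumes g [measurable]: "g \<in> borel_measurable borel" and p: "1 \<le> p" "p \<le> 2"
    and M: "0 \<le> M" "(\<integral>\<^sup>+ w. ennreal (norm (g w) powr p / defect w) \<partial>disc_measure) \<le> ennreal M"
    and z: "z \<in> unit_disc" and t: "0 < t"
  shows "integrable disc_measure (\<lambda>w. g w / (1 - z * cnj w) powr 2)"
    and "measure circle_measure {v. norm (LINT w|disc_measure. g w / (1 - (v * z) * cnj w) powr 2) > t} \<le> 6 * M / t powr p"
proof -
  \<comment> \<open>The majorant is 1 + |g|^p / defect, as the defect is at most 1.\<close>
  have g_int: "integrable disc_measure g"
  proof (rule integrableI_bounded)
    have "(\<integral>\<^sup>+ w. ennreal (norm (g w)) \<partial>disc_measure)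
       \<le> (\<integral>\<^sup>+ w. 1 + ennreal (norm (g w) powr p / defect w) \<partial>disc_measure)"
    proof (rule nn_integral_mono_AE)
      show "AE w in disc_measure. ennreal (norm (g w)) \<le> 1 + ennreal (norm (g w) powr p / defect w)"
        using AE_disc_defect_pos
      proof eventually_elim
        case (elim w)
        have "norm (g w) \<le> 1 + norm (g w) powr p"
        proof (cases "norm (g w) \<le> 1")
          case False
          then have "norm (g w) powr 1 \<le> norm (g w) powr p" using p by (intro powr_mono) auto
          then show ?thesis using False by simp
        qed (simp add: add_increasing2)
        also have "norm (g w) powr p \<le> norm (g w) powr p / defect w"
          using elim by (simp add: pos_le_divide_eq mult_left_le)
        finally have le: "norm (g w) \<le> 1 + norm (g w) powr p / defect w" by simp
        have "1 + ennreal (norm (g w) powr p / defect w) = ennreal (1 + norm (g w) powr p / defect w)"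
          using elim ennreal_plus[of 1 "norm (g w) powr p / defect w"] by simp
        then show ?case using ennreal_leI[OF le] by simp
      qed
    qed
    also have "\<dots> \<le> 1 + ennreal M" using M(2) by (subst nn_integral_add) (auto simp: disc.emeasure_space_1[simplified])
    also have "\<dots> < \<infinity>" by simp
    finally show "(\<integral>\<^sup>+ w. ennreal (norm (g w)) \<partial>disc_measure) < \<infinity>" .
  qed simp
  have int: "integrable disc_measure (\<lambda>w. h w / (1 - z * cnj w) powr 2)"
    if h: "integrable disc_measure h" and z: "z \<in> unit_disc" for h z
  proof (rule Bochner_Integration.integrable_bound)
    show "integrable disc_measure (\<lambda>w. h w / complex_of_real ((1 - norm z)\<^sup>2))" using h by simp
    show "AE w in disc_measure. norm (h w / (1 - z * cnj w) powr 2) \<le> norm (h w / complex_of_real ((1 - norm z)\<^sup>2))"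
      using AE_disc_unit_disc
    proof eventually_elim
      case (elim w)
      have z1: "0 < 1 - norm z" using z by (simp add: unit_disc_def)
      have le: "1 - norm z \<le> norm (1 - z * cnj w)" by (rule norm_one_minus_ge[OF elim])
      have le2: "(1 - norm z)\<^sup>2 \<le> norm ((1 - z * cnj w) powr 2)"
        unfolding norm_powr_two by (rule power_mono[OF le]) (use z1 in simp)
      have pos: "0 < (1 - norm z)\<^sup>2" using z1 by simp
      have "norm (h w) / norm ((1 - z * cnj w) powr 2) \<le> norm (h w) / (1 - norm z)\<^sup>2"
        by (intro divide_left_mono[OF le2] mult_pos_pos less_le_trans[OF pos le2] pos) simp
      then show ?case unfolding norm_divide norm_of_real by simp
    qed
    have [measurable]: "h \<in> borel_measurable borel" using borel_measurable_integrable[OF h] by simp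
    show "(\<lambda>w. h w / (1 - z * cnj w) powr 2) \<in> borel_measurable disc_measure" by measurable
  qed
  show "integrable disc_measure (\<lambda>w. g w / (1 - z * cnj w) powr 2)" by (rule int[OF g_int z])
  define g1 where "g1 w = (if norm (g w) > t then g w else 0)" for w
  define g2 where "g2 w = (if norm (g w) > t then 0 else g w)" for w
  have [measurable]: "g1 \<in> borel_measurable borel" "g2 \<in> borel_measurable borel"
    unfolding g1_def g2_def by measurable
  have g1_int: "integrable disc_measure g1" and g2_int: "integrable disc_measure g2"
    by (auto intro!: Bochner_Integration.integrable_bound[OF g_int] simp: g1_def g2_def)
  let ?F = "\<lambda>h v. LINT w|disc_measure. h w / (1 - (v * z) * cnj w) powr 2"
  have [measurable]: "?F h \<in> borel_measurable borel" if [measurable]: "h \<in> borel_measurable borel" for h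
    by measurable
  have F: "?F g v = ?F g1 v + ?F g2 v" if "norm v = 1" for v
  proof -
    have v: "v * z \<in> unit_disc" using z that by (simp add: unit_disc_def norm_mult)
    have "?F g v = (LINT w|disc_measure. g1 w / (1 - (v * z) * cnj w) powr 2 + g2 w / (1 - (v * z) * cnj w) powr 2)"
      by (rule Bochner_Integration.integral_cong) (auto simp: g1_def g2_def)
    then show ?thesis using int[OF g1_int v] int[OF g2_int v] by simp
  qed
  have le: "measure circle_measure {v. norm (?F g v) > t}
      \<le> measure circle_measure ({v. norm (?F g1 v) > t / 2} \<union> {v. (norm (?F g2 v))\<^sup>2 > (t / 2)\<^sup>2})"
  proof (rule measure_mono_AE_circle)
    show "AE v in circle_measure. v \<in> {v. norm (?F g v) > t} \<longrightarrow> v \<in> {v. norm (?F g1 v) > t / 2} \<union> {v. (norm (?F g2 v))\<^sup>2 > (t / 2)\<^sup>2}"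
      using AE_circle_norm
    proof eventually_elim
      case (elim v)
      have "norm (?F g v) \<le> norm (?F g1 v) + norm (?F g2 v)" unfolding F[OF elim] by (rule norm_triangle_ineq)
      moreover have "norm (?F g2 v) > t / 2 \<Longrightarrow> (norm (?F g2 v))\<^sup>2 > (t / 2)\<^sup>2"
        using t by (intro power_strict_mono) auto
      ultimately show ?case by fastforce
    qed
  qed measurable
  also have "\<dots> \<le> measure circle_measure {v. norm (?F g1 v) > t / 2} + measure circle_measure {v. (norm (?F g2 v))\<^sup>2 > (t / 2)\<^sup>2}"
    by (rule measure_Un_le) measurable
  also have "measure circle_measure {v. norm (?F g1 v) > t / 2} \<le> (t powr (1 - p) * M) / (t / 2)"
  proof (rule markov_circle)
    have "(\<integral>\<^sup>+ v. ennreal (norm (?F g1 v)) \<partial>circle_measure) \<le> (\<integral>\<^sup>+ w. ennreal (norm (g1 w) / defect w) \<partial>disc_measure)"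
      by (rule circle_L1_bound[OF _ z]) measurable
    also have "\<dots> \<le> (\<integral>\<^sup>+ w. ennreal (t powr (1 - p)) * ennreal (norm (g w) powr p / defect w) \<partial>disc_measure)"
    proof (rule nn_integral_mono_AE)
      show "AE w in disc_measure. ennreal (norm (g1 w) / defect w) \<le> ennreal (t powr (1 - p)) * ennreal (norm (g w) powr p / defect w)"
        using AE_disc_defect_pos
      proof eventually_elim
        case (elim w)
        have "norm (g1 w) \<le> t powr (1 - p) * norm (g w) powr p"
        proof (cases "norm (g w) > t")
          case True
          then have "norm (g w) powr (1 - p) \<le> t powr (1 - p)" using t p by (intro powr_mono2') auto
          then have "norm (g w) powr (1 - p) * norm (g w) powr p \<le> t powr (1 - p) * norm (g w) powr p"
            by (rule mult_right_mono) simp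
          then show ?thesis using True t by (simp add: powr_add[symmetric] g1_def)
        qed (simp add: g1_def)
        then have "norm (g1 w) / defect w \<le> t powr (1 - p) * norm (g w) powr p / defect w"
          using elim by (intro divide_right_mono) auto
        then show ?case using elim by (simp add: ennreal_mult'[symmetric] ennreal_leI)
      qed
    qed
    also have "\<dots> = ennreal (t powr (1 - p)) * (\<integral>\<^sup>+ w. ennreal (norm (g w) powr p / defect w) \<partial>disc_measure)"
      by (rule nn_integral_cmult) measurable
    also have "\<dots> \<le> ennreal (t powr (1 - p)) * ennreal M" by (rule mult_left_mono[OF M(2)]) simp
    finally show "(\<integral>\<^sup>+ v. ennreal (norm (?F g1 v)) \<partial>circle_measure) \<le> ennreal (t powr (1 - p) * M)"
      using M by (simp add: ennreal_mult)
  qed (use t M in auto)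
  also have "measure circle_measure {v. (norm (?F g2 v))\<^sup>2 > (t / 2)\<^sup>2} \<le> (t powr (2 - p) * M) / (t / 2)\<^sup>2"
  proof (rule markov_circle)
    have "(\<integral>\<^sup>+ w. ennreal ((norm (g2 w))\<^sup>2 / defect w) \<partial>disc_measure)
       \<le> (\<integral>\<^sup>+ w. ennreal (t powr (2 - p)) * ennreal (norm (g w) powr p / defect w) \<partial>disc_measure)"
    proof (rule nn_integral_mono_AE)
      show "AE w in disc_measure. ennreal ((norm (g2 w))\<^sup>2 / defect w) \<le> ennreal (t powr (2 - p)) * ennreal (norm (g w) powr p / defect w)"
        using AE_disc_defect_pos
      proof eventually_elim
        case (elim w)
        have "(norm (g2 w))\<^sup>2 \<le> t powr (2 - p) * norm (g w) powr p"
        proof (cases "g2 w = 0")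
          case False
          then have le: "norm (g w) \<le> t" "g w \<noteq> 0" "g2 w = g w" by (auto simp: g2_def split: if_splits)
          then have "norm (g w) powr (2 - p) \<le> t powr (2 - p)" using t p by (intro powr_mono2) auto
          then have "norm (g w) powr (2 - p) * norm (g w) powr p \<le> t powr (2 - p) * norm (g w) powr p"
            by (rule mult_right_mono) simp
          moreover have "norm (g w) powr (2 - p) * norm (g w) powr p = (norm (g w))\<^sup>2"
            using le by (simp add: powr_add[symmetric] powr_numeral)
          ultimately show ?thesis using le by simp
        qed simp
        then have "(norm (g2 w))\<^sup>2 / defect w \<le> t powr (2 - p) * norm (g w) powr p / defect w"
          using elim by (intro divide_right_mono) auto
        then show ?case using elim by (simp add: ennreal_mult'[symmetric] ennreal_leI)
      qed
    qed
    also have "\<dots> = ennreal (t powr (2 - p)) * (\<integral>\<^sup>+ w. ennreal (norm (g w) powr p / defect w) \<partial>disc_measure)"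
      by (rule nn_integral_cmult) measurable
    also have "\<dots> \<le> ennreal (t powr (2 - p)) * ennreal M" by (rule mult_left_mono[OF M(2)]) simp
    finally have "(\<integral>\<^sup>+ w. ennreal ((norm (g2 w))\<^sup>2 / defect w) \<partial>disc_measure) \<le> ennreal (t powr (2 - p) * M)"
      using M by (simp add: ennreal_mult)
    then show "(\<integral>\<^sup>+ v. ennreal ((norm (?F g2 v))\<^sup>2) \<partial>circle_measure) \<le> ennreal (t powr (2 - p) * M)"
      by (intro circle_L2_bound[OF _ g2_int _ _ z]) (use M in auto)
  qed (use t M in auto)
  \<comment> \<open>Markov's inequality at level t / 2 yields 2 M / t^p from the L^1 part and 4 M /
    t^p from the L^2 part.\<close>
  also have "t powr (1 - p) * M / (t / 2) + t powr (2 - p) * M / (t / 2)\<^sup>2 = 6 * M / t powr p"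
    using t by (simp add: powr_diff powr_numeral field_simps power2_eq_square)
  finally show "measure circle_measure {v. norm (?F g v) > t} \<le> 6 * M / t powr p" by simp
qed

text \<open>At a = -1/q the exponent a + 1/q vanishes, so the passage to the disc asks for a circle
  bound that is uniform in the radius; it is available with s = p > q.\<close>

theorem weak_type_T_critical:
  assumes "1 \<le> q" "q < p" "p \<le> 2"
  shows "weak_type (T_op (- 1 / q) (1 / p) 2) (ennreal p) (ennreal q)"
proof -
  let ?K = "T_op (- 1 / q) (1 / p) 2"
  let ?C = "(p / (p - q)) powr (1 / q) * 6 powr (1 / p)"
  note K = weighted_operator_T_op[of "- 1 / q" "1 / p" 2]
  have "converges_ae ?K f \<and> (\<forall>t>0. distr_fun (apply_op ?K f) t \<le> (?C * B / t) powr q)"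
    if f [measurable]: "f \<in> borel_measurable borel" and B: "B \<ge> 0" "Lp_norm (ennreal p) f \<le> ennreal B" for f B
  proof -
    define g where "g w = complex_of_real (defect w powr (1 / p)) * f w" for w
    have [measurable]: "g \<in> borel_measurable borel" unfolding g_def by measurable
    have kg: "kernel ?K z w * f w = g w / (1 - z * cnj w) powr 2" for z w
      by (simp add: T_op_def g_def)
    have "(\<integral>\<^sup>+ w. ennreal (norm (g w) powr p / defect w) \<partial>disc_measure) = (\<integral>\<^sup>+ w. ennreal (norm (f w) powr p) \<partial>disc_measure)"
    proof (rule nn_integral_cong_AE)
      show "AE w in disc_measure. ennreal (norm (g w) powr p / defect w) = ennreal (norm (f w) powr p)"
        using AE_disc_defect_pos
        by eventually_elim (use assms in \<open>simp add: g_def norm_mult powr_mult powr_powr\<close>)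
    qed
    also have "\<dots> \<le> ennreal (B powr p)" using B assms by (subst Lp_norm_le_iff[symmetric]) auto
    finally have gB: "(\<integral>\<^sup>+ w. ennreal (norm (g w) powr p / defect w) \<partial>disc_measure) \<le> ennreal (B powr p)" .
    have "converges_ae ?K f \<and> (\<forall>t>0. distr_fun (apply_op ?K f) t \<le> ((p / (p - q)) powr (1 / q) * (6 powr (1 / p) * B) / t) powr q)"
    proof (rule weighted_operator_weak_bound[OF K f])
      fix z :: complex assume z: "z \<in> unit_disc"
      show "integrable disc_measure (\<lambda>w. kernel ?K z w * f w)"
        unfolding kg by (rule circle_weak_bound(1)[OF _ _ _ _ gB z zero_less_one]) (use assms in auto)
      fix t :: real assume t: "t > 0"
      have "measure circle_measure {v. norm (LINT w|disc_measure. kernel ?K (v * z) w * f w) > t} \<le> 6 * B powr p / t powr p"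
        unfolding kg by (rule circle_weak_bound(2)[OF _ _ _ _ gB z t]) (use assms in auto)
      also have "\<dots> = (6 powr (1 / p) * B * defect z powr - (- 1 / q + 1 / q) / t) powr p"
        using defect_pos[OF z] B t assms by (simp add: powr_mult powr_divide powr_powr)
      finally show "measure circle_measure {v. norm (LINT w|disc_measure. kernel ?K (v * z) w * f w) > t}
         \<le> (6 powr (1 / p) * B * defect z powr - (- 1 / q + 1 / q) / t) powr p" .
    qed (use assms B in auto)
    then show ?thesis by (simp add: mult.assoc)
  qed
  moreover have "?C \<ge> 0" by simp
  ultimately have "weakly_bounded (Lp_norm (ennreal p)) ?K q"
    unfolding weakly_bounded_def by blast
  then show ?thesis using weak_type_weakly_bounded[OF K] assms by simp
qed

section \<open>Lower bounds and the failure of the positive operators\<close>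

lemma norm_integral_of_real_ge:
  assumes "integrable disc_measure (\<lambda>w. complex_of_real (u w))" "\<And>w. 0 \<le> u w" "0 \<le> L"
    and "ennreal L \<le> (\<integral>\<^sup>+ w. ennreal (u w) \<partial>disc_measure)"
  shows "L \<le> norm (LINT w|disc_measure. complex_of_real (u w))"
proof -
  have int: "integrable disc_measure u" using integrable_Re[OF assms(1)] by simp
  have "(\<integral>\<^sup>+ w. ennreal (u w) \<partial>disc_measure) = ennreal (LINT w|disc_measure. u w)"
    by (rule nn_integral_eq_integral[OF int]) (use assms in simp)
  then have "ennreal L \<le> ennreal (LINT w|disc_measure. u w)" using assms(4) by simp
  moreover have "0 \<le> (LINT w|disc_measure. u w)" using assms(2) by simp
  ultimately have "L \<le> (LINT w|disc_measure. u w)" by (simp add: ennreal_le_iff)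
  then show ?thesis by simp
qed

text \<open>The form in which lower bounds for the image contradict a weak-type estimate. The factor
  2 comes from testing at level L / 2, since level sets are defined by a strict inequality.\<close>

lemma weak_bound_lower:
  assumes K: "weighted_operator a K" and f [measurable]: "f \<in> borel_measurable borel"
    and bound: "\<forall>t>0. distr_fun (apply_op K f) t \<le> (D / t) powr q"
    and A: "A \<in> sets borel" "A \<subseteq> {0..1}" and L: "0 < L"
    and ge: "AE z in disc_measure. defect z \<in> A \<longrightarrow>
        L \<le> defect z powr a * norm (LINT w|disc_measure. kernel K z w * f w)"
  shows "measure lborel A \<le> (2 * D / L) powr q"
proof -
  note [measurable] = A(1) borel_integral_kernel[OF K f]
  have "emeasure disc_measure {w. defect w \<in> A} = emeasure lborel A"
    using A by (simp add: emeasure_disc_defect Int_absorb2)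
  then have "measure lborel A = measure disc_measure {w. defect w \<in> A}" by (simp add: measure_def)
  also have "\<dots> \<le> measure disc_measure {z. defect z powr a * norm (LINT w|disc_measure. kernel K z w * f w) > L / 2}"
    by (rule disc.finite_measure_mono_AE) (use ge L in \<open>auto elim!: eventually_mono\<close>)
  also have "\<dots> = distr_fun (apply_op K f) (L / 2)" by (simp add: distr_fun_weighted[OF K f])
  also have "\<dots> \<le> (D / (L / 2)) powr q" using bound[rule_format, of "L / 2"] L by simp
  finally show ?thesis by (simp add: mult.commute)
qed

lemma nn_integral_inverse_Icc:
  assumes "0 < e" "e \<le> 1" "0 \<le> k"
  shows "(\<integral>\<^sup>+ s. ennreal (k / s) * indicator {e..1} s \<partial>lborel) = ennreal (k * ln (1 / e))"
proof -
  have "(\<integral>\<^sup>+ s. ennreal (k / s) * indicator {e..1} s \<partial>lborel) = ennreal (k * ln 1 - k * ln e)"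
    by (rule nn_integral_FTC_Icc) (use assms in \<open>auto intro!: derivative_eq_intros\<close>)
  then show ?thesis using assms by (simp add: ln_div)
qed

text \<open>The two sides differ by \<open>defect z * defect w\<close>.\<close>

lemma defect_mult_le:
  assumes "z \<in> unit_disc" "w \<in> unit_disc"
  shows "1 - (norm (z * cnj w))\<^sup>2 \<le> defect z + defect w"
proof -
  have "0 \<le> defect z * defect w" using defect_pos[OF assms(1)] defect_pos[OF assms(2)] by simp
  then show ?thesis by (simp add: norm_mult power_mult_distrib algebra_simps)
qed

text \<open>Next to a radial factor the kernel may be replaced by its mean over circles, which
  Parseval's identity computes.\<close>

lemma nn_integral_disc_kernel_average:
  assumes [measurable]: "h \<in> borel_measurable borel" "k \<in> borel_measurable borel"
    and h: "\<And>v w. norm v = 1 \<Longrightarrow> h (v * w) = h w"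
  shows "(\<integral>\<^sup>+ w. h w * k (z * cnj w) \<partial>disc_measure)
     = (\<integral>\<^sup>+ w. h w * (\<integral>\<^sup>+ v. k (v * (z * cnj w)) \<partial>circle_measure) \<partial>disc_measure)"
proof -
  have "(\<integral>\<^sup>+ w. h w * (\<integral>\<^sup>+ v. k (v * (z * cnj w)) \<partial>circle_measure) \<partial>disc_measure)
      = (\<integral>\<^sup>+ w. (\<integral>\<^sup>+ v. h w * k (v * (z * cnj w)) \<partial>circle_measure) \<partial>disc_measure)"
    by (simp add: nn_integral_cmult)
  also have "\<dots> = (\<integral>\<^sup>+ v. (\<integral>\<^sup>+ w. h w * k (v * (z * cnj w)) \<partial>disc_measure) \<partial>circle_measure)"
    by (rule circle_disc.Fubini') measurable
  also have "\<dots> = (\<integral>\<^sup>+ v. (\<integral>\<^sup>+ w. h w * k (z * cnj w) \<partial>disc_measure) \<partial>circle_measure)"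
  proof (rule nn_integral_cong_AE)
    show "AE v in circle_measure. (\<integral>\<^sup>+ w. h w * k (v * (z * cnj w)) \<partial>disc_measure) = (\<integral>\<^sup>+ w. h w * k (z * cnj w) \<partial>disc_measure)"
      using AE_circle_norm
    proof eventually_elim
      case (elim v)
      have "norm (cnj v) = 1" using elim by simp
      from nn_integral_disc_rotate[OF this, of "\<lambda>w. h w * k (z * cnj w)"] h[OF this]
      show ?case by (simp add: mult_ac)
    qed
  qed
  finally show ?thesis by (simp add: circle.emeasure_space_1[simplified])
qed

text \<open>For defect z \<le> e \<le> defect w the circle mean of the kernel is at least 1 / (2
  defect w). The test function turns this into half of the logarithmic integral \<Lambda>, while its
  L^p norm is only \<Lambda>^(1/p). As p > 1, large \<Lambda> is impossible.\<close>

theorem not_weak_type_S_critical: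
  assumes p: "1 < p" and q: "0 < q"
  shows "\<not> weak_type (S_op (- 1 / q) (1 / p) 2) (ennreal p) (ennreal q)"
proof
  let ?K = "S_op (- 1 / q) (1 / p) 2"
  note K = weighted_operator_S_op[of "- 1 / q" "1 / p" 2]
  assume "weak_type ?K (ennreal p) (ennreal q)"
  then obtain C where C0: "C \<ge> 0" and C: "\<And>f B. f \<in> borel_measurable borel \<Longrightarrow> B \<ge> 0 \<Longrightarrow> Lp_norm (ennreal p) f \<le> ennreal B \<Longrightarrow>
     converges_ae ?K f \<and> (\<forall>t>0. distr_fun (apply_op ?K f) t \<le> (C * B / t) powr q)"
    unfolding weak_type_weakly_bounded[OF K q] weakly_bounded_def by blast
  have main: "\<Lambda> powr (1 - 1 / p) \<le> 4 * C" if \<Lambda>: "\<Lambda> > 0" for \<Lambda>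
  proof -
    \<comment> \<open>Chosen so that the integral of 1 / s over [e, 1] is \<Lambda>.\<close>
    define e where "e = exp (- \<Lambda>)"
    have e: "0 < e" "e \<le> 1" "ln (1 / e) = \<Lambda>" using \<Lambda> by (auto simp: e_def ln_div)
    define u where "u w = (if e \<le> defect w then defect w powr (- 1 / p) else 0)" for w
    let ?f = "\<lambda>w. complex_of_real (u w)"
    have [measurable]: "u \<in> borel_measurable borel" unfolding u_def by measurable
    have u0: "0 \<le> u w" for w by (simp add: u_def)
    have f: "?f \<in> borel_measurable borel" by measurable
    have "(\<integral>\<^sup>+ w. ennreal (norm (?f w) powr p) \<partial>disc_measure)
        = (\<integral>\<^sup>+ w. ennreal (1 / defect w) * indicator {e..} (defect w) \<partial>disc_measure)"
    proof (rule nn_integral_cong)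
      fix w
      show "ennreal (norm (?f w) powr p) = ennreal (1 / defect w) * indicator {e..} (defect w)"
      proof (cases "e \<le> defect w")
        case True
        then have "u w = defect w powr (- 1 / p)" by (simp add: u_def)
        then have "norm (?f w) powr p = defect w powr (- 1 / p * p)" unfolding norm_of_real by (simp add: powr_powr)
        also have "\<dots> = 1 / defect w" using p e True by (simp add: powr_minus_divide)
        finally show ?thesis using True by simp
      qed (simp add: u_def)
    qed
    also have "\<dots> = (\<integral>\<^sup>+ s. (ennreal (1 / s) * indicator {e..} s) * indicator {0..1} s \<partial>lborel)"
      by (rule nn_integral_disc_radial) measurable
    also have "\<dots> = (\<integral>\<^sup>+ s. ennreal (1 / s) * indicator {e..1} s \<partial>lborel)"
      using e by (intro nn_integral_cong) (auto simp: indicator_def)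
    also have "\<dots> = ennreal \<Lambda>" using nn_integral_inverse_Icc[OF e(1,2), of 1] e(3) by simp
    finally have "Lp_norm (ennreal p) ?f \<le> ennreal (\<Lambda> powr (1 / p))"
      using p \<Lambda> by (subst Lp_norm_le_iff) (auto simp: powr_powr)
    note Cf = C[OF f powr_ge_zero this]
    \<comment> \<open>Tested on the thin annulus of defect at most e: its area e is balanced by the
      weight \<open>e powr (- 1 / q)\<close>, so e drops out of the final inequality.\<close>
    have "measure lborel {0..e} \<le> (2 * (C * \<Lambda> powr (1 / p)) / (e powr (- 1 / q) * (\<Lambda> / 2))) powr q"
    proof (rule weak_bound_lower[OF K f])
      show "AE z in disc_measure. defect z \<in> {0..e} \<longrightarrow> e powr (- 1 / q) * (\<Lambda> / 2)
         \<le> defect z powr (- 1 / q) * norm (LINT w|disc_measure. kernel ?K z w * ?f w)"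
        using Cf[THEN conjunct1, unfolded converges_ae_borel_iff[OF K f]] AE_disc_unit_disc
      proof eventually_elim
        case (elim z)
        let ?u = "\<lambda>w. defect w powr (1 / p) / norm (1 - z * cnj w) powr 2 * u w"
        have k: "kernel ?K z w * ?f w = complex_of_real (?u w)" for w
          by (simp add: kernel_S_op)
        show ?case
        proof
          assume d: "defect z \<in> {0..e}"
          have dz: "0 < defect z" by (rule defect_pos[OF elim(2)])
          have "\<Lambda> / 2 \<le> norm (LINT w|disc_measure. kernel ?K z w * ?f w)"
            unfolding k
          proof (rule norm_integral_of_real_ge)
            show "integrable disc_measure (\<lambda>w. complex_of_real (?u w))" using elim(1) unfolding k .
            have "ennreal (\<Lambda> / 2) = (\<integral>\<^sup>+ s. ennreal (1 / 2 / s) * indicator {e..1} s \<partial>lborel)"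
              using nn_integral_inverse_Icc[OF e(1,2), of "1 / 2"] e(3) by simp
            also have "\<dots> = (\<integral>\<^sup>+ s. ennreal (1 / (2 * s)) * indicator {e..} s * indicator {0..1} s \<partial>lborel)"
              using e by (intro nn_integral_cong) (auto simp: indicator_def)
            also have "\<dots> = (\<integral>\<^sup>+ w. ennreal (1 / (2 * defect w)) * indicator {e..} (defect w) \<partial>disc_measure)"
              by (rule nn_integral_disc_radial[symmetric]) measurable
            also have "\<dots> \<le> (\<integral>\<^sup>+ w. indicator {e..} (defect w) *
               (\<integral>\<^sup>+ v. ennreal (1 / (norm (1 - v * (z * cnj w)))\<^sup>2) \<partial>circle_measure) \<partial>disc_measure)"
            proof (rule nn_integral_mono_AE)
              show "AE w in disc_measure. ennreal (1 / (2 * defect w)) * indicator {e..} (defect w)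
                 \<le> indicator {e..} (defect w) * (\<integral>\<^sup>+ v. ennreal (1 / (norm (1 - v * (z * cnj w)))\<^sup>2) \<partial>circle_measure)"
                using AE_disc_unit_disc
              proof eventually_elim
                case (elim w)
                have x: "norm (z * cnj w) < 1" by (rule norm_mult_cnj_less[OF \<open>z \<in> unit_disc\<close> elim])
                have "1 / (2 * defect w) \<le> 1 / (1 - (norm (z * cnj w))\<^sup>2)" if "e \<le> defect w"
                  using defect_mult_le[OF \<open>z \<in> unit_disc\<close> elim] defect_pos[OF elim] that d x
                  by (intro divide_left_mono mult_pos_pos) (auto simp: abs_square_less_1)
                then show ?case unfolding circle_poisson[OF x]
                  by (auto simp: indicator_def intro!: ennreal_leI)
              qed
            qed
            also have "\<dots> = (\<integral>\<^sup>+ w. indicator {e..} (defect w) * ennreal (1 / (norm (1 - z * cnj w))\<^sup>2) \<partial>disc_measure)"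
              by (rule nn_integral_disc_kernel_average[symmetric]) (simp_all add: norm_mult)
            also have "\<dots> = (\<integral>\<^sup>+ w. ennreal (?u w) \<partial>disc_measure)"
              using e p by (intro nn_integral_cong)
                (auto simp: u_def indicator_def powr_add[symmetric] powr_numeral)
            finally show "ennreal (\<Lambda> / 2) \<le> (\<integral>\<^sup>+ w. ennreal (?u w) \<partial>disc_measure)" .
          qed (use \<Lambda> u0 in auto)
          moreover have "e powr (- 1 / q) \<le> defect z powr (- 1 / q)"
            using d dz q by (intro powr_mono2') auto
          ultimately show "e powr (- 1 / q) * (\<Lambda> / 2)
            \<le> defect z powr (- 1 / q) * norm (LINT w|disc_measure. kernel ?K z w * ?f w)"
            using \<Lambda> by (intro mult_mono) auto
        qed
      qed
    qed (use Cf e \<Lambda> in auto)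
    also have "2 * (C * \<Lambda> powr (1 / p)) / (e powr (- 1 / q) * (\<Lambda> / 2)) = e powr (1 / q) * (4 * C / \<Lambda> powr (1 - 1 / p))"
      using e \<Lambda> by (simp add: powr_diff powr_minus field_simps)
    also have "(e powr (1 / q) * (4 * C / \<Lambda> powr (1 - 1 / p))) powr q = e * (4 * C / \<Lambda> powr (1 - 1 / p)) powr q"
      by (subst powr_mult) (use C0 e q in \<open>auto simp: powr_powr\<close>)
    finally have "1 \<le> (4 * C / \<Lambda> powr (1 - 1 / p)) powr q" using e by simp
    then have "1 \<le> 4 * C / \<Lambda> powr (1 - 1 / p)"
      using C0 q powr_less_mono2[of q "4 * C / \<Lambda> powr (1 - 1 / p)" 1] by (fastforce simp: not_le[symmetric])
    then show ?thesis using \<Lambda> by (simp add: field_simps)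
  qed
  define \<Lambda> where "\<Lambda> = (4 * C + 1) powr (1 / (1 - 1 / p))"
  have "\<Lambda> powr (1 - 1 / p) = 4 * C + 1" using C0 p by (simp add: \<Lambda>_def powr_powr)
  moreover have "\<Lambda> > 0" using C0 by (simp add: \<Lambda>_def)
  ultimately show False using main[of \<Lambda>] by simp
qed

section \<open>Divergence of the circle means of the Cauchy kernel\<close>

text \<open>The ratio of consecutive coefficients is (n + 1/2) / (n + 1), and (n + 1/2)^2 \<ge> n (n
  + 1). Equality at n = 1 fixes the constant 1/4.\<close>

lemma binomial_coeff_half_ge: "n \<ge> 1 \<Longrightarrow> 1 / (4 * real n) \<le> (binomial_coeff (1/2) n)\<^sup>2"
proof (induction n rule: nat_induct_at_least)
  case base then show ?case by (simp add: binomial_coeff_def power2_eq_square)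
next
  case (Suc n)
  have eq: "binomial_coeff (1/2) (Suc n) = binomial_coeff (1/2) n * ((real n + 1/2) / (real n + 1))"
    by (simp add: binomial_coeff_def pochhammer_Suc field_simps)
  have "1 / (4 * real (Suc n)) \<le> 1 / (4 * real n) * ((real n + 1/2) / (real n + 1))\<^sup>2"
    using Suc(1) by (simp add: divide_simps power2_eq_square) (simp add: algebra_simps)
  also have "\<dots> \<le> (binomial_coeff (1/2) n)\<^sup>2 * ((real n + 1/2) / (real n + 1))\<^sup>2"
    by (rule mult_right_mono[OF Suc(2)]) simp
  finally show ?case by (simp only: eq power_mult_distrib)
qed

text \<open>The integrand is the squared modulus of (1 - v x)^(-c), so Parseval's identity applies
  to its binomial series. Later kernel means use this with half of their exponent in place of
  c.\<close>

lemma circle_kernel_parseval: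
  assumes x: "norm x < 1"
  shows "(\<integral>\<^sup>+ v. ennreal (1 / norm (1 - v * x) powr (2 * c)) \<partial>circle_measure)
       = ennreal (\<Sum>k. (binomial_coeff c k)\<^sup>2 * ((norm x)\<^sup>2) ^ k)"
    and "summable (\<lambda>k. (binomial_coeff c k)\<^sup>2 * ((norm x)\<^sup>2) ^ k)"
proof -
  define a where "a k = complex_of_real (binomial_coeff c k) * x ^ k" for k
  have na: "norm (a k) = \<bar>binomial_coeff c k\<bar> * norm x ^ k" for k
    unfolding a_def norm_mult norm_power norm_of_real ..
  have sm: "summable (\<lambda>k. norm (a k))"
    unfolding na by (rule binomial_coeff_summable) (use x in auto)
  have eq: "1 / norm (1 - v * x) powr (2 * c) = (norm (\<Sum>k. a k * v ^ k))\<^sup>2" if "norm v = 1" for v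
  proof -
    have "norm (v * x) < 1" using x that by (simp add: norm_mult)
    from binomial_coeff_sums[OF this, of c] have "(\<Sum>k. a k * v ^ k) = 1 / (1 - v * x) powr complex_of_real c"
      by (simp add: a_def power_mult_distrib mult_ac sums_iff)
    then have "norm (\<Sum>k. a k * v ^ k) = 1 / norm (1 - v * x) powr c"
      by (simp only: norm_divide norm_powr_of_real norm_one)
    then show ?thesis by (simp add: power2_eq_square powr_add[symmetric])
  qed
  have bd: "norm (\<Sum>k. a k * v ^ k) \<le> (\<Sum>k. norm (a k))" if "norm v = 1" for v
    by (rule order_trans[OF summable_norm]) (use sm that in \<open>auto simp: norm_mult norm_power\<close>)
  have na2: "(norm (a k))\<^sup>2 = (binomial_coeff c k)\<^sup>2 * ((norm x)\<^sup>2) ^ k" for k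
    unfolding na by (simp add: power_mult_distrib power_mult[symmetric] mult.commute)
  have "(\<integral>\<^sup>+ v. ennreal (1 / norm (1 - v * x) powr (2 * c)) \<partial>circle_measure)
      = (\<integral>\<^sup>+ v. ennreal ((norm (\<Sum>k. a k * v ^ k))\<^sup>2) \<partial>circle_measure)"
    by (rule nn_integral_cong_AE) (use AE_circle_norm in eventually_elim, simp only: eq)
  also have "\<dots> = ennreal (LINT v|circle_measure. (norm (\<Sum>k. a k * v ^ k))\<^sup>2)"
  proof (rule nn_integral_eq_integral)
    show "integrable circle_measure (\<lambda>v. (norm (\<Sum>k. a k * v ^ k))\<^sup>2)"
      by (rule circle.integrable_const_bound[where B="(\<Sum>k. norm (a k))\<^sup>2"])
         (use AE_circle_norm in \<open>auto intro!: power_mono bd elim: eventually_mono\<close>)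
  qed simp
  also have "(LINT v|circle_measure. (norm (\<Sum>k. a k * v ^ k))\<^sup>2) = (\<Sum>k. (binomial_coeff c k)\<^sup>2 * ((norm x)\<^sup>2) ^ k)"
    using circle_parseval(1)[OF sm] by (simp add: na2)
  finally show "(\<integral>\<^sup>+ v. ennreal (1 / norm (1 - v * x) powr (2 * c)) \<partial>circle_measure)
       = ennreal (\<Sum>k. (binomial_coeff c k)\<^sup>2 * ((norm x)\<^sup>2) ^ k)" .
  show "summable (\<lambda>k. (binomial_coeff c k)\<^sup>2 * ((norm x)\<^sup>2) ^ k)"
    using circle_parseval(2)[OF sm] by (simp add: na2)
qed

text \<open>For the kernel exponent 1 the Parseval series has terms of order 1 / k. Close to the
  boundary the first n of them keep at least half of their size, and the harmonic series
  diverges.\<close>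

lemma circle_cauchy_kernel_unbounded:
  "\<exists>e>0. e \<le> 1 \<and> (\<forall>x. norm x < 1 \<longrightarrow> 1 - e \<le> (norm x)\<^sup>2 \<longrightarrow>
      ennreal Q \<le> (\<integral>\<^sup>+ v. ennreal (1 / norm (1 - v * x)) \<partial>circle_measure))"
proof -
  \<comment> \<open>8 = 4 * 2, with 4 from the lower bound for the squared coefficients and 2 from
    |x|^(2 k) \<ge> 1/2.\<close>
  obtain n where n: "8 * Q \<le> (\<Sum>k=1..n. 1 / real k)"
  proof -
    have "\<not> summable (\<lambda>k. 1 / real (Suc k))"
      using not_summable_harmonic[where 'a=real] summable_Suc_iff[of "\<lambda>k. 1 / real k"]
      by (simp add: inverse_eq_divide)
    then have "\<not> (\<forall>n. (\<Sum>k<n. 1 / real (Suc k)) \<le> 8 * Q)"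
      using summableI_nonneg_bounded[of "\<lambda>k. 1 / real (Suc k)" "8 * Q"] by auto
    then obtain n where "8 * Q \<le> (\<Sum>k<n. 1 / real (Suc k))" by (auto simp: not_le intro: less_imp_le)
    also have "\<dots> = (\<Sum>k=1..n. 1 / real k)"
      by (rule sum.reindex_bij_witness[of _ "\<lambda>k. k - 1" Suc]) auto
    finally show ?thesis using that by blast
  qed
  \<comment> \<open>Makes n e < 1/2 in Bernoulli's inequality.\<close>
  define e where "e = 1 / (2 * (real n + 1))"
  have e: "0 < e" "e \<le> 1" by (auto simp: e_def field_simps)
  have "ennreal Q \<le> (\<integral>\<^sup>+ v. ennreal (1 / norm (1 - v * x)) \<partial>circle_measure)"
    if x: "norm x < 1" "1 - e \<le> (norm x)\<^sup>2" for x
  proof -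
    let ?r = "(norm x)\<^sup>2"
    have r: "0 \<le> ?r" "?r \<le> 1" using x by (auto simp: power_le_one)
    have "1 / 2 \<le> 1 + real n * (- e)" by (simp add: e_def field_simps)
    also have "\<dots> \<le> (1 + (- e)) ^ n" by (rule Bernoulli_inequality) (use e in auto)
    also have "\<dots> \<le> ?r ^ n" by (rule power_mono) (use x e in auto)
    finally have rn: "1 / 2 \<le> ?r ^ n" .
    have "Q \<le> (\<Sum>k=1..n. 1 / (4 * real k) * (1 / 2))"
    proof -
      have "(\<Sum>k=1..n. 1 / (4 * real k) * (1 / 2)) = (\<Sum>k=1..n. 1 / real k) / 8"
        unfolding sum_divide_distrib by (rule sum.cong) auto
      then show ?thesis using n by simp
    qed
    also have "\<dots> \<le> (\<Sum>k=1..n. (binomial_coeff (1/2) k)\<^sup>2 * ?r ^ k)"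
    proof (intro sum_mono mult_mono)
      fix k assume k: "k \<in> {1..n}"
      show "1 / (4 * real k) \<le> (binomial_coeff (1/2) k)\<^sup>2" using k by (intro binomial_coeff_half_ge) auto
      have "?r ^ n \<le> ?r ^ k" using k r by (intro power_decreasing) auto
      then show "1 / 2 \<le> ?r ^ k" using rn by linarith
    qed auto
    also have "\<dots> \<le> (\<Sum>k. (binomial_coeff (1/2) k)\<^sup>2 * ?r ^ k)"
      by (rule sum_le_suminf[OF circle_kernel_parseval(2)[OF x(1)]]) auto
    finally show ?thesis
      using circle_kernel_parseval(1)[OF x(1), of "1/2"] by (simp add: ennreal_leI)
  qed
  then show ?thesis using e by blast
qed

lemma nn_integral_powr_Icc:
  assumes "0 < r" "0 \<le> e"
  shows "(\<integral>\<^sup>+ s. ennreal (s powr (r - 1)) * indicator {0..e} s \<partial>lborel) = ennreal (e powr r / r)"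
proof -
  have "((\<lambda>s. s powr (r - 1)) has_integral (e powr (r - 1 + 1) / (r - 1 + 1))) {0..e}"
    by (rule has_integral_powr_from_0) (use assms in auto)
  then have "((\<lambda>s. s powr (r - 1)) has_integral (e powr r / r)) {0..e}" by simp
  from nn_integral_has_integral_lebesgue[OF _ this]
  have "(\<integral>\<^sup>+ s. ennreal (indicator {0..e} s * s powr (r - 1)) \<partial>lborel) = ennreal (e powr r / r)" by simp
  then show ?thesis by (simp add: ennreal_mult' ennreal_indicator mult.commute)
qed

text \<open>The indicator of the annulus of defect at most e has Lorentz norm p e^(1/p), which is
  also the integral of s^(1/p - 1) over [0, e]. On that annulus S multiplies this integral by a
  kernel mean of at least Q, and Q is at free disposal.\<close>

theorem not_restricted_weak_type_S_critical:
  assumes p: "1 < p" and q: "0 < q"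
  shows "\<not> restricted_weak_type (S_op (- 1 / q) (1 / p - 1) 1) (ennreal p) (ennreal q)"
proof
  let ?K = "S_op (- 1 / q) (1 / p - 1) 1"
  note K = weighted_operator_S_op[of "- 1 / q" "1 / p - 1" 1]
  assume "restricted_weak_type ?K (ennreal p) (ennreal q)"
  then obtain C where C0: "C \<ge> 0" and C: "\<And>f B. f \<in> borel_measurable borel \<Longrightarrow> B \<ge> 0 \<Longrightarrow> Lp1_norm (ennreal p) f \<le> ennreal B \<Longrightarrow>
     converges_ae ?K f \<and> (\<forall>t>0. distr_fun (apply_op ?K f) t \<le> (C * B / t) powr q)"
    unfolding restricted_weak_type_weakly_bounded[OF K q ennreal_neq_top[folded infinity_ennreal_def]] weakly_bounded_def by blast
  \<comment> \<open>Any value above 2 C gives the contradiction; the 2 is the one of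
    \<open>weak_bound_lower\<close>.\<close>
  define Q where "Q = 2 * C + 1"
  have Q: "Q > 0" using C0 by (simp add: Q_def)
  obtain d where d: "0 < d" "d \<le> 1" and dQ: "\<And>x. norm x < 1 \<Longrightarrow> 1 - d \<le> (norm x)\<^sup>2 \<Longrightarrow>
      ennreal Q \<le> (\<integral>\<^sup>+ v. ennreal (1 / norm (1 - v * x)) \<partial>circle_measure)"
    using circle_cauchy_kernel_unbounded[of Q] by blast
  \<comment> \<open>Half of d, because the defects of z and w add up in
    \<open>defect_mult_le\<close>.\<close>
  define e where "e = d / 2"
  have e: "0 < e" "e \<le> 1" using d by (auto simp: e_def)
  define E where "E = {w. defect w \<in> {..e}}"
  have [measurable]: "E \<in> sets borel" unfolding E_def by measurable
  let ?f = "indicator E :: complex \<Rightarrow> complex"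
  have f: "?f \<in> borel_measurable borel" by measurable
  have E_meas: "measure disc_measure E = e"
  proof -
    have "emeasure disc_measure E = emeasure lborel ({..e} \<inter> {0..1})"
      unfolding E_def by (rule emeasure_disc_defect) simp
    also have "{..e} \<inter> {0..1} = {0..e}" using e by auto
    finally show ?thesis using e by (simp add: measure_def)
  qed
  have distr: "distr_fun ?f t = (if t < 1 then e else 0)" if "t > 0" for t
  proof -
    have "{z. norm (?f z) > t} = (if t < 1 then E else {})" using that by (auto simp: indicator_def)
    then show ?thesis using E_meas by (simp add: distr_fun_eq[OF f])
  qed
  have "(\<integral>\<^sup>+ t\<in>{0<..}. ennreal (distr_fun ?f t powr (1 / p)) \<partial>lborel)
      = (\<integral>\<^sup>+ t. ennreal (e powr (1 / p)) * indicator {0<..<1::real} t \<partial>lborel)"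
    by (rule nn_integral_cong) (auto simp: indicator_def distr)
  also have "\<dots> = ennreal (e powr (1 / p))" by (subst nn_integral_cmult_indicator) auto
  finally have "Lp1_norm (ennreal p) ?f \<le> ennreal (p * e powr (1 / p))"
    using p by (simp add: Lp1_norm_def ennreal_mult)
  note Cf = C[OF f _ this]
  have Cf: "converges_ae ?K ?f" "\<forall>t>0. distr_fun (apply_op ?K ?f) t \<le> (C * (p * e powr (1 / p)) / t) powr q"
    using Cf p by auto
  have "measure lborel {0..e} \<le> (2 * (C * (p * e powr (1 / p))) / (e powr (- 1 / q) * (Q * (p * e powr (1 / p))))) powr q"
  proof (rule weak_bound_lower[OF K f])
    show "AE z in disc_measure. defect z \<in> {0..e} \<longrightarrow> e powr (- 1 / q) * (Q * (p * e powr (1 / p)))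
       \<le> defect z powr (- 1 / q) * norm (LINT w|disc_measure. kernel ?K z w * ?f w)"
      using Cf(1)[unfolded converges_ae_borel_iff[OF K f]] AE_disc_unit_disc
    proof eventually_elim
      case (elim z)
      let ?u = "\<lambda>w. defect w powr (1 / p - 1) / norm (1 - z * cnj w) powr 1 * indicator E w"
      have k: "kernel ?K z w * ?f w = complex_of_real (?u w)" for w
        by (simp add: kernel_S_op indicator_def)
      show ?case
      proof
        assume dd: "defect z \<in> {0..e}"
        have dz: "0 < defect z" by (rule defect_pos[OF elim(2)])
        have "Q * (p * e powr (1 / p)) \<le> norm (LINT w|disc_measure. kernel ?K z w * ?f w)"
          unfolding k
        proof (rule norm_integral_of_real_ge)
          show "integrable disc_measure (\<lambda>w. complex_of_real (?u w))" using elim(1) unfolding k .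
          have "ennreal (Q * (p * e powr (1 / p))) = ennreal Q * (\<integral>\<^sup>+ s. ennreal (s powr (1 / p - 1)) * indicator {0..e} s \<partial>lborel)"
            using nn_integral_powr_Icc[of "1 / p" e] e p Q by (simp add: ennreal_mult mult.commute[of p])
          also have "(\<integral>\<^sup>+ s. ennreal (s powr (1 / p - 1)) * indicator {0..e} s \<partial>lborel)
              = (\<integral>\<^sup>+ s. (ennreal (s powr (1 / p - 1)) * indicator {..e} s) * indicator {0..1} s \<partial>lborel)"
            using e by (intro nn_integral_cong) (auto simp: indicator_def)
          also have "(\<integral>\<^sup>+ s. (ennreal (s powr (1 / p - 1)) * indicator {..e} s) * indicator {0..1} s \<partial>lborel)
             = (\<integral>\<^sup>+ w. ennreal (defect w powr (1 / p - 1)) * indicator {..e} (defect w) \<partial>disc_measure)"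
            by (rule nn_integral_disc_radial[symmetric]) measurable
          also have "ennreal Q * \<dots> = (\<integral>\<^sup>+ w. ennreal Q * (ennreal (defect w powr (1 / p - 1)) * indicator {..e} (defect w)) \<partial>disc_measure)"
            by (rule nn_integral_cmult[symmetric]) measurable
          also have "\<dots> \<le> (\<integral>\<^sup>+ w. (ennreal (defect w powr (1 / p - 1)) * indicator {..e} (defect w)) *
             (\<integral>\<^sup>+ v. ennreal (1 / norm (1 - v * (z * cnj w))) \<partial>circle_measure) \<partial>disc_measure)"
          proof (rule nn_integral_mono_AE)
            show "AE w in disc_measure. ennreal Q * (ennreal (defect w powr (1 / p - 1)) * indicator {..e} (defect w))
               \<le> (ennreal (defect w powr (1 / p - 1)) * indicator {..e} (defect w)) *
               (\<integral>\<^sup>+ v. ennreal (1 / norm (1 - v * (z * cnj w))) \<partial>circle_measure)"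
              using AE_disc_unit_disc
            proof eventually_elim
              case (elim w)
              have x: "norm (z * cnj w) < 1" by (rule norm_mult_cnj_less[OF \<open>z \<in> unit_disc\<close> elim])
              have "ennreal Q \<le> (\<integral>\<^sup>+ v. ennreal (1 / norm (1 - v * (z * cnj w))) \<partial>circle_measure)" if "defect w \<le> e"
                by (rule dQ[OF x]) (use defect_mult_le[OF \<open>z \<in> unit_disc\<close> elim] that dd e_def in auto)
              then show ?case
                by (cases "defect w \<le> e") (auto simp: mult.commute[of "ennreal Q"] intro: mult_left_mono)
            qed
          qed
          also have "\<dots> = (\<integral>\<^sup>+ w. (ennreal (defect w powr (1 / p - 1)) * indicator {..e} (defect w)) *
              ennreal (1 / norm (1 - z * cnj w)) \<partial>disc_measure)"
            by (rule nn_integral_disc_kernel_average[symmetric]) (simp_all add: norm_mult)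
          also have "\<dots> = (\<integral>\<^sup>+ w. ennreal (?u w) \<partial>disc_measure)"
            by (intro nn_integral_cong) (auto simp: E_def indicator_def ennreal_mult'[symmetric])
          finally show "ennreal (Q * (p * e powr (1 / p))) \<le> (\<integral>\<^sup>+ w. ennreal (?u w) \<partial>disc_measure)" .
        qed (use Q p in auto)
        moreover have "e powr (- 1 / q) \<le> defect z powr (- 1 / q)"
          using dd dz q by (intro powr_mono2') auto
        ultimately show "e powr (- 1 / q) * (Q * (p * e powr (1 / p)))
          \<le> defect z powr (- 1 / q) * norm (LINT w|disc_measure. kernel ?K z w * ?f w)"
          using Q p by (intro mult_mono) auto
      qed
    qed
  qed (use Cf e Q p in auto)
  also have "2 * (C * (p * e powr (1 / p))) / (e powr (- 1 / q) * (Q * (p * e powr (1 / p)))) = e powr (1 / q) * (2 * C / Q)"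
    using e Q p by (simp add: powr_minus field_simps)
  also have "(e powr (1 / q) * (2 * C / Q)) powr q = e * (2 * C / Q) powr q"
    by (subst powr_mult) (use C0 e q Q in \<open>auto simp: powr_powr\<close>)
  finally have "1 \<le> (2 * C / Q) powr q" using e by simp
  moreover have "2 * C / Q < 1" using C0 by (simp add: Q_def)
  then have "(2 * C / Q) powr q < 1" using C0 Q q powr_less_mono2[of q "2 * C / Q" 1] by simp
  ultimately show False by simp
qed

section \<open>Cauchy integrals of indicator functions\<close>

text \<open>The power series at 0 converges absolutely on the circle of radius |z|: this gives the
  bound, and the coefficient formula picks out the constant term.\<close>

lemma circle_mean_value:
  assumes f: "f holomorphic_on ball 0 1" and [measurable]: "f \<in> borel_measurable borel" and z: "z \<in> unit_disc"
  shows "(LINT v|circle_measure. f (v * z)) = f 0" and "\<exists>B. \<forall>v. norm v = 1 \<longrightarrow> norm (f (v * z)) \<le> B"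
proof -
  define c where "c n = (deriv ^^ n) f 0 / fact n" for n
  have ser: "(\<lambda>n. c n * w ^ n) sums f w" if "norm w < 1" for w
    using holomorphic_power_series[OF f, of w] that by (simp add: c_def)
  define y where "y = complex_of_real ((norm z + 1) / 2)"
  have y: "norm z < norm y" "norm y < 1" using z unfolding y_def norm_of_real unit_disc_def by auto
  have sm: "summable (\<lambda>n. norm (c n * z ^ n))"
    by (rule powser_insidea[OF sums_summable[OF ser[OF y(2)]] y(1)])
  have eq: "f (v * z) = (\<Sum>n. (c n * z ^ n) * v ^ n)" if "norm v = 1" for v
    using ser[of "v * z"] that z by (simp add: sums_iff norm_mult unit_disc_def power_mult_distrib mult_ac)
  have bd: "norm (f (v * z)) \<le> (\<Sum>n. norm (c n * z ^ n))" if "norm v = 1" for v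
    unfolding eq[OF that] by (rule order_trans[OF summable_norm]) (use sm that in \<open>auto simp: norm_mult norm_power\<close>)
  then show "\<exists>B. \<forall>v. norm v = 1 \<longrightarrow> norm (f (v * z)) \<le> B" by blast
  have "(LINT v|circle_measure. f (v * z)) = (LINT v|circle_measure. (\<Sum>n. (c n * z ^ n) * v ^ n) * cnj v ^ 0)"
    by (rule integral_cong_AE) (use AE_circle_norm in \<open>auto simp: eq elim: eventually_mono\<close>)
  also have "\<dots> = c 0 * z ^ 0" by (rule circle_series_coeff[OF sm])
  finally show "(LINT v|circle_measure. f (v * z)) = f 0" by (simp add: c_def)
qed

text \<open>The Cauchy integral, or Szego projection, of the indicator of A.\<close>

definition cauchy_indicator :: "complex set \<Rightarrow> complex \<Rightarrow> complex" where
  "cauchy_indicator A x = (LINT v|circle_measure. indicator A v / (1 - x * cnj v))"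

text \<open>The Moebius map 1 / (1 - y) sends the unit disc to the half-plane Re > 1/2.\<close>

lemma Re_inverse_one_minus:
  assumes "norm y < 1" shows "1 / 2 < Re (1 / (1 - y))"
proof -
  have y: "1 - y \<noteq> 0" using assms by auto
  have "(norm (1 - y))\<^sup>2 = 1 - 2 * Re y + (norm y)\<^sup>2"
    unfolding cmod_power2 by (simp add: power2_eq_square algebra_simps)
  also have "\<dots> < 2 * (1 - Re y)" using assms by (simp add: abs_square_less_1)
  finally have "1 / 2 * (norm (1 - y))\<^sup>2 < 1 - Re y" by simp
  moreover have "Re (1 / (1 - y)) = (1 - Re y) / (norm (1 - y))\<^sup>2"
    by (simp add: Re_divide cmod_power2)
  moreover have "0 < (norm (1 - y))\<^sup>2" using y by simp
  ultimately show ?thesis by (simp only: pos_less_divide_eq)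
qed

text \<open>The real part of the Cauchy kernel exceeds 1/2 and its mean over the whole circle is 1,
  so integration over A leaves a real part between |A| / 2 and 1. Such values in a vertical strip
  are special to indicator functions, and the sine maps this strip into the right
  half-plane.\<close>

lemma cauchy_indicator_facts:
  assumes [measurable]: "A \<in> sets borel"
  shows cauchy_indicator_holomorphic: "cauchy_indicator A holomorphic_on ball 0 1"
    and cauchy_indicator_0: "cauchy_indicator A 0 = complex_of_real (measure circle_measure A)"
    and cauchy_indicator_Re: "x \<in> unit_disc \<Longrightarrow> measure circle_measure A / 2 \<le> Re (cauchy_indicator A x)"
        "x \<in> unit_disc \<Longrightarrow> Re (cauchy_indicator A x) \<le> 1"
proof -
  let ?I = "indicator A :: complex \<Rightarrow> complex"
  have lt1: "norm (x * cnj v) < 1" if "norm x < 1" "norm v = 1" for x v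
    using that by (simp add: norm_mult)
  have geo: "(\<Sum>k. x ^ k * cnj v ^ k) = 1 / (1 - x * cnj v)" if "norm x < 1" "norm v = 1" for x v
    using suminf_geometric[OF lt1[OF that]] by (simp add: power_mult_distrib)
  have sm: "summable (\<lambda>k. norm (x ^ k))" if "norm x < 1" for x :: complex
    using that by (simp add: norm_power summable_geometric)
  have ser: "(\<lambda>k. (LINT v|circle_measure. cnj v ^ k * g v) * (x - 0) ^ k) sums
      (LINT v|circle_measure. g v / (1 - x * cnj v))"
    if x: "norm x < 1" and [measurable]: "g \<in> borel_measurable borel" and g: "\<And>v. norm (g v) \<le> 1" for x g
  proof -
    note * = circle_suminf_integral[OF sm[OF x], of g cnj 1]
    have "(LINT v|circle_measure. g v / (1 - x * cnj v)) = (LINT v|circle_measure. (\<Sum>k. x ^ k * cnj v ^ k) * g v)"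
    proof (rule integral_cong_AE)
      show "AE v in circle_measure. g v / (1 - x * cnj v) = (\<Sum>k. x ^ k * cnj v ^ k) * g v"
        using AE_circle_norm by eventually_elim (simp add: geo[OF x])
    qed measurable
    then show ?thesis using * g by (simp add: sums_iff mult.commute)
  qed
  have I1: "norm (?I v) \<le> 1" for v by (simp add: indicator_def)
  have [measurable]: "?I \<in> borel_measurable borel" by measurable
  show "cauchy_indicator A holomorphic_on ball 0 1"
  proof (rule power_series_holomorphic)
    fix x :: complex assume "x \<in> ball 0 1"
    then show "(\<lambda>k. (LINT v|circle_measure. cnj v ^ k * ?I v) * (x - 0) ^ k) sums cauchy_indicator A x"
      unfolding cauchy_indicator_def by (intro ser I1) auto
  qed
  show "cauchy_indicator A 0 = complex_of_real (measure circle_measure A)"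
  proof -
    have "cauchy_indicator A 0 = (LINT v|circle_measure. complex_of_real (indicator A v))"
      unfolding cauchy_indicator_def by (rule Bochner_Integration.integral_cong) (auto simp: indicator_def)
    then show ?thesis by simp
  qed
  have one: "(LINT v|circle_measure. 1 / (1 - x * cnj v)) = 1" if x: "norm x < 1" for x
  proof -
    have "(LINT v|circle_measure. cnj v ^ k * 1) = (if k = 0 then 1 else 0)" for k
      using circle_orthogonal[of 0 k] by simp
    then have "(\<lambda>k. (if k = 0 then 1 else 0) * (x - 0) ^ k) sums (LINT v|circle_measure. 1 / (1 - x * cnj v))"
      using ser[OF x, of "\<lambda>_. 1"] by simp
    moreover have "(\<lambda>k. (if k = 0 then 1 else 0) * (x - 0) ^ k) = (\<lambda>k. if k = 0 then (1::complex) else 0)"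
      by auto
    ultimately show ?thesis using sums_single[of 0 "\<lambda>_. 1::complex"] sums_unique2 by auto
  qed
  fix x assume "x \<in> unit_disc"
  then have x: "norm x < 1" by (simp add: unit_disc_def)
  have int: "integrable circle_measure (\<lambda>v. g v / (1 - x * cnj v))"
    if [measurable]: "g \<in> borel_measurable borel" and g: "\<And>v. norm (g v) \<le> 1" for g
  proof (rule integrable_circle_bounded)
    fix v :: complex assume v: "norm v = 1"
    have le: "1 - norm x \<le> norm (1 - x * cnj v)"
      using norm_triangle_ineq2[of 1 "x * cnj v"] v by (simp add: norm_mult)
    show "norm (g v / (1 - x * cnj v)) \<le> 1 / (1 - norm x)"
      unfolding norm_divide by (rule frac_le) (use g x le in auto)
  qed measurable
  have ReC: "Re (cauchy_indicator A x) = (LINT v|circle_measure. indicator A v * Re (1 / (1 - x * cnj v)))"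
  proof -
    have "Re (cauchy_indicator A x) = (LINT v|circle_measure. Re (?I v / (1 - x * cnj v)))"
      unfolding cauchy_indicator_def by (rule integral_Re[OF int[OF _ I1], symmetric]) measurable
    also have "\<dots> = (LINT v|circle_measure. indicator A v * Re (1 / (1 - x * cnj v)))"
      by (rule Bochner_Integration.integral_cong[OF refl]) (auto split: split_indicator)
    finally show ?thesis .
  qed
  have int1: "integrable circle_measure (\<lambda>v. Re (1 / (1 - x * cnj v)))"
    by (rule integrable_Re[OF int]) auto
  have intA: "integrable circle_measure (\<lambda>v. indicator A v * Re (1 / (1 - x * cnj v)))"
    by (rule Bochner_Integration.integrable_bound[OF int1]) (auto split: split_indicator)
  have pos: "AE v in circle_measure. 1 / 2 < Re (1 / (1 - x * cnj v))"
    using AE_circle_norm by eventually_elim (rule Re_inverse_one_minus, rule lt1[OF x])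
  have "measure circle_measure A / 2 = (LINT v|circle_measure. indicator A v * (1 / 2))" by simp
  also have "\<dots> \<le> (LINT v|circle_measure. indicator A v * Re (1 / (1 - x * cnj v)))"
  proof (rule integral_mono_AE[OF _ intA])
    show "integrable circle_measure (\<lambda>v. indicator A v * (1 / 2 :: real))"
      by (rule circle.integrable_const_bound[where B=1]) (auto split: split_indicator)
  qed (use pos in \<open>auto elim!: eventually_mono split: split_indicator\<close>)
  finally show "measure circle_measure A / 2 \<le> Re (cauchy_indicator A x)" unfolding ReC .
  have "(LINT v|circle_measure. indicator A v * Re (1 / (1 - x * cnj v))) \<le> (LINT v|circle_measure. Re (1 / (1 - x * cnj v)))"
    by (rule integral_mono_AE[OF intA int1]) (use pos in \<open>auto elim!: eventually_mono split: split_indicator\<close>)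
  also have "\<dots> = Re (LINT v|circle_measure. 1 / (1 - x * cnj v))"
    by (rule integral_Re[OF int]) auto
  also have "\<dots> = 1" unfolding one[OF x] by simp
  finally show "Re (cauchy_indicator A x) \<le> 1" unfolding ReC .
qed

lemma borel_cauchy_indicator [measurable]:
  assumes [measurable]: "A \<in> sets borel"
  shows "cauchy_indicator A \<in> borel_measurable borel"
  unfolding cauchy_indicator_def by measurable

section \<open>Moments of Cauchy integrals through the sine\<close>

text \<open>The inequality x / r \<le> exp (x / r), raised to the power r.\<close>

lemma powr_le_exp:
  fixes x r :: real
  assumes "0 \<le> x" "0 < r" shows "x powr r \<le> r powr r * exp x"
proof -
  have "x / r \<le> 1 + x / r" by simp
  also have "\<dots> \<le> exp (x / r)" by (rule exp_ge_add_one_self)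
  finally have "(x / r) powr r \<le> exp (x / r) powr r"
    using assms by (intro powr_mono2) auto
  also have "exp (x / r) powr r = exp x" using assms by (simp add: powr_def)
  finally show ?thesis using assms by (simp add: powr_divide field_simps)
qed

text \<open>At 0 the sine has a simple zero, while the left-hand side vanishes to order r \<ge> 1.
  Far up and down the strip the sine grows like exp |Im| and beats every power. The width 1 of the
  strip is less than pi/3, which keeps the cosine of the real part above 1/2.\<close>

lemma norm_powr_le_norm_sin:
  fixes r :: real
  assumes "1 \<le> r"
  obtains K where "0 \<le> K" "\<And>\<zeta>::complex. 0 \<le> Re \<zeta> \<Longrightarrow> Re \<zeta> \<le> 1 \<Longrightarrow> norm \<zeta> powr r \<le> K * norm (sin \<zeta>)"
proof -
  have cos_ge: "1 / 2 \<le> cos x" if "0 \<le> x" "x \<le> 1" for x :: real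
  proof -
    have "x \<le> pi / 3" using that pi_gt3 by linarith
    then have "cos (pi / 3) \<le> cos x" using that by (intro cos_monotone_0_pi_le) auto
    then show ?thesis by (simp add: cos_60)
  qed
  have sin_ge: "x / 2 \<le> sin x" if "0 \<le> x" "x \<le> 1" for x :: real
  proof (cases "x = 0")
    case False
    have "\<exists>y>0. y < x \<and> sin x - sin 0 = (x - 0) * cos y"
      by (rule MVT2) (use that False in \<open>auto intro!: derivative_eq_intros\<close>)
    then obtain y where y: "0 < y" "y < x" "sin x = x * cos y" by auto
    have "x * (1 / 2) \<le> x * cos y" using y that by (intro mult_left_mono cos_ge) auto
    then show ?thesis using y by simp
  qed simp
  have exp2: "2 \<le> exp y + exp (- y)" for y :: real
    using cosh_real_ge_1[of y] by (simp add: cosh_def)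
  define sh where "sh y = \<bar>exp y - exp (- y)\<bar> / 2" for y :: real
  have sin_low: "Re \<zeta> / 2 \<le> norm (sin \<zeta>)" "sh (Im \<zeta>) / 2 \<le> norm (sin \<zeta>)" if "0 \<le> Re \<zeta>" "Re \<zeta> \<le> 1" for \<zeta>
  proof -
    have e: "2 \<le> exp (Im \<zeta>) + exp (- Im \<zeta>)" by (rule exp2)
    have "Re \<zeta> / 2 \<le> sin (Re \<zeta>) * 1" using sin_ge[OF that] by simp
    also have "sin (Re \<zeta>) * 1 \<le> sin (Re \<zeta>) * ((exp (Im \<zeta>) + exp (- Im \<zeta>)) / 2)"
      using e sin_ge[OF that] that by (intro mult_left_mono) auto
    also have "\<dots> = Re (sin \<zeta>)" by (simp add: Re_sin)
    finally show "Re \<zeta> / 2 \<le> norm (sin \<zeta>)" using complex_Re_le_cmod[of "sin \<zeta>"] by linarith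
    have "1 / 2 * sh (Im \<zeta>) \<le> cos (Re \<zeta>) * sh (Im \<zeta>)"
      by (rule mult_right_mono[OF cos_ge[OF that]]) (simp add: sh_def)
    also have "\<dots> = \<bar>Im (sin \<zeta>)\<bar>"
      using cos_ge[OF that] by (simp add: Im_sin sh_def abs_mult)
    finally show "sh (Im \<zeta>) / 2 \<le> norm (sin \<zeta>)" using abs_Im_le_cmod[of "sin \<zeta>"] by linarith
  qed
  have sh_sym: "sh (- y) = sh y" for y by (simp add: sh_def abs_minus_commute)
  have sh_pos: "y \<le> sh y" if "0 \<le> y" for y
  proof -
    have "(\<lambda>y::real. exp y - exp (- y) - 2 * y) 0 \<le> (\<lambda>y. exp y - exp (- y) - 2 * y) y"
    proof (rule DERIV_nonneg_imp_nondecreasing[OF that])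
      fix x :: real
      have "0 \<le> exp x + exp (- x) - 2" using exp2[of x] by simp
      moreover have "((\<lambda>y. exp y - exp (- y) - 2 * y) has_real_derivative exp x + exp (- x) - 2) (at x)"
        by (auto intro!: derivative_eq_intros)
      ultimately show "\<exists>y. ((\<lambda>y. exp y - exp (- y) - 2 * y) has_real_derivative y) (at x) \<and> 0 \<le> y" by blast
    qed
    then have "2 * y \<le> exp y - exp (- y)" by simp
    then show ?thesis using that by (simp add: sh_def)
  qed
  have sh_ge: "\<bar>y\<bar> \<le> sh y" for y using sh_pos[of "\<bar>y\<bar>"] sh_sym[of y] by (cases "0 \<le> y") auto
  have sh_exp: "exp \<bar>y\<bar> \<le> 4 * sh y" if "1 \<le> \<bar>y\<bar>" for y
  proof -
    have *: "exp y \<le> 4 * sh y" if "1 \<le> y" for y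
    proof -
      have "2 \<le> exp y" using exp_ge_add_one_self[of y] that by linarith
      moreover have "exp (- y) \<le> 1" using that by simp
      ultimately have "2 * exp (- y) \<le> exp y" by linarith
      moreover have "4 * sh y = 2 * exp y - 2 * exp (- y)" using that by (simp add: sh_def)
      ultimately show ?thesis by linarith
    qed
    show ?thesis using *[of "\<bar>y\<bar>"] that sh_sym[of y] by (cases "0 \<le> y") auto
  qed
  \<comment> \<open>The first summand serves |Im| \<le> 1, the second |Im| > 1.\<close>
  define K where "K = 2 powr (r - 1) * 4 + r powr r * exp 1 * 8"
  have K0: "0 \<le> K" by (simp add: K_def)
  have "norm \<zeta> powr r \<le> K * norm (sin \<zeta>)" if z: "0 \<le> Re \<zeta>" "Re \<zeta> \<le> 1" for \<zeta> :: complex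
  proof -
    let ?y = "Im \<zeta>"
    have n: "norm \<zeta> \<le> Re \<zeta> + \<bar>?y\<bar>" using cmod_le[of \<zeta>] z by simp
    show ?thesis
    proof (cases "\<bar>?y\<bar> \<le> 1")
      case True
      then have n2: "norm \<zeta> \<le> 2" using n z by linarith
      have "norm \<zeta> \<le> 4 * norm (sin \<zeta>)" using n sin_low[OF z] sh_ge[of ?y] by linarith
      moreover have "norm \<zeta> powr r = norm \<zeta> powr (r - 1) * norm \<zeta>"
      proof (cases "\<zeta> = 0")
        case False
        then show ?thesis using powr_add[of "norm \<zeta>" "r - 1" 1] by simp
      qed simp
      moreover have "norm \<zeta> powr (r - 1) \<le> 2 powr (r - 1)" using n2 assms by (intro powr_mono2) auto
      ultimately have "norm \<zeta> powr r \<le> 2 powr (r - 1) * (4 * norm (sin \<zeta>))"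
        by (simp only:) (intro mult_mono; simp)
      also have "\<dots> \<le> K * norm (sin \<zeta>)"
        unfolding mult.assoc[symmetric] by (rule mult_right_mono) (simp_all add: K_def)
      finally show ?thesis .
    next
      case False
      have "norm \<zeta> powr r \<le> (1 + \<bar>?y\<bar>) powr r" using n z assms by (intro powr_mono2) auto
      also have "\<dots> \<le> r powr r * exp (1 + \<bar>?y\<bar>)" by (rule powr_le_exp) (use assms in auto)
      also have "\<dots> = r powr r * exp 1 * exp \<bar>?y\<bar>" by (simp add: exp_add)
      also have "\<dots> \<le> r powr r * exp 1 * (8 * norm (sin \<zeta>))"
        using sh_exp[of ?y] sin_low(2)[OF z] False by (intro mult_left_mono) auto
      also have "\<dots> \<le> K * norm (sin \<zeta>)"
        unfolding mult.assoc[symmetric] by (rule mult_right_mono) (simp_all add: K_def)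
      finally show ?thesis .
    qed
  qed
  with K0 show ?thesis by (rule that)
qed

text \<open>Since \<open>0 < Re H \<le> 1\<close> for the Cauchy integral \<open>H\<close>, the function \<open>(sin H)\<^sup>\<sigma>\<close> is holomorphic
  with real part comparable to its modulus when \<open>\<sigma> < 1\<close>, and it dominates every power of \<open>\<bar>H\<bar>\<close>.
  Its mean value over a circle is its value at \<open>0\<close>.\<close>

lemma cauchy_indicator_moment:
  assumes \<sigma>: "0 < \<sigma>" "\<sigma> < 1" and u: "\<sigma> \<le> u"
  obtains K where "0 \<le> K" "\<And>A z. A \<in> sets borel \<Longrightarrow> z \<in> unit_disc \<Longrightarrow>
     (\<integral>\<^sup>+ v. ennreal (norm (cauchy_indicator A (v * z)) powr u) \<partial>circle_measure) \<le> ennreal (K * measure circle_measure A powr \<sigma>)"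
proof -
  obtain K0 where K0: "0 \<le> K0" "\<And>\<zeta>::complex. 0 \<le> Re \<zeta> \<Longrightarrow> Re \<zeta> \<le> 1 \<Longrightarrow> norm \<zeta> powr (u / \<sigma>) \<le> K0 * norm (sin \<zeta>)"
    using norm_powr_le_norm_sin[of "u / \<sigma>"] \<sigma> u by auto
  \<comment> \<open>\<open>sin H\<close> has positive real part, hence argument below pi/2 in
    modulus, so the real part of its \<sigma>-th power is at least k times its modulus.\<close>
  define k where "k = cos (\<sigma> * (pi / 2))"
  have k: "0 < k" unfolding k_def using \<sigma> by (intro cos_gt_zero) auto
  define K where "K = K0 powr \<sigma> / k"
  have bound: "(\<integral>\<^sup>+ v. ennreal (norm (cauchy_indicator A (v * z)) powr u) \<partial>circle_measure) \<le> ennreal (K * measure circle_measure A powr \<sigma>)"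
    if A [measurable]: "A \<in> sets borel" and z: "z \<in> unit_disc" for A z
  proof (cases "measure circle_measure A = 0")
    \<comment> \<open>Strict positivity of Re H needs |A| > 0. If A is a null set, the Cauchy
      integral vanishes identically.\<close>
    case True
    have "AE v in circle_measure. v \<notin> A"
      using True by (intro AE_not_in) (auto simp: null_sets_def circle.emeasure_eq_measure)
    then have "cauchy_indicator A x = (LINT v|circle_measure. 0)" for x
      unfolding cauchy_indicator_def by (intro integral_cong_AE) (auto elim: eventually_mono)
    then show ?thesis by simp
  next
    case False
    define m where "m = measure circle_measure A"
    have m: "0 < m" "m \<le> 1" using False by (auto simp: m_def less_le)
    let ?H = "cauchy_indicator A"
    let ?\<Phi> = "\<lambda>x. sin (?H x) powr complex_of_real \<sigma>"
    have H: "0 < Re (?H x)" "Re (?H x) \<le> 1" if "x \<in> unit_disc" for x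
      using cauchy_indicator_Re[OF A that] m unfolding m_def by auto
    have sinH: "0 < Re (sin (?H x))" if "x \<in> unit_disc" for x
    proof -
      have "0 < sin (Re (?H x))" using H[OF that] pi_gt3 by (intro sin_gt_zero) auto
      then show ?thesis by (simp add: Re_sin add_pos_pos)
    qed
    have hol: "?\<Phi> holomorphic_on ball 0 1"
    proof (rule holomorphic_on_powr)
      show "(\<lambda>x. sin (?H x)) holomorphic_on ball 0 1"
        by (rule holomorphic_on_compose[OF cauchy_indicator_holomorphic[OF A] holomorphic_on_sin, unfolded comp_def])
      show "(\<lambda>x. complex_of_real \<sigma>) holomorphic_on ball 0 1" by (rule holomorphic_on_const)
      fix x :: complex assume "x \<in> ball 0 1"
      then show "sin (?H x) \<notin> \<real>\<^sub>\<le>\<^sub>0"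
        using sinH[of x] by (auto simp: unit_disc_def complex_nonpos_Reals_iff)
    qed
    have [measurable]: "sin \<in> borel_measurable (borel :: complex measure)"
      by (intro borel_measurable_continuous_onI continuous_intros)
    have meas: "?\<Phi> \<in> borel_measurable borel" by measurable
    obtain B where B: "\<And>v. norm v = 1 \<Longrightarrow> norm (?\<Phi> (v * z)) \<le> B"
      using circle_mean_value(2)[OF hol meas z] by blast
    have int: "integrable circle_measure (\<lambda>v. ?\<Phi> (v * z))"
      by (rule integrable_circle_bounded[OF _ B]) measurable
    have vz: "v * z \<in> unit_disc" if "norm v = 1" for v using that z by (simp add: unit_disc_def norm_mult)
    have pw: "norm (?H (v * z)) powr u \<le> K * Re (?\<Phi> (v * z))" if v: "norm v = 1" for v
    proof -
      let ?s = "sin (?H (v * z))"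
      note H' = H[OF vz[OF v]]
      have s: "0 < Re ?s" by (rule sinH[OF vz[OF v]])
      then have s0: "?s \<noteq> 0" by auto
      have "\<bar>Im (Ln ?s)\<bar> < pi / 2" using Re_Ln_pos_lt[OF s0] s by blast
      then have "k \<le> cos (\<sigma> * Im (Ln ?s))"
      proof -
        have "cos (\<sigma> * (pi / 2)) \<le> cos \<bar>\<sigma> * Im (Ln ?s)\<bar>"
          using \<open>\<bar>Im (Ln ?s)\<bar> < pi / 2\<close> \<sigma> by (intro cos_monotone_0_pi_le) (auto simp: abs_mult field_simps intro: order_trans[of _ "1 * (pi / 2)"])
        then show ?thesis by (simp add: k_def)
      qed
      moreover have "Re (?\<Phi> (v * z)) = norm ?s powr \<sigma> * cos (\<sigma> * Im (Ln ?s))"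
        using s0 by (simp add: powr_def Re_exp)
      ultimately have "norm ?s powr \<sigma> * k \<le> Re (?\<Phi> (v * z))"
        by (simp add: mult_left_mono)
      then have 1: "norm ?s powr \<sigma> \<le> Re (?\<Phi> (v * z)) / k" using k by (simp add: pos_le_divide_eq)
      have "norm (?H (v * z)) powr u = (norm (?H (v * z)) powr (u / \<sigma>)) powr \<sigma>"
        using \<sigma> by (simp add: powr_powr)
      also have "\<dots> \<le> (K0 * norm ?s) powr \<sigma>"
        using \<sigma> H' by (intro powr_mono2 K0) auto
      also have "\<dots> = K0 powr \<sigma> * norm ?s powr \<sigma>" using K0 by (simp add: powr_mult)
      also have "\<dots> \<le> K0 powr \<sigma> * (Re (?\<Phi> (v * z)) / k)" by (rule mult_left_mono[OF 1]) simp
      finally show ?thesis by (simp add: K_def)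
    qed
    have "(\<integral>\<^sup>+ v. ennreal (norm (?H (v * z)) powr u) \<partial>circle_measure) \<le> (\<integral>\<^sup>+ v. ennreal (K * Re (?\<Phi> (v * z))) \<partial>circle_measure)"
      by (rule nn_integral_mono_AE) (use AE_circle_norm in eventually_elim, rule ennreal_leI, rule pw)
    also have "\<dots> = ennreal (LINT v|circle_measure. K * Re (?\<Phi> (v * z)))"
    proof (rule nn_integral_eq_integral)
      show "integrable circle_measure (\<lambda>v. K * Re (?\<Phi> (v * z)))" using integrable_Re[OF int] by simp
      show "AE v in circle_measure. 0 \<le> K * Re (?\<Phi> (v * z))"
        using AE_circle_norm by eventually_elim (rule order_trans[OF _ pw], simp_all)
    qed
    also have "(LINT v|circle_measure. K * Re (?\<Phi> (v * z))) = K * Re (?\<Phi> 0)"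
      using integral_Re[OF int] circle_mean_value(1)[OF hol meas z] by simp
    \<comment> \<open>At the centre H equals the measure m of A, and sin m \<le> m.\<close>
    also have "\<dots> \<le> K * m powr \<sigma>"
    proof (rule mult_left_mono)
      have "Re (?\<Phi> 0) \<le> norm (?\<Phi> 0)" by (rule complex_Re_le_cmod)
      also have "\<dots> = \<bar>sin m\<bar> powr \<sigma>"
        unfolding norm_powr_of_real cauchy_indicator_0[OF A] m_def[symmetric] sin_of_real norm_of_real ..
      also have "\<dots> \<le> m powr \<sigma>"
        using m \<sigma> abs_sin_x_le_abs_x[of m] by (intro powr_mono2) auto
      finally show "Re (?\<Phi> 0) \<le> m powr \<sigma>" .
    qed (use k in \<open>simp add: K_def\<close>)
    finally show ?thesis by (simp add: m_def ennreal_leI)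
  qed
  show ?thesis by (rule that[OF _ bound]) (use k in \<open>simp add: K_def\<close>)
qed

section \<open>The critical operator on \<open>L\<^sup>p\<^sup>,\<^sup>1\<close>\<close>

lemma layer_cake:
  assumes [measurable]: "g \<in> borel_measurable borel" "h \<in> borel_measurable borel" and h: "\<And>w. 0 \<le> h w"
  shows "(\<integral>\<^sup>+ w. g w * ennreal (h w) \<partial>disc_measure)
    = (\<integral>\<^sup>+ t. (\<integral>\<^sup>+ w. g w * indicator {w. t < h w} w \<partial>disc_measure) * indicator {0..} t \<partial>lborel)"
proof -
  interpret P: pair_sigma_finite disc_measure lborel ..
  have eq: "ennreal (h w) = (\<integral>\<^sup>+ t. indicator {0..<h w} t \<partial>lborel)" for w
    using h[of w] by simp
  have "(\<integral>\<^sup>+ w. g w * ennreal (h w) \<partial>disc_measure) = (\<integral>\<^sup>+ w. (\<integral>\<^sup>+ t. g w * indicator {0..<h w} t \<partial>lborel) \<partial>disc_measure)"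
    unfolding eq by (subst nn_integral_cmult) auto
  also have "\<dots> = (\<integral>\<^sup>+ w. (\<integral>\<^sup>+ t. g w * indicator {w. t < h w} w * indicator {0..} t \<partial>lborel) \<partial>disc_measure)"
    by (intro nn_integral_cong) (auto simp: indicator_def)
  also have "\<dots> = (\<integral>\<^sup>+ t. (\<integral>\<^sup>+ w. g w * indicator {w. t < h w} w * indicator {0..} t \<partial>disc_measure) \<partial>lborel)"
    by (rule P.Fubini'[symmetric]) measurable
  also have "\<dots> = (\<integral>\<^sup>+ t. (\<integral>\<^sup>+ w. g w * indicator {w. t < h w} w \<partial>disc_measure) * indicator {0..} t \<partial>lborel)"
    by (intro nn_integral_cong nn_integral_multc) measurable
  finally show ?thesis .
qed

text \<open>Kolmogorov's inequality: on E the distribution function of \<Phi> at height t is at most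
  the smaller of |E| and (N / t)^r, and X is the height at which these two agree.\<close>

lemma weak_bound_integral_over_set:
  fixes r :: real
  assumes [measurable]: "\<Phi> \<in> borel_measurable borel" "E \<in> sets borel" and \<Phi>: "\<And>w. 0 \<le> \<Phi> w" and r: "1 < r" and N: "0 \<le> N"
    and weak: "\<And>l. 0 < l \<Longrightarrow> measure disc_measure {w. l < \<Phi> w} \<le> (N / l) powr r"
  shows "(\<integral>\<^sup>+ w. indicator E w * ennreal (\<Phi> w) \<partial>disc_measure)
    \<le> ennreal (r / (r - 1) * N * measure disc_measure E powr (1 - 1 / r))"
proof (cases "measure disc_measure E = 0")
  case True
  then have "AE w in disc_measure. w \<notin> E"
    by (intro AE_not_in) (auto simp: null_sets_def disc.emeasure_eq_measure)
  then have "(\<integral>\<^sup>+ w. indicator E w * ennreal (\<Phi> w) \<partial>disc_measure) = (\<integral>\<^sup>+ w. 0 \<partial>disc_measure)"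
    by (intro nn_integral_cong_AE) (auto elim!: eventually_mono)
  then show ?thesis by simp
next
  case False
  define m where "m = measure disc_measure E"
  have m: "0 < m" using False by (auto simp: m_def less_le)
  define X where "X = N / m powr (1 / r)"
  have X: "0 \<le> X" using N by (simp add: X_def)
  have "(\<integral>\<^sup>+ w. indicator E w * ennreal (\<Phi> w) \<partial>disc_measure)
    = (\<integral>\<^sup>+ t. (\<integral>\<^sup>+ w. indicator E w * indicator {w. t < \<Phi> w} w \<partial>disc_measure) * indicator {0..} t \<partial>lborel)"
    by (rule layer_cake) (use \<Phi> in auto)
  also have "\<dots> \<le> (\<integral>\<^sup>+ t. ennreal m * (ennreal (min 1 ((X / t) powr r)) * indicator {0..} t) \<partial>lborel)"
  proof (rule nn_integral_mono_AE, rule AE_mp[OF AE_lborel_singleton[of 0]], rule AE_I2, rule impI)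
    fix t :: real assume "t \<noteq> 0"
    show "(\<integral>\<^sup>+ w. indicator E w * indicator {w. t < \<Phi> w} w \<partial>disc_measure) * indicator {0..} t
       \<le> ennreal m * (ennreal (min 1 ((X / t) powr r)) * indicator {0..} t)"
    proof (cases "0 < t")
      case True
      have "(\<integral>\<^sup>+ w. indicator E w * indicator {w. t < \<Phi> w} w \<partial>disc_measure) = emeasure disc_measure (E \<inter> {w. t < \<Phi> w})"
        by (simp only: indicator_inter_arith[symmetric]) (rule nn_integral_indicator, measurable)
      also have "\<dots> = ennreal (measure disc_measure (E \<inter> {w. t < \<Phi> w}))" by (simp add: disc.emeasure_eq_measure)
      also have "\<dots> \<le> ennreal (m * min 1 ((X / t) powr r))"
      proof (rule ennreal_leI)
        have 1: "measure disc_measure (E \<inter> {w. t < \<Phi> w}) \<le> m"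
          unfolding m_def by (rule disc.finite_measure_mono) auto
        have "measure disc_measure (E \<inter> {w. t < \<Phi> w}) \<le> measure disc_measure {w. t < \<Phi> w}"
          by (rule disc.finite_measure_mono) auto
        also have "\<dots> \<le> (N / t) powr r" by (rule weak[OF True])
        also have "\<dots> = m * (X / t) powr r"
        proof -
          have "X powr r = N powr r / m" using m N r by (simp add: X_def powr_divide powr_powr)
          moreover have "(X / t) powr r = X powr r / t powr r" using X True by (simp add: powr_divide)
          moreover have "(N / t) powr r = N powr r / t powr r" using N True by (simp add: powr_divide)
          ultimately show ?thesis using m by simp
        qed
        finally show "measure disc_measure (E \<inter> {w. t < \<Phi> w}) \<le> m * min 1 ((X / t) powr r)"
          using 1 m by (simp add: min_def)
      qed
      finally show ?thesis using True m by (simp add: ennreal_mult)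
    qed (use \<open>t \<noteq> 0\<close> in simp)
  qed
  also have "\<dots> = ennreal m * (\<integral>\<^sup>+ t. ennreal (min 1 ((X / t) powr r)) * indicator {0..} t \<partial>lborel)"
    by (rule nn_integral_cmult) measurable
  also have "\<dots> \<le> ennreal m * ennreal (r / (r - 1) * X)"
    by (rule mult_left_mono[OF nn_integral_truncated_powr[OF X r]]) simp
  also have "\<dots> = ennreal (m * (r / (r - 1) * X))" using m X r by (intro ennreal_mult[symmetric]) auto
  also have "m * (r / (r - 1) * X) = r / (r - 1) * N * m powr (1 - 1 / r)"
    using m by (simp add: X_def powr_diff)
  finally show ?thesis by (simp add: m_def)
qed

lemma Lp1_norm_borel:
  assumes [measurable]: "f \<in> borel_measurable borel" and p: "1 < p"
  shows "Lp1_norm (ennreal p) f = ennreal p *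
    (\<integral>\<^sup>+ t. ennreal (measure disc_measure {w. t < norm (f w)} powr (1 / p)) * indicator {0..} t \<partial>lborel)"
proof -
  have "(\<integral>\<^sup>+ t\<in>{0<..}. ennreal (distr_fun f t powr (1 / p)) \<partial>lborel)
     = (\<integral>\<^sup>+ t. ennreal (measure disc_measure {w. t < norm (f w)} powr (1 / p)) * indicator {0..} t \<partial>lborel)"
  proof (rule nn_integral_cong_AE, rule AE_mp[OF AE_lborel_singleton[of 0]], rule AE_I2, rule impI)
    fix t :: real assume "t \<noteq> 0"
    then show "ennreal (distr_fun f t powr (1 / p)) * indicator {0<..} t
       = ennreal (measure disc_measure {w. t < norm (f w)} powr (1 / p)) * indicator {0..} t"
      by (auto simp: distr_fun_eq indicator_def)
  qed
  then show ?thesis using p by (simp add: Lp1_norm_def)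
qed

text \<open>Duality of L^{p,1} and weak L^{p'}: f is resolved into its level sets, each treated by
  \<open>weak_bound_integral_over_set\<close> with r = p'. The constant r / (r - 1) = p is absorbed
  by the factor p in the Lorentz norm.\<close>

lemma Lorentz_Holder:
  assumes [measurable]: "f \<in> borel_measurable borel" "\<Phi> \<in> borel_measurable borel" and \<Phi>: "\<And>w. 0 \<le> \<Phi> w"
    and p: "1 < p" and N: "0 \<le> N"
    and weak: "\<And>l. 0 < l \<Longrightarrow> measure disc_measure {w. l < \<Phi> w} \<le> (N / l) powr (p / (p - 1))"
  shows "(\<integral>\<^sup>+ w. ennreal (norm (f w) * \<Phi> w) \<partial>disc_measure) \<le> ennreal N * Lp1_norm (ennreal p) f"
proof -
  let ?r = "p / (p - 1)"
  have r: "1 < ?r" "?r / (?r - 1) = p" "1 - 1 / ?r = 1 / p" using p by (auto simp: field_simps)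
  have "(\<integral>\<^sup>+ w. ennreal (norm (f w) * \<Phi> w) \<partial>disc_measure) = (\<integral>\<^sup>+ w. ennreal (\<Phi> w) * ennreal (norm (f w)) \<partial>disc_measure)"
    using \<Phi> by (simp add: ennreal_mult'' mult.commute)
  also have "\<dots> = (\<integral>\<^sup>+ t. (\<integral>\<^sup>+ w. ennreal (\<Phi> w) * indicator {w. t < norm (f w)} w \<partial>disc_measure) * indicator {0..} t \<partial>lborel)"
    by (rule layer_cake) auto
  also have "\<dots> \<le> (\<integral>\<^sup>+ t. ennreal (p * N) * (ennreal (measure disc_measure {w. t < norm (f w)} powr (1 / p)) * indicator {0..} t) \<partial>lborel)"
  proof (rule nn_integral_mono)
    fix t :: real
    have "(\<integral>\<^sup>+ w. ennreal (\<Phi> w) * indicator {w. t < norm (f w)} w \<partial>disc_measure)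
        = (\<integral>\<^sup>+ w. indicator {w. t < norm (f w)} w * ennreal (\<Phi> w) \<partial>disc_measure)"
      by (simp add: mult.commute)
    also have "\<dots> \<le> ennreal (?r / (?r - 1) * N * measure disc_measure {w. t < norm (f w)} powr (1 - 1 / ?r))"
      by (rule weak_bound_integral_over_set) (use \<Phi> N r weak in auto)
    also have "\<dots> = ennreal (p * N) * ennreal (measure disc_measure {w. t < norm (f w)} powr (1 / p))"
      unfolding r using p N by (subst ennreal_mult[symmetric]) auto
    finally show "(\<integral>\<^sup>+ w. ennreal (\<Phi> w) * indicator {w. t < norm (f w)} w \<partial>disc_measure) * indicator {0..} t
       \<le> ennreal (p * N) * (ennreal (measure disc_measure {w. t < norm (f w)} powr (1 / p)) * indicator {0..} t)"
      by (simp add: indicator_def)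
  qed
  also have "\<dots> = ennreal (p * N) * (\<integral>\<^sup>+ t. ennreal (measure disc_measure {w. t < norm (f w)} powr (1 / p)) * indicator {0..} t \<partial>lborel)"
    by (rule nn_integral_cmult) measurable
  also have "\<dots> = ennreal N * Lp1_norm (ennreal p) f"
    unfolding Lp1_norm_borel[OF assms(1) p] using p N by (simp add: ennreal_mult mult_ac)
  finally show ?thesis .
qed

section \<open>Restricted estimates by duality with Cauchy integrals\<close>

text \<open>Fubini's theorem moves the kernel onto the indicator. As a function of v, the factor 1 /
  (1 - v z \<open>cnj w\<close>) is the conjugate of the Cauchy kernel at the point
  \<open>cnj z * w\<close>, so g is paired with the Cauchy integral of A.\<close>

lemma integral_indicator_duality:
  assumes g: "integrable disc_measure g" and A [measurable]: "A \<in> sets borel" and z: "z \<in> unit_disc"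
  shows "ennreal (norm (LINT v|circle_measure. indicator A v * (LINT w|disc_measure. g w / (1 - (v * z) * cnj w))))
     \<le> (\<integral>\<^sup>+ w. ennreal (norm (g w) * norm (cauchy_indicator A (cnj z * w))) \<partial>disc_measure)"
proof -
  have [measurable]: "g \<in> borel_measurable borel" using borel_measurable_integrable[OF g] by simp
  let ?h = "\<lambda>v w. indicator A v * (g w / (1 - (v * z) * cnj w))"
  have h_le: "norm (?h v w) \<le> norm (g w) / (1 - norm z)" if "norm v = 1" "w \<in> unit_disc" for v w
  proof -
    have "1 - norm z \<le> norm (1 - (v * z) * cnj w)"
      using norm_one_minus_ge[OF that(2), of "v * z"] that(1) by (simp add: norm_mult)
    then have "norm (g w) / norm (1 - (v * z) * cnj w) \<le> norm (g w) / (1 - norm z)"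
      using z by (intro frac_le) (auto simp: unit_disc_def)
    moreover have "0 \<le> norm (g w) / (1 - norm z)" using z by (simp add: unit_disc_def)
    ultimately show ?thesis by (auto simp: norm_mult norm_divide split: split_indicator)
  qed
  have int: "integrable (circle_measure \<Otimes>\<^sub>M disc_measure) (\<lambda>(v, w). ?h v w)"
  proof (rule integrableI_bounded)
    have "(\<integral>\<^sup>+ x. norm (case x of (v, w) \<Rightarrow> ?h v w) \<partial>(circle_measure \<Otimes>\<^sub>M disc_measure))
       = (\<integral>\<^sup>+ v. \<integral>\<^sup>+ w. norm (?h v w) \<partial>disc_measure \<partial>circle_measure)"
      by (subst disc.nn_integral_fst[symmetric]) auto
    also have "\<dots> \<le> (\<integral>\<^sup>+ v. \<integral>\<^sup>+ w. ennreal (norm (g w) / (1 - norm z)) \<partial>disc_measure \<partial>circle_measure)"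
    proof (rule nn_integral_mono_AE)
      show "AE v in circle_measure. (\<integral>\<^sup>+ w. norm (?h v w) \<partial>disc_measure) \<le> (\<integral>\<^sup>+ w. ennreal (norm (g w) / (1 - norm z)) \<partial>disc_measure)"
        using AE_circle_norm
      proof eventually_elim
        case (elim v)
        show ?case
          by (rule nn_integral_mono_AE) (use AE_disc_unit_disc in eventually_elim, rule ennreal_leI, rule h_le[OF elim])
      qed
    qed
    also have "\<dots> = (\<integral>\<^sup>+ w. ennreal (norm (g w / complex_of_real (1 - norm z))) \<partial>disc_measure)"
      using z unfolding norm_divide norm_of_real by (simp add: circle.emeasure_space_1[simplified] unit_disc_def)
    also have "\<dots> < \<infinity>"
    proof -
      have "integrable disc_measure (\<lambda>w. g w / complex_of_real (1 - norm z))" using g by simp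
      then show ?thesis unfolding integrable_iff_bounded by blast
    qed
    finally show "(\<integral>\<^sup>+ x. norm (case x of (v, w) \<Rightarrow> ?h v w) \<partial>(circle_measure \<Otimes>\<^sub>M disc_measure)) < \<infinity>" .
  qed measurable
  have inner: "norm (LINT v|circle_measure. ?h v w) = norm (g w) * norm (cauchy_indicator A (cnj z * w))" for w
  proof -
    have "(LINT v|circle_measure. ?h v w) = (LINT v|circle_measure. g w * cnj (indicator A v / (1 - (cnj z * w) * cnj v)))"
      by (rule Bochner_Integration.integral_cong) (auto split: split_indicator simp: mult_ac)
    also have "\<dots> = g w * cnj (cauchy_indicator A (cnj z * w))"
    proof -
      have "(LINT v|circle_measure. g w * cnj (k v)) = g w * cnj (LINT v|circle_measure. k v)" for k :: "complex \<Rightarrow> complex"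
        by simp
      then show ?thesis unfolding cauchy_indicator_def .
    qed
    finally show ?thesis by (simp add: norm_mult)
  qed
  have "(LINT v|circle_measure. indicator A v * (LINT w|disc_measure. g w / (1 - (v * z) * cnj w)))
     = (LINT v|circle_measure. (LINT w|disc_measure. ?h v w))" by (simp only: integral_mult_right_zero)
  also have "\<dots> = (LINT w|disc_measure. (LINT v|circle_measure. ?h v w))"
    by (rule circle_disc.Fubini_integral[OF int, symmetric])
  finally have eq: "(LINT v|circle_measure. indicator A v * (LINT w|disc_measure. g w / (1 - (v * z) * cnj w)))
     = (LINT w|disc_measure. (LINT v|circle_measure. ?h v w))" .
  show ?thesis unfolding eq inner[symmetric] by (rule integral_norm_bound_ennreal_any)
qed

text \<open>If A is a level set of Re (\<omega> F), then |A| t / 2 is at most the modulus of the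
  integral of F over A, which duality bounds by c |A|^(1/s') B. Cancelling leaves |A|^(1/s) \<le> 2
  c B / t. The condition s < p means s' > p', which leaves room for a moment of order u between
  them.\<close>

lemma circle_restricted_bound:
  fixes p s :: real
  assumes p: "1 < p" and s: "1 < s" "s < p"
  obtains C where "0 \<le> C"
    "\<And>f B z t. f \<in> borel_measurable borel \<Longrightarrow> 0 \<le> B \<Longrightarrow> Lp1_norm (ennreal p) f \<le> ennreal B \<Longrightarrow> z \<in> unit_disc \<Longrightarrow> 0 < t \<Longrightarrow>
      integrable disc_measure (\<lambda>w. complex_of_real (defect w powr (1 / p - 1)) * f w) \<and>
      measure circle_measure {v. norm (LINT w|disc_measure. complex_of_real (defect w powr (1 / p - 1)) * f w / (1 - (v * z) * cnj w)) > t}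
        \<le> 4 * (C * B / t) powr s"
proof -
  define p' where "p' = p / (p - 1)"
  define s' where "s' = s / (s - 1)"
  \<comment> \<open>u > p' is needed for the passage from circles to the disc, and u < s' makes
    \<sigma> = u / s' less than 1, as \<open>cauchy_indicator_moment\<close> demands. The resulting
    power of |A| is \<sigma> / u = 1 / s'.\<close>
  define u where "u = (p' + s') / 2"
  define \<sigma> where "\<sigma> = u / s'"
  have p': "1 < p'" "1 / p - 1 = - (1 / p')" using p by (auto simp: p'_def field_simps)
  have s': "p' < s'" "1 - 1 / s' = 1 / s" using p s by (auto simp: p'_def s'_def field_simps)
  have u: "p' < u" "u < s'" using s' by (auto simp: u_def)
  have \<sigma>: "0 < \<sigma>" "\<sigma> < 1" "\<sigma> \<le> u" "\<sigma> / u = 1 / s'" using u p' s' by (auto simp: \<sigma>_def field_simps intro: order_trans[of _ "1 * u"])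
  obtain K where K: "0 \<le> K" "\<And>A z. A \<in> sets borel \<Longrightarrow> z \<in> unit_disc \<Longrightarrow>
     (\<integral>\<^sup>+ v. ennreal (norm (cauchy_indicator A (v * z)) powr u) \<partial>circle_measure) \<le> ennreal (K * measure circle_measure A powr \<sigma>)"
    using cauchy_indicator_moment[OF \<sigma>(1-3)] by blast
  define c1 where "c1 = (u / (u - p')) powr (1 / p') * K powr (1 / u)"
  have c1: "0 \<le> c1" by (simp add: c1_def)
  \<comment> \<open>The moment of order u on circles becomes a weak L^{p'} bound on the disc. The
    weight defect^(-1/p') is the critical one for the exponent p', so uniformity in the radius is
    enough.\<close>
  have H_weak: "measure disc_measure {w. l < defect w powr (1 / p - 1) * norm (cauchy_indicator A (cnj z * w))}
      \<le> (c1 * measure circle_measure A powr (1 / s') / l) powr p'"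
    if A [measurable]: "A \<in> sets borel" and z: "z \<in> unit_disc" and l: "0 < l" for A z l
  proof -
    let ?N = "(K * measure circle_measure A powr \<sigma>) powr (1 / u)"
    have "measure disc_measure {w. defect w powr (- (1 / p')) * norm (cauchy_indicator A (cnj z * w)) > l} \<le> u / (u - p') * (?N / l) powr p'"
    proof (rule weak_bound_from_circles[OF _ u(1)])
      fix w :: complex and t :: real assume w: "w \<in> unit_disc" and t: "0 < t"
      have zw: "cnj z * w \<in> unit_disc"
        using norm_mult_cnj_less[OF w z] by (simp add: unit_disc_def mult.commute)
      have "measure circle_measure {v. norm (cauchy_indicator A (cnj z * (v * w))) > t}
         = measure circle_measure {v. norm (cauchy_indicator A (v * (cnj z * w))) powr u > t powr u}"
      proof -
        have "t < x \<longleftrightarrow> t powr u < x powr u" if "0 \<le> x" for x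
          using t u p' that powr_less_mono2[of u t x] powr_mono2[of u x t] by linarith
        then show ?thesis by (simp only: norm_ge_zero mult.left_commute)
      qed
      also have "\<dots> \<le> K * measure circle_measure A powr \<sigma> / t powr u"
        by (rule markov_circle[OF _ _ _ K(2)[OF A zw]]) (use t K in auto)
      also have "\<dots> = (?N / t) powr u"
        using t K u p' by (simp add: powr_divide powr_powr)
      also have "?N / t = ?N * defect w powr - (- (1 / p') + 1 / p') / t" using defect_pos[OF w] by simp
      finally show "measure circle_measure {v. norm (cauchy_indicator A (cnj z * (v * w))) > t}
        \<le> (?N * defect w powr - (- (1 / p') + 1 / p') / t) powr u" .
    qed (use p' l in auto)
    also have "u / (u - p') * (?N / l) powr p' = (c1 * measure circle_measure A powr (1 / s') / l) powr p'"
    proof -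
      define b where "b = (u / (u - p')) powr (1 / p')"
      have N: "?N = K powr (1 / u) * measure circle_measure A powr (1 / s')"
        using K \<sigma>(4) by (simp add: powr_mult powr_powr)
      have b: "b powr p' = u / (u - p')" using u p' by (simp add: b_def powr_powr)
      have "u / (u - p') * (?N / l) powr p' = b powr p' * (?N / l) powr p'" by (simp only: b)
      also have "\<dots> = (b * (?N / l)) powr p'" by (rule powr_mult[symmetric])
      finally show ?thesis by (simp add: N c1_def b_def mult_ac)
    qed
    finally show ?thesis unfolding p' .
  qed
  have main: "integrable disc_measure (\<lambda>w. complex_of_real (defect w powr (1 / p - 1)) * f w) \<and>
      measure circle_measure {v. norm (LINT w|disc_measure. complex_of_real (defect w powr (1 / p - 1)) * f w / (1 - (v * z) * cnj w)) > t}
        \<le> 4 * (2 * c1 * B / t) powr s"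
    if f [measurable]: "f \<in> borel_measurable borel" and B: "0 \<le> B" "Lp1_norm (ennreal p) f \<le> ennreal B"
      and z: "z \<in> unit_disc" and t: "0 < t" for f B z t
  proof -
    define g where "g w = complex_of_real (defect w powr (1 / p - 1)) * f w" for w
    have [measurable]: "g \<in> borel_measurable borel" unfolding g_def by measurable
    \<comment> \<open>The weight defect^(-1/p') has weak L^{p'} norm at most 1, so the Lorentz
      duality gives integrability.\<close>
    have g_int: "integrable disc_measure g"
    proof (rule integrableI_bounded)
      have "(\<integral>\<^sup>+ w. ennreal (norm (g w)) \<partial>disc_measure) = (\<integral>\<^sup>+ w. ennreal (norm (f w) * defect w powr (1 / p - 1)) \<partial>disc_measure)"
        by (simp add: g_def norm_mult mult.commute)
      also have "\<dots> \<le> ennreal 1 * Lp1_norm (ennreal p) f"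
      proof (rule Lorentz_Holder[OF f _ _ p])
        fix l :: real assume l: "0 < l"
        have "measure disc_measure {w. l < defect w powr (1 / p - 1)} \<le> measure disc_measure {w. defect w \<in> {..(1 / l) powr p'}}"
        proof (rule disc.finite_measure_mono_AE)
          show "AE w in disc_measure. w \<in> {w. l < defect w powr (1 / p - 1)} \<longrightarrow> w \<in> {w. defect w \<in> {..(1 / l) powr p'}}"
            using AE_disc_defect_pos
          proof (eventually_elim, intro impI)
            fix w assume w: "0 < defect w" and "w \<in> {w. l < defect w powr (1 / p - 1)}"
            then have "l * defect w powr (1 / p') < 1" unfolding p' by (simp add: powr_minus field_simps)
            then have "defect w powr (1 / p') < 1 / l" using l by (simp add: field_simps)
            then have "(defect w powr (1 / p')) powr p' \<le> (1 / l) powr p'" using p' by (intro powr_mono2) auto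
            then show "w \<in> {w. defect w \<in> {..(1 / l) powr p'}}" using w p' by (simp add: powr_powr)
          qed
        qed measurable
        also have "measure disc_measure {w. defect w \<in> {..(1 / l) powr p'}} \<le> (1 / l) powr p'"
        proof -
          have "emeasure disc_measure {w. defect w \<in> {..(1 / l) powr p'}} = emeasure lborel ({..(1 / l) powr p'} \<inter> {0..1})"
            by (rule emeasure_disc_defect) simp
          also have "\<dots> \<le> emeasure lborel {0..(1 / l) powr p'}" by (rule emeasure_mono) auto
          also have "\<dots> = ennreal ((1 / l) powr p')" by simp
          finally show ?thesis by (simp add: disc.emeasure_eq_measure)
        qed
        finally show "measure disc_measure {w. l < defect w powr (1 / p - 1)} \<le> (1 / l) powr (p / (p - 1))" by (simp only: p'_def)
      qed auto
      also have "\<dots> < \<infinity>" using B(2) by (simp add: le_less_trans)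
      finally show "(\<integral>\<^sup>+ w. ennreal (norm (g w)) \<partial>disc_measure) < \<infinity>" .
    qed simp
    let ?F = "\<lambda>v. LINT w|disc_measure. g w / (1 - (v * z) * cnj w)"
    have Fm [measurable]: "?F \<in> borel_measurable borel" by measurable
    have F_bd: "\<exists>D. \<forall>v. norm v = 1 \<longrightarrow> norm (?F v) \<le> D"
    proof (intro exI allI impI)
      fix v :: complex assume v: "norm v = 1"
      have z1: "norm z < 1" using z by (simp add: unit_disc_def)
      show "norm (?F v) \<le> (LINT w|disc_measure. norm (g w) / (1 - norm z))"
      proof (rule order_trans[OF integral_norm_bound], rule integral_mono_AE')
        show "integrable disc_measure (\<lambda>w. norm (g w) / (1 - norm z))" using g_int by simp
        show "AE w in disc_measure. norm (g w / (1 - (v * z) * cnj w)) \<le> norm (g w) / (1 - norm z)"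
          using AE_disc_unit_disc
        proof eventually_elim
          case (elim w)
          have "1 - norm z \<le> norm (1 - (v * z) * cnj w)"
            using norm_one_minus_ge[OF elim, of "v * z"] v by (simp add: norm_mult)
          then show ?case unfolding norm_divide using z1 by (intro frac_le) auto
        qed
        show "AE w in disc_measure. 0 \<le> norm (g w) / (1 - norm z)" using z1 by simp
      qed
    qed
    then obtain D where D: "\<And>v. norm v = 1 \<Longrightarrow> norm (?F v) \<le> D" by blast
    have part: "measure circle_measure {v. Re (\<omega> * ?F v) > t / 2} \<le> (2 * c1 * B / t) powr s" if w: "norm \<omega> = 1" for \<omega>
    proof -
      define A where "A = {v. Re (\<omega> * ?F v) > t / 2}"
      have A [measurable]: "A \<in> sets borel" unfolding A_def by measurable
      define m where "m = measure circle_measure A"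
      have intA: "integrable circle_measure (\<lambda>v. indicator A v * ?F v)"
      proof (rule integrable_circle_bounded[where B="max 0 D"])
        fix v :: complex assume "norm v = 1"
        from D[OF this] show "norm (indicator A v * ?F v) \<le> max 0 D" by (auto split: split_indicator)
      qed measurable
      have "m * (t / 2) = (LINT v|circle_measure. indicator A v * (t / 2))" by (simp add: m_def)
      also have "\<dots> \<le> (LINT v|circle_measure. Re (\<omega> * (indicator A v * ?F v)))"
      proof (rule integral_mono_AE)
        show "integrable circle_measure (\<lambda>v. indicator A v * (t / 2))"
          by (rule circle.integrable_const_bound[where B="t / 2"]) (use t in \<open>auto split: split_indicator\<close>)
        show "integrable circle_measure (\<lambda>v. Re (\<omega> * (indicator A v * ?F v)))"
          by (rule integrable_Re) (use intA in simp)
        show "AE v in circle_measure. indicator A v * (t / 2) \<le> Re (\<omega> * (indicator A v * ?F v))"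
          by (rule AE_I2) (auto split: split_indicator simp: A_def)
      qed
      also have "\<dots> = Re (\<omega> * (LINT v|circle_measure. indicator A v * ?F v))"
        using integral_Re[of circle_measure "\<lambda>v. \<omega> * (indicator A v * ?F v)"] intA by simp
      also have "\<dots> \<le> norm (LINT v|circle_measure. indicator A v * ?F v)"
        using complex_Re_le_cmod[of "\<omega> * (LINT v|circle_measure. indicator A v * ?F v)"] w by (simp add: norm_mult)
      finally have 1: "m * (t / 2) \<le> norm (LINT v|circle_measure. indicator A v * ?F v)" .
      have "ennreal (norm (LINT v|circle_measure. indicator A v * ?F v)) \<le> ennreal (c1 * m powr (1 / s') * B)"
      proof -
        have "ennreal (norm (LINT v|circle_measure. indicator A v * ?F v))
           \<le> (\<integral>\<^sup>+ w. ennreal (norm (g w) * norm (cauchy_indicator A (cnj z * w))) \<partial>disc_measure)"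
          by (rule integral_indicator_duality[OF g_int A z])
        also have "\<dots> = (\<integral>\<^sup>+ w. ennreal (norm (f w) * (defect w powr (1 / p - 1) * norm (cauchy_indicator A (cnj z * w)))) \<partial>disc_measure)"
          by (simp add: g_def norm_mult mult_ac)
        also have "\<dots> \<le> ennreal (c1 * m powr (1 / s')) * Lp1_norm (ennreal p) f"
          by (rule Lorentz_Holder[OF f _ _ p])
             (use c1 H_weak[OF A z] in \<open>auto simp: m_def p'_def\<close>)
        also have "\<dots> \<le> ennreal (c1 * m powr (1 / s')) * ennreal B" by (rule mult_left_mono[OF B(2)]) simp
        finally show ?thesis using B c1 by (simp add: ennreal_mult)
      qed
      then have 2: "norm (LINT v|circle_measure. indicator A v * ?F v) \<le> c1 * m powr (1 / s') * B"
        using B c1 by (subst (asm) ennreal_le_iff) auto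
      show ?thesis unfolding A_def[symmetric] m_def[symmetric]
      proof (cases "m = 0")
        case False
        then have m: "0 < m" by (simp add: m_def less_le)
        have "m powr (1 / s) * m powr (1 / s') = m" using m s'(2) by (simp add: powr_add[symmetric] flip: s'(2))
        then have "m powr (1 / s) * m powr (1 / s') * (t / 2) \<le> c1 * m powr (1 / s') * B" using 1 2 by simp
        then have "m powr (1 / s') * (m powr (1 / s) * (t / 2)) \<le> m powr (1 / s') * (c1 * B)" by (simp add: mult_ac)
        then have "m powr (1 / s) * (t / 2) \<le> c1 * B" using m by simp
        then have "m powr (1 / s) \<le> 2 * c1 * B / t" using t by (simp add: field_simps)
        then have "(m powr (1 / s)) powr s \<le> (2 * c1 * B / t) powr s" using s by (intro powr_mono2) auto
        then show "m \<le> (2 * c1 * B / t) powr s" using m s by (simp add: powr_powr)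
      qed simp
    qed
    \<comment> \<open>If |F| > t, the real or the imaginary part exceeds t / 2 in modulus: four
      half-planes, whence the factor 4.\<close>
    have "measure circle_measure {v. norm (?F v) > t}
      \<le> measure circle_measure (({v. Re (1 * ?F v) > t / 2} \<union> {v. Re ((-1) * ?F v) > t / 2}) \<union>
         ({v. Re (\<i> * ?F v) > t / 2} \<union> {v. Re ((- \<i>) * ?F v) > t / 2}))"
    proof (rule circle.finite_measure_mono)
      have key: "(t / 2 < Re (1 * x) \<or> t / 2 < Re ((-1) * x)) \<or> (t / 2 < Re (\<i> * x) \<or> t / 2 < Re ((- \<i>) * x))" if "t < norm x" for x
        using cmod_le[of x] that by (auto simp: abs_if split: if_splits)
      show "{v. norm (?F v) > t} \<subseteq> ({v. Re (1 * ?F v) > t / 2} \<union> {v. Re ((-1) * ?F v) > t / 2}) \<union>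
         ({v. Re (\<i> * ?F v) > t / 2} \<union> {v. Re ((- \<i>) * ?F v) > t / 2})"
        by (rule subsetI, simp only: Un_iff mem_Collect_eq, rule key)
    qed simp
    also have "\<dots> \<le> (measure circle_measure {v. Re (1 * ?F v) > t / 2} + measure circle_measure {v. Re ((-1) * ?F v) > t / 2})
       + (measure circle_measure {v. Re (\<i> * ?F v) > t / 2} + measure circle_measure {v. Re ((- \<i>) * ?F v) > t / 2})"
      by (intro order_trans[OF measure_Un_le] add_mono measure_Un_le) measurable
    also have "\<dots> \<le> 4 * (2 * c1 * B / t) powr s"
      using part[of 1] part[of "-1"] part[of "\<i>"] part[of "- \<i>"] by simp
    finally show ?thesis using g_int by (simp add: g_def[abs_def])
  qed
  show ?thesis by (rule that[of "2 * c1"]) (use c1 main in auto)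
qed

theorem restricted_weak_type_T_critical:
  assumes "1 \<le> q" "q < p"
  shows "restricted_weak_type (T_op (- 1 / q) (1 / p - 1) 1) (ennreal p) (ennreal q)"
proof -
  let ?K = "T_op (- 1 / q) (1 / p - 1) 1"
  \<comment> \<open>Any exponent strictly between q and p serves: s > q for the passage to the disc,
    s < p for the circle bound.\<close>
  define s where "s = (p + q) / 2"
  have s: "1 < s" "q < s" "s < p" using assms by (auto simp: s_def)
  have p: "1 < p" using assms by simp
  note K = weighted_operator_T_op[of "- 1 / q" "1 / p - 1" 1]
  obtain C where C: "0 \<le> C"
    "\<And>f B z t. f \<in> borel_measurable borel \<Longrightarrow> 0 \<le> B \<Longrightarrow> Lp1_norm (ennreal p) f \<le> ennreal B \<Longrightarrow> z \<in> unit_disc \<Longrightarrow> 0 < t \<Longrightarrow>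
      integrable disc_measure (\<lambda>w. complex_of_real (defect w powr (1 / p - 1)) * f w) \<and>
      measure circle_measure {v. norm (LINT w|disc_measure. complex_of_real (defect w powr (1 / p - 1)) * f w / (1 - (v * z) * cnj w)) > t}
        \<le> 4 * (C * B / t) powr s"
    using circle_restricted_bound[OF p s(1,3)] by blast
  let ?C = "(s / (s - q)) powr (1 / q) * (4 powr (1 / s) * C)"
  have "converges_ae ?K f \<and> (\<forall>t>0. distr_fun (apply_op ?K f) t \<le> (?C * B / t) powr q)"
    if f [measurable]: "f \<in> borel_measurable borel" and B: "B \<ge> 0" "Lp1_norm (ennreal p) f \<le> ennreal B" for f B
  proof -
    define g where "g w = complex_of_real (defect w powr (1 / p - 1)) * f w" for w
    have kg: "kernel ?K z w * f w = g w / (1 - z * cnj w)" for z w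
      by (simp add: T_op_def g_def)
    note Cf = C(2)[OF f B, folded g_def]
    have "converges_ae ?K f \<and> (\<forall>t>0. distr_fun (apply_op ?K f) t \<le> ((s / (s - q)) powr (1 / q) * (4 powr (1 / s) * C * B) / t) powr q)"
    proof (rule weighted_operator_weak_bound[OF K f])
      fix z :: complex assume z: "z \<in> unit_disc"
      have g_int: "integrable disc_measure g" using Cf[OF z zero_less_one] by simp
      then have [measurable]: "g \<in> borel_measurable borel" using borel_measurable_integrable by force
      have z1: "norm z < 1" using z by (simp add: unit_disc_def)
      show "integrable disc_measure (\<lambda>w. kernel ?K z w * f w)" unfolding kg
      proof (rule Bochner_Integration.integrable_bound)
        show "integrable disc_measure (\<lambda>w. g w / complex_of_real (1 - norm z))" using g_int by simp
        show "AE w in disc_measure. norm (g w / (1 - z * cnj w)) \<le> norm (g w / complex_of_real (1 - norm z))"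
          using AE_disc_unit_disc
        proof eventually_elim
          case (elim w)
          show ?case unfolding norm_divide norm_of_real using norm_one_minus_ge[OF elim, of z] z1
            by (intro frac_le) auto
        qed
      qed measurable
      fix t :: real assume t: "t > 0"
      have "measure circle_measure {v. norm (LINT w|disc_measure. kernel ?K (v * z) w * f w) > t} \<le> 4 * (C * B / t) powr s"
        unfolding kg using Cf[OF z t] by simp
      also have "\<dots> = (4 powr (1 / s) * C * B * defect z powr - (- 1 / q + 1 / q) / t) powr s"
      proof -
        have "4 * (C * B / t) powr s = (4 powr (1 / s)) powr s * (C * B / t) powr s" using s by (simp add: powr_powr)
        also have "\<dots> = (4 powr (1 / s) * (C * B / t)) powr s"
          by (rule powr_mult[symmetric])
        finally show ?thesis using defect_pos[OF z] by (simp add: mult.assoc)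
      qed
      finally show "measure circle_measure {v. norm (LINT w|disc_measure. kernel ?K (v * z) w * f w) > t}
         \<le> (4 powr (1 / s) * C * B * defect z powr - (- 1 / q + 1 / q) / t) powr s" .
    qed (use assms s B C in auto)
    then show ?thesis by (simp add: mult.assoc)
  qed
  moreover have "?C \<ge> 0" using C by simp
  ultimately have "weakly_bounded (Lp1_norm (ennreal p)) ?K q"
    unfolding weakly_bounded_def by blast
  then show ?thesis using restricted_weak_type_weakly_bounded[OF K] assms by simp
qed

section \<open>Sufficient conditions for the positive operators\<close>

lemma binomial_coeff_pos: "0 < c \<Longrightarrow> 0 < binomial_coeff c n"
  by (simp add: binomial_coeff_def pochhammer_pos)

text \<open>Up to a factor tending to 1, the ratio R is the reciprocal of Gauss's product for the
  Gamma function, so it converges to 1 / Gamma c > 0. Convergence of R and of its reciprocals gives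
  the two bounds.\<close>

lemma binomial_coeff_asymp:
  assumes c: "0 < c"
  shows "\<exists>k1>0. \<exists>k2>0. \<forall>n\<ge>1. k1 * real n powr (c - 1) \<le> binomial_coeff c n \<and> binomial_coeff c n \<le> k2 * real n powr (c - 1)"
proof -
  define R where "R n = binomial_coeff c n / real n powr (c - 1)" for n
  have R_pos: "0 < R n" if "1 \<le> n" for n
    using that c by (simp add: R_def binomial_coeff_pos)
  have G: "0 < Gamma c" using c by (rule Gamma_real_pos)
  have "(\<lambda>n. real n / (c + real n) * inverse (Gamma_series c n)) \<longlonglongrightarrow> 1 * inverse (Gamma c)"
    by (intro tendsto_mult tendsto_inverse Gamma_series_LIMSEQ) (use G in \<open>real_asymp | simp\<close>)+
  moreover have "eventually (\<lambda>n. real n / (c + real n) * inverse (Gamma_series c n) = R n) sequentially"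
    using eventually_ge_at_top[of 1]
  proof eventually_elim
    case (elim n)
    have "exp (c * ln (real n)) = real n powr (c - 1) * real n"
      using elim by (simp add: powr_def mult_exp_exp[symmetric] exp_diff left_diff_distrib)
    then have GS: "Gamma_series c n = fact n * (real n powr (c - 1) * real n) / (pochhammer c n * (c + real n))"
      by (simp add: Gamma_series_def pochhammer_Suc)
    have "N / S * inverse (F * (W * N) / (P * S)) = P / F / W"
      if "0 < N" "0 < S" "0 < F" "0 < W" "0 < P" for N S F W P :: real
      using that by (simp add: field_simps)
    from this[of "real n" "c + real n" "fact n" "real n powr (c - 1)" "pochhammer c n"]
    show ?case using elim c pochhammer_pos[of c n] unfolding GS R_def binomial_coeff_def by simp
  qed
  ultimately have lim: "R \<longlonglongrightarrow> inverse (Gamma c)"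
    by (simp add: Lim_transform_eventually)
  then have "Bseq R" by (intro convergent_imp_Bseq convergentI)
  then obtain k2 where k2: "0 < k2" "\<And>n. norm (R n) \<le> k2" by (auto elim: BseqE)
  have "(\<lambda>n. inverse (R n)) \<longlonglongrightarrow> inverse (inverse (Gamma c))"
    by (intro tendsto_inverse lim) (use G in simp)
  then have "Bseq (\<lambda>n. inverse (R n))" by (intro convergent_imp_Bseq convergentI)
  then obtain k1 where k1: "0 < k1" "\<And>n. norm (inverse (R n)) \<le> k1" by (auto elim: BseqE)
  have "1 / k1 * real n powr (c - 1) \<le> binomial_coeff c n \<and> binomial_coeff c n \<le> k2 * real n powr (c - 1)"
    if n: "1 \<le> n" for n
  proof
    have pw: "0 < real n powr (c - 1)" using n by simp
    have "inverse (R n) \<le> k1" using k1(2)[of n] R_pos[OF n] by simp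
    then have "1 / k1 \<le> R n" using R_pos[OF n] k1(1) by (simp add: field_simps)
    then show "1 / k1 * real n powr (c - 1) \<le> binomial_coeff c n"
      using pw by (simp add: R_def pos_le_divide_eq)
    have "R n \<le> k2" using k2(2)[of n] by simp
    then show "binomial_coeff c n \<le> k2 * real n powr (c - 1)"
      using pw by (simp add: R_def pos_divide_le_eq)
  qed
  moreover have "0 < 1 / k1" using k1 by simp
  ultimately show ?thesis using k2(1) by blast
qed

text \<open>The squared coefficients of (1 - x)^(-c/2) are of order n^(c - 2), which is summable for
  c < 1.\<close>

lemma circle_kernel_bounded:
  assumes c: "0 < c" "c < 1"
  obtains K where "0 < K" "\<And>x. norm x < 1 \<Longrightarrow> (\<integral>\<^sup>+ v. ennreal (1 / norm (1 - v * x) powr c) \<partial>circle_measure) \<le> ennreal K"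
proof -
  have c2: "0 < c / 2" using c by simp
  obtain k2 where k2: "0 < k2" "\<And>n. 1 \<le> n \<Longrightarrow> binomial_coeff (c / 2) n \<le> k2 * real n powr (c / 2 - 1)"
    using binomial_coeff_asymp[OF c2] by metis
  \<comment> \<open>At n = 0 the power is 0 by convention, while the coefficient is 1.\<close>
  define s where "s n = (if n = 0 then 1 else k2\<^sup>2 * real n powr (c - 2))" for n
  have s0: "0 \<le> s n" for n by (simp add: s_def)
  have "summable (\<lambda>n. k2\<^sup>2 * real n powr (c - 2))"
    using c by (intro summable_mult) (simp add: summable_real_powr_iff)
  then have sm: "summable s"
    by (rule summable_cong[THEN iffD1, rotated]) (auto simp: s_def intro!: eventually_sequentiallyI[of 1])
  have le: "(binomial_coeff (c / 2) n)\<^sup>2 \<le> s n" for n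
  proof (cases "n = 0")
    case False
    have "(binomial_coeff (c / 2) n)\<^sup>2 \<le> (k2 * real n powr (c / 2 - 1))\<^sup>2"
      using k2(2)[of n] False c by (intro power_mono) (auto intro!: less_imp_le binomial_coeff_pos)
    also have "\<dots> = s n" using False by (simp add: s_def power_mult_distrib powr_power)
    finally show ?thesis .
  qed (simp add: s_def binomial_coeff_def)
  show ?thesis
  proof (rule that[of "suminf s"])
    have "1 \<le> suminf s" using sum_le_suminf[OF sm, of "{0}"] s0 by (simp add: s_def)
    then show "0 < suminf s" by simp
    fix x :: complex assume x: "norm x < 1"
    have "(\<Sum>k. (binomial_coeff (c / 2) k)\<^sup>2 * ((norm x)\<^sup>2) ^ k) \<le> suminf s"
    proof (rule suminf_le[OF _ circle_kernel_parseval(2)[OF x] sm])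
      fix k
      have "((norm x)\<^sup>2) ^ k \<le> 1" using x by (intro power_le_one) (auto simp: power_le_one)
      then have "(binomial_coeff (c / 2) k)\<^sup>2 * ((norm x)\<^sup>2) ^ k \<le> (binomial_coeff (c / 2) k)\<^sup>2" by (simp add: mult_left_le)
      then show "(binomial_coeff (c / 2) k)\<^sup>2 * ((norm x)\<^sup>2) ^ k \<le> s k" using le[of k] by linarith
    qed
    then show "(\<integral>\<^sup>+ v. ennreal (1 / norm (1 - v * x) powr c) \<partial>circle_measure) \<le> ennreal (suminf s)"
      using circle_kernel_parseval(1)[OF x, of "c / 2"] by (simp add: ennreal_leI)
  qed
qed

text \<open>The order n^(c - 2) of the squared coefficients is also that of the coefficients of (1 -
  r)^(1 - c). Comparing the two power series at r = |x|^2 replaces an estimate of the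
  integral.\<close>

lemma circle_kernel_growth:
  assumes c: "1 < c"
  obtains K where "0 < K" "\<And>x. norm x < 1 \<Longrightarrow>
    (\<integral>\<^sup>+ v. ennreal (1 / norm (1 - v * x) powr c) \<partial>circle_measure) \<le> ennreal (K * (1 - (norm x)\<^sup>2) powr (1 - c))"
proof -
  have c2: "0 < c / 2" using c by simp
  obtain k2 where k2: "0 < k2" "\<And>n. 1 \<le> n \<Longrightarrow> binomial_coeff (c / 2) n \<le> k2 * real n powr (c / 2 - 1)"
    using binomial_coeff_asymp[OF c2] by metis
  have c1: "0 < c - 1" using c by simp
  obtain k1 where k1: "0 < k1" "\<And>n. 1 \<le> n \<Longrightarrow> k1 * real n powr (c - 1 - 1) \<le> binomial_coeff (c - 1) n"
    using binomial_coeff_asymp[OF c1] by metis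
  define K where "K = max 1 (k2\<^sup>2 / k1)"
  have K: "0 < K" by (simp add: K_def)
  have le: "(binomial_coeff (c / 2) n)\<^sup>2 \<le> K * binomial_coeff (c - 1) n" for n
  proof (cases "n = 0")
    case False
    have "(binomial_coeff (c / 2) n)\<^sup>2 \<le> (k2 * real n powr (c / 2 - 1))\<^sup>2"
      using k2(2)[of n] False c by (intro power_mono) (auto intro!: less_imp_le binomial_coeff_pos)
    also have "\<dots> = k2\<^sup>2 / k1 * (k1 * real n powr (c - 1 - 1))"
      using False k1(1) by (simp add: power_mult_distrib powr_power)
    also have "\<dots> \<le> K * binomial_coeff (c - 1) n"
      using False k1 by (intro mult_mono) (auto simp: K_def)
    finally show ?thesis .
  qed (simp add: K_def binomial_coeff_def)
  show ?thesis
  proof (rule that[OF K])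
    fix x :: complex assume x: "norm x < 1"
    let ?r = "(norm x)\<^sup>2"
    have r: "0 \<le> ?r" "?r < 1" using x by (auto simp: abs_square_less_1)
    have "(\<lambda>k. complex_of_real (binomial_coeff (c - 1) k) * complex_of_real ?r ^ k) sums
       (1 / (1 - complex_of_real ?r) powr complex_of_real (c - 1))"
    proof (rule binomial_coeff_sums)
      have "norm (complex_of_real ?r) = \<bar>?r\<bar>" by (rule norm_of_real)
      then show "norm (complex_of_real ?r) < 1" using r by linarith
    qed
    also have "1 / (1 - complex_of_real ?r) powr complex_of_real (c - 1) = complex_of_real ((1 - ?r) powr (1 - c))"
    proof -
      have "(1 - complex_of_real ?r) powr complex_of_real (c - 1) = complex_of_real ((1 - ?r) powr (c - 1))"
        using r by (subst powr_of_real[symmetric]) (auto simp del: of_real_power)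
      moreover have "(1 - ?r) powr (1 - c) = 1 / (1 - ?r) powr (c - 1)" by (simp add: powr_minus_divide[symmetric])
      ultimately show ?thesis by simp
    qed
    finally have "(\<lambda>k. complex_of_real (binomial_coeff (c - 1) k * ?r ^ k)) sums complex_of_real ((1 - ?r) powr (1 - c))"
      by simp
    then have sums: "(\<lambda>k. binomial_coeff (c - 1) k * ?r ^ k) sums ((1 - ?r) powr (1 - c))"
      by (simp only: sums_of_real_iff)
    have "(\<Sum>k. (binomial_coeff (c / 2) k)\<^sup>2 * ?r ^ k) \<le> (\<Sum>k. K * (binomial_coeff (c - 1) k * ?r ^ k))"
    proof (rule suminf_le[OF _ circle_kernel_parseval(2)[OF x] summable_mult[OF sums_summable[OF sums]]])
      fix k
      have "(binomial_coeff (c / 2) k)\<^sup>2 * ?r ^ k \<le> (K * binomial_coeff (c - 1) k) * ?r ^ k"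
        by (rule mult_right_mono[OF le]) simp
      then show "(binomial_coeff (c / 2) k)\<^sup>2 * ?r ^ k \<le> K * (binomial_coeff (c - 1) k * ?r ^ k)" by (simp only: mult.assoc)
    qed
    also have "\<dots> = K * (1 - ?r) powr (1 - c)"
      using sums_mult[OF sums, of K] by (simp only: sums_iff)
    finally show "(\<integral>\<^sup>+ v. ennreal (1 / norm (1 - v * x) powr c) \<partial>circle_measure) \<le> ennreal (K * (1 - ?r) powr (1 - c))"
      using circle_kernel_parseval(1)[OF x, of "c / 2"] by (simp add: ennreal_leI)
  qed
qed

lemma defect_mult_ge:
  assumes "z \<in> unit_disc" "w \<in> unit_disc"
  shows "defect z \<le> 1 - (norm (z * cnj w))\<^sup>2" "defect w \<le> 1 - (norm (z * cnj w))\<^sup>2"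
proof -
  have "(norm z)\<^sup>2 \<le> 1" "(norm w)\<^sup>2 \<le> 1" using assms by (auto simp: unit_disc_def power_le_one)
  then show "defect z \<le> 1 - (norm (z * cnj w))\<^sup>2" "defect w \<le> 1 - (norm (z * cnj w))\<^sup>2"
    by (auto simp: norm_mult power_mult_distrib mult_left_le mult_right_le_one_le mult_left_le_one_le)
qed

lemma nn_integral_disc_powr_kernel:
  "(\<integral>\<^sup>+ w. ennreal (defect w powr B / norm (1 - z * cnj w) powr c) \<partial>disc_measure)
   = (\<integral>\<^sup>+ w. ennreal (defect w powr B) * (\<integral>\<^sup>+ v. ennreal (1 / norm (1 - v * (z * cnj w)) powr c) \<partial>circle_measure) \<partial>disc_measure)"
proof -
  have "(\<integral>\<^sup>+ w. ennreal (defect w powr B / norm (1 - z * cnj w) powr c) \<partial>disc_measure)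
    = (\<integral>\<^sup>+ w. ennreal (defect w powr B) * ennreal (1 / norm (1 - z * cnj w) powr c) \<partial>disc_measure)"
    by (simp add: ennreal_mult'[symmetric])
  also have "\<dots> = (\<integral>\<^sup>+ w. ennreal (defect w powr B) * (\<integral>\<^sup>+ v. ennreal (1 / norm (1 - v * (z * cnj w)) powr c) \<partial>circle_measure) \<partial>disc_measure)"
    by (rule nn_integral_disc_kernel_average) (simp_all add: norm_mult)
  finally show ?thesis .
qed

lemma nn_integral_disc_defect_powr:
  assumes "-1 < B"
  shows "(\<integral>\<^sup>+ w. ennreal (defect w powr B) \<partial>disc_measure) = ennreal (1 / (B + 1))"
  using nn_integral_disc_radial[of "\<lambda>s. ennreal (s powr B)"] nn_integral_powr_Icc[of "B + 1" 1] assms by simp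

text \<open>For c < 1 the circle means of the kernel stay bounded, and what remains is an integrable
  power of the defect.\<close>

lemma forelli_rudin_bounded:
  assumes c: "0 < c" "c < 1" and B: "-1 < B"
  obtains K where "0 < K" "\<And>z. z \<in> unit_disc \<Longrightarrow>
     (\<integral>\<^sup>+ w. ennreal (defect w powr B / norm (1 - z * cnj w) powr c) \<partial>disc_measure) \<le> ennreal K"
proof -
  obtain K where K: "0 < K" "\<And>x. norm x < 1 \<Longrightarrow> (\<integral>\<^sup>+ v. ennreal (1 / norm (1 - v * x) powr c) \<partial>circle_measure) \<le> ennreal K"
    using circle_kernel_bounded[OF c] by blast
  show ?thesis
  proof (rule that[of "K / (B + 1)"])
    fix z assume z: "z \<in> unit_disc"
    have "(\<integral>\<^sup>+ w. ennreal (defect w powr B / norm (1 - z * cnj w) powr c) \<partial>disc_measure)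
       \<le> (\<integral>\<^sup>+ w. ennreal (defect w powr B) * ennreal K \<partial>disc_measure)"
      unfolding nn_integral_disc_powr_kernel
    proof (rule nn_integral_mono_AE)
      show "AE w in disc_measure. ennreal (defect w powr B) * (\<integral>\<^sup>+ v. ennreal (1 / norm (1 - v * (z * cnj w)) powr c) \<partial>circle_measure)
         \<le> ennreal (defect w powr B) * ennreal K"
        using AE_disc_unit_disc by eventually_elim (intro mult_left_mono K(2) norm_mult_cnj_less z, simp_all)
    qed
    also have "\<dots> = ennreal (1 / (B + 1)) * ennreal K"
      by (subst nn_integral_multc) (simp_all add: nn_integral_disc_defect_powr[OF B])
    also have "\<dots> = ennreal (K / (B + 1))" using K B by (simp add: ennreal_mult''[symmetric])
    finally show "(\<integral>\<^sup>+ w. ennreal (defect w powr B / norm (1 - z * cnj w) powr c) \<partial>disc_measure) \<le> ennreal (K / (B + 1))" .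
  qed (use K B in auto)
qed

lemma nn_integral_powr_atLeast:
  assumes "0 < a" "r < 0"
  shows "(\<integral>\<^sup>+ s. ennreal (s powr (r - 1)) * indicator {a..} s \<partial>lborel) = ennreal (a powr r / (- r))"
proof -
  have "(\<integral>\<^sup>+ s. ennreal (s powr (r - 1)) * indicator {a..} s \<partial>lborel) = ennreal (0 - a powr r / r)"
  proof (rule nn_integral_FTC_atLeast[where F="\<lambda>s. s powr r / r"])
    fix s assume "a \<le> s"
    then have "0 < s" using assms by simp
    then show "((\<lambda>s. s powr r / r) has_real_derivative s powr (r - 1)) (at s)"
      using assms by (auto intro!: derivative_eq_intros has_real_derivative_powr)
    show "0 \<le> s powr (r - 1)" by simp
  next
    have "((\<lambda>s. s powr r) \<longlongrightarrow> 0) at_top"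
      using assms by (intro tendsto_neg_powr filterlim_ident) auto
    from tendsto_divide[OF this tendsto_const[of r]] show "((\<lambda>s. s powr r / r) \<longlongrightarrow> 0) at_top" using assms by simp
  qed simp
  then show ?thesis by simp
qed

text \<open>The circle mean of the kernel is bounded by a power of the larger of the two defects.
  Splitting the radial integral at \<open>defect z\<close> leaves two pure powers: B > -1 makes the
  lower one converge at 0, B + 2 < c the upper one at infinity. Their constants are the two summands
  of L.\<close>

lemma forelli_rudin_growth:
  assumes B: "-1 < B" "B + 2 < c"
  obtains K where "0 < K" "\<And>z. z \<in> unit_disc \<Longrightarrow>
     (\<integral>\<^sup>+ w. ennreal (defect w powr B / norm (1 - z * cnj w) powr c) \<partial>disc_measure) \<le> ennreal (K * defect z powr (B + 2 - c))"
proof -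
  have c: "1 < c" using B by simp
  obtain K where K: "0 < K" "\<And>x. norm x < 1 \<Longrightarrow>
     (\<integral>\<^sup>+ v. ennreal (1 / norm (1 - v * x) powr c) \<partial>circle_measure) \<le> ennreal (K * (1 - (norm x)\<^sup>2) powr (1 - c))"
    using circle_kernel_growth[OF c] by blast
  define L where "L = 1 / (B + 1) + 1 / (c - B - 2)"
  have L: "0 < L" using B by (simp add: L_def add_pos_pos)
  show ?thesis
  proof (rule that[of "K * L"])
    fix z assume z: "z \<in> unit_disc"
    let ?d = "defect z"
    have d: "0 < ?d" by (rule defect_pos[OF z])
    have "(\<integral>\<^sup>+ w. ennreal (defect w powr B / norm (1 - z * cnj w) powr c) \<partial>disc_measure)
       \<le> (\<integral>\<^sup>+ w. ennreal K * ennreal (defect w powr B * max ?d (defect w) powr (1 - c)) \<partial>disc_measure)"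
      unfolding nn_integral_disc_powr_kernel
    proof (rule nn_integral_mono_AE)
      show "AE w in disc_measure. ennreal (defect w powr B) * (\<integral>\<^sup>+ v. ennreal (1 / norm (1 - v * (z * cnj w)) powr c) \<partial>circle_measure)
         \<le> ennreal K * ennreal (defect w powr B * max ?d (defect w) powr (1 - c))"
        using AE_disc_unit_disc
      proof eventually_elim
        case (elim w)
        have "(\<integral>\<^sup>+ v. ennreal (1 / norm (1 - v * (z * cnj w)) powr c) \<partial>circle_measure)
          \<le> ennreal (K * (1 - (norm (z * cnj w))\<^sup>2) powr (1 - c))"
          by (rule K(2)[OF norm_mult_cnj_less[OF z elim]])
        also have "\<dots> \<le> ennreal (K * max ?d (defect w) powr (1 - c))"
          using K d defect_mult_ge[OF z elim] c by (intro ennreal_leI mult_left_mono powr_mono2') auto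
        finally have "ennreal (defect w powr B) * (\<integral>\<^sup>+ v. ennreal (1 / norm (1 - v * (z * cnj w)) powr c) \<partial>circle_measure)
          \<le> ennreal (defect w powr B) * ennreal (K * max ?d (defect w) powr (1 - c))" by (rule mult_left_mono) simp
        also have "\<dots> = ennreal K * ennreal (defect w powr B * max ?d (defect w) powr (1 - c))"
          using K by (simp add: ennreal_mult mult_ac)
        finally show ?case .
      qed
    qed
    also have "\<dots> = ennreal K * (\<integral>\<^sup>+ w. ennreal (defect w powr B * max ?d (defect w) powr (1 - c)) \<partial>disc_measure)"
      by (rule nn_integral_cmult) measurable
    also have "(\<integral>\<^sup>+ w. ennreal (defect w powr B * max ?d (defect w) powr (1 - c)) \<partial>disc_measure)
      = (\<integral>\<^sup>+ s. ennreal (s powr B * max ?d s powr (1 - c)) * indicator {0..1} s \<partial>lborel)"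
      by (rule nn_integral_disc_radial) measurable
    also have "\<dots> \<le> (\<integral>\<^sup>+ s. ennreal (?d powr (1 - c)) * (ennreal (s powr (B + 1 - 1)) * indicator {0..?d} s)
        + ennreal (s powr ((B + 2 - c) - 1)) * indicator {?d..} s \<partial>lborel)"
    proof (rule nn_integral_mono)
      fix s :: real
      show "ennreal (s powr B * max ?d s powr (1 - c)) * indicator {0..1} s
         \<le> ennreal (?d powr (1 - c)) * (ennreal (s powr (B + 1 - 1)) * indicator {0..?d} s)
        + ennreal (s powr ((B + 2 - c) - 1)) * indicator {?d..} s"
      proof (cases "s \<le> ?d")
        case True
        then have "ennreal (s powr B * max ?d s powr (1 - c)) * indicator {0..1} s
          \<le> ennreal (?d powr (1 - c)) * (ennreal (s powr (B + 1 - 1)) * indicator {0..?d} s)"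
          by (auto simp: indicator_def max_def ennreal_mult'[symmetric] mult.commute)
        then show ?thesis by (rule order_trans) simp
      next
        case False
        then have "s powr B * max ?d s powr (1 - c) = s powr ((B + 2 - c) - 1)"
          using d by (simp add: max_def powr_add[symmetric] algebra_simps)
        then show ?thesis using False by (simp add: indicator_def)
      qed
    qed
    also have "\<dots> = ennreal (?d powr (1 - c)) * (\<integral>\<^sup>+ s. ennreal (s powr (B + 1 - 1)) * indicator {0..?d} s \<partial>lborel)
       + (\<integral>\<^sup>+ s. ennreal (s powr ((B + 2 - c) - 1)) * indicator {?d..} s \<partial>lborel)"
      by (subst nn_integral_add, simp, simp, subst nn_integral_cmult, simp_all)
    also have "\<dots> = ennreal (?d powr (1 - c) * (?d powr (B + 1) / (B + 1)) + ?d powr (B + 2 - c) / (- (B + 2 - c)))"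
      using nn_integral_powr_Icc[of "B + 1" ?d] nn_integral_powr_atLeast[of ?d "B + 2 - c"] d B
      by (simp add: ennreal_mult'[symmetric] ennreal_plus)
    also have "?d powr (1 - c) * (?d powr (B + 1) / (B + 1)) + ?d powr (B + 2 - c) / (- (B + 2 - c)) = L * ?d powr (B + 2 - c)"
    proof -
      have "?d powr (1 - c) * ?d powr (B + 1) = ?d powr (B + 2 - c)" by (simp add: powr_add[symmetric] algebra_simps)
      then show ?thesis by (simp add: L_def distrib_right)
    qed
    finally have "(\<integral>\<^sup>+ w. ennreal (defect w powr B / norm (1 - z * cnj w) powr c) \<partial>disc_measure)
      \<le> ennreal K * ennreal (L * ?d powr (B + 2 - c))" by (simp add: mult_left_mono)
    then show "(\<integral>\<^sup>+ w. ennreal (defect w powr B / norm (1 - z * cnj w) powr c) \<partial>disc_measure)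
      \<le> ennreal (K * L * ?d powr (B + 2 - c))" using K L by (simp add: ennreal_mult mult.assoc)
  qed (use K L in simp)
qed

text \<open>Lowering \<open>b\<close> and \<open>c\<close> by the same amount enlarges the kernel, because
  \<open>1 - \<bar>w\<bar>\<^sup>2 \<le> 2 \<bar>1 - z w*\<bar>\<close>.\<close>

lemma kernel_S_comparison:
  assumes z: "z \<in> unit_disc" and w: "w \<in> unit_disc" and bc: "b0 \<le> b" "c - c0 \<le> b - b0"
  shows "defect w powr b / norm (1 - z * cnj w) powr c
     \<le> 2 powr (2 * (b - b0) + c0 - c) * (defect w powr b0 / norm (1 - z * cnj w) powr c0)"
proof -
  let ?n = "norm (1 - z * cnj w)"
  have n0: "0 < ?n"
    using norm_mult_cnj_less[OF z w] norm_triangle_ineq2[of 1 "z * cnj w"] unfolding norm_one by linarith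
  have n2: "?n \<le> 2" using norm_triangle_ineq4[of 1 "z * cnj w"] norm_mult_cnj_less[OF z w] by simp
  have d: "0 < defect w" by (rule defect_pos[OF w])
  have "defect w = (1 + norm w) * (1 - norm w)" by (simp add: power2_eq_square algebra_simps)
  also have "\<dots> \<le> 2 * (1 - norm w)" using w by (intro mult_right_mono) (auto simp: unit_disc_def)
  also have "1 - norm w \<le> ?n"
  proof -
    have "norm (z * cnj w) \<le> norm w" using z by (simp add: norm_mult unit_disc_def mult_left_le_one_le)
    then show ?thesis using norm_triangle_ineq2[of 1 "z * cnj w"] unfolding norm_one by linarith
  qed
  finally have dn: "defect w \<le> 2 * ?n" by simp
  have "defect w powr b = defect w powr b0 * defect w powr (b - b0)" by (simp add: powr_add[symmetric])
  also have "\<dots> \<le> defect w powr b0 * (2 * ?n) powr (b - b0)"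
    using dn d bc by (intro mult_left_mono powr_mono2) auto
  also have "(2 * ?n) powr (b - b0) = 2 powr (b - b0) * ?n powr (b - b0)" by (rule powr_mult)
  finally have "defect w powr b / ?n powr c \<le> defect w powr b0 * (2 powr (b - b0) * ?n powr (b - b0)) / ?n powr c"
    by (rule divide_right_mono) simp
  also have "\<dots> = 2 powr (b - b0) * (defect w powr b0 / ?n powr c0) * ?n powr (b - b0 + c0 - c)"
    using n0 by (simp add: powr_diff powr_add field_simps)
  also have "\<dots> \<le> 2 powr (b - b0) * (defect w powr b0 / ?n powr c0) * 2 powr (b - b0 + c0 - c)"
    using n0 n2 bc by (intro mult_left_mono powr_mono2) auto
  also have "\<dots> = 2 powr (2 * (b - b0) + c0 - c) * (defect w powr b0 / ?n powr c0)"
  proof -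
    have "2 powr (b - b0) * 2 powr (b - b0 + c0 - c) = (2::real) powr (2 * (b - b0) + c0 - c)"
      by (simp add: powr_add[symmetric] algebra_simps)
    then show ?thesis by (simp add: mult_ac)
  qed
  finally show ?thesis .
qed

lemma borel_kernel_S [measurable]: "kernel (S_op a b c) z \<in> borel_measurable borel"
  using weighted_operator_borel_kernel[OF weighted_operator_S_op] by (simp add: borel_kernel_def)

section \<open>Reduction of parameters and the Schur test\<close>

text \<open>The kernels are positive, so their comparison carries over to the operators applied to
  |f|. A smaller a enlarges the weight, because the defect is at most 1. The lemma moves general
  parameters to ones with explicit integrals.\<close>

lemma weak_type_S_comparison:
  assumes q: "0 < q" and abc: "a0 \<le> a" "b0 \<le> b" "c - c0 \<le> b - b0"
    and S: "weak_type (S_op a0 b0 c0) p (ennreal q)"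
  shows "weak_type (S_op a b c) p (ennreal q)"
proof -
  let ?K = "S_op a b c" and ?M = "S_op a0 b0 c0"
  note K = weighted_operator_S_op[of a b c] and K0 = weighted_operator_S_op[of a0 b0 c0]
  define L where "L = (2::real) powr (2 * (b - b0) + c0 - c)"
  have L: "0 < L" by (simp add: L_def)
  obtain C where C0: "C \<ge> 0" and C: "\<And>f B. f \<in> borel_measurable borel \<Longrightarrow> B \<ge> 0 \<Longrightarrow> Lp_norm p f \<le> ennreal B \<Longrightarrow>
     converges_ae ?M f \<and> (\<forall>t>0. distr_fun (apply_op ?M f) t \<le> (C * B / t) powr q)"
    using S unfolding weak_type_weakly_bounded[OF K0 q] weakly_bounded_def by blast
  have "converges_ae ?K f \<and> (\<forall>t>0. distr_fun (apply_op ?K f) t \<le> (L * C * B / t) powr q)"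
    if f [measurable]: "f \<in> borel_measurable borel" and B: "B \<ge> 0" "Lp_norm p f \<le> ennreal B" for f B
  proof -
    let ?f = "\<lambda>w. complex_of_real (norm (f w))"
    have fm [measurable]: "?f \<in> borel_measurable borel" by measurable
    have "Lp_norm p ?f \<le> ennreal B" using B(2) unfolding Lp_norm_def by (simp only: norm_of_real abs_norm_cancel)
    note Cf = C[OF fm B(1) this]
    have int: "integrable disc_measure (\<lambda>w. kernel ?K z w * f w) \<and>
        norm (LINT w|disc_measure. kernel ?K z w * f w) \<le> L * norm (LINT w|disc_measure. kernel ?M z w * ?f w)"
      if z: "z \<in> unit_disc" and int0: "integrable disc_measure (\<lambda>w. kernel ?M z w * ?f w)" for z
    proof
      let ?k0 = "\<lambda>w. norm (kernel ?M z w * ?f w)"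
      have le: "AE w in disc_measure. norm (kernel ?K z w * f w) \<le> L * ?k0 w"
        using AE_disc_unit_disc
      proof eventually_elim
        case (elim w)
        have "norm (kernel ?K z w) \<le> L * norm (kernel ?M z w)"
          using kernel_S_comparison[OF z elim abc(2,3)] by (simp only: norm_kernel_S_op L_def)
        then show ?case unfolding norm_mult mult.assoc[symmetric]
          by (intro mult_mono mult_nonneg_nonneg) (use L in auto)
      qed
      have int0': "integrable disc_measure (\<lambda>w. L * ?k0 w)" using int0 by (intro integrable_mult_right integrable_norm) auto
      show int1: "integrable disc_measure (\<lambda>w. kernel ?K z w * f w)"
        by (rule Bochner_Integration.integrable_bound[OF int0']) (use le L in \<open>auto simp: abs_mult\<close>)
      have "norm (LINT w|disc_measure. kernel ?K z w * f w) \<le> (LINT w|disc_measure. norm (kernel ?K z w * f w))"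
        by (rule integral_norm_bound)
      also have "\<dots> \<le> (LINT w|disc_measure. L * ?k0 w)"
        by (rule integral_mono_AE[OF integrable_norm[OF int1] int0' le])
      also have "\<dots> = L * (LINT w|disc_measure. ?k0 w)" by simp
      also have "(LINT w|disc_measure. ?k0 w) = norm (LINT w|disc_measure. complex_of_real (?k0 w))"
        by (simp only: integral_complex_of_real norm_of_real) simp
      also have "(\<lambda>w. complex_of_real (?k0 w)) = (\<lambda>w. kernel ?M z w * ?f w)"
      proof -
        have key: "complex_of_real (norm (complex_of_real x * complex_of_real y)) = complex_of_real x * complex_of_real y"
          if "0 \<le> x" "0 \<le> y" for x y using that by (simp add: norm_mult)
        show ?thesis by (intro ext, unfold kernel_S_op, rule key) simp_all
      qed
      finally show "norm (LINT w|disc_measure. kernel ?K z w * f w) \<le> L * norm (LINT w|disc_measure. kernel ?M z w * ?f w)" .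
    qed
    note conv0 = Cf[THEN conjunct1, unfolded converges_ae_borel_iff[OF K0 fm]]
    have "converges_ae ?K f"
      unfolding converges_ae_borel_iff[OF K f] using conv0 AE_disc_unit_disc
      by eventually_elim (use int in blast)
    moreover have "distr_fun (apply_op ?K f) t \<le> (L * C * B / t) powr q" if t: "t > 0" for t
    proof -
      note [measurable] = borel_integral_kernel[OF K f] borel_integral_kernel[OF K0 fm]
      have "distr_fun (apply_op ?K f) t \<le> distr_fun (apply_op ?M ?f) (t / L)"
        unfolding distr_fun_weighted[OF K f] distr_fun_weighted[OF K0 fm]
      proof (rule disc.finite_measure_mono_AE)
        show "AE z in disc_measure. z \<in> {z. defect z powr a * norm (LINT w|disc_measure. kernel ?K z w * f w) > t} \<longrightarrow>
           z \<in> {z. defect z powr a0 * norm (LINT w|disc_measure. kernel ?M z w * ?f w) > t / L}"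
          using conv0 AE_disc_unit_disc
        proof eventually_elim
          case (elim z)
          have "defect z powr a \<le> defect z powr a0"
            using defect_pos[OF elim(2)] abc(1) by (intro powr_mono') auto
          then have "defect z powr a * norm (LINT w|disc_measure. kernel ?K z w * f w)
            \<le> defect z powr a0 * (L * norm (LINT w|disc_measure. kernel ?M z w * ?f w))"
            using int[OF elim(2,1)] by (intro mult_mono) auto
          then show ?case using L by (auto simp: pos_divide_less_eq mult_ac)
        qed
      qed measurable
      also have "\<dots> \<le> (C * B / (t / L)) powr q" using Cf[THEN conjunct2, rule_format, of "t / L"] t L by simp
      finally show ?thesis by (simp add: mult_ac)
    qed
    ultimately show ?thesis by blast
  qed
  moreover have "0 \<le> L * C" using L C0 by simp
  ultimately show ?thesis unfolding weak_type_weakly_bounded[OF K q] weakly_bounded_def by blast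
qed

lemma S_integrable_and_le:
  assumes f [measurable]: "f \<in> borel_measurable borel" and z: "z \<in> unit_disc"
    and le: "(\<integral>\<^sup>+ w. ennreal (defect w powr b / norm (1 - z * cnj w) powr c * norm (f w)) \<partial>disc_measure) \<le> X" and X: "X < \<infinity>"
  shows "integrable disc_measure (\<lambda>w. kernel (S_op a b c) z w * f w)"
    and "ennreal (norm (LINT w|disc_measure. kernel (S_op a b c) z w * f w)) \<le> X"
proof -
  have *: "(\<integral>\<^sup>+ w. ennreal (norm (kernel (S_op a b c) z w * f w)) \<partial>disc_measure) \<le> X"
    unfolding norm_mult norm_kernel_S_op by (rule le)
  show "integrable disc_measure (\<lambda>w. kernel (S_op a b c) z w * f w)"
    by (rule integrableI_bounded) (use * X in \<open>auto intro: le_less_trans\<close>)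
  show "ennreal (norm (LINT w|disc_measure. kernel (S_op a b c) z w * f w)) \<le> X"
    by (rule order_trans[OF integral_norm_bound_ennreal_any *])
qed

text \<open>The two integral bounds are the hypotheses of a Schur test with weights \<open>1\<close>.\<close>

lemma weak_type_S_Schur:
  assumes p: "1 < p" and q: "0 < q" "q < p" and c: "0 < c" and K: "0 < K1" "0 < K2"
    and J: "\<And>z w. z \<in> unit_disc \<Longrightarrow> w \<in> unit_disc \<Longrightarrow>
       (\<integral>\<^sup>+ v. ennreal (1 / norm (1 - v * (z * cnj w)) powr c) \<partial>circle_measure) \<le> ennreal (K1 * defect z powr - x)"
    and I: "\<And>z. z \<in> unit_disc \<Longrightarrow>
       (\<integral>\<^sup>+ w. ennreal (defect w powr (b * (p / (p - 1))) / norm (1 - z * cnj w) powr c) \<partial>disc_measure) \<le> ennreal (K2 * defect z powr - y)"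
    and xy: "x + (p - 1) * y = p * (a + 1 / q)"
  shows "weak_type (S_op a b c) (ennreal p) (ennreal q)"
proof -
  let ?K = "S_op a b c"
  note W = weighted_operator_S_op[of a b c]
  let ?p' = "p / (p - 1)"
  define C where "C = (2 powr p * K1 * K2 powr (p - 1)) powr (1 / p)"
  have Cp: "C powr p = 2 powr p * K1 * K2 powr (p - 1)" using K p by (simp add: C_def powr_powr)
  have C0: "0 \<le> C" by (simp add: C_def)
  have "converges_ae ?K f \<and> (\<forall>t>0. distr_fun (apply_op ?K f) t \<le> ((p / (p - q)) powr (1 / q) * C * B / t) powr q)"
    if f [measurable]: "f \<in> borel_measurable borel" and B: "B \<ge> 0" "Lp_norm (ennreal p) f \<le> ennreal B" for f B
  proof -
    have fB: "(\<integral>\<^sup>+ w. ennreal (norm (f w) powr p) \<partial>disc_measure) \<le> ennreal (B powr p)"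
      using B p by (subst Lp_norm_le_iff[symmetric]) auto
    define X where "X z = (\<integral>\<^sup>+ w. ennreal (norm (f w) powr p) * ennreal (1 / norm (1 - z * cnj w) powr c) \<partial>disc_measure)" for z
    have [measurable]: "X \<in> borel_measurable borel" unfolding X_def by measurable
    \<comment> \<open>Young's inequality instead of Hoelder's: the free factor \<kappa> will balance
      the two terms.\<close>
    have young: "(\<integral>\<^sup>+ w. ennreal (defect w powr b / norm (1 - z * cnj w) powr c * norm (f w)) \<partial>disc_measure)
        \<le> ennreal (\<kappa> powr p) * X z + ennreal (\<kappa> powr - ?p' * (K2 * defect z powr - y))"
      if z: "z \<in> unit_disc" and k: "0 < \<kappa>" for z \<kappa>
    proof -
      have "(\<integral>\<^sup>+ w. ennreal (defect w powr b / norm (1 - z * cnj w) powr c * norm (f w)) \<partial>disc_measure)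
        \<le> (\<integral>\<^sup>+ w. ennreal (\<kappa> powr p) * (ennreal (norm (f w) powr p) * ennreal (1 / norm (1 - z * cnj w) powr c))
           + ennreal (\<kappa> powr - ?p') * ennreal (defect w powr (b * ?p') / norm (1 - z * cnj w) powr c) \<partial>disc_measure)"
      proof (rule nn_integral_mono)
        fix w
        let ?n = "norm (1 - z * cnj w) powr c"
        have "(\<kappa> * norm (f w)) * (defect w powr b / \<kappa>) \<le> (\<kappa> * norm (f w)) powr p / p + (defect w powr b / \<kappa>) powr ?p' / ?p'"
          by (rule Youngs_inequality) (use p k in \<open>auto simp: field_simps\<close>)
        also have "\<dots> \<le> (\<kappa> * norm (f w)) powr p + (defect w powr b / \<kappa>) powr ?p'"
        proof (rule add_mono)
          have *: "r / s \<le> r" if "0 \<le> r" "1 \<le> s" for r s :: real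
            using that by (simp add: pos_divide_le_eq mult_le_cancel_left1)
          show "(\<kappa> * norm (f w)) powr p / p \<le> (\<kappa> * norm (f w)) powr p" by (rule *) (use p in auto)
          show "(defect w powr b / \<kappa>) powr ?p' / ?p' \<le> (defect w powr b / \<kappa>) powr ?p'"
            by (rule *) (use p in \<open>auto simp: field_simps\<close>)
        qed
        also have "\<dots> = \<kappa> powr p * norm (f w) powr p + \<kappa> powr - ?p' * defect w powr (b * ?p')"
          using k by (simp add: powr_mult powr_divide powr_powr powr_minus_divide)
        finally have "defect w powr b * norm (f w) \<le> \<kappa> powr p * norm (f w) powr p + \<kappa> powr - ?p' * defect w powr (b * ?p')"
          using k by (simp add: mult.commute)
        then have "defect w powr b * norm (f w) / ?n \<le> (\<kappa> powr p * norm (f w) powr p + \<kappa> powr - ?p' * defect w powr (b * ?p')) / ?n"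
          by (rule divide_right_mono) simp
        then have "defect w powr b / ?n * norm (f w) \<le> \<kappa> powr p * (norm (f w) powr p * (1 / ?n)) + \<kappa> powr - ?p' * (defect w powr (b * ?p') / ?n)"
          by (simp add: add_divide_distrib)
        from ennreal_leI[OF this]
        show "ennreal (defect w powr b / ?n * norm (f w)) \<le> ennreal (\<kappa> powr p) * (ennreal (norm (f w) powr p) * ennreal (1 / ?n))
           + ennreal (\<kappa> powr - ?p') * ennreal (defect w powr (b * ?p') / ?n)"
          by (subst (asm) ennreal_plus) (auto simp only: ennreal_mult powr_ge_zero mult_nonneg_nonneg divide_nonneg_nonneg zero_le_one)
      qed
      also have "\<dots> = ennreal (\<kappa> powr p) * X z + ennreal (\<kappa> powr - ?p') *
          (\<integral>\<^sup>+ w. ennreal (defect w powr (b * ?p') / norm (1 - z * cnj w) powr c) \<partial>disc_measure)"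
        unfolding X_def by (subst nn_integral_add, simp, simp, subst nn_integral_cmult, simp, subst nn_integral_cmult, simp_all)
      also have "\<dots> \<le> ennreal (\<kappa> powr p) * X z + ennreal (\<kappa> powr - ?p') * ennreal (K2 * defect z powr - y)"
        by (intro add_mono order_refl mult_left_mono I z) simp
      also have "ennreal (\<kappa> powr - ?p') * ennreal (K2 * defect z powr - y) = ennreal (\<kappa> powr - ?p' * (K2 * defect z powr - y))"
        using K by (intro ennreal_mult[symmetric]) auto
      finally show ?thesis .
    qed
    have X_avg: "(\<integral>\<^sup>+ v. X (v * z) \<partial>circle_measure) \<le> ennreal (B powr p * (K1 * defect z powr - x))" if z: "z \<in> unit_disc" for z
    proof -
      have "(\<integral>\<^sup>+ v. X (v * z) \<partial>circle_measure)
        = (\<integral>\<^sup>+ w. (\<integral>\<^sup>+ v. ennreal (norm (f w) powr p) * ennreal (1 / norm (1 - v * z * cnj w) powr c) \<partial>circle_measure) \<partial>disc_measure)"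
        unfolding X_def by (rule disc_circle.Fubini') measurable
      also have "\<dots> = (\<integral>\<^sup>+ w. ennreal (norm (f w) powr p) * (\<integral>\<^sup>+ v. ennreal (1 / norm (1 - v * (z * cnj w)) powr c) \<partial>circle_measure) \<partial>disc_measure)"
        by (simp add: nn_integral_cmult mult.assoc)
      also have "\<dots> \<le> (\<integral>\<^sup>+ w. ennreal (norm (f w) powr p) * ennreal (K1 * defect z powr - x) \<partial>disc_measure)"
        by (rule nn_integral_mono_AE) (use AE_disc_unit_disc in eventually_elim, intro mult_left_mono J z, simp_all)
      also have "\<dots> = (\<integral>\<^sup>+ w. ennreal (norm (f w) powr p) \<partial>disc_measure) * ennreal (K1 * defect z powr - x)"
        by (rule nn_integral_multc) measurable
      also have "\<dots> \<le> ennreal (B powr p) * ennreal (K1 * defect z powr - x)" by (rule mult_right_mono[OF fB]) simp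
      also have "\<dots> = ennreal (B powr p * (K1 * defect z powr - x))" using K by (intro ennreal_mult[symmetric]) auto
      finally show ?thesis .
    qed
    have X_fin: "X z < \<infinity>" if z: "z \<in> unit_disc" for z
    proof -
      have z1: "0 < 1 - norm z" using z by (simp add: unit_disc_def)
      have "X z \<le> (\<integral>\<^sup>+ w. ennreal (norm (f w) powr p) * ennreal (1 / (1 - norm z) powr c) \<partial>disc_measure)"
        unfolding X_def
      proof (rule nn_integral_mono_AE)
        show "AE w in disc_measure. ennreal (norm (f w) powr p) * ennreal (1 / norm (1 - z * cnj w) powr c)
          \<le> ennreal (norm (f w) powr p) * ennreal (1 / (1 - norm z) powr c)"
          using AE_disc_unit_disc
        proof eventually_elim
          case (elim w)
          have "(1 - norm z) powr c \<le> norm (1 - z * cnj w) powr c"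
            using norm_one_minus_ge[OF elim, of z] z1 c by (intro powr_mono2) auto
          then show ?case using z1 by (intro mult_left_mono ennreal_leI frac_le) auto
        qed
      qed
      also have "\<dots> = (\<integral>\<^sup>+ w. ennreal (norm (f w) powr p) \<partial>disc_measure) * ennreal (1 / (1 - norm z) powr c)"
        by (rule nn_integral_multc) measurable
      also have "\<dots> \<le> ennreal (B powr p) * ennreal (1 / (1 - norm z) powr c)" by (rule mult_right_mono[OF fB]) simp
      also have "\<dots> < \<infinity>" by (simp add: ennreal_mult_less_top)
      finally show ?thesis .
    qed
    have nn_fin: "ennreal (\<kappa> powr p) * X z + ennreal (\<kappa> powr - ?p' * (K2 * defect z powr - y)) < \<infinity>" if "z \<in> unit_disc" for z \<kappa>
      using X_fin[OF that] by (simp add: ennreal_mult_less_top)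
    have "converges_ae ?K f \<and> (\<forall>t>0. distr_fun (apply_op ?K f) t \<le> ((p / (p - q)) powr (1 / q) * (C * B) / t) powr q)"
    proof (rule weighted_operator_weak_bound[OF W f q])
      fix z :: complex assume z: "z \<in> unit_disc"
      show "integrable disc_measure (\<lambda>w. kernel ?K z w * f w)"
        by (rule S_integrable_and_le(1)[OF f z young[OF z zero_less_one] nn_fin[OF z]])
      fix t :: real assume t: "0 < t"
      have d: "0 < defect z" by (rule defect_pos[OF z])
      \<comment> \<open>With this choice the term without f equals t / 2, so an image above t forces
        the term with X to exceed t / 2, and Markov's inequality applies to its circle mean.\<close>
      define Y where "Y = 2 * K2 * defect z powr - y / t"
      have Y: "0 < Y" using K d t by (simp add: Y_def)
      define \<kappa> where "\<kappa> = Y powr (1 / ?p')"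
      have \<kappa>: "0 < \<kappa>" using Y by (simp add: \<kappa>_def)
      have k1: "\<kappa> powr - ?p' * (K2 * defect z powr - y) = t / 2"
      proof -
        have "\<kappa> powr - ?p' = 1 / Y" using Y p by (simp add: \<kappa>_def powr_powr powr_minus_divide)
        then show ?thesis using K d t by (simp add: Y_def)
      qed
      have k2: "\<kappa> powr p = Y powr (p - 1)" using Y p by (simp add: \<kappa>_def powr_powr)
      have "emeasure circle_measure {v. norm (LINT w|disc_measure. kernel ?K (v * z) w * f w) > t}
        \<le> emeasure circle_measure {v\<in>UNIV. 1 \<le> ennreal (2 / t * \<kappa> powr p) * X (v * z)}"
      proof (rule emeasure_mono_AE)
        show "AE v in circle_measure. v \<in> {v. norm (LINT w|disc_measure. kernel ?K (v * z) w * f w) > t} \<longrightarrow>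
           v \<in> {v\<in>UNIV. 1 \<le> ennreal (2 / t * \<kappa> powr p) * X (v * z)}"
          using AE_circle_norm
        proof eventually_elim
          case (elim v)
          have vz: "v * z \<in> unit_disc" using z elim by (simp add: unit_disc_def norm_mult)
          have dv: "defect (v * z) = defect z" using elim by (simp add: norm_mult)
          define r where "r = enn2real (X (v * z))"
          have r: "X (v * z) = ennreal r" "0 \<le> r" using X_fin[OF vz] by (auto simp: r_def)
          have "ennreal (norm (LINT w|disc_measure. kernel ?K (v * z) w * f w)) \<le> ennreal (\<kappa> powr p) * ennreal r + ennreal (t / 2)"
            using S_integrable_and_le(2)[OF f vz young[OF vz \<kappa>] nn_fin[OF vz]] unfolding dv k1 r(1) .
          also have "\<dots> = ennreal (\<kappa> powr p * r + t / 2)" using r t by (simp add: ennreal_mult ennreal_plus)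
          finally have le: "norm (LINT w|disc_measure. kernel ?K (v * z) w * f w) \<le> \<kappa> powr p * r + t / 2"
            using r t by (subst (asm) ennreal_le_iff) auto
          show ?case
          proof (intro impI)
            assume "v \<in> {v. norm (LINT w|disc_measure. kernel ?K (v * z) w * f w) > t}"
            then have "1 \<le> 2 / t * \<kappa> powr p * r" using le t by (simp add: field_simps)
            then have "1 \<le> ennreal (2 / t * \<kappa> powr p * r)" by (simp only: ennreal_ge_1)
            also have "\<dots> = ennreal (2 / t * \<kappa> powr p) * X (v * z)"
              unfolding r(1) using r t by (intro ennreal_mult) auto
            finally show "v \<in> {v\<in>UNIV. 1 \<le> ennreal (2 / t * \<kappa> powr p) * X (v * z)}" by blast
          qed
        qed
      qed measurable
      also have "\<dots> \<le> ennreal (2 / t * \<kappa> powr p) * (\<integral>\<^sup>+ v. X (v * z) * indicator UNIV v \<partial>circle_measure)"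
        by (rule nn_integral_Markov_inequality) auto
      also have "\<dots> \<le> ennreal (2 / t * \<kappa> powr p) * ennreal (B powr p * (K1 * defect z powr - x))"
        using X_avg[OF z] by (simp add: mult_left_mono)
      also have "\<dots> = ennreal (2 / t * \<kappa> powr p * (B powr p * (K1 * defect z powr - x)))"
        using t K by (intro ennreal_mult[symmetric]) auto
      also have "2 / t * \<kappa> powr p * (B powr p * (K1 * defect z powr - x)) = (C * B * defect z powr - (a + 1 / q) / t) powr p"
      proof -
        have f1: "\<kappa> powr p = 2 powr (p - 1) * K2 powr (p - 1) * defect z powr (- y * (p - 1)) / t powr (p - 1)"
          unfolding k2 Y_def using t K d by (simp add: powr_mult powr_divide powr_powr)
        \<comment> \<open>The relation \<open>xy\<close> says that the powers of the defect from
          both Schur integrals combine to the one matching the weight a.\<close>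
        have f2: "defect z powr (- y * (p - 1)) * defect z powr - x = defect z powr (- (a + 1 / q) * p)"
        proof -
          have "- y * (p - 1) + - x = - (a + 1 / q) * p" using xy by (simp add: algebra_simps)
          then show ?thesis by (simp only: powr_add[symmetric])
        qed
        have f3: "2 * 2 powr (p - 1) = (2::real) powr p" using powr_add[of 2 1 "p - 1"] by simp
        have f4: "t * t powr (p - 1) = t powr p" using powr_add[of t 1 "p - 1"] t by simp
        have f5: "(C * B * defect z powr - (a + 1 / q) / t) powr p
           = C powr p * B powr p * defect z powr (- (a + 1 / q) * p) / t powr p"
          using t by (simp add: powr_mult powr_divide powr_powr)
        have "2 / t * (A * W * D1 / T) * (Bp * (K1 * D2)) = (2 * A) * K1 * W * Bp * (D1 * D2) / (t * T)"
          for A W D1 T Bp D2 :: real by simp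
        then show ?thesis unfolding f1 f5 Cp f2[symmetric] f3[symmetric] f4[symmetric] .
      qed
      finally show "measure circle_measure {v. norm (LINT w|disc_measure. kernel ?K (v * z) w * f w) > t}
        \<le> (C * B * defect z powr - (a + 1 / q) / t) powr p"
        by (simp add: circle.emeasure_eq_measure)
    qed (use B C0 in auto)
    then show ?thesis by (simp add: mult.assoc)
  qed
  moreover have "0 \<le> (p / (p - q)) powr (1 / q) * C" using C0 by simp
  ultimately show ?thesis unfolding weak_type_weakly_bounded[OF W q(1)] weakly_bounded_def by blast
qed

text \<open>If c - 1 < \<beta>, the parameters are lowered to a = -1/q and a kernel exponent below
  1, where both Schur integrals are bounded. Otherwise \<alpha> > 0 by \<open>crit\<close>; then
  \<beta> is replaced by a small h, with c0 - 1 = \<alpha> + h on the boundary of the admissible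
  range.\<close>

theorem weak_type_S_sufficient:
  fixes p q a b c :: real
  assumes p: "1 < p" and q: "0 < q" "q < p"
    and \<alpha>: "0 \<le> a + 1 / q" and \<beta>: "0 < b + 1 - 1 / p" and c: "c - 1 \<le> (a + 1 / q) + (b + 1 - 1 / p)"
    and crit: "\<not> (a + 1 / q = 0 \<and> c - 1 = b + 1 - 1 / p)"
  shows "weak_type (S_op a b c) (ennreal p) (ennreal q)"
proof -
  define \<alpha> where "\<alpha> = a + 1 / q"
  define \<beta> where "\<beta> = b + 1 - 1 / p"
  let ?p' = "p / (p - 1)"
  have p': "1 < ?p'" "(p - 1) * ?p' = p" using p by (auto simp: field_simps)
  have bp': "(x - 1 + 1 / p) * ?p' = x * ?p' - 1" for x
  proof -
    have "(- 1 + 1 / p) * ?p' = - 1" using p by (simp add: field_simps)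
    moreover have "(x - 1 + 1 / p) * ?p' = x * ?p' + (- 1 + 1 / p) * ?p'"
      by (simp only: distrib_right[symmetric]) simp
    ultimately show ?thesis by linarith
  qed
  show ?thesis
  proof (cases "c - 1 < \<beta>")
    case True
    \<comment> \<open>The midpoint between max 0 (c - 1) and \<beta>: e < \<beta> keeps the power of
      the defect integrable, and e > c - 1 brings the kernel exponent below 1.\<close>
    define e where "e = (max 0 (c - 1) + \<beta>) / 2"
    define c0 where "c0 = max (c - e) (1 / 2)"
    have e: "0 < e" "e < \<beta>" "c - e < 1" using True \<beta> by (auto simp: e_def \<beta>_def max_def field_simps)
    have c0: "0 < c0" "c0 < 1" using e by (auto simp: c0_def)
    have B: "-1 < (b - e) * ?p'"
    proof -
      have "(b - e) * ?p' = (\<beta> - e) * ?p' - 1" using bp'[of "\<beta> - e"] by (simp add: \<beta>_def)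
      moreover have "0 < (\<beta> - e) * ?p'" using e p' by (intro mult_pos_pos) auto
      ultimately show ?thesis by linarith
    qed
    obtain K1 where K1: "0 < K1" "\<And>x. norm x < 1 \<Longrightarrow> (\<integral>\<^sup>+ v. ennreal (1 / norm (1 - v * x) powr c0) \<partial>circle_measure) \<le> ennreal K1"
      using circle_kernel_bounded[OF c0] by blast
    obtain K2 where K2: "0 < K2" "\<And>z. z \<in> unit_disc \<Longrightarrow>
       (\<integral>\<^sup>+ w. ennreal (defect w powr ((b - e) * ?p') / norm (1 - z * cnj w) powr c0) \<partial>disc_measure) \<le> ennreal K2"
      using forelli_rudin_bounded[OF c0 B] by blast
    have one: "defect z powr - 0 = 1" if "z \<in> unit_disc" for z using defect_pos[OF that] by simp
    have "weak_type (S_op (- 1 / q) (b - e) c0) (ennreal p) (ennreal q)"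
      by (rule weak_type_S_Schur[OF p q c0(1) K1(1) K2(1), where x=0 and y=0])
         (simp_all only: one mult_1_right K1(2) K2(2) norm_mult_cnj_less, simp)
    then show ?thesis
      by (rule weak_type_S_comparison[OF q(1), rotated 3]) (use \<alpha> e in \<open>auto simp: c0_def\<close>)
  next
    case False
    have \<alpha>0: "0 < \<alpha>" using False c crit \<alpha> by (auto simp: \<alpha>_def \<beta>_def)
    \<comment> \<open>The choice gives h p' < \<alpha>, which implies the growth condition B + 2 <
      c0 for B = b0 p'.\<close>
    define h where "h = min \<beta> (\<alpha> / (2 * ?p'))"
    have h: "0 < h" "h \<le> \<beta>" "h * ?p' < \<alpha>"
    proof -
      have "0 < \<alpha> / (2 * ?p')" by (intro divide_pos_pos mult_pos_pos \<alpha>0) (use p in simp_all)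
      then show "0 < h" "h \<le> \<beta>" using \<beta> unfolding h_def \<beta>_def by auto
      have "h * ?p' \<le> \<alpha> / (2 * ?p') * ?p'" using p' by (intro mult_right_mono) (auto simp: h_def)
      also have "\<dots> = \<alpha> / 2"
      proof -
        have "\<alpha> / (2 * r) * r = \<alpha> / 2" if "1 < r" for r using that by simp
        then show ?thesis using p'(1) by blast
      qed
      finally show "h * ?p' < \<alpha>" using \<alpha>0 by linarith
    qed
    define c0 where "c0 = 1 + \<alpha> + h"
    define b0 where "b0 = b - (\<beta> - h)"
    have c0: "1 < c0" using \<alpha>0 h by (simp add: c0_def)
    have b0: "b0 * ?p' = h * ?p' - 1"
    proof -
      have "b0 = h - 1 + 1 / p" by (simp add: b0_def \<beta>_def)
      then show ?thesis using bp'[of h] by (simp only:)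
    qed
    have B: "-1 < b0 * ?p'" "b0 * ?p' + 2 < c0" using b0 h p' mult_pos_pos[of h ?p'] by (auto simp: c0_def)
    obtain K1 where K1: "0 < K1" "\<And>x. norm x < 1 \<Longrightarrow>
       (\<integral>\<^sup>+ v. ennreal (1 / norm (1 - v * x) powr c0) \<partial>circle_measure) \<le> ennreal (K1 * (1 - (norm x)\<^sup>2) powr (1 - c0))"
      using circle_kernel_growth[OF c0] by blast
    obtain K2 where K2: "0 < K2" "\<And>z. z \<in> unit_disc \<Longrightarrow>
       (\<integral>\<^sup>+ w. ennreal (defect w powr (b0 * ?p') / norm (1 - z * cnj w) powr c0) \<partial>disc_measure) \<le> ennreal (K2 * defect z powr (b0 * ?p' + 2 - c0))"
      using forelli_rudin_growth[OF B] by blast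
    have "weak_type (S_op a b0 c0) (ennreal p) (ennreal q)"
    proof (rule weak_type_S_Schur[OF p q _ K1(1) K2(1), where x="c0 - 1" and y="c0 - b0 * ?p' - 2"])
      show "0 < c0" using c0 by simp
    next
      fix z w assume z: "z \<in> unit_disc" and w: "w \<in> unit_disc"
      have "(\<integral>\<^sup>+ v. ennreal (1 / norm (1 - v * (z * cnj w)) powr c0) \<partial>circle_measure) \<le> ennreal (K1 * (1 - (norm (z * cnj w))\<^sup>2) powr (1 - c0))"
        by (rule K1(2)[OF norm_mult_cnj_less[OF z w]])
      also have "\<dots> \<le> ennreal (K1 * defect z powr - (c0 - 1))"
        using K1 defect_pos[OF z] defect_mult_ge(1)[OF z w] c0 by (auto intro!: ennreal_leI mult_left_mono powr_mono2')
      finally show "(\<integral>\<^sup>+ v. ennreal (1 / norm (1 - v * (z * cnj w)) powr c0) \<partial>circle_measure) \<le> ennreal (K1 * defect z powr - (c0 - 1))" .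
    next
      fix z assume z: "z \<in> unit_disc"
      have "b0 * ?p' + 2 - c0 = - (c0 - b0 * ?p' - 2)" by simp
      with K2(2)[OF z] show "(\<integral>\<^sup>+ w. ennreal (defect w powr (b0 * ?p') / norm (1 - z * cnj w) powr c0) \<partial>disc_measure)
         \<le> ennreal (K2 * defect z powr - (c0 - b0 * ?p' - 2))" by (simp only:)
    next
      have "(c0 - 1) + (p - 1) * (c0 - b0 * ?p' - 2) = p * \<alpha> + p * h - h * ((p - 1) * ?p')"
        unfolding b0 c0_def by (simp only: algebra_simps)
      then show "(c0 - 1) + (p - 1) * (c0 - b0 * ?p' - 2) = p * (a + 1 / q)"
        unfolding p'(2) by (simp add: \<alpha>_def mult.commute)
    qed
    then show ?thesis
      by (rule weak_type_S_comparison[OF q(1), rotated 3]) (use c h in \<open>auto simp: b0_def c0_def \<alpha>_def \<beta>_def\<close>)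
  qed
qed

section \<open>Sufficiency at p = infinity\<close>

text \<open>For bounded f the image has a pointwise bound R that depends on the radius alone. The
  share of a circle above level t is then 0 for t > R and at most 1 otherwise, and such a step
  satisfies the circle bound with every positive exponent; q + 1 is one above q.\<close>

lemma weak_type_S_infinity_Schur:
  assumes q: "0 < q" and K2: "0 < K2"
    and I: "\<And>z. z \<in> unit_disc \<Longrightarrow>
       (\<integral>\<^sup>+ w. ennreal (defect w powr b / norm (1 - z * cnj w) powr c) \<partial>disc_measure) \<le> ennreal (K2 * defect z powr - (a + 1 / q))"
  shows "weak_type (S_op a b c) \<infinity> (ennreal q)"
proof -
  let ?K = "S_op a b c"
  note W = weighted_operator_S_op[of a b c]
  let ?s = "q + 1"
  have "converges_ae ?K f \<and> (\<forall>t>0. distr_fun (apply_op ?K f) t \<le> ((?s / (?s - q)) powr (1 / q) * K2 * B / t) powr q)"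
    if f [measurable]: "f \<in> borel_measurable borel" and B: "B \<ge> 0" "Lp_norm \<infinity> f \<le> ennreal B" for f B
  proof -
    have fB: "AE w in disc_measure. norm (f w) \<le> B" using B Lp_norm_infinity_le_iff[OF f] by blast
    have le: "(\<integral>\<^sup>+ w. ennreal (defect w powr b / norm (1 - z * cnj w) powr c * norm (f w)) \<partial>disc_measure)
       \<le> ennreal (K2 * defect z powr - (a + 1 / q) * B)" if z: "z \<in> unit_disc" for z
    proof -
      have "(\<integral>\<^sup>+ w. ennreal (defect w powr b / norm (1 - z * cnj w) powr c * norm (f w)) \<partial>disc_measure)
        \<le> (\<integral>\<^sup>+ w. ennreal (defect w powr b / norm (1 - z * cnj w) powr c) * ennreal B \<partial>disc_measure)"
      proof (rule nn_integral_mono_AE)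
        show "AE w in disc_measure. ennreal (defect w powr b / norm (1 - z * cnj w) powr c * norm (f w))
           \<le> ennreal (defect w powr b / norm (1 - z * cnj w) powr c) * ennreal B"
          using fB B(1) by (auto elim!: eventually_mono simp: ennreal_mult[symmetric] simp del: times_divide_eq_left intro!: ennreal_leI mult_left_mono)
      qed
      also have "\<dots> = (\<integral>\<^sup>+ w. ennreal (defect w powr b / norm (1 - z * cnj w) powr c) \<partial>disc_measure) * ennreal B"
        by (rule nn_integral_multc) measurable
      also have "\<dots> \<le> ennreal (K2 * defect z powr - (a + 1 / q)) * ennreal B" by (rule mult_right_mono[OF I[OF z]]) simp
      also have "\<dots> = ennreal (K2 * defect z powr - (a + 1 / q) * B)" using K2 B by (intro ennreal_mult[symmetric]) auto
      finally show ?thesis .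
    qed
    have "converges_ae ?K f \<and> (\<forall>t>0. distr_fun (apply_op ?K f) t \<le> ((?s / (?s - q)) powr (1 / q) * (K2 * B) / t) powr q)"
    proof (rule weighted_operator_weak_bound[OF W f])
      fix z :: complex assume z: "z \<in> unit_disc"
      show "integrable disc_measure (\<lambda>w. kernel ?K z w * f w)"
        by (rule S_integrable_and_le(1)[OF f z le[OF z]]) simp
      fix t :: real assume t: "0 < t"
      let ?R = "K2 * B * defect z powr - (a + 1 / q)"
      show "measure circle_measure {v. norm (LINT w|disc_measure. kernel ?K (v * z) w * f w) > t} \<le> (?R / t) powr ?s"
      proof (cases "t \<le> ?R")
        case True
        then have "1 powr ?s \<le> (?R / t) powr ?s" using t q by (intro powr_mono2) auto
        then show ?thesis using order_trans[OF circle.prob_le_1] by simp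
      next
        case False
        have "AE v in circle_measure. \<not> t < norm (LINT w|disc_measure. kernel ?K (v * z) w * f w)"
          using AE_circle_norm
        proof eventually_elim
          case (elim v)
          have vz: "v * z \<in> unit_disc" using z elim by (simp add: unit_disc_def norm_mult)
          have dv: "defect (v * z) = defect z" using elim by (simp add: norm_mult)
          have "ennreal (norm (LINT w|disc_measure. kernel ?K (v * z) w * f w)) \<le> ennreal (K2 * defect z powr - (a + 1 / q) * B)"
            using S_integrable_and_le(2)[OF f vz le[OF vz]] unfolding dv by simp
          then have "norm (LINT w|disc_measure. kernel ?K (v * z) w * f w) \<le> K2 * defect z powr - (a + 1 / q) * B"
            using K2 B by (subst (asm) ennreal_le_iff) auto
          then show ?case using False by (simp add: mult_ac)
        qed
        then have "measure circle_measure {v. norm (LINT w|disc_measure. kernel ?K (v * z) w * f w) > t} = 0"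
          using circle.finite_measure_mono_AE[of "{v. norm (LINT w|disc_measure. kernel ?K (v * z) w * f w) > t}" "{}"]
          by (simp add: measure_le_0_iff)
        then show ?thesis by simp
      qed
    qed (use q B K2 in auto)
    then show ?thesis by (simp add: mult.assoc)
  qed
  moreover have "0 \<le> (?s / (?s - q)) powr (1 / q) * K2" using K2 by simp
  ultimately show ?thesis unfolding weak_type_weakly_bounded[OF W q] weakly_bounded_def by blast
qed

text \<open>The case distinction of \<open>weak_type_S_sufficient\<close> with 1/p = 0. As f enters
  only through its supremum, one Forelli-Rudin integral suffices, and in the second case b can be
  kept while c is raised to the boundary of its range.\<close>

theorem weak_type_S_infinity_sufficient:
  fixes q a b c :: real
  assumes q: "0 < q"
    and \<alpha>: "0 \<le> a + 1 / q" and \<beta>: "0 < b + 1" and c: "c - 1 \<le> (a + 1 / q) + (b + 1)"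
    and crit: "\<not> (a + 1 / q = 0 \<and> c - 1 = b + 1)"
  shows "weak_type (S_op a b c) \<infinity> (ennreal q)"
proof (cases "c - 1 < b + 1")
  case True
  define e where "e = (max 0 (c - 1) + (b + 1)) / 2"
  define c0 where "c0 = max (c - e) (1 / 2)"
  have e: "0 < e" "e < b + 1" "c - e < 1" using True \<beta> by (auto simp: e_def max_def field_simps)
  have c0: "0 < c0" "c0 < 1" using e by (auto simp: c0_def)
  have B: "-1 < b - e" using e by simp
  obtain K2 where K2: "0 < K2" "\<And>z. z \<in> unit_disc \<Longrightarrow>
     (\<integral>\<^sup>+ w. ennreal (defect w powr (b - e) / norm (1 - z * cnj w) powr c0) \<partial>disc_measure) \<le> ennreal K2"
    using forelli_rudin_bounded[OF c0 B] by blast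
  have one: "defect z powr - (- 1 / q + 1 / q) = 1" if "z \<in> unit_disc" for z using defect_pos[OF that] by simp
  have "weak_type (S_op (- 1 / q) (b - e) c0) \<infinity> (ennreal q)"
    by (rule weak_type_S_infinity_Schur[OF q K2(1)]) (simp only: one mult_1_right K2(2))
  then show ?thesis
    by (rule weak_type_S_comparison[OF q, rotated 3]) (use \<alpha> e in \<open>auto simp: c0_def\<close>)
next
  case False
  define \<alpha> where "\<alpha> = a + 1 / q"
  have \<alpha>0: "0 < \<alpha>" using False c crit \<alpha> by (auto simp: \<alpha>_def)
  define c0 where "c0 = 1 + \<alpha> + (b + 1)"
  have B: "-1 < b" "b + 2 < c0" using \<beta> \<alpha>0 by (auto simp: c0_def)
  obtain K2 where K2: "0 < K2" "\<And>z. z \<in> unit_disc \<Longrightarrow>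
     (\<integral>\<^sup>+ w. ennreal (defect w powr b / norm (1 - z * cnj w) powr c0) \<partial>disc_measure) \<le> ennreal (K2 * defect z powr (b + 2 - c0))"
    using forelli_rudin_growth[OF B] by blast
  have e: "b + 2 - c0 = - (a + 1 / q)" by (simp add: c0_def \<alpha>_def)
  have "weak_type (S_op a b c0) \<infinity> (ennreal q)"
    by (rule weak_type_S_infinity_Schur[OF q K2(1)]) (simp only: e[symmetric] K2(2))
  then show ?thesis
    by (rule weak_type_S_comparison[OF q, rotated 3]) (use c in \<open>auto simp: c0_def \<alpha>_def\<close>)
qed

section \<open>Lacunary polynomials on the circle\<close>

text \<open>Equal exponents are allowed, because in the fourth moment the indices are pairs whose
  frequencies may coincide.\<close>

lemma circle_finite_square:
  fixes a :: "'i \<Rightarrow> complex" and n :: "'i \<Rightarrow> nat"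
  assumes "finite I"
  shows "complex_of_real (LINT v|circle_measure. (norm (\<Sum>i\<in>I. a i * v ^ n i))\<^sup>2)
     = (\<Sum>i\<in>I. \<Sum>l\<in>I. if n i = n l then a i * cnj (a l) else 0)"
proof -
  have int: "integrable circle_measure (\<lambda>v. v ^ k * cnj v ^ l)" for k l
    by (rule integrable_circle_bounded[where B=1]) (auto simp: norm_mult norm_power)
  have eq: "complex_of_real ((norm (\<Sum>i\<in>I. a i * v ^ n i))\<^sup>2)
      = (\<Sum>i\<in>I. \<Sum>l\<in>I. (a i * cnj (a l)) * (v ^ n i * cnj v ^ n l))" for v
  proof -
    have "complex_of_real ((norm (\<Sum>i\<in>I. a i * v ^ n i))\<^sup>2) = (\<Sum>i\<in>I. a i * v ^ n i) * (\<Sum>l\<in>I. cnj (a l) * cnj v ^ n l)"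
      unfolding complex_norm_square by simp
    then show ?thesis by (simp add: sum_product mult_ac)
  qed
  have "complex_of_real (LINT v|circle_measure. (norm (\<Sum>i\<in>I. a i * v ^ n i))\<^sup>2)
     = (LINT v|circle_measure. (\<Sum>i\<in>I. \<Sum>l\<in>I. (a i * cnj (a l)) * (v ^ n i * cnj v ^ n l)))"
    unfolding eq[symmetric] by (rule integral_complex_of_real[symmetric])
  also have "\<dots> = (\<Sum>i\<in>I. \<Sum>l\<in>I. (a i * cnj (a l)) * (LINT v|circle_measure. v ^ n i * cnj v ^ n l))"
    using int by simp
  also have "\<dots> = (\<Sum>i\<in>I. \<Sum>l\<in>I. if n i = n l then a i * cnj (a l) else 0)"
    by (intro sum.cong refl) (simp add: circle_orthogonal)
  finally show ?thesis .
qed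

text \<open>Powers of 2 form a Sidon set. The larger exponents agree, since 2^l + 2^m is at most
  2^(max l m + 1), and then so do the smaller ones.\<close>

lemma sum_two_powers_eq:
  fixes j k l m :: nat
  assumes "(2::nat) ^ j + 2 ^ k = 2 ^ l + 2 ^ m"
  shows "(l = j \<and> m = k) \<or> (l = k \<and> m = j)"
proof -
  have aux: "\<not> max l m < max j k" if eq: "(2::nat) ^ j + 2 ^ k = 2 ^ l + 2 ^ m" for j k l m :: nat
  proof
    assume lt: "max l m < max j k"
    have "(2::nat) ^ l \<le> 2 ^ max l m" "(2::nat) ^ m \<le> 2 ^ max l m" by (simp_all add: power_increasing)
    from add_mono[OF this] have "(2::nat) ^ l + 2 ^ m \<le> 2 ^ Suc (max l m)" by simp
    also have "\<dots> \<le> 2 ^ max j k" using lt by (intro power_increasing) auto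
    also have "\<dots> < 2 ^ j + 2 ^ k" by (simp add: max_def)
    finally show False using eq by simp
  qed
  have M: "max j k = max l m" using aux[OF assms] aux[OF assms[symmetric]] by linarith
  have s: "(2::nat) ^ j + 2 ^ k = 2 ^ max j k + 2 ^ min j k" for j k :: nat by (simp add: max_def min_def)
  have "(2::nat) ^ min j k = 2 ^ min l m" using assms s[of j k] s[of l m] M by simp
  then have "min j k = min l m" by simp
  with M show ?thesis by (auto simp: max_def min_def split: if_splits)
qed

text \<open>The square of the polynomial is a sum over pairs, and the frequency 2^j + 2^k is
  attained only by (j, k) and its swap. Each row of the double sum thus has at most two entries,
  which gives the factor 2.\<close>

lemma lacunary_moments:
  fixes a :: "nat \<Rightarrow> complex"
  assumes J: "finite J"
  defines "X \<equiv> \<Sum>j\<in>J. (norm (a j))\<^sup>2"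
  shows "(LINT v|circle_measure. (norm (\<Sum>j\<in>J. a j * v ^ (2 ^ j)))\<^sup>2) = X"
    and "(LINT v|circle_measure. (norm (\<Sum>j\<in>J. a j * v ^ (2 ^ j))) ^ 4) \<le> 2 * X\<^sup>2"
proof -
  have "complex_of_real (LINT v|circle_measure. (norm (\<Sum>j\<in>J. a j * v ^ (2 ^ j)))\<^sup>2)
     = (\<Sum>i\<in>J. \<Sum>l\<in>J. if (2::nat) ^ i = 2 ^ l then a i * cnj (a l) else 0)"
    by (rule circle_finite_square[OF J])
  also have "\<dots> = (\<Sum>i\<in>J. a i * cnj (a i))" using J by (simp add: sum.delta)
  also have "\<dots> = complex_of_real X" unfolding X_def of_real_sum complex_norm_square ..
  finally show "(LINT v|circle_measure. (norm (\<Sum>j\<in>J. a j * v ^ (2 ^ j)))\<^sup>2) = X" by (simp only: of_real_eq_iff)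
  define A where "A P = a (fst P) * a (snd P)" for P
  define n where "n P = (2::nat) ^ fst P + 2 ^ snd P" for P :: "nat \<times> nat"
  let ?I = "J \<times> J"
  have sq: "(\<Sum>j\<in>J. a j * v ^ (2 ^ j))\<^sup>2 = (\<Sum>P\<in>?I. A P * v ^ n P)" for v
    unfolding power2_eq_square sum_product sum.cartesian_product A_def n_def
    by (intro sum.cong refl) (simp add: power_add mult_ac split: prod.split)
  have X2: "(\<Sum>P\<in>?I. (norm (A P))\<^sup>2) = X\<^sup>2"
    unfolding X_def power2_eq_square[of "sum _ _"] sum_product sum.cartesian_product A_def
    by (intro sum.cong refl) (simp add: norm_mult power_mult_distrib split: prod.split)
  have nA: "norm (A Q) = norm (A P) \<and> Q \<in> {P, prod.swap P}" if "n P = n Q" for P Q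
  proof -
    obtain j k l m where PQ: "P = (j, k)" "Q = (l, m)" by (cases P; cases Q)
    have "(l = j \<and> m = k) \<or> (l = k \<and> m = j)"
      by (rule sum_two_powers_eq) (use that in \<open>simp add: PQ n_def\<close>)
    then show ?thesis by (auto simp: PQ A_def norm_mult mult.commute)
  qed
  have four: "(LINT v|circle_measure. (norm (\<Sum>j\<in>J. a j * v ^ (2 ^ j))) ^ 4)
      = (LINT v|circle_measure. (norm (\<Sum>P\<in>?I. A P * v ^ n P))\<^sup>2)"
    unfolding sq[symmetric] by (simp add: norm_power power_mult[symmetric])
  have "(LINT v|circle_measure. (norm (\<Sum>j\<in>J. a j * v ^ (2 ^ j))) ^ 4)
     \<le> norm (complex_of_real (LINT v|circle_measure. (norm (\<Sum>P\<in>?I. A P * v ^ n P))\<^sup>2))"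
    unfolding four norm_of_real by simp
  also have "\<dots> = norm (\<Sum>P\<in>?I. \<Sum>Q\<in>?I. if n P = n Q then A P * cnj (A Q) else 0)"
    by (subst circle_finite_square) (use J in auto)
  also have "\<dots> \<le> (\<Sum>P\<in>?I. 2 * (norm (A P))\<^sup>2)"
  proof (intro sum_norm_le)
    fix P assume "P \<in> ?I"
    let ?S = "{Q \<in> ?I. n P = n Q}"
    have S: "?S \<subseteq> {P, prod.swap P}" using nA by blast
    have "card ?S \<le> card {P, prod.swap P}" by (rule card_mono[OF _ S]) simp
    also have "\<dots> \<le> 2" by (simp add: card_insert_if)
    finally have card: "card ?S \<le> 2" .
    have eq: "(\<Sum>Q\<in>?I. if n P = n Q then A P * cnj (A Q) else 0) = (\<Sum>Q\<in>?S. A P * cnj (A Q))"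
      by (rule sum.inter_filter[where A="?I" and P="\<lambda>Q. n P = n Q" and g="\<lambda>Q. A P * cnj (A Q)", OF finite_cartesian_product[OF J J], symmetric])
    have "norm (\<Sum>Q\<in>?S. A P * cnj (A Q)) \<le> (\<Sum>Q\<in>?S. (norm (A P))\<^sup>2)"
    proof (rule sum_norm_le)
      fix Q assume "Q \<in> ?S"
      then have "norm (A Q) = norm (A P)" using nA[of P Q] by blast
      then show "norm (A P * cnj (A Q)) \<le> (norm (A P))\<^sup>2" by (simp add: norm_mult power2_eq_square)
    qed
    also have "\<dots> = real (card ?S) * (norm (A P))\<^sup>2" by simp
    also have "\<dots> \<le> 2 * (norm (A P))\<^sup>2" using card by (intro mult_right_mono) auto
    finally show "norm (\<Sum>Q\<in>?I. if n P = n Q then A P * cnj (A Q) else 0) \<le> 2 * (norm (A P))\<^sup>2"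
      unfolding eq .
  qed
  also have "\<dots> = 2 * X\<^sup>2" by (simp only: X2 sum_distrib_left[symmetric])
  finally show "(LINT v|circle_measure. (norm (\<Sum>j\<in>J. a j * v ^ (2 ^ j))) ^ 4) \<le> 2 * X\<^sup>2" .
qed

text \<open>A Paley-Zygmund argument: a fourth moment comparable to the square of the second keeps
  the mass from concentrating on a small set.\<close>

lemma lacunary_lower_bound:
  fixes a :: "nat \<Rightarrow> complex"
  assumes J: "finite J" and X: "0 < (\<Sum>j\<in>J. (norm (a j))\<^sup>2)"
  shows "1 / 8 \<le> measure circle_measure {v. (norm (\<Sum>j\<in>J. a j * v ^ (2 ^ j)))\<^sup>2 > (\<Sum>j\<in>J. (norm (a j))\<^sup>2) / 2}"
proof -
  define X where "X = (\<Sum>j\<in>J. (norm (a j))\<^sup>2)"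
  define F where "F v = (\<Sum>j\<in>J. a j * v ^ (2 ^ j))" for v
  define S where "S = {v. (norm (F v))\<^sup>2 > X / 2}"
  have [measurable]: "F \<in> borel_measurable borel" unfolding F_def by measurable
  have [measurable]: "S \<in> sets borel" unfolding S_def by measurable
  have X0: "0 < X" using X by (simp add: X_def)
  have bd: "norm (F v) \<le> (\<Sum>j\<in>J. norm (a j))" if "norm v = 1" for v
    unfolding F_def by (rule order_trans[OF norm_sum]) (simp add: norm_mult norm_power that)
  have int: "integrable circle_measure (\<lambda>v. norm (F v) ^ k)" for k
    by (rule circle.integrable_const_bound[where B="(\<Sum>j\<in>J. norm (a j)) ^ k"])
       (use AE_circle_norm in \<open>auto intro!: power_mono bd elim: eventually_mono\<close>)
  have intS: "integrable circle_measure (\<lambda>v. 2 * X * indicator S v)"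
    by (rule circle.integrable_const_bound[where B="2 * X"]) (use X0 in \<open>auto split: split_indicator\<close>)
  have "X = (LINT v|circle_measure. (norm (F v))\<^sup>2)"
    unfolding F_def X_def by (rule lacunary_moments(1)[OF J, symmetric])
  \<comment> \<open>With y = |F|^2, this is (y - 4 X)^2 \<ge> 0 on S and y \<le> X / 2 off S. After
    integration X \<le> X / 2 + X / 4 + 2 X |S|, which is where 1/8 comes from.\<close>
  also have "\<dots> \<le> (LINT v|circle_measure. X / 2 + norm (F v) ^ 4 / (8 * X) + 2 * X * indicator S v)"
  proof (rule integral_mono)
    show "integrable circle_measure (\<lambda>v. (norm (F v))\<^sup>2)" by (rule int)
    show "integrable circle_measure (\<lambda>v. X / 2 + norm (F v) ^ 4 / (8 * X) + 2 * X * indicator S v)"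
      using int intS by simp
    fix v
    let ?y = "(norm (F v))\<^sup>2"
    have y4: "norm (F v) ^ 4 = ?y\<^sup>2" by (simp add: power_mult[symmetric])
    show "?y \<le> X / 2 + norm (F v) ^ 4 / (8 * X) + 2 * X * indicator S v"
    proof (cases "v \<in> S")
      case True
      have "0 \<le> (?y - 4 * X)\<^sup>2 / (8 * X)" using X0 by simp
      also have "\<dots> = ?y\<^sup>2 / (8 * X) - ?y + 2 * X"
      proof -
        have "(y - 4 * t)\<^sup>2 / (8 * t) = y\<^sup>2 / (8 * t) - y + 2 * t" if "0 < t" for y t :: real
          using that by (simp add: field_simps power2_eq_square)
        then show ?thesis using X0 by blast
      qed
      finally have "?y \<le> ?y\<^sup>2 / (8 * X) + 2 * X" by linarith
      moreover have "0 \<le> X / 2" using X0 by simp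
      moreover have "2 * X * indicator S v = 2 * X" using True by simp
      ultimately show ?thesis unfolding y4 by linarith
    next
      case False
      then have "?y \<le> X / 2" by (simp add: S_def)
      moreover have "0 \<le> norm (F v) ^ 4 / (8 * X)" using X0 by simp
      ultimately show ?thesis using False by simp
    qed
  qed
  also have "\<dots> = X / 2 + (LINT v|circle_measure. norm (F v) ^ 4) / (8 * X) + 2 * X * measure circle_measure S"
    using int intS by simp
  also have "(LINT v|circle_measure. norm (F v) ^ 4) / (8 * X) \<le> 2 * X\<^sup>2 / (8 * X)"
    unfolding F_def X_def by (rule divide_right_mono[OF lacunary_moments(2)[OF J]]) (use X in simp)
  also have "2 * X\<^sup>2 / (8 * X) = X / 4" using X0 by (simp add: power2_eq_square)
  finally have "X / 4 \<le> 2 * X * measure circle_measure S" by simp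
  then have "1 / 8 \<le> measure circle_measure S" using X0 by simp
  then show ?thesis by (simp add: S_def F_def X_def)
qed

section \<open>Necessary conditions for the holomorphic operators\<close>

text \<open>x stands for 1/p, with value 0 at p = infinity, so that finite and infinite exponents
  share the same test functions.\<close>

definition reciprocal_exponent :: "ennreal \<Rightarrow> real \<Rightarrow> bool" where
  "reciprocal_exponent p x \<longleftrightarrow> (p = \<infinity> \<and> x = 0) \<or> (\<exists>r>1. p = ennreal r \<and> x = 1 / r)"

text \<open>For finite p the p-th power of |f| is at most 1 / s at defect s, so the scale-invariant
  measure ds / s of A controls the norm; for p = infinity f is bounded by 1.\<close>

lemma Lp_norm_test_function:
  assumes p: "reciprocal_exponent p x" and f [measurable]: "f \<in> borel_measurable borel" and A [measurable]: "A \<in> sets borel"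
    and le: "AE w in disc_measure. norm (f w) \<le> defect w powr - x * indicator A (defect w)"
    and \<Lambda>: "0 < \<Lambda>" "(\<integral>\<^sup>+ s. ennreal (1 / s) * indicator A s * indicator {0..1} s \<partial>lborel) \<le> ennreal \<Lambda>"
  shows "Lp_norm p f \<le> ennreal (\<Lambda> powr x)"
  using p unfolding reciprocal_exponent_def
proof (elim disjE exE conjE)
  assume "p = \<infinity>" "x = 0"
  have "AE w in disc_measure. norm (f w) \<le> 1"
    using le AE_disc_defect_pos
  proof eventually_elim
    case (elim w)
    have "defect w powr - x * indicator A (defect w) \<le> 1"
      using elim(2) \<open>x = 0\<close> by (simp split: split_indicator)
    with elim(1) show ?case by linarith
  qed
  then show ?thesis using \<open>p = \<infinity>\<close> \<open>x = 0\<close> \<Lambda>(1) Lp_norm_infinity_le_iff[OF f, of 1] by simp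
next
  fix r assume r: "1 < r" and p: "p = ennreal r" and x: "x = 1 / r"
  have "(\<integral>\<^sup>+ w. ennreal (norm (f w) powr r) \<partial>disc_measure) \<le> (\<integral>\<^sup>+ w. ennreal (1 / defect w) * indicator A (defect w) \<partial>disc_measure)"
  proof (rule nn_integral_mono_AE)
    show "AE w in disc_measure. ennreal (norm (f w) powr r) \<le> ennreal (1 / defect w) * indicator A (defect w)"
      using le AE_disc_defect_pos
    proof eventually_elim
      case (elim w)
      have "norm (f w) powr r \<le> (defect w powr - x * indicator A (defect w)) powr r"
        using elim r by (intro powr_mono2) auto
      also have "\<dots> = 1 / defect w * indicator A (defect w)"
      proof -
        have "(defect w powr - x) powr r = defect w powr (- x * r)" by (rule powr_powr)
        also have "- x * r = - 1" using r x by simp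
        finally have "(defect w powr - x) powr r = 1 / defect w" using elim by (simp add: powr_minus_divide)
        then show ?thesis by (simp add: indicator_def)
      qed
      finally show ?case by (auto simp: indicator_def ennreal_leI split: if_splits)
    qed
  qed
  also have "\<dots> = (\<integral>\<^sup>+ s. ennreal (1 / s) * indicator A s * indicator {0..1} s \<partial>lborel)"
    by (rule nn_integral_disc_radial) measurable
  also have "\<dots> \<le> ennreal \<Lambda>" by fact
  also have "\<Lambda> = (\<Lambda> powr x) powr r" using \<Lambda> r x by (simp add: powr_powr)
  finally show ?thesis unfolding p using r by (subst Lp_norm_le_iff) auto
qed

lemma powr_ge_min:
  fixes l h s e :: real
  assumes "0 < l" "l \<le> s" "s \<le> h"
  shows "min (l powr e) (h powr e) \<le> s powr e" and "s powr e \<le> max (l powr e) (h powr e)"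
proof -
  consider "0 \<le> e" | "e < 0" by linarith
  then have "min (l powr e) (h powr e) \<le> s powr e \<and> s powr e \<le> max (l powr e) (h powr e)"
  proof cases
    case 1
    then have "l powr e \<le> s powr e" "s powr e \<le> h powr e" using assms by (auto intro!: powr_mono2)
    then show ?thesis by auto
  next
    case 2
    then have "h powr e \<le> s powr e" "s powr e \<le> l powr e" using assms by (auto intro!: powr_mono2')
    then show ?thesis by auto
  qed
  then show "min (l powr e) (h powr e) \<le> s powr e" and "s powr e \<le> max (l powr e) (h powr e)" by auto
qed

text \<open>The test functions are homogeneous in the angular variable, so only one Taylor coefficient of
  their images survives.\<close>

definition test_function :: "real \<Rightarrow> real set \<Rightarrow> nat \<Rightarrow> complex \<Rightarrow> complex" where
  "test_function x A n w = complex_of_real (defect w powr - x * indicator A (defect w)) * sgn w ^ n"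

definition test_moment :: "real \<Rightarrow> real set \<Rightarrow> nat \<Rightarrow> real" where
  "test_moment e A n = (LINT w|disc_measure. defect w powr e * indicator A (defect w) * norm w ^ n)"

lemma borel_test_function [measurable]:
  assumes [measurable]: "A \<in> sets borel"
  shows "test_function x A n \<in> borel_measurable borel"
  unfolding test_function_def by measurable

lemma integrable_test_moment:
  assumes [measurable]: "A \<in> sets borel" and A: "A \<subseteq> {l..1}" "0 < l"
  shows "integrable disc_measure (\<lambda>w. defect w powr e * indicator A (defect w) * norm w ^ n)"
proof (rule disc.integrable_const_bound[where B="max (l powr e) (1 powr e)"])
  show "AE w in disc_measure. norm (defect w powr e * indicator A (defect w) * norm w ^ n) \<le> max (l powr e) (1 powr e)"
    using AE_disc_unit_disc
  proof eventually_elim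
    case (elim w)
    have "norm w ^ n \<le> 1" using elim by (intro power_le_one) (auto simp: unit_disc_def)
    then have "norm (defect w powr e * indicator A (defect w) * norm w ^ n) \<le> defect w powr e * indicator A (defect w)"
      by (simp add: abs_mult mult_left_le)
    also have "\<dots> \<le> max (l powr e) (1 powr e)"
    proof (cases "defect w \<in> A")
      case True
      then have "l \<le> defect w" "defect w \<le> 1" using A by auto
      then show ?thesis using powr_ge_min(2)[OF A(2), of "defect w" 1 e] True by simp
    qed (simp add: le_max_iff_disj)
    finally show ?case .
  qed
qed measurable

text \<open>Rotation averaging annihilates every moment of the test function except the n-th, so
  only one monomial is left of the series. The kernel is bounded for either sign of c, as |1 - z
  \<open>cnj w\<close>| lies between 1 - |z| and 2.\<close>

lemma T_test_function:
  assumes [measurable]: "A \<in> sets borel" and A: "A \<subseteq> {l..1}" "0 < l" and z: "z \<in> unit_disc"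
  shows "(LINT w|disc_measure. kernel (T_op a b c) z w * test_function x A n w)
      = complex_of_real (binomial_coeff c n * test_moment (b - x) A n) * z ^ n"
    and "integrable disc_measure (\<lambda>w. kernel (T_op a b c) z w * test_function x A n w)"
proof -
  define g where "g w = complex_of_real (defect w powr (b - x) * indicator A (defect w)) * sgn w ^ n" for w
  have [measurable]: "g \<in> borel_measurable borel" unfolding g_def by measurable
  have kg: "kernel (T_op a b c) z w * test_function x A n w = g w / (1 - z * cnj w) powr complex_of_real c" for w
    by (simp add: T_op_def test_function_def g_def powr_diff powr_minus field_simps)
  have g_int: "integrable disc_measure g"
  proof (rule Bochner_Integration.integrable_bound[OF integrable_test_moment[OF assms(1) A, of "b - x" 0]])
    show "AE w in disc_measure. norm (g w) \<le> norm (defect w powr (b - x) * indicator A (defect w) * norm w ^ 0)"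
      by (rule AE_I2) (simp add: g_def norm_mult norm_power norm_sgn abs_mult power_0_left)
  qed simp
  define c' where "c' k = (LINT w|disc_measure. g w * cnj w ^ k)" for k
  have gk: "integrable disc_measure (\<lambda>w. g w * cnj w ^ k)" for k
  proof (rule Bochner_Integration.integrable_bound[OF g_int])
    show "AE w in disc_measure. norm (g w * cnj w ^ k) \<le> norm (g w)"
      using AE_disc_unit_disc
      by eventually_elim (auto simp: norm_mult norm_power unit_disc_def intro!: mult_left_le power_le_one)
  qed simp
  have c'0: "c' k = 0" if "k \<noteq> n" for k
  proof -
    have "c' k = (LINT w|disc_measure. (LINT v|circle_measure. g (v * w) * cnj (v * w) ^ k))"
      unfolding c'_def by (rule integral_disc_average[OF gk])
    also have "\<dots> = (LINT w|disc_measure. (LINT v|circle_measure. (g w * cnj w ^ k) * (v ^ n * cnj v ^ k)))"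
    proof (rule Bochner_Integration.integral_cong[OF refl], rule integral_cong_AE)
      fix w
      show "AE v in circle_measure. g (v * w) * cnj (v * w) ^ k = (g w * cnj w ^ k) * (v ^ n * cnj v ^ k)"
        using AE_circle_norm
      proof eventually_elim
        case (elim v)
        then have "sgn (v * w) = v * sgn w" by (simp add: sgn_div_norm norm_mult)
        then show ?case using elim by (simp add: g_def norm_mult power_mult_distrib mult_ac)
      qed
    qed measurable
    also have "\<dots> = 0" using that by (simp add: circle_orthogonal)
    finally show ?thesis .
  qed
  have c'n: "c' n = complex_of_real (test_moment (b - x) A n)"
  proof -
    have "g w * cnj w ^ n = complex_of_real (defect w powr (b - x) * indicator A (defect w) * norm w ^ n)" for w
    proof -
      have "sgn w * cnj w = complex_of_real (norm w)"
        by (cases "w = 0") (simp_all add: sgn_div_norm scaleR_conv_of_real complex_norm_square[symmetric] field_simps power2_eq_square flip: of_real_mult)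
      then have "sgn w ^ n * cnj w ^ n = complex_of_real (norm w ^ n)" by (simp add: power_mult_distrib[symmetric])
      then show ?thesis by (simp add: g_def mult.assoc)
    qed
    then show ?thesis unfolding c'_def test_moment_def by (simp only: integral_complex_of_real)
  qed
  have "(LINT w|disc_measure. kernel (T_op a b c) z w * test_function x A n w)
     = (\<Sum>k. complex_of_real (binomial_coeff c k) * c' k * z ^ k)"
    unfolding kg c'_def by (rule disc_series(1)[OF g_int z])
  also have "\<dots> = (\<Sum>k. if k = n then complex_of_real (binomial_coeff c k) * c' k * z ^ k else 0)"
    by (rule suminf_cong) (simp add: c'0)
  also have "\<dots> = complex_of_real (binomial_coeff c n) * c' n * z ^ n"
    using sums_single[of n "\<lambda>k. complex_of_real (binomial_coeff c k) * c' k * z ^ k"] by (simp add: sums_iff)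
  finally show "(LINT w|disc_measure. kernel (T_op a b c) z w * test_function x A n w)
      = complex_of_real (binomial_coeff c n * test_moment (b - x) A n) * z ^ n"
    by (simp add: c'n)
  have z1: "0 < 1 - norm z" using z by (simp add: unit_disc_def)
  define D where "D = max ((1 - norm z) powr - c) (2 powr - c)"
  show "integrable disc_measure (\<lambda>w. kernel (T_op a b c) z w * test_function x A n w)"
    unfolding kg
  proof (rule Bochner_Integration.integrable_bound)
    show "integrable disc_measure (\<lambda>w. g w * complex_of_real D)" using g_int by simp
    show "AE w in disc_measure. norm (g w / (1 - z * cnj w) powr complex_of_real c) \<le> norm (g w * complex_of_real D)"
      using AE_disc_unit_disc
    proof eventually_elim
      case (elim w)
      have "norm (1 - z * cnj w) \<le> 2"
        using norm_triangle_ineq4[of 1 "z * cnj w"] norm_mult_cnj_less[OF z elim] by simp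
      then have "norm (1 - z * cnj w) powr - c \<le> D"
        using powr_ge_min(2)[OF z1 norm_one_minus_ge[OF elim]] by (simp add: D_def)
      then have "norm (g w) * norm (1 - z * cnj w) powr - c \<le> norm (g w) * D" by (rule mult_left_mono) simp
      moreover have "0 \<le> D" by (simp add: D_def le_max_iff_disj)
      ultimately show ?case by (simp add: norm_mult norm_divide norm_powr_of_real powr_minus_divide)
    qed
  qed measurable
qed

lemma test_moment_ge:
  assumes [measurable]: "A \<in> sets borel" and A: "A \<subseteq> {l..1}" "0 < l" and "0 \<le> \<kappa>"
    and le: "\<And>w. w \<in> unit_disc \<Longrightarrow> defect w \<in> A \<Longrightarrow> \<kappa> \<le> defect w powr e * norm w ^ n"
  shows "\<kappa> * measure lborel A \<le> test_moment e A n"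
proof -
  have "emeasure disc_measure {w. defect w \<in> A} = emeasure lborel A"
  proof -
    have "A \<inter> {0..1} = A" using A by auto
    then show ?thesis by (simp add: emeasure_disc_defect)
  qed
  then have "measure lborel A = measure disc_measure {w. defect w \<in> A}" by (simp add: measure_def)
  also have "\<dots> = (LINT w|disc_measure. indicator A (defect w))"
  proof -
    have "(LINT w|disc_measure. indicator A (defect w)) = (LINT w|disc_measure. indicator {w. defect w \<in> A} w :: real)"
      by (rule Bochner_Integration.integral_cong) (auto simp: indicator_def)
    then show ?thesis by simp
  qed
  finally have "\<kappa> * measure lborel A = (LINT w|disc_measure. \<kappa> * indicator A (defect w))" by simp
  also have "\<dots> \<le> test_moment e A n"
    unfolding test_moment_def
  proof (rule integral_mono_AE[OF _ integrable_test_moment[OF assms(1) A]])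
    show "integrable disc_measure (\<lambda>w. \<kappa> * indicator A (defect w))"
      by (rule disc.integrable_const_bound[where B="\<kappa>"]) (use assms(4) in \<open>auto split: split_indicator\<close>)
    show "AE w in disc_measure. \<kappa> * indicator A (defect w) \<le> defect w powr e * indicator A (defect w) * norm w ^ n"
      using AE_disc_unit_disc by eventually_elim (use le in \<open>auto split: split_indicator\<close>)
  qed
  finally show ?thesis .
qed

lemma nn_integral_inverse_cut:
  assumes e: "0 < e" "e \<le> 1"
  shows "(\<integral>\<^sup>+ s. ennreal (1 / s) * indicator {e..1} s * indicator {0..1} s \<partial>lborel) = ennreal (ln (1 / e))"
proof -
  have "(\<integral>\<^sup>+ s. ennreal (1 / s) * indicator {e..1} s * indicator {0..1} s \<partial>lborel)
      = (\<integral>\<^sup>+ s. ennreal (1 / s) * indicator {e..1} s \<partial>lborel)"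
    by (intro nn_integral_cong) (use e in \<open>auto split: split_indicator\<close>)
  then show ?thesis using nn_integral_inverse_Icc[OF e, of 1] by simp
qed

text \<open>For y \<le> -1 the power s^y dominates 1 / s on (0, 1], and the integral of 1 / s over
  [e, 1] is the logarithm.\<close>

lemma test_moment_log:
  assumes e: "0 < e" "e \<le> 1" and y: "y \<le> - 1"
  shows "ln (1 / e) \<le> test_moment y {e..1} 0"
proof -
  have int: "integrable disc_measure (\<lambda>w. defect w powr (- 1) * indicator {e..1} (defect w) * norm w ^ 0)"
    by (rule integrable_test_moment) (use e in auto)
  have "ennreal (ln (1 / e)) = (\<integral>\<^sup>+ s. ennreal (s powr (- 1) * indicator {e..1} s) * indicator {0..1} s \<partial>lborel)"
    unfolding nn_integral_inverse_cut[OF e, symmetric]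
    by (intro nn_integral_cong) (use e in \<open>auto simp: powr_minus_divide split: split_indicator\<close>)
  also have "\<dots> = (\<integral>\<^sup>+ w. ennreal (defect w powr (- 1) * indicator {e..1} (defect w)) \<partial>disc_measure)"
    by (rule nn_integral_disc_radial[symmetric]) measurable
  also have "\<dots> = ennreal (test_moment (- 1) {e..1} 0)"
    unfolding test_moment_def using nn_integral_eq_integral[OF int] by simp
  finally have "ln (1 / e) \<le> test_moment (- 1) {e..1} 0"
    by (subst (asm) ennreal_inj) (use e in \<open>auto simp: test_moment_def\<close>)
  also have "\<dots> \<le> test_moment y {e..1} 0"
    unfolding test_moment_def
  proof (rule integral_mono_AE[OF int integrable_test_moment])
    show "AE w in disc_measure. defect w powr (- 1) * indicator {e..1} (defect w) * norm w ^ 0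
        \<le> defect w powr y * indicator {e..1} (defect w) * norm w ^ 0"
      using AE_disc_defect_pos by eventually_elim (intro mult_right_mono powr_mono' y; simp)
  qed (use e in auto)
  finally show ?thesis .
qed

lemma norm_test_function_le:
  "AE w in disc_measure. norm (test_function x A n w) \<le> defect w powr - x * indicator A (defect w)"
  by (rule AE_I2) (simp add: test_function_def norm_mult norm_power norm_sgn abs_mult power_0_left)

section \<open>Necessary inequalities for T\<close>

text \<open>The condition x < 1/2 means p > 2. The estimate for T is stated with an explicit
  constant and in terms of distribution functions, a form in which the weak-type hypothesis and the
  restricted one at p = infinity can both supply it.\<close>

locale weak_type_T =
  fixes p :: ennreal and x q a b c C :: real
  assumes p: "reciprocal_exponent p x" and x: "x < 1 / 2" and q: "0 < q" and C0: "0 \<le> C"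
    and bound: "\<And>f B. f \<in> borel_measurable borel \<Longrightarrow> B \<ge> 0 \<Longrightarrow> Lp_norm p f \<le> ennreal B \<Longrightarrow>
       \<forall>t>0. distr_fun (apply_op (T_op a b c) f) t \<le> (C * B / t) powr q"
begin

lemma test_bound:
  assumes A: "A \<in> sets borel" "A \<subseteq> {l..1}" "0 < l"
    and \<Lambda>: "0 < \<Lambda>" "(\<integral>\<^sup>+ s. ennreal (1 / s) * indicator A s * indicator {0..1} s \<partial>lborel) \<le> ennreal \<Lambda>"
    and A': "A' \<in> sets borel" "A' \<subseteq> {0..1}" and L: "0 < L"
    and ge: "\<And>z. z \<in> unit_disc \<Longrightarrow> defect z \<in> A' \<Longrightarrow>
       L \<le> defect z powr a * (\<bar>binomial_coeff c n * test_moment (b - x) A n\<bar> * norm z ^ n)"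
  shows "measure lborel A' \<le> (2 * (C * \<Lambda> powr x) / L) powr q"
proof (rule weak_bound_lower[OF weighted_operator_T_op[of a b c] borel_test_function[OF A(1)] _ A' L])
  show "\<forall>t>0. distr_fun (apply_op (T_op a b c) (test_function x A n)) t \<le> (C * \<Lambda> powr x / t) powr q"
    by (rule bound[OF borel_test_function[OF A(1)] _ Lp_norm_test_function[OF p _ A(1) norm_test_function_le \<Lambda>]])
       (use A in \<open>auto intro: borel_test_function\<close>)
  show "AE z in disc_measure. defect z \<in> A' \<longrightarrow> L \<le> defect z powr a *
      norm (LINT w|disc_measure. kernel (T_op a b c) z w * test_function x A n w)"
    using AE_disc_unit_disc
  proof eventually_elim
    case (elim z)
    show ?case
      unfolding T_test_function(1)[OF A elim] norm_mult norm_power norm_of_real[where 'a=complex]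
      using ge[OF elim] by (simp add: abs_mult)
  qed
qed

text \<open>If b - x \<le> -1, the radial test function on defect \<ge> e has norm at most
  \<Lambda>^x with \<Lambda> = ln (1 / e), but moment at least \<Lambda>. Apart from the weight its
  image is constant, so testing on the fixed annulus between defects 1/4 and 1/2 bounds \<Lambda>^(1
  - x), which is absurd for large \<Lambda>.\<close>

lemma b_condition: "0 < b + 1 - x"
proof (rule ccontr)
  assume "\<not> 0 < b + 1 - x"
  then have bx: "b - x \<le> - 1" by simp
  define \<kappa> where "\<kappa> = min ((1 / 4) powr a) ((1 / 2) powr a)"
  have \<kappa>: "0 < \<kappa>" by (simp add: \<kappa>_def)
  have main: "(1 / 4) powr (1 / q) * \<Lambda> powr (1 - x) \<le> 2 * C / \<kappa>" if \<Lambda>: "0 < \<Lambda>" for \<Lambda>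
  proof -
    define e where "e = exp (- \<Lambda>)"
    have e: "0 < e" "e \<le> 1" "ln (1 / e) = \<Lambda>" using \<Lambda> by (auto simp: e_def ln_div)
    have M: "\<Lambda> \<le> test_moment (b - x) {e..1} 0" using test_moment_log[OF e(1,2) bx] e(3) by simp
    have "measure lborel {1 / 4..1 / 2::real} \<le> (2 * (C * \<Lambda> powr x) / (\<kappa> * \<Lambda>)) powr q"
    proof (rule test_bound[of "{e..1}" e])
      show "(\<integral>\<^sup>+ s. ennreal (1 / s) * indicator {e..1} s * indicator {0..1} s \<partial>lborel) \<le> ennreal \<Lambda>"
        unfolding nn_integral_inverse_cut[OF e(1,2)] e(3) ..
      fix z :: complex assume z: "z \<in> unit_disc" "defect z \<in> {1 / 4..1 / 2}"
      have "\<kappa> \<le> defect z powr a" unfolding \<kappa>_def using z by (intro powr_ge_min) auto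
      then show "\<kappa> * \<Lambda> \<le> defect z powr a * (\<bar>binomial_coeff c 0 * test_moment (b - x) {e..1} 0\<bar> * norm z ^ 0)"
        using M \<kappa> \<Lambda> by (intro mult_mono) (auto simp: binomial_coeff_def)
    qed (use e \<Lambda> \<kappa> in auto)
    then have "1 / 4 \<le> (2 * (C * \<Lambda> powr x) / (\<kappa> * \<Lambda>)) powr q" by simp
    then have "(1 / 4) powr (1 / q) \<le> ((2 * (C * \<Lambda> powr x) / (\<kappa> * \<Lambda>)) powr q) powr (1 / q)"
      using q by (intro powr_mono2) auto
    also have "\<dots> = 2 * (C * \<Lambda> powr x) / (\<kappa> * \<Lambda>)" using q C0 \<Lambda> \<kappa> by (simp add: powr_powr)
    also have "\<dots> = 2 * C / \<kappa> / \<Lambda> powr (1 - x)" using \<Lambda> by (simp add: powr_diff field_simps)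
    finally have "(1 / 4) powr (1 / q) \<le> 2 * C / \<kappa> / \<Lambda> powr (1 - x)" .
    then show ?thesis by (rule pos_le_divide_eq[THEN iffD1, rotated]) (use \<Lambda> in simp)
  qed
  define D where "D = 2 * C / \<kappa> / (1 / 4) powr (1 / q)"
  have D: "0 \<le> D" using C0 \<kappa> by (simp add: D_def)
  define \<Lambda> where "\<Lambda> = (D + 1) powr (1 / (1 - x))"
  have "0 < \<Lambda>" using D by (simp add: \<Lambda>_def)
  from main[OF this] have "\<Lambda> powr (1 - x) * (1 / 4) powr (1 / q) \<le> 2 * C / \<kappa>" by (simp only: mult.commute)
  then have "\<Lambda> powr (1 - x) \<le> D" unfolding D_def by (rule pos_le_divide_eq[THEN iffD2, rotated]) simp
  moreover have "\<Lambda> powr (1 - x) = D + 1" using D x by (simp add: \<Lambda>_def powr_powr)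
  ultimately show False by simp
qed

text \<open>The image of a fixed radial function is a constant times defect^a. Testing it where the
  defect is at most t bounds t^(1 + a q), which fails for small t if a q < -1.\<close>

lemma a_condition: "0 \<le> a + 1 / q"
proof (rule ccontr)
  assume "\<not> 0 \<le> a + 1 / q"
  then have "a < - (1 / q)" by simp
  moreover have "0 < 1 / q" using q by simp
  ultimately have "a < 0" by linarith
  moreover have "1 + a * q < 0" using \<open>a < - (1 / q)\<close> q by (simp add: field_simps)
  ultimately have a: "a < 0" "1 + a * q < 0" by auto
  let ?A = "{1 / 2..1::real}"
  define M where "M = test_moment (b - x) ?A 0"
  have "min ((1 / 2) powr (b - x)) (1 powr (b - x)) * measure lborel ?A \<le> M"
    unfolding M_def
  proof (rule test_moment_ge[of _ "1 / 2"])
    fix w :: complex assume "defect w \<in> ?A"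
    then show "min ((1 / 2) powr (b - x)) (1 powr (b - x)) \<le> defect w powr (b - x) * norm w ^ 0"
      using powr_ge_min(1)[of "1/2" "defect w" 1 "b - x"] by simp
  qed auto
  moreover have "0 < min ((1 / 2) powr (b - x)) (1 powr (b - x)) * measure lborel ?A" by simp
  ultimately have M: "0 < M" by linarith
  have main: "t powr (1 + a * q) \<le> (2 * (C * ln 2 powr x) / M) powr q" if t: "0 < t" "t \<le> 1" for t
  proof -
    have "measure lborel {0..t} \<le> (2 * (C * ln 2 powr x) / (t powr a * M)) powr q"
    proof (rule test_bound[of ?A "1 / 2"])
      show "(\<integral>\<^sup>+ s. ennreal (1 / s) * indicator ?A s * indicator {0..1} s \<partial>lborel) \<le> ennreal (ln 2)"
        using nn_integral_inverse_cut[of "1 / 2"] by simp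
      fix z :: complex assume z: "z \<in> unit_disc" "defect z \<in> {0..t}"
      have "t powr a \<le> defect z powr a" using z defect_pos[OF z(1)] a by (intro powr_mono2') auto
      then show "t powr a * M \<le> defect z powr a * (\<bar>binomial_coeff c 0 * test_moment (b - x) ?A 0\<bar> * norm z ^ 0)"
        using M by (intro mult_mono) (auto simp: binomial_coeff_def M_def)
    qed (use t M in auto)
    then have "t \<le> (2 * (C * ln 2 powr x) / (t powr a * M)) powr q" using t by simp
    also have "2 * (C * ln 2 powr x) / (t powr a * M) = t powr (- a) * (2 * (C * ln 2 powr x) / M)"
      by (simp add: powr_minus field_simps)
    also have "(t powr (- a) * (2 * (C * ln 2 powr x) / M)) powr q = t powr (- a * q) * (2 * (C * ln 2 powr x) / M) powr q"
      by (subst powr_mult) (simp add: powr_powr)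
    finally have h: "t \<le> t powr (- a * q) * (2 * (C * ln 2 powr x) / M) powr q" .
    have "t * t powr (a * q) \<le> (t powr (- a * q) * (2 * (C * ln 2 powr x) / M) powr q) * t powr (a * q)"
      by (rule mult_right_mono[OF h]) simp
    also have "\<dots> = (t powr (- a * q) * t powr (a * q)) * (2 * (C * ln 2 powr x) / M) powr q" by (simp only: mult_ac)
    finally show ?thesis using t by (simp add: powr_add[symmetric] powr_add)
  qed
  \<comment> \<open>y exceeds the bound by 1, and t solves t^(1 + a q) = y; the negative exponent
    puts t below 1.\<close>
  define y where "y = (2 * (C * ln 2 powr x) / M) powr q + 1"
  have y: "1 \<le> y" by (simp add: y_def)
  define t where "t = y powr (1 / (1 + a * q))"
  have "0 < t" using y by (simp add: t_def)
  moreover have "t \<le> 1"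
  proof -
    have "t \<le> 1 powr (1 / (1 + a * q))" unfolding t_def using y a by (intro powr_mono2') auto
    then show ?thesis by simp
  qed
  moreover have "t powr (1 + a * q) = y" using y a by (simp add: t_def powr_powr)
  ultimately show False using main[of t] by (simp add: y_def)
qed

section \<open>Dyadic blocks and lacunary superpositions\<close>

text \<open>Defects of order 2^(-j), the scale on which the monomial of degree 2^j still has size
  one. The upper end 2^(-j) / 2 is what Bernoulli's inequality requires, and half-open intervals
  make the blocks disjoint.\<close>

definition block :: "nat \<Rightarrow> real set" where
  "block j = {2 powr (- real j) / 4 <.. 2 powr (- real j) / 2}"

lemma block_borel [measurable, simp]: "block j \<in> sets borel"
  by (simp add: block_def)

lemma block_subset: "block j \<subseteq> {2 powr (- real j) / 4..1}"
proof -
  have "(2::real) powr (- real j) \<le> 2 powr 0" by (rule powr_mono) auto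
  then show ?thesis by (auto simp: block_def)
qed

lemma measure_block: "measure lborel (block j) = 2 powr (- real j) / 4"
  by (simp add: block_def)

text \<open>Bernoulli's inequality for |z|^2 = 1 - d with n = 2^j: (1 - d)^n \<ge> 1 - n d \<ge>
  1/2.\<close>

lemma norm_power_ge_half:
  assumes z: "z \<in> unit_disc" and d: "defect z \<le> 2 powr (- real j) / 2"
  shows "1 / 2 \<le> norm z ^ (2 ^ j)"
proof -
  let ?n = "(2::nat) ^ j"
  have t: "2 powr (- real j) = 1 / real ?n" by (simp add: powr_minus_divide powr_realpow)
  have "1 / 2 \<le> 1 + real ?n * (- defect z)" using d unfolding t by (simp add: field_simps)
  also have "\<dots> \<le> (1 + (- defect z)) ^ ?n"
    by (rule Bernoulli_inequality) (use z in \<open>simp add: unit_disc_def\<close>)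
  also have "\<dots> = ((norm z)\<^sup>2) ^ ?n" by simp
  also have "\<dots> \<le> norm z ^ ?n"
    using z by (intro power_mono) (auto simp: unit_disc_def power2_eq_square mult_left_le)
  finally show ?thesis .
qed

text \<open>The Taylor coefficient of index 2^j is of order 2^(j (c - 1)), and the moment over block
  j is at least of order 2^(-j (b - x)), the size of the integrand, times the length 2^(-j) of the
  block.\<close>

lemma test_coefficient_lower:
  assumes "0 < c"
  shows "\<exists>k>0. \<forall>j. k * 2 powr (real j * (c - 1 - (b + 1 - x)))
     \<le> binomial_coeff c (2 ^ j) * test_moment (b - x) (block j) (2 ^ j)"
proof -
  obtain k1 where k1: "0 < k1" "\<And>n. 1 \<le> n \<Longrightarrow> k1 * real n powr (c - 1) \<le> binomial_coeff c n"
    using binomial_coeff_asymp[OF assms] by metis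
  define e where "e = b - x"
  define \<kappa> where "\<kappa> = min ((1 / 4) powr e) ((1 / 2) powr e)"
  have \<kappa>: "0 < \<kappa>" by (simp add: \<kappa>_def)
  have "k1 * \<kappa> / 8 * 2 powr (real j * (c - 1 - (b + 1 - x))) \<le> binomial_coeff c (2 ^ j) * test_moment e (block j) (2 ^ j)" for j
  proof -
    let ?t = "(2::real) powr (- real j)"
    have "(\<kappa> * ?t powr e / 2) * measure lborel (block j) \<le> test_moment e (block j) (2 ^ j)"
    proof (rule test_moment_ge[OF _ block_subset])
      fix w assume w: "w \<in> unit_disc" "defect w \<in> block j"
      have "\<kappa> \<le> (defect w / ?t) powr e"
        unfolding \<kappa>_def by (rule powr_ge_min) (use w in \<open>auto simp: block_def field_simps\<close>)
      then have "\<kappa> * ?t powr e \<le> (defect w / ?t) powr e * ?t powr e" by (rule mult_right_mono) simp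
      also have "\<dots> = defect w powr e" by (simp add: powr_mult[symmetric])
      finally have 1: "\<kappa> * ?t powr e \<le> defect w powr e" .
      have 2: "1 / 2 \<le> norm w ^ (2 ^ j)" by (rule norm_power_ge_half[OF w(1)]) (use w in \<open>simp add: block_def\<close>)
      have "(\<kappa> * ?t powr e) * (1 / 2) \<le> defect w powr e * norm w ^ (2 ^ j)"
        using 1 2 \<kappa> by (intro mult_mono) auto
      then show "\<kappa> * ?t powr e / 2 \<le> defect w powr e * norm w ^ (2 ^ j)" by simp
    qed (use \<kappa> in auto)
    then have M: "\<kappa> * ?t powr e * ?t / 8 \<le> test_moment e (block j) (2 ^ j)" by (simp add: measure_block)
    have "(k1 * real (2 ^ j) powr (c - 1)) * (\<kappa> * ?t powr e * ?t / 8) \<le> binomial_coeff c (2 ^ j) * test_moment e (block j) (2 ^ j)"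
      using k1(2)[of "2 ^ j"] M k1(1) \<kappa> assms by (intro mult_mono) (auto intro: less_imp_le binomial_coeff_pos)
    also have "(k1 * real (2 ^ j) powr (c - 1)) * (\<kappa> * ?t powr e * ?t / 8)
        = k1 * \<kappa> / 8 * (real (2 ^ j) powr (c - 1) * ?t powr e * ?t)" by simp
    also have "real (2 ^ j) powr (c - 1) * ?t powr e * ?t = 2 powr (real j * (c - 1 - (b + 1 - x)))"
    proof -
      have "real (2 ^ j) = 2 powr real j" by (simp add: powr_realpow)
      then have "real (2 ^ j) powr (c - 1) * ?t powr e * ?t = 2 powr (real j * (c - 1) + - real j * e + - real j)"
        by (simp only: powr_powr powr_add)
      also have "real j * (c - 1) + - real j * e + - real j = real j * (c - 1 - (b + 1 - x))"
        by (simp add: e_def algebra_simps)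
      finally show ?thesis .
    qed
    finally show ?thesis .
  qed
  moreover have "0 < k1 * \<kappa> / 8" using k1 \<kappa> by simp
  ultimately show ?thesis unfolding e_def by blast
qed

lemma nn_integral_inverse_block:
  "(\<integral>\<^sup>+ s. ennreal (1 / s) * indicator (block j) s * indicator {0..1} s \<partial>lborel) \<le> ennreal 1"
proof -
  let ?t = "(2::real) powr (- real j)"
  have "(\<integral>\<^sup>+ s. ennreal (1 / s) * indicator (block j) s * indicator {0..1} s \<partial>lborel)
     \<le> (\<integral>\<^sup>+ s. ennreal (4 / ?t) * indicator (block j) s \<partial>lborel)"
  proof (rule nn_integral_mono)
    fix s :: real
    have "1 / s \<le> 4 / ?t" if "s \<in> block j"
    proof -
      have "?t / 4 < s" using that by (simp add: block_def)
      then have "1 / s \<le> 1 / (?t / 4)" by (intro divide_left_mono mult_pos_pos) (auto intro: less_trans[of 0 "?t / 4"])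
      then show ?thesis by simp
    qed
    then show "ennreal (1 / s) * indicator (block j) s * indicator {0..1} s \<le> ennreal (4 / ?t) * indicator (block j) s"
      by (auto split: split_indicator intro!: ennreal_leI)
  qed
  also have "\<dots> = ennreal (4 / ?t) * emeasure lborel (block j)" by (rule nn_integral_cmult_indicator) simp
  also have "emeasure lborel (block j) = ennreal (?t / 4)" by (simp add: block_def)
  also have "ennreal (4 / ?t) * ennreal (?t / 4) = ennreal 1" by (simp add: ennreal_mult[symmetric])
  finally show ?thesis .
qed

text \<open>The test function on block j has norm at most 1, and on the same block its weighted
  image is at least a multiple of 2^(j (y - a)). As the block has measure 2^(-j) / 4, a weak-type
  bound would keep 2^(j ((y - a) q - 1)) bounded, whereas y > a + 1/q makes this exponent
  positive.\<close>

lemma c_condition: "c - 1 \<le> (a + 1 / q) + (b + 1 - x)"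
proof (rule ccontr)
  define y where "y = c - 1 - (b + 1 - x)"
  assume "\<not> c - 1 \<le> (a + 1 / q) + (b + 1 - x)"
  then have y: "a + 1 / q < y" by (simp add: y_def)
  have c: "0 < c" using y b_condition a_condition by (simp add: y_def)
  obtain k where k: "0 < k" "\<And>j. k * 2 powr (real j * y) \<le> binomial_coeff c (2 ^ j) * test_moment (b - x) (block j) (2 ^ j)"
    using test_coefficient_lower[OF c] unfolding y_def by metis
  define \<kappa> where "\<kappa> = min ((1 / 4) powr a) ((1 / 2) powr a)"
  have \<kappa>: "0 < \<kappa>" by (simp add: \<kappa>_def)
  define D where "D = (4 * C / (\<kappa> * k)) powr q"
  define r where "r = (2::real) powr (- ((y - a) * q - 1))"
  have main: "1 / 4 \<le> D * r ^ j" for j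
  proof -
    let ?t = "(2::real) powr (- real j)"
    let ?L = "\<kappa> * ?t powr a * (k * 2 powr (real j * y) * (1 / 2))"
    have L: "0 < ?L" using \<kappa> k by simp
    have "measure lborel (block j) \<le> (2 * (C * 1 powr x) / ?L) powr q"
    proof (rule test_bound[OF block_borel block_subset _ _ nn_integral_inverse_block block_borel _ L])
      show "block j \<subseteq> {0..1}" by (rule order_trans[OF block_subset]) auto
      fix z assume z: "z \<in> unit_disc" "defect z \<in> block j"
      have "\<kappa> \<le> (defect z / ?t) powr a"
        unfolding \<kappa>_def by (rule powr_ge_min) (use z in \<open>auto simp: block_def field_simps\<close>)
      then have "\<kappa> * ?t powr a \<le> (defect z / ?t) powr a * ?t powr a" by (rule mult_right_mono) simp
      also have "\<dots> = defect z powr a" by (simp add: powr_mult[symmetric])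
      finally have 1: "\<kappa> * ?t powr a \<le> defect z powr a" .
      have 2: "1 / 2 \<le> norm z ^ (2 ^ j)" by (rule norm_power_ge_half[OF z(1)]) (use z in \<open>simp add: block_def\<close>)
      have 3: "k * 2 powr (real j * y) * (1 / 2)
         \<le> \<bar>binomial_coeff c (2 ^ j) * test_moment (b - x) (block j) (2 ^ j)\<bar> * norm z ^ (2 ^ j)"
        using k 2 by (intro mult_mono order_trans[OF k(2) abs_ge_self]) auto
      show "?L \<le> defect z powr a * (\<bar>binomial_coeff c (2 ^ j) * test_moment (b - x) (block j) (2 ^ j)\<bar> * norm z ^ (2 ^ j))"
        by (rule mult_mono[OF 1 3]) (use k in auto)
    qed auto
    then have "?t / 4 \<le> (2 * C / ?L) powr q" by (simp add: measure_block)
    also have "2 * C / ?L = (4 * C / (\<kappa> * k)) * (2 powr (real j * a) * 2 powr (- (real j * y)))"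
    proof -
      have ta: "?t powr a = 2 powr (- (real j * a))" by (simp only: powr_powr mult_minus_left)
      show ?thesis unfolding ta using \<kappa> k by (simp add: powr_minus field_simps)
    qed
    also have "2 powr (real j * a) * 2 powr (- (real j * y)) = (2::real) powr (- (real j * (y - a)))"
      by (simp add: powr_add[symmetric] algebra_simps)
    also have "((4 * C / (\<kappa> * k)) * 2 powr (- (real j * (y - a)))) powr q = D * 2 powr (- (real j * (y - a)) * q)"
      unfolding D_def by (subst powr_mult) (simp add: powr_powr)
    finally have h: "?t / 4 * 2 powr real j \<le> D * 2 powr (- (real j * (y - a)) * q) * 2 powr real j"
      by (rule mult_right_mono) simp
    have f1: "?t * 2 powr real j = 1" by (simp add: powr_add[symmetric])
    have f2: "2 powr (- (real j * (y - a)) * q) * 2 powr real j = r ^ j"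
    proof -
      have "r ^ j = r powr real j" by (simp add: r_def powr_realpow)
      then show ?thesis unfolding r_def powr_powr powr_add[symmetric] by (simp add: algebra_simps)
    qed
    have "1 / 4 = ?t / 4 * 2 powr real j" using f1 by simp
    also note h
    also have "D * 2 powr (- (real j * (y - a)) * q) * 2 powr real j = D * r ^ j" by (simp only: mult.assoc f2)
    finally show ?thesis .
  qed
  have "0 < (y - a) * q - 1" using y q by (simp add: field_simps)
  then have r: "0 \<le> r" "r < 1" using powr_less_mono[of "- ((y - a) * q - 1)" 0 2] by (auto simp: r_def)
  then have "(\<lambda>j. D * r ^ j) \<longlonglongrightarrow> D * 0" by (intro tendsto_mult_left LIMSEQ_realpow_zero)
  then have "eventually (\<lambda>j. D * r ^ j < 1 / 4) sequentially" by (intro order_tendstoD(2)[of _ "D * 0"]) auto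
  then obtain j where "D * r ^ j < 1 / 4" unfolding eventually_sequentially by blast
  then show False using main[of j] by linarith
qed

lemma block_disjoint: "disjoint_family_on block J"
proof -
  have *: "block i \<inter> block j = {}" if "i < j" for i j
  proof -
    have "(2::real) powr (- real j) \<le> 2 powr (- real i - 1)" using that by (intro powr_mono) auto
    also have "\<dots> = 2 powr (- real i) / 2" by (simp add: powr_diff)
    finally show ?thesis by (auto simp: block_def)
  qed
  show ?thesis
    unfolding disjoint_family_on_def
  proof (intro ballI impI)
    fix i j :: nat assume "i \<noteq> j"
    then consider "i < j" | "j < i" by linarith
    then show "block i \<inter> block j = {}"
    proof cases
      case 1
      then show ?thesis by (rule *)
    next
      case 2
      then show ?thesis using *[OF 2] by (simp only: Int_commute)
    qed
  qed
qed

text \<open>At the critical parameters all m_j are at least k > 0. Closer to the boundary than all N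
  blocks, every circle has an eighth of its length where the image exceeds a multiple of N^(1/2).
  The area of this region and the weight cancel, so N^(1/2 - x) would have to stay bounded.\<close>

lemma critical_condition: "\<not> (a + 1 / q = 0 \<and> c - 1 = b + 1 - x)"
proof
  assume crit: "a + 1 / q = 0 \<and> c - 1 = b + 1 - x"
  then have a: "a = - 1 / q" by simp
  have c: "0 < c" using crit b_condition by simp
  have zero: "c - 1 - (b + 1 - x) = 0" using crit by simp
  define m where "m j = binomial_coeff c (2 ^ j) * test_moment (b - x) (block j) (2 ^ j)" for j
  obtain k where k: "0 < k" "\<And>j. k \<le> m j"
    using test_coefficient_lower[OF c] unfolding zero m_def by auto
  note K = weighted_operator_T_op[of a b c]
  have main: "(1 / 8) powr (1 / q) \<le> C * sqrt 8 / k * real N powr (x - 1 / 2)" if N: "1 \<le> N" for N :: nat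
  proof -
    let ?J = "{1..N}"
    define f where "f w = (\<Sum>j\<in>?J. test_function x (block j) (2 ^ j) w)" for w
    define U where "U = (\<Union>j\<in>?J. block j)"
    have [measurable]: "f \<in> borel_measurable borel" unfolding f_def by measurable
    have U [measurable]: "U \<in> sets borel" unfolding U_def by measurable
    have fU: "norm (f w) \<le> defect w powr - x * indicator U (defect w)" for w
    proof -
      have "norm (f w) \<le> (\<Sum>j\<in>?J. defect w powr - x * indicator (block j) (defect w))"
        unfolding f_def by (rule sum_norm_le) (simp add: test_function_def norm_mult norm_power norm_sgn abs_mult power_0_left)
      also have "\<dots> = defect w powr - x * indicator U (defect w)"
        unfolding U_def by (simp only: sum_distrib_left[symmetric] indicator_UN_disjoint[OF finite_atLeastAtMost block_disjoint])
      finally show ?thesis .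
    qed
    have "(\<integral>\<^sup>+ s. ennreal (1 / s) * indicator U s * indicator {0..1} s \<partial>lborel)
       = (\<integral>\<^sup>+ s. (\<Sum>j\<in>?J. ennreal (1 / s) * indicator (block j) s * indicator {0..1} s) \<partial>lborel)"
      unfolding U_def indicator_UN_disjoint[OF finite_atLeastAtMost block_disjoint]
      by (simp only: sum_distrib_left sum_distrib_right)
    also have "\<dots> = (\<Sum>j\<in>?J. (\<integral>\<^sup>+ s. ennreal (1 / s) * indicator (block j) s * indicator {0..1} s \<partial>lborel))"
      by (rule nn_integral_sum) measurable
    also have "\<dots> \<le> (\<Sum>j\<in>?J. ennreal 1)" by (rule sum_mono) (rule nn_integral_inverse_block)
    also have "\<dots> = ennreal (real N)" by (simp add: ennreal_of_nat_eq_real_of_nat)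
    finally have \<Lambda>: "(\<integral>\<^sup>+ s. ennreal (1 / s) * indicator U s * indicator {0..1} s \<partial>lborel) \<le> ennreal (real N)" .
    have "Lp_norm p f \<le> ennreal (real N powr x)"
      by (rule Lp_norm_test_function[OF p _ U _ _ \<Lambda>]) (use fU N in auto)
    then have fb: "\<forall>t>0. distr_fun (apply_op (T_op a b c) f) t \<le> (C * real N powr x / t) powr q"
      by (intro bound) auto
    define G where "G z = (LINT w|disc_measure. kernel (T_op a b c) z w * f w)" for z
    have [measurable]: "G \<in> borel_measurable borel" unfolding G_def by (rule borel_integral_kernel[OF K]) measurable
    have G: "G z = (\<Sum>j\<in>?J. complex_of_real (m j) * z ^ (2 ^ j))" if z: "z \<in> unit_disc" for z
    proof -
      have "G z = (LINT w|disc_measure. (\<Sum>j\<in>?J. kernel (T_op a b c) z w * test_function x (block j) (2 ^ j) w))"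
        unfolding G_def f_def by (simp only: sum_distrib_left)
      also have "\<dots> = (\<Sum>j\<in>?J. (LINT w|disc_measure. kernel (T_op a b c) z w * test_function x (block j) (2 ^ j) w))"
        by (rule Bochner_Integration.integral_sum) (rule T_test_function(2)[OF block_borel block_subset _ z], simp)
      also have "\<dots> = (\<Sum>j\<in>?J. complex_of_real (m j) * z ^ (2 ^ j))"
        unfolding m_def by (rule sum.cong[OF refl], rule T_test_function(1)[OF block_borel block_subset _ z]) simp
      finally show ?thesis .
    qed
    \<comment> \<open>For defects up to e, all the monomials of degree 2^j with j \<le> N still have
      modulus at least 1/2.\<close>
    define e where "e = 2 powr (- real N) / 2"
    have e: "0 < e" "e \<le> 1"
    proof -
      have "(2::real) powr (- real N) \<le> 2 powr 0" by (rule powr_mono) auto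
      then show "0 < e" "e \<le> 1" by (auto simp: e_def)
    qed
    \<comment> \<open>Each coefficient on the circle has modulus at least k / 2, so half of the
      second moment is at least k^2 N / 8; the first factor is the smallest value of the weight for
      defects up to e.\<close>
    define l where "l = e powr (- 1 / q) * (k * sqrt (real N / 8))"
    have l: "0 < l" using e k N by (simp add: l_def)
    define S where "S = {z. defect z powr a * norm (G z) > l}"
    have [measurable]: "S \<in> sets borel" unfolding S_def by measurable
    have circ: "1 / 8 \<le> measure circle_measure {v. v * z \<in> S}" if z: "z \<in> unit_disc" and dz: "defect z \<le> e" for z
    proof -
      define al where "al j = complex_of_real (m j) * z ^ (2 ^ j)" for j
      define X where "X = (\<Sum>j\<in>?J. (norm (al j))\<^sup>2)"
      have al: "k / 2 \<le> norm (al j)" if j: "j \<in> ?J" for j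
      proof -
        have "(2::real) powr (- real N) \<le> 2 powr (- real j)" using j by (intro powr_mono) auto
        then have "defect z \<le> 2 powr (- real j) / 2" using dz unfolding e_def by linarith
        then have "1 / 2 \<le> norm z ^ (2 ^ j)" by (rule norm_power_ge_half[OF z])
        then have "k * (1 / 2) \<le> \<bar>m j\<bar> * norm z ^ (2 ^ j)"
          using k by (intro mult_mono order_trans[OF k(2) abs_ge_self]) auto
        then show ?thesis unfolding al_def norm_mult norm_of_real norm_power by simp
      qed
      have "real N * (k / 2)\<^sup>2 = (\<Sum>j\<in>?J. (k / 2)\<^sup>2)" by simp
      also have "\<dots> \<le> X" unfolding X_def using al k by (intro sum_mono power_mono) auto
      finally have XN: "real N * (k / 2)\<^sup>2 \<le> X" .
      moreover have "0 < real N * (k / 2)\<^sup>2" using N k by simp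
      ultimately have X: "0 < X" by linarith
      have "1 / 8 \<le> measure circle_measure {v. (norm (\<Sum>j\<in>?J. al j * v ^ (2 ^ j)))\<^sup>2 > X / 2}"
        unfolding X_def by (rule lacunary_lower_bound) (use X in \<open>auto simp: X_def\<close>)
      also have "\<dots> \<le> measure circle_measure {v. v * z \<in> S}"
      proof (rule measure_mono_AE_circle)
        show "AE v in circle_measure. v \<in> {v. (norm (\<Sum>j\<in>?J. al j * v ^ (2 ^ j)))\<^sup>2 > X / 2} \<longrightarrow> v \<in> {v. v * z \<in> S}"
          using AE_circle_norm
        proof (eventually_elim, intro impI)
          fix v :: complex assume v: "norm v = 1" and vX: "v \<in> {v. (norm (\<Sum>j\<in>?J. al j * v ^ (2 ^ j)))\<^sup>2 > X / 2}"
          have vz: "v * z \<in> unit_disc" using v z by (simp add: unit_disc_def norm_mult)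
          have "G (v * z) = (\<Sum>j\<in>?J. al j * v ^ (2 ^ j))"
            unfolding G[OF vz] al_def by (simp add: power_mult_distrib mult_ac)
          then have "(norm (G (v * z)))\<^sup>2 > X / 2" using vX by simp
          moreover have "(k * sqrt (real N / 8))\<^sup>2 \<le> X / 2" using XN by (simp add: power_mult_distrib power_divide)
          ultimately have "(k * sqrt (real N / 8))\<^sup>2 < (norm (G (v * z)))\<^sup>2" by linarith
          then have 1: "k * sqrt (real N / 8) < norm (G (v * z))" by (rule power_less_imp_less_base) simp
          have dv: "defect (v * z) = defect z" using v by (simp add: norm_mult)
          have d: "0 < defect z" by (rule defect_pos[OF z])
          have 2: "e powr (- 1 / q) \<le> defect z powr a" unfolding a using d dz q by (intro powr_mono2') auto
          have "l < e powr (- 1 / q) * norm (G (v * z))" unfolding l_def using 1 e by (intro mult_strict_left_mono) auto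
          also have "\<dots> \<le> defect z powr a * norm (G (v * z))" by (rule mult_right_mono[OF 2]) simp
          finally show "v \<in> {v. v * z \<in> S}" unfolding S_def mem_Collect_eq dv .
        qed
        show "{v. v * z \<in> S} \<in> sets borel" by measurable
      qed
      finally show ?thesis .
    qed
    have "ennreal (1 / 8) * ennreal e = ennreal (1 / 8) * emeasure disc_measure {z. defect z \<in> {..e}}"
    proof -
      have "{..e} \<inter> {0..1} = {0..e}" using e by auto
      then show ?thesis using e by (simp only: emeasure_disc_defect[OF borel_closed[OF closed_atMost]]) simp
    qed
    also have "\<dots> = (\<integral>\<^sup>+ z. ennreal (1 / 8) * indicator {z. defect z \<in> {..e}} z \<partial>disc_measure)"
      by (rule nn_integral_cmult_indicator[symmetric]) measurable
    also have "\<dots> \<le> (\<integral>\<^sup>+ z. (\<integral>\<^sup>+ v. indicator S (v * z) \<partial>circle_measure) \<partial>disc_measure)"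
    proof (rule nn_integral_mono_AE)
      show "AE z in disc_measure. ennreal (1 / 8) * indicator {z. defect z \<in> {..e}} z \<le> (\<integral>\<^sup>+ v. indicator S (v * z) \<partial>circle_measure)"
        using AE_disc_unit_disc
      proof eventually_elim
        case (elim z)
        have "(\<integral>\<^sup>+ v. indicator S (v * z) \<partial>circle_measure) = (\<integral>\<^sup>+ v. indicator {v. v * z \<in> S} v \<partial>circle_measure)"
          by (rule nn_integral_cong) (simp split: split_indicator)
        also have "\<dots> = ennreal (measure circle_measure {v. v * z \<in> S})"
          by (simp add: circle.emeasure_eq_measure)
        finally show ?case using circ[OF elim] by (cases "defect z \<le> e") (auto intro!: ennreal_leI)
      qed
    qed
    also have "\<dots> = (\<integral>\<^sup>+ z. indicator S z \<partial>disc_measure)"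
      by (rule nn_integral_disc_average[symmetric]) measurable
    also have "\<dots> = ennreal (measure disc_measure S)" by (simp add: disc.emeasure_eq_measure)
    also have "measure disc_measure S = distr_fun (apply_op (T_op a b c) f) l"
      unfolding distr_fun_weighted[OF K \<open>f \<in> borel_measurable borel\<close>] S_def G_def ..
    finally have "ennreal (1 / 8 * e) \<le> ennreal (distr_fun (apply_op (T_op a b c) f) l)"
      using e by (subst ennreal_mult) auto
    then have "1 / 8 * e \<le> distr_fun (apply_op (T_op a b c) f) l"
      by (subst (asm) ennreal_le_iff) (auto simp: distr_fun_def)
    also have "\<dots> \<le> (C * real N powr x / l) powr q" using fb l by blast
    also have "C * real N powr x / l = e powr (1 / q) * (C * sqrt 8 / k * real N powr (x - 1 / 2))"
    proof -
      have "real N powr (x - 1 / 2) = real N powr x / sqrt (real N)" by (simp add: powr_diff powr_half_sqrt)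
      then show ?thesis using e k by (simp add: l_def powr_minus real_sqrt_divide field_simps)
    qed
    also have "(e powr (1 / q) * (C * sqrt 8 / k * real N powr (x - 1 / 2))) powr q = e * (C * sqrt 8 / k * real N powr (x - 1 / 2)) powr q"
      by (subst powr_mult) (use e q in \<open>simp add: powr_powr\<close>)
    finally have "e * (1 / 8) \<le> e * (C * sqrt 8 / k * real N powr (x - 1 / 2)) powr q" by (simp only: mult.commute)
    then have "1 / 8 \<le> (C * sqrt 8 / k * real N powr (x - 1 / 2)) powr q" using e by simp
    then have "(1 / 8) powr (1 / q) \<le> ((C * sqrt 8 / k * real N powr (x - 1 / 2)) powr q) powr (1 / q)"
      using q by (intro powr_mono2) auto
    also have "\<dots> = C * sqrt 8 / k * real N powr (x - 1 / 2)" using q C0 k by (simp add: powr_powr)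
    finally show ?thesis .
  qed
  have "((\<lambda>N. real N powr (x - 1 / 2)) \<longlongrightarrow> 0) sequentially"
    using x by (intro tendsto_neg_powr filterlim_real_sequentially) auto
  then have "((\<lambda>N. C * sqrt 8 / k * real N powr (x - 1 / 2)) \<longlongrightarrow> C * sqrt 8 / k * 0) sequentially"
    by (rule tendsto_mult_left)
  then have "eventually (\<lambda>N. C * sqrt 8 / k * real N powr (x - 1 / 2) < (1 / 8) powr (1 / q)) sequentially"
    by (intro order_tendstoD(2)[of _ "C * sqrt 8 / k * 0"]) auto
  then have "eventually (\<lambda>N. False) sequentially"
    using eventually_ge_at_top[of 1]
  proof eventually_elim
    case (elim N)
    then show ?case using main[of N] by linarith
  qed
  then show False by simp
qed

end

text \<open>The binary digits of a function with values in \<open>[0, 1]\<close> decompose it into indicator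
  functions with geometrically decreasing weights. The weak norm tolerates such a
  superposition, although it satisfies no triangle inequality for \<open>q = 1\<close>.\<close>

primrec binary_remainder :: "('a \<Rightarrow> real) \<Rightarrow> nat \<Rightarrow> 'a \<Rightarrow> real" where
  "binary_remainder f 0 = f"
| "binary_remainder f (Suc n) =
     (\<lambda>w. 2 * binary_remainder f n w - indicator {w. 1 / 2 \<le> binary_remainder f n w} w)"

definition binary_digit :: "('a \<Rightarrow> real) \<Rightarrow> nat \<Rightarrow> 'a set" where
  "binary_digit f n = {w. 1 / 2 \<le> binary_remainder f n w}"

lemma borel_binary_remainder [measurable]:
  assumes [measurable]: "f \<in> borel_measurable borel"
  shows "binary_remainder f n \<in> borel_measurable borel"
  by (induction n) auto

lemma binary_digit_sets [measurable]:
  assumes [measurable]: "f \<in> borel_measurable borel"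
  shows "binary_digit f n \<in> sets borel"
  unfolding binary_digit_def by measurable

lemma binary_remainder_bounds:
  assumes "\<And>w. 0 \<le> f w \<and> f w \<le> 1"
  shows "0 \<le> binary_remainder f n w \<and> binary_remainder f n w \<le> 1"
proof (induction n)
  case 0
  then show ?case using assms by simp
next
  case (Suc n)
  then show ?case by (auto split: split_indicator)
qed

lemma binary_expansion:
  "f w = (\<Sum>i<n. (1 / 2) ^ Suc i * indicator (binary_digit f i) w) + (1 / 2) ^ n * binary_remainder f n w"
proof (induction n)
  case (Suc n)
  let ?R = "binary_remainder f n w"
  have "(1 / 2) ^ n * ?R = (1 / 2) ^ Suc n * indicator (binary_digit f n) w + (1 / 2) ^ Suc n * binary_remainder f (Suc n) w"
    by (simp add: binary_digit_def algebra_simps)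
  then show ?case using Suc by (simp only: sum.lessThan_Suc)
qed simp

section \<open>From indicator functions to bounded functions at p = infinity\<close>

text \<open>The tolerances may grow like (3/2)^i because digit i carries the weight 2^(-i - 1): the
  total is t / 4 times a geometric series of ratio 3/4, hence at most t. The remainder after n
  digits contributes a multiple of 2^(-n).\<close>

lemma norm_integral_binary_le:
  fixes k :: "complex \<Rightarrow> complex"
  assumes k: "integrable disc_measure k" and f [measurable]: "f \<in> borel_measurable borel"
    and f01: "\<And>w. 0 \<le> f w \<and> f w \<le> 1" and d: "0 \<le> d"
    and le: "\<And>i. d * norm (LINT w|disc_measure. k w * indicator (binary_digit f i) w) \<le> t / 2 * (3 / 2) ^ i"
  shows "d * norm (LINT w|disc_measure. k w * complex_of_real (f w)) \<le> t"
proof -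
  have [measurable]: "k \<in> borel_measurable borel"
    using borel_measurable_integrable[OF k] by simp
  have int: "integrable disc_measure (\<lambda>w. k w * complex_of_real (g w))"
    if [measurable]: "g \<in> borel_measurable borel" and "\<And>w. 0 \<le> g w \<and> g w \<le> 1" for g :: "complex \<Rightarrow> real"
    by (rule Bochner_Integration.integrable_bound[OF k])
       (use that(2) in \<open>auto simp: norm_mult intro!: mult_right_le_one_le\<close>)
  define I where "I = (LINT w|disc_measure. norm (k w))"
  have main: "d * norm (LINT w|disc_measure. k w * complex_of_real (f w)) \<le> t + d * I * (1 / 2) ^ n" for n
  proof -
    let ?L = "\<lambda>i. LINT w|disc_measure. k w * indicator (binary_digit f i) w"
    let ?r = "binary_remainder f n"
    have r01: "0 \<le> ?r w" "?r w \<le> 1" for w using binary_remainder_bounds[where f=f and n=n and w=w, OF f01] by auto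
    have intE: "integrable disc_measure (\<lambda>w. k w * indicator (binary_digit f i) w)" for i
      using int[of "indicator (binary_digit f i)"] by (simp add: of_real_indicator)
    have intr: "integrable disc_measure (\<lambda>w. k w * complex_of_real (?r w))"
      by (rule int[OF borel_binary_remainder[OF f] binary_remainder_bounds[OF f01]])
    have "k w * complex_of_real (f w) = (\<Sum>i<n. (1 / 2) ^ Suc i * (k w * indicator (binary_digit f i) w))
        + (1 / 2) ^ n * (k w * complex_of_real (?r w))" for w
      by (subst binary_expansion[of f w n])
         (simp add: of_real_indicator sum_distrib_left distrib_left mult_ac)
    then have "(LINT w|disc_measure. k w * complex_of_real (f w))
       = (LINT w|disc_measure. (\<Sum>i<n. (1 / 2) ^ Suc i * (k w * indicator (binary_digit f i) w))
           + (1 / 2) ^ n * (k w * complex_of_real (?r w)))" by (simp only:)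
    also have "\<dots> = (LINT w|disc_measure. (\<Sum>i<n. (1 / 2) ^ Suc i * (k w * indicator (binary_digit f i) w)))
           + (LINT w|disc_measure. (1 / 2) ^ n * (k w * complex_of_real (?r w)))"
      by (intro Bochner_Integration.integral_add Bochner_Integration.integrable_sum integrable_mult_right intE intr)
    also have "\<dots> = (\<Sum>i<n. (1 / 2) ^ Suc i * ?L i) + (1 / 2) ^ n * (LINT w|disc_measure. k w * complex_of_real (?r w))"
      by (subst Bochner_Integration.integral_sum)
         (intro integrable_mult_right intE, simp only: integral_mult_right_zero)
    finally have "norm (LINT w|disc_measure. k w * complex_of_real (f w)) \<le>
        norm (\<Sum>i<n. (1 / 2) ^ Suc i * ?L i) + norm ((1 / 2) ^ n * (LINT w|disc_measure. k w * complex_of_real (?r w)))"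
      by (simp only: norm_triangle_ineq)
    also have "\<dots> \<le> (\<Sum>i<n. (1 / 2) ^ Suc i * norm (?L i)) + (1 / 2) ^ n * I"
    proof (rule add_mono)
      show "norm (\<Sum>i<n. (1 / 2) ^ Suc i * ?L i) \<le> (\<Sum>i<n. (1 / 2) ^ Suc i * norm (?L i))"
        by (rule sum_norm_le) (simp add: norm_mult norm_power norm_divide)
      have "norm (LINT w|disc_measure. k w * complex_of_real (?r w)) \<le> (LINT w|disc_measure. norm (k w * complex_of_real (?r w)))"
        by (rule integral_norm_bound)
      also have "\<dots> \<le> I" unfolding I_def
        by (rule integral_mono[OF integrable_norm[OF intr] integrable_norm[OF k]])
           (use r01 in \<open>auto simp: norm_mult intro!: mult_right_le_one_le\<close>)
      finally show "norm ((1 / 2) ^ n * (LINT w|disc_measure. k w * complex_of_real (?r w))) \<le> (1 / 2) ^ n * I"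
        by (simp add: norm_mult norm_power norm_divide mult_left_mono)
    qed
    finally have "d * norm (LINT w|disc_measure. k w * complex_of_real (f w))
       \<le> d * ((\<Sum>i<n. (1 / 2) ^ Suc i * norm (?L i)) + (1 / 2) ^ n * I)" by (rule mult_left_mono[OF _ d])
    also have "\<dots> = (\<Sum>i<n. (1 / 2) ^ Suc i * (d * norm (?L i))) + d * I * (1 / 2) ^ n"
      by (simp add: distrib_left sum_distrib_left mult_ac)
    also have "(\<Sum>i<n. (1 / 2) ^ Suc i * (d * norm (?L i))) \<le> (\<Sum>i<n. (1 / 2) ^ Suc i * (t / 2 * (3 / 2) ^ i))"
      by (intro sum_mono mult_left_mono le) auto
    also have "\<dots> = t / 4 * (\<Sum>i<n. (3 / 4) ^ i)"
      unfolding sum_distrib_left by (intro sum.cong refl) (simp add: power_mult_distrib[symmetric] field_simps)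
    also have "\<dots> \<le> t / 4 * 4"
    proof (rule mult_left_mono)
      have "(\<Sum>i<n. (3 / 4 :: real) ^ i) = 4 * (1 - (3 / 4) ^ n)" by (simp add: sum_gp_strict)
      also have "\<dots> \<le> 4" by simp
      finally show "(\<Sum>i<n. (3 / 4 :: real) ^ i) \<le> 4" .
      have "0 \<le> t / 2 * (3 / 2) ^ (0::nat)" by (rule order_trans[OF _ le]) (use d in simp)
      then show "0 \<le> t / 4" by simp
    qed
    finally show ?thesis by simp
  qed
  have "(\<lambda>n. t + d * I * (1 / 2) ^ n) \<longlonglongrightarrow> t + d * I * 0"
    by (intro tendsto_intros LIMSEQ_realpow_zero) auto
  then show ?thesis by (intro LIMSEQ_le_const[of _ t]) (use main in auto)
qed

text \<open>A_i is the set where the image of digit i exceeds its tolerance; off the union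
  \<open>norm_integral_binary_le\<close> applies. Because q \<ge> 1, the measure of A_i decays like
  (2/3)^i, and the sum 3 (2 C / t)^q is at most (6 C / t)^q. A growth rate of the tolerances
  strictly between 1 and 2 is what makes both series converge.\<close>

lemma restricted_infinity_unit_interval:
  assumes K: "weighted_operator a K" and q: "1 \<le> q" and C0: "0 \<le> C"
    and C: "\<And>E. E \<in> sets borel \<Longrightarrow> converges_ae K (indicator E) \<and>
       (\<forall>t>0. distr_fun (apply_op K (indicator E)) t \<le> (C / t) powr q)"
    and f [measurable]: "f \<in> borel_measurable borel" and f01: "\<And>w. 0 \<le> f w \<and> f w \<le> 1" and t: "0 < t"
  shows "distr_fun (apply_op K (\<lambda>w. complex_of_real (f w))) t \<le> (6 * C / t) powr q"
proof -
  have [measurable]: "case_prod (kernel K) \<in> borel_measurable (borel \<Otimes>\<^sub>M borel)"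
    using K by (simp add: weighted_operator_def)
  define F where "F g z = defect z powr a * norm (LINT w|disc_measure. kernel K z w * g w)" for g z
  have F_measurable [measurable]: "F g \<in> borel_measurable borel" if [measurable]: "g \<in> borel_measurable borel" for g
    unfolding F_def using borel_integral_kernel[OF K that] by measurable
  have distr: "distr_fun (apply_op K g) s = measure disc_measure {z. F g z > s}" if "g \<in> borel_measurable borel" for g s
    unfolding F_def by (rule distr_fun_weighted[OF K that])
  let ?E = "\<lambda>i. indicator (binary_digit f i) :: complex \<Rightarrow> complex"
  define A where "A i = {z. F (?E i) z > t / 2 * (3 / 2) ^ i}" for i
  have A_sets [measurable]: "A i \<in> sets borel" for i unfolding A_def by measurable
  have A_le: "measure disc_measure (A i) \<le> (2 * C / t) powr q * (2 / 3) ^ i" for i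
  proof -
    have "measure disc_measure (A i) = distr_fun (apply_op K (?E i)) (t / 2 * (3 / 2) ^ i)"
      unfolding A_def by (rule distr[symmetric]) measurable
    also have "\<dots> \<le> (C / (t / 2 * (3 / 2) ^ i)) powr q"
      by (rule C[OF binary_digit_sets[OF f], THEN conjunct2, rule_format]) (use t in simp)
    also have "C / (t / 2 * (3 / 2) ^ i) = (2 * C / t) * (2 / 3) ^ i"
      using t by (simp add: power_divide field_simps)
    also have "\<dots> powr q = (2 * C / t) powr q * ((2 / 3) ^ i) powr q" using C0 t by (subst powr_mult) auto
    also have "\<dots> \<le> (2 * C / t) powr q * ((2 / 3) ^ i) powr 1"
      using q by (intro mult_left_mono powr_mono') (auto intro: power_le_one)
    finally show ?thesis by simp
  qed
  have sums: "(\<lambda>i. (2 * C / t) powr q * (2 / 3) ^ i) sums ((2 * C / t) powr q * (1 / (1 - 2 / 3)))"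
    by (intro sums_mult geometric_sums) simp
  have summable: "summable (\<lambda>i. measure disc_measure (A i))"
    by (rule summable_comparison_test'[OF sums_summable[OF sums], of 0]) (use A_le in simp)
  have "AE z in disc_measure. integrable disc_measure (\<lambda>w. kernel K z w * indicator UNIV w)"
    using C[of UNIV] by (subst converges_ae_borel_iff[OF K, symmetric]) auto
  then have int: "AE z in disc_measure. integrable disc_measure (kernel K z)" by simp
  have "distr_fun (apply_op K (\<lambda>w. complex_of_real (f w))) t = measure disc_measure {z. F (\<lambda>w. complex_of_real (f w)) z > t}"
    by (rule distr) measurable
  also have "\<dots> \<le> measure disc_measure (\<Union>i. A i)"
  proof (rule disc.finite_measure_mono_AE)
    show "AE z in disc_measure. z \<in> {z. F (\<lambda>w. complex_of_real (f w)) z > t} \<longrightarrow> z \<in> (\<Union>i. A i)"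
      using int AE_disc_unit_disc
    proof eventually_elim
      case (elim z)
      note k = elim(1)
      show ?case
      proof (intro impI, rule ccontr)
        assume z: "z \<in> {z. F (\<lambda>w. complex_of_real (f w)) z > t}" "z \<notin> (\<Union>i. A i)"
        have "F (\<lambda>w. complex_of_real (f w)) z \<le> t" unfolding F_def
          by (rule norm_integral_binary_le[OF k f f01]) (use z(2) in \<open>auto simp: A_def F_def not_less\<close>)
        then show False using z(1) by simp
      qed
    qed
  qed simp
  also have "\<dots> \<le> (\<Sum>i. measure disc_measure (A i))"
    by (rule disc.finite_measure_subadditive_countably) (use summable in auto)
  also have "\<dots> \<le> (2 * C / t) powr q * (1 / (1 - 2 / 3))"
    unfolding sums_unique[OF sums] by (rule suminf_le[OF A_le summable sums_summable[OF sums]])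
  also have "\<dots> = (2 * C / t) powr q * 3 powr 1" by simp
  also have "\<dots> \<le> (2 * C / t) powr q * 3 powr q" using q by (intro mult_left_mono powr_mono) auto
  also have "\<dots> = (6 * C / t) powr q" using C0 t by (subst powr_mult[symmetric]) auto
  finally show ?thesis .
qed

text \<open>f / B is a combination of four functions with values in [0, 1] and coefficients 1, -1,
  i, -i. The tolerance t / 4 for each turns the constant 6 into 24, and the union of four
  exceptional sets turns 24 into 96, since 4 \<le> 4^q.\<close>

lemma restricted_infinity_bounded:
  assumes K: "weighted_operator a K" and q: "1 \<le> q" and C0: "0 \<le> C"
    and C: "\<And>E. E \<in> sets borel \<Longrightarrow> converges_ae K (indicator E) \<and>
       (\<forall>t>0. distr_fun (apply_op K (indicator E)) t \<le> (C / t) powr q)"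
    and f [measurable]: "f \<in> borel_measurable borel" and B: "0 \<le> B" "Lp_norm \<infinity> f \<le> ennreal B" and t: "0 < t"
  shows "distr_fun (apply_op K f) t \<le> (96 * C * B / t) powr q"
proof -
  have [measurable]: "case_prod (kernel K) \<in> borel_measurable (borel \<Otimes>\<^sub>M borel)"
    using K by (simp add: weighted_operator_def)
  have [measurable]: "kernel K z \<in> borel_measurable borel" for z
    using weighted_operator_borel_kernel[OF K] by (simp add: borel_kernel_def)
  have fB: "AE w in disc_measure. norm (f w) \<le> B" using Lp_norm_infinity_le_iff[OF f B(1)] B(2) by simp
  define u :: "nat \<Rightarrow> complex" where "u k = [1, -1, \<i>, -\<i>] ! k" for k
  \<comment> \<open>Clipping at 1 keeps the values in [0, 1] everywhere, although |f| \<le> B holds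
    only almost everywhere.\<close>
  define g where "g k w = max 0 (min 1 (Re (cnj (u k) * f w) / B))" for k w
  have g01: "0 \<le> g k w \<and> g k w \<le> 1" for k w by (simp add: g_def)
  have [measurable]: "g k \<in> borel_measurable borel" for k unfolding g_def by measurable
  have u: "norm (u k) = 1" if "k < 4" for k using that by (auto simp: u_def less_Suc_eq numeral_eq_Suc)
  have decomp: "f w = complex_of_real B * (\<Sum>k<4. u k * complex_of_real (g k w))" if "norm (f w) \<le> B" for w
  proof -
    have R: "\<bar>Re (f w)\<bar> \<le> B" "\<bar>Im (f w)\<bar> \<le> B"
      using that abs_Re_le_cmod[of "f w"] abs_Im_le_cmod[of "f w"] by linarith+
    have *: "B * (max 0 (min 1 (r / B)) - max 0 (min 1 (- r / B))) = r" if "\<bar>r\<bar> \<le> B" for r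
    proof (cases "B = 0")
      case False
      then have "0 < B" using B by simp
      then have "\<bar>r / B\<bar> \<le> 1" and "- r / B = - (r / B)" using that by (simp_all add: abs_divide)
      moreover have "max 0 (min 1 s) - max 0 (min 1 (- s)) = s" if "\<bar>s\<bar> \<le> 1" for s :: real
        using that by (auto simp: max_def min_def)
      ultimately have *: "max 0 (min 1 (r / B)) - max 0 (min 1 (- r / B)) = r / B" by (simp only:)
      show ?thesis unfolding * using False by simp
    qed (use that in simp)
    show ?thesis
      using *[OF R(1)] *[OF R(2)] by (intro complex_eqI) (simp_all add: g_def u_def numeral_eq_Suc algebra_simps)
  qed
  define F where "F g z = defect z powr a * norm (LINT w|disc_measure. kernel K z w * g w)" for g z
  have F_measurable [measurable]: "F h \<in> borel_measurable borel" if [measurable]: "h \<in> borel_measurable borel" for h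
    unfolding F_def using borel_integral_kernel[OF K that] by measurable
  have distr: "distr_fun (apply_op K h) s = measure disc_measure {z. F h z > s}" if "h \<in> borel_measurable borel" for h s
    unfolding F_def by (rule distr_fun_weighted[OF K that])
  let ?g = "\<lambda>k w. complex_of_real (g k w)"
  define A where "A k = {z. t / 4 < B * F (?g k) z}" for k
  have A_sets [measurable]: "A k \<in> sets borel" for k unfolding A_def by measurable
  have A_le: "measure disc_measure (A k) \<le> (24 * C * B / t) powr q" for k
  proof (cases "B = 0")
    case True
    then have "A k = {}" using t by (simp add: A_def)
    then show ?thesis by simp
  next
    case False
    then have B0: "0 < B" using B by simp
    have "A k = {z. F (?g k) z > t / (4 * B)}" using B0 by (simp add: A_def field_simps)
    then have "measure disc_measure (A k) = distr_fun (apply_op K (?g k)) (t / (4 * B))"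
      by (simp add: distr)
    also have "\<dots> \<le> (6 * C / (t / (4 * B))) powr q"
      by (rule restricted_infinity_unit_interval[OF K q C0 C _ g01]) (use t B0 in auto)
    also have "6 * C / (t / (4 * B)) = 24 * C * B / t" by simp
    finally show ?thesis .
  qed
  have "AE z in disc_measure. integrable disc_measure (\<lambda>w. kernel K z w * indicator UNIV w)"
    using C[of UNIV] by (subst converges_ae_borel_iff[OF K, symmetric]) auto
  then have int: "AE z in disc_measure. integrable disc_measure (kernel K z)" by simp
  have "distr_fun (apply_op K f) t = measure disc_measure {z. F f z > t}" by (rule distr[OF f])
  also have "\<dots> \<le> measure disc_measure (\<Union>k<4. A k)"
  proof (rule disc.finite_measure_mono_AE)
    show "AE z in disc_measure. z \<in> {z. F f z > t} \<longrightarrow> z \<in> (\<Union>k<4. A k)"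
      using int
    proof eventually_elim
      case (elim z)
      note k = elim
      show ?case
      proof (intro impI, rule ccontr)
        assume z: "z \<in> {z. F f z > t}" "z \<notin> (\<Union>k<4. A k)"
        have intg: "integrable disc_measure (\<lambda>w. kernel K z w * ?g k w)" for k
          by (rule Bochner_Integration.integrable_bound[OF k])
             (use g01 in \<open>auto simp: norm_mult intro!: mult_right_le_one_le\<close>)
        have "(LINT w|disc_measure. kernel K z w * f w)
           = (LINT w|disc_measure. complex_of_real B * (\<Sum>k<4. u k * (kernel K z w * ?g k w)))"
        proof (rule integral_cong_AE)
          have "kernel K z w * f w = complex_of_real B * (\<Sum>k<4. u k * (kernel K z w * ?g k w))" if "norm (f w) \<le> B" for w
            by (subst decomp[OF that]) (simp only: sum_distrib_left mult_ac)
          then show "AE w in disc_measure. kernel K z w * f w = complex_of_real B * (\<Sum>k<4. u k * (kernel K z w * ?g k w))"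
            by (rule eventually_mono[OF fB])
        qed measurable
        also have "\<dots> = complex_of_real B * (\<Sum>k<4. u k * (LINT w|disc_measure. kernel K z w * ?g k w))"
          by (simp only: integral_mult_right_zero Bochner_Integration.integral_sum[OF integrable_mult_right[OF intg]])
        finally have "F f z = B * (defect z powr a * norm (\<Sum>k<4. u k * (LINT w|disc_measure. kernel K z w * ?g k w)))"
          using B by (simp add: F_def norm_mult)
        also have "\<dots> \<le> B * (defect z powr a * (\<Sum>k<4. norm (LINT w|disc_measure. kernel K z w * ?g k w)))"
          using B by (intro mult_left_mono sum_norm_le) (auto simp: norm_mult u)
        also have "\<dots> = (\<Sum>k<4. B * F (?g k) z)" by (simp add: F_def sum_distrib_left)
        also have "\<dots> \<le> (\<Sum>k<4::nat. t / 4)" using z(2) by (intro sum_mono) (auto simp: A_def not_less)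
        finally show False using z(1) by simp
      qed
    qed
  qed simp
  also have "\<dots> \<le> (\<Sum>k<4. measure disc_measure (A k))"
    by (rule disc.finite_measure_subadditive_finite) auto
  also have "\<dots> \<le> (\<Sum>k<4::nat. (24 * C * B / t) powr q)" by (rule sum_mono) (rule A_le)
  also have "\<dots> = 4 powr 1 * (24 * C * B / t) powr q" by simp
  also have "\<dots> \<le> 4 powr q * (24 * C * B / t) powr q" using q by (intro mult_right_mono powr_mono) auto
  also have "\<dots> = (4 * (24 * C * B / t)) powr q" by (rule powr_mult[symmetric])
  also have "4 * (24 * C * B / t) = 96 * C * B / t" by simp
  finally show ?thesis .
qed

section \<open>Conclusion\<close>

text \<open>For p > 2 the conditions forced by T, with the critical case excluded, are exactly the
  hypotheses of the sufficiency theorems for S, read with x = 1/p or x = 0.\<close>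

lemma weak_type_S_if_T:
  assumes p: "2 < p" and q: "0 < q" and qp: "ennreal q < p" and T: "weak_type (T_op a b c) p (ennreal q)"
  shows "weak_type (S_op a b c) p (ennreal q)"
proof -
  obtain C where C0: "0 \<le> C" and C: "\<And>f B. f \<in> borel_measurable borel \<Longrightarrow> B \<ge> 0 \<Longrightarrow> Lp_norm p f \<le> ennreal B \<Longrightarrow>
       \<forall>t>0. distr_fun (apply_op (T_op a b c) f) t \<le> (C * B / t) powr q"
    using T unfolding weak_type_iff[OF weighted_operator_borel_kernel[OF weighted_operator_T_op] q] by blast
  show ?thesis
  proof (cases p)
    case (real r)
    have r: "2 < r" using p real by (simp add: ennreal_less_iff flip: ennreal_numeral)
    have "q < r" using qp real q by (simp add: ennreal_less_iff)
    interpret weak_type_T p "1 / r" q a b c C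
      by unfold_locales (use r real q C0 C in \<open>auto simp: reciprocal_exponent_def\<close>)
    show ?thesis unfolding \<open>p = ennreal r\<close>
      by (rule weak_type_S_sufficient)
         (use r q \<open>q < r\<close> b_condition a_condition c_condition critical_condition in auto)
  next
    case top
    interpret weak_type_T \<infinity> 0 q a b c C
      by unfold_locales (use q C0 C top in \<open>auto simp: reciprocal_exponent_def\<close>)
    have "weak_type (S_op a b c) \<infinity> (ennreal q)"
      by (rule weak_type_S_infinity_sufficient)
         (use q b_condition a_condition c_condition critical_condition in auto)
    then show ?thesis by (simp add: top)
  qed
qed

text \<open>The estimate for T extends from indicators to bounded functions with the constant 96 C,
  so the necessary conditions become available. The weak-type bound obtained for S is then
  specialized to indicators, whose norm is at most 1.\<close>

lemma restricted_weak_type_infinity_S_if_T: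
  assumes q: "1 \<le> q" and T: "restricted_weak_type (T_op a b c) \<infinity> (ennreal q)"
  shows "restricted_weak_type (S_op a b c) \<infinity> (ennreal q)"
proof -
  have q0: "0 < q" using q by simp
  obtain C where C0: "0 \<le> C" and C: "\<And>E. E \<in> sets borel \<Longrightarrow> converges_ae (T_op a b c) (indicator E) \<and>
       (\<forall>t>0. distr_fun (apply_op (T_op a b c) (indicator E)) t \<le> (C / t) powr q)"
    using T unfolding restricted_weak_type_infinity_iff[OF weighted_operator_borel_kernel[OF weighted_operator_T_op] q0] by blast
  interpret weak_type_T \<infinity> 0 q a b c "96 * C"
    by unfold_locales
       (use q0 C0 restricted_infinity_bounded[OF weighted_operator_T_op q C0 C] in \<open>auto simp: reciprocal_exponent_def\<close>)
  have "weak_type (S_op a b c) \<infinity> (ennreal q)"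
    by (rule weak_type_S_infinity_sufficient)
       (use q0 b_condition a_condition c_condition critical_condition in auto)
  then obtain D where D0: "0 \<le> D" and D: "\<And>f B. f \<in> borel_measurable borel \<Longrightarrow> B \<ge> 0 \<Longrightarrow> Lp_norm \<infinity> f \<le> ennreal B \<Longrightarrow>
       converges_ae (S_op a b c) f \<and> (\<forall>t>0. distr_fun (apply_op (S_op a b c) f) t \<le> (D * B / t) powr q)"
    unfolding weak_type_iff[OF weighted_operator_borel_kernel[OF weighted_operator_S_op] q0] by blast
  have "converges_ae (S_op a b c) (indicator E) \<and> (\<forall>t>0. distr_fun (apply_op (S_op a b c) (indicator E)) t \<le> (D / t) powr q)"
    if E [measurable]: "E \<in> sets borel" for E
  proof -
    have "Lp_norm \<infinity> (indicator E) \<le> ennreal 1"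
      by (subst Lp_norm_infinity_le_iff) (auto split: split_indicator)
    then show ?thesis using D[of "indicator E" 1] by simp
  qed
  then show ?thesis
    unfolding restricted_weak_type_infinity_iff[OF weighted_operator_borel_kernel[OF weighted_operator_S_op] q0]
    using D0 by blast
qed

text \<open>q < p makes q finite, so that q is a real number even when p is infinite.\<close>

lemma Omega_H_cases:
  assumes "(p, q) \<in> Omega_H"
  obtains r where "1 \<le> r" "q = ennreal r" "ennreal r < p" "1 < p"
proof -
  have pq: "1 \<le> q" "q < p" using assms by (auto simp: Omega_H_def)
  then have "q < \<infinity>" by (metis order.strict_trans2 top_greatest infinity_ennreal_def)
  then obtain r where r: "0 \<le> r" "q = ennreal r" by (cases q) auto
  have "1 \<le> r" using pq(1) r by (simp add: ennreal_1[symmetric] ennreal_le_iff del: ennreal_1)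
  then show ?thesis using that r pq by (metis order.strict_trans1)
qed

lemma FR_w_example:
  assumes "(p, q) \<in> FR_w"
  shows "\<exists>a b c. weak_type (T_op a b c) p q \<and> \<not> weak_type (S_op a b c) p q"
proof -
  have O: "(p, q) \<in> Omega_H" and p2: "p \<le> 2" using assms by (auto simp: FR_w_def)
  obtain r where r: "1 \<le> r" "q = ennreal r" "ennreal r < p" by (rule Omega_H_cases[OF O])
  obtain s where s: "0 \<le> s" "p = ennreal s" using p2 by (cases p) (auto simp: top_unique)
  have "s \<le> 2" using p2 s by (simp add: ennreal_le_iff flip: ennreal_numeral)
  moreover have "r < s" using r s by (simp add: ennreal_less_iff)
  ultimately have "weak_type (T_op (- 1 / r) (1 / s) 2) p q" "\<not> weak_type (S_op (- 1 / r) (1 / s) 2) p q"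
    unfolding r(2) s(2) using weak_type_T_critical[of r s] not_weak_type_S_critical[of s r] r by auto
  then show ?thesis by blast
qed

lemma FR_rw_example:
  assumes "(p, q) \<in> FR_rw"
  shows "\<exists>a b c. restricted_weak_type (T_op a b c) p q \<and> \<not> restricted_weak_type (S_op a b c) p q"
proof -
  have O: "(p, q) \<in> Omega_H" and p: "p \<noteq> \<infinity>" using assms by (auto simp: FR_rw_def)
  obtain r where r: "1 \<le> r" "q = ennreal r" "ennreal r < p" by (rule Omega_H_cases[OF O])
  obtain s where s: "0 \<le> s" "p = ennreal s" using p by (cases p) auto
  have "r < s" using r s by (simp add: ennreal_less_iff)
  then have "restricted_weak_type (T_op (- 1 / r) (1 / s - 1) 1) p q"
    "\<not> restricted_weak_type (S_op (- 1 / r) (1 / s - 1) 1) p q"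
    unfolding r(2) s(2)
    using restricted_weak_type_T_critical[of r s] not_restricted_weak_type_S_critical[of s r] r by auto
  then show ?thesis by blast
qed

lemma weak_FR_pair_le_2:
  assumes O: "(p, q) \<in> Omega_H" and pair: "weak_FR_pair a b c p q"
  shows "(p, q) \<in> FR_w"
proof -
  obtain r where r: "1 \<le> r" "q = ennreal r" "ennreal r < p" and p1: "1 < p" by (rule Omega_H_cases[OF O])
  have "p \<le> 2"
  proof (rule ccontr)
    assume "\<not> p \<le> 2"
    then have "2 < p" by simp
    moreover have "0 < r" using r(1) by simp
    ultimately have "weak_type (T_op a b c) p q = weak_type (S_op a b c) p q"
      unfolding r(2) using weak_type_S_if_T[OF _ _ r(3)] weak_type_T_if_S[of r] by blast
    then show False using pair by (simp add: weak_FR_pair_def)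
  qed
  then show ?thesis using O p1 by (simp add: FR_w_def)
qed

lemma restricted_weak_FR_pair_finite:
  assumes O: "(p, q) \<in> Omega_H" and pair: "restricted_weak_FR_pair a b c p q"
  shows "(p, q) \<in> FR_rw"
proof -
  obtain r where r: "1 \<le> r" "q = ennreal r" by (rule Omega_H_cases[OF O])
  have "p \<noteq> \<infinity>"
  proof
    assume "p = \<infinity>"
    have "restricted_weak_type (T_op a b c) p q = restricted_weak_type (S_op a b c) p q"
      unfolding r(2) \<open>p = \<infinity>\<close>
      using restricted_weak_type_infinity_S_if_T[OF r(1)] restricted_weak_type_T_if_S[of r] r(1) by (meson less_le_trans zero_less_one)
    then show False using pair by (simp add: restricted_weak_FR_pair_def)
  qed
  then show ?thesis using O by (simp add: FR_rw_def)
qed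

theorem theorem1p4:
  shows "{(p, q) \<in> Omega_H. \<exists>a b c. weak_FR_pair a b c p q} = FR_w \<and>
    (\<forall>(p, q) \<in> FR_w. \<exists>a b c. weak_type (T_op a b c) p q \<and> \<not> weak_type (S_op a b c) p q) \<and>
    {(p, q) \<in> Omega_H. \<exists>a b c. restricted_weak_FR_pair a b c p q} = FR_rw \<and>
    (\<forall>(p, q) \<in> FR_rw. \<exists>a b c. restricted_weak_type (T_op a b c) p q \<and>
                              \<not> restricted_weak_type (S_op a b c) p q)"
proof (intro conjI)
  have "(p, q) \<in> {(p, q) \<in> Omega_H. \<exists>a b c. weak_FR_pair a b c p q} \<longleftrightarrow> (p, q) \<in> FR_w" for p q
  proof
    assume pq: "(p, q) \<in> FR_w"
    obtain a b c where "weak_FR_pair a b c p q"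
      using FR_w_example[OF pq] unfolding weak_FR_pair_def by blast
    moreover have "(p, q) \<in> Omega_H" using pq by (simp add: FR_w_def)
    ultimately show "(p, q) \<in> {(p, q) \<in> Omega_H. \<exists>a b c. weak_FR_pair a b c p q}" by blast
  qed (use weak_FR_pair_le_2 in blast)
  then show "{(p, q) \<in> Omega_H. \<exists>a b c. weak_FR_pair a b c p q} = FR_w" by auto
  have "(p, q) \<in> {(p, q) \<in> Omega_H. \<exists>a b c. restricted_weak_FR_pair a b c p q} \<longleftrightarrow> (p, q) \<in> FR_rw" for p q
  proof
    assume pq: "(p, q) \<in> FR_rw"
    obtain a b c where "restricted_weak_FR_pair a b c p q"
      using FR_rw_example[OF pq] unfolding restricted_weak_FR_pair_def by blast
    moreover have "(p, q) \<in> Omega_H" using pq by (simp add: FR_rw_def)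
    ultimately show "(p, q) \<in> {(p, q) \<in> Omega_H. \<exists>a b c. restricted_weak_FR_pair a b c p q}" by blast
  qed (use restricted_weak_FR_pair_finite in blast)
  then show "{(p, q) \<in> Omega_H. \<exists>a b c. restricted_weak_FR_pair a b c p q} = FR_rw" by auto
qed (use FR_w_example FR_rw_example in blast)+

end
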